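(* Let $n,p\ge 1$ be integers (either $n<p$ or $n\ge p$ is allowed), let $\Sigma_p$ be a $p\times p$ positive definite Hermitian matrix, let $\pi_j$ ($1\le j\le p$) be the inverse of the $j$th largest eigenvalue of $\Sigma_p$, and let $\lambda_1\ge\dots\ge\lambda_p\ge 0$ be the eigenvalues of a complex Wishart matrix $W_{\mathbb{C}}(\Sigma_p/n,n)$. For any fixed $q$ satisfying $0<q<\min\{\pi_j\}_{j=1}^p$, let $K_{n,p}$ be the operator acting on $L^2((0,\infty))$ with kernel $$K_{n,p}(\eta,\zeta)=\frac{n}{(2\pi i)^2}\int_\Gamma dz\int_\Sigma dw\, e^{-\eta n(z-q)+\zeta n(w-q)}\,\frac{1}{w-z}\left(\frac{z}{w}\right)^n\prod_{k=1}^p\frac{\pi_k-w}{\pi_k-z},$$ where $\Sigma$ is a simple closed contour enclosing $0$ and lying in $\{w:\mathrm{Re}(w)<q\}$ and $\Gamma$ is a simple closed contour enclosing $\pi_1,\dots,\pi_p$ and lying in $\{z:\mathrm{Re}(z)>q\}$, both oriented counterclockwise. Then, for any real-valued measurable bounded function $f$ on $\mathbb{R}$ which equals $0$ for all $x\le 0$, $$E\prod_{j=1}^p\bigl(1+f(\lambda_j)\bigr)=\det(1+K_{n,p}f),$$ where on the right-hand side $1$ is the identity operator, $f$ denotes the operator of multiplication by the function $f(\cdot)$ on $L^2((0,\infty))$, and $\det$ is the Fredholm determinant on $L^2((0,\infty))$.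
   Context: $W_{\mathbb{C}}(\Sigma_p/n,n)$ denotes the $p$-dimensional complex Wishart matrix with $n$ degrees of freedom and scale $\Sigma_p/n$, i.e. a random matrix distributed as $\frac1n XX^*$ where $X$ is a $p\times n$ matrix whose columns are i.i.d. complex Gaussian $N_{\mathbb{C}}(0,\Sigma_p)$ vectors (circularly symmetric, mean zero, with $E[xx^*]=\Sigma_p$). It is singular when $n<p$, in which case $\lambda_{n+1}=\dots=\lambda_p=0$. The expectation $E$ is with respect to the joint distribution of $\lambda_1,\dots,\lambda_p$. The symbol $\pi$ without index in $2\pi i$ is the usual constant; the contour $\Sigma$ is unrelated to the covariance matrix $\Sigma_p$. An operator $K$ with kernel $K(\eta,\zeta)$ acts by $(Kh)(\eta)=\int_0^\infty K(\eta,\zeta)h(\zeta)\,d\zeta$. *)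

theory Defs
  imports "HOL-Complex_Analysis.Complex_Analysis" "HOL-Probability.Probability"
begin

section \<open>Eigenvalues of Hermitian matrices\<close>

definition hermitian_pos_def :: "complex ^ 'p ^ 'p \<Rightarrow> bool" where
  "hermitian_pos_def S \<longleftrightarrow>
     (\<forall>i j. S $ i $ j = cnj (S $ j $ i)) \<and>
     (\<forall>v. v \<noteq> 0 \<longrightarrow> 0 < Re (\<Sum>i\<in>UNIV. cnj (v $ i) * (S *v v) $ i))"

definition charpoly :: "complex ^ 'p ^ 'p \<Rightarrow> complex poly" where
  "charpoly A = det (\<chi> i j. (if i = j then [:0, 1:] else 0) - [:A $ i $ j:])"

text \<open>The eigenvalues are listed with multiplicity. Taking the real part of a root of the
  characteristic polynomial loses nothing for Hermitian matrices, the only ones to which this is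
  applied. The index \<open>j\<close> runs from 1 to the size of the matrix.\<close>

definition nth_largest_eigenvalue :: "complex ^ 'p ^ 'p \<Rightarrow> nat \<Rightarrow> real" where
  "nth_largest_eigenvalue A j =
     rev (sorted_list_of_multiset (image_mset Re (proots (charpoly A)))) ! (j - 1)"


section \<open>Complex Gaussian vectors and complex Wishart matrices\<close>

text \<open>The circularly symmetric law with mean zero and positive definite covariance
  \<open>E[x x\<^sup>*] = S\<close>. Lebesgue measure on \<open>\<complex>\<^sup>p\<close> is that of the real Euclidean space of
  real and imaginary parts.\<close>

definition complex_normal :: "complex ^ 'p ^ 'p \<Rightarrow> (complex ^ 'p) measure" where
  "complex_normal S = density lborel (\<lambda>x. ennreal (
     exp (- Re (\<Sum>i\<in>UNIV. cnj (x $ i) * (matrix_inv S *v x) $ i)) /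
     (pi ^ CARD('p) * Re (det S))))"

text \<open>The law \<open>W\<^sub>\<complex>(S/n, n)\<close> of \<open>X X\<^sup>* / n\<close>, where \<open>x k\<close> is the \<open>k\<close>-th of
  the \<open>n\<close> i.i.d. columns of \<open>X\<close>.\<close>

definition complex_wishart :: "complex ^ 'p ^ 'p \<Rightarrow> nat \<Rightarrow> (complex ^ 'p ^ 'p) measure" where
  "complex_wishart S n =
     distr (Pi\<^sub>M {..<n} (\<lambda>_. complex_normal S)) borel
       (\<lambda>x. \<chi> i j. (\<Sum>k<n. x k $ i * cnj (x k $ j)) / of_nat n)"


section \<open>Operators on the Hilbert space of square-integrable functions on the half-line\<close>

text \<open>Elements of \<open>L\<^sup>2((0,\<infinity>))\<close> are represented by functions, and identified when they are
  equal almost everywhere; operators map functions to functions.\<close>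

abbreviation half_line :: "real measure" where
  "half_line \<equiv> restrict_space lborel {0<..}"

definition L2 :: "(real \<Rightarrow> complex) set" where
  "L2 = {h. h \<in> borel_measurable half_line \<and> integrable half_line (\<lambda>x. (cmod (h x))\<^sup>2)}"

definition L2_inner :: "(real \<Rightarrow> complex) \<Rightarrow> (real \<Rightarrow> complex) \<Rightarrow> complex" where
  "L2_inner g h = (\<integral>x. cnj (g x) * h x \<partial>half_line)"

definition L2_norm :: "(real \<Rightarrow> complex) \<Rightarrow> real" where
  "L2_norm h = sqrt (\<integral>x. (cmod (h x))\<^sup>2 \<partial>half_line)"

definition orthonormal_basis :: "(nat \<Rightarrow> real \<Rightarrow> complex) \<Rightarrow> bool" where
  "orthonormal_basis e \<longleftrightarrow>
     (\<forall>i. e i \<in> L2) \<and>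
     (\<forall>i j. L2_inner (e i) (e j) = (if i = j then 1 else 0)) \<and>
     (\<forall>h\<in>L2. (\<lambda>N. L2_norm (\<lambda>x. h x - (\<Sum>i<N. L2_inner (e i) h * e i x))) \<longlonglongrightarrow> 0)"

text \<open>On a Hilbert space the trace class operators are the nuclear operators: those of the form
  \<open>A = \<Sum>\<^sub>k \<langle>v\<^sub>k, \<cdot>\<rangle> u\<^sub>k\<close> with \<open>\<Sum>\<^sub>k \<parallel>u\<^sub>k\<parallel> \<parallel>v\<^sub>k\<parallel> < \<infinity>\<close>.\<close>

definition trace_class :: "((real \<Rightarrow> complex) \<Rightarrow> real \<Rightarrow> complex) \<Rightarrow> bool" where
  "trace_class A \<longleftrightarrow>
     (\<exists>u v. (\<forall>k::nat. u k \<in> L2 \<and> v k \<in> L2) \<and>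
            summable (\<lambda>k. L2_norm (u k) * L2_norm (v k)) \<and>
            (\<forall>h\<in>L2. A h \<in> L2 \<and>
               (\<lambda>N. L2_norm (\<lambda>x. A h x - (\<Sum>k<N. L2_inner (v k) h * u k x))) \<longlonglongrightarrow> 0))"

text \<open>The Fredholm determinant of \<open>T = 1 + A\<close> with \<open>A\<close> of trace class: the limit of the
  leading \<open>N \<times> N\<close> determinants of the matrix of \<open>T\<close> in an orthonormal basis, the same for every
  basis. The sum over permutations is the Leibniz formula, spelled out because the size \<open>N\<close>
  varies.\<close>

definition has_fredholm_det :: "((real \<Rightarrow> complex) \<Rightarrow> real \<Rightarrow> complex) \<Rightarrow> complex \<Rightarrow> bool" where
  "has_fredholm_det T d \<longleftrightarrow>
     trace_class (\<lambda>h x. T h x - h x) \<and>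
     (\<forall>e. orthonormal_basis e \<longrightarrow>
        (\<lambda>N. \<Sum>s | s permutes {..<N}.
                of_int (sign s) * (\<Prod>i<N. L2_inner (e i) (T (e (s i))))) \<longlonglongrightarrow> d)"

definition kernel_operator ::
    "(real \<Rightarrow> real \<Rightarrow> complex) \<Rightarrow> (real \<Rightarrow> complex) \<Rightarrow> real \<Rightarrow> complex" where
  "kernel_operator K h = (\<lambda>\<eta>. \<integral>\<zeta>. K \<eta> \<zeta> * h \<zeta> \<partial>half_line)"

definition mult_operator :: "(real \<Rightarrow> real) \<Rightarrow> (real \<Rightarrow> complex) \<Rightarrow> real \<Rightarrow> complex" where
  "mult_operator f h = (\<lambda>x. of_real (f x) * h x)"


section \<open>The kernel\<close>

definition ccw_contour :: "(real \<Rightarrow> complex) \<Rightarrow> bool" where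
  "ccw_contour g \<longleftrightarrow>
     valid_path g \<and> simple_path g \<and> pathfinish g = pathstart g \<and>
     (\<forall>z\<in>inside (path_image g). winding_number g z = 1)"

text \<open>Here \<open>g\<close> is the contour of \<open>z\<close> and \<open>c\<close> that of \<open>w\<close>; \<open>\<pi>\<close> is the sequence
  \<open>\<pi>\<^sub>1, \<dots>, \<pi>\<^sub>p\<close>.\<close>

definition K_kernel ::
    "nat \<Rightarrow> nat \<Rightarrow> (nat \<Rightarrow> real) \<Rightarrow> real \<Rightarrow> (real \<Rightarrow> complex) \<Rightarrow> (real \<Rightarrow> complex) \<Rightarrow>
     real \<Rightarrow> real \<Rightarrow> complex" where
  "K_kernel n p \<pi> q g c \<eta> \<zeta> =
     of_nat n / (2 * of_real pi * \<i>)\<^sup>2 *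
     contour_integral g (\<lambda>z. contour_integral c (\<lambda>w.
       exp (- of_real \<eta> * of_nat n * (z - of_real q) + of_real \<zeta> * of_nat n * (w - of_real q)) *
       (1 / (w - z)) * (z / w) ^ n *
       (\<Prod>k=1..p. (of_real (\<pi> k) - w) / (of_real (\<pi> k) - z))))"

end

theory Submission
  imports Defs "Jordan_Normal_Form.Determinant" "HOL-Computational_Algebra.Fundamental_Theorem_Algebra"
begin

text \<open>By unitary invariance the rows of the Gaussian matrix \<open>X\<close> may be taken independent, with
  entries of rate \<open>\<pi>\<^sub>i\<close> in the \<open>i\<close>-th row. Adding one Gaussian row to an \<open>n \<times> n\<close> diagonal matrix
  moves its spectrum \<open>\<mu>\<close> to an interlacing one \<open>l\<close>. The secular equation expresses the squared moduli
  of the entries of the row through \<open>l\<close>, with Jacobian \<open>\<Delta>(l) / \<Delta>(\<mu>)\<close> (Vandermonde products), so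
  that the expectation of \<open>det (h\<^sub>a(l\<^sub>b)) / \<Delta>(l)\<close> over the row has the same form at \<open>\<mu>\<close>, each
  \<open>h\<^sub>a\<close> being averaged against an exponential law. This is iterated over the \<open>p\<close> rows with
  \<open>h\<^sub>a = (1 + f) \<tau>\<^sub>a\<close>, where the polynomials \<open>\<tau>\<^sub>a\<close> are those that the averages map to monomials, and
  then the initial diagonal matrix tends to \<open>0\<close>: the limit is an \<open>n \<times> n\<close> determinant. On the other
  side, \<open>(z/w)\<^sup>n / (w - z) = 1 / (w - z) - (\<Sum>b<n. z\<^sup>b / w\<^sup>b\<^sup>+\<^sup>1)\<close> shows that the kernel has rank \<open>n\<close>,
  and its Fredholm determinant is the same \<open>n \<times> n\<close> determinant. Continuous \<open>f\<close> vanishing near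
  \<open>0\<close> suffice, since both sides are continuous under bounded pointwise limits.\<close>

section \<open>Interlacing and the secular equation\<close>

text \<open>The recursion acts on the \<open>n\<close> by \<open>n\<close> matrix formed by
  \<open>diag e\<close> plus the Gram matrix of the rows, not on the \<open>p\<close> by
  \<open>p\<close> one: each row is a rank-one perturbation at fixed size, so \<open>n < p\<close>
  and \<open>n \<ge> p\<close> need no distinction, and the two spectra differ only by zeros, which
  \<open>1 + f\<close> does not see. It cannot start from the zero matrix, since the secular
  equation wants a simple spectrum; it starts from the diagonal entries
  \<open>(n - b) / (k + 1)\<close>. As \<open>k\<close> grows, alternant over Vandermonde product
  becomes 0 / 0, and only the Taylor coefficients of order below \<open>n\<close> of the averaged
  functions survive. This is where \<open>f\<close> must vanish near \<open>0\<close>: the averages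
  are convolutions with a density cut off at the origin, and the cut would spoil smoothness in the
  starting point. On polynomials, averaging at rate \<open>r\<close> is inverted by
  \<open>1 - (1 / r) d/dx\<close>, which keeps degrees. Hence the alternant of the
  \<open>(1 + f) \<tau>\<^sub>a\<close> is a constant times the Vandermonde product times the
  product of the \<open>1 + f\<close>, and the summand 1 averages to the identity matrix of the
  Fredholm side.\<close>

lemma nn_integral_PiM_map:
 fixes M :: "'i => 'b measure" and N :: "'i => 'c measure"
 assumes M: "product_sigma_finite M" and N: "product_sigma_finite N" and "finite I"
  and T: "\<And>i. i \<in> I ==> T i \<in> N i \<rightarrow>\<^sub>M M i"
  and eq: "\<And>i F. i \<in> I ==> F \<in> borel_measurable (M i) ==>
   (\<integral>\<^sup>+y. F (T i y) \<partial>N i) = c i * (\<integral>\<^sup>+y. F y \<partial>M i)"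
  and "F \<in> borel_measurable (PiM I M)"
 shows "(\<integral>\<^sup>+x. F (\<lambda>i\<in>I. T i (x i)) \<partial>PiM I N) = (\<Prod>i\<in>I. c i) * (\<integral>\<^sup>+x. F x \<partial>PiM I M)"
 using assms(3-) 
proof (induction I arbitrary: F rule: finite_induct)
 case empty
 interpret M: product_sigma_finite M by fact
 interpret N: product_sigma_finite N by fact
 show ?case using M.nn_integral_empty[of F] N.nn_integral_empty[of "\<lambda>_. F (\<lambda>_. undefined)"]
  by (simp add: restrict_def)
next
 case (insert i I)
 interpret M: product_sigma_finite M by fact
 interpret N: product_sigma_finite N by fact
 interpret Mi: sigma_finite_measure "M i" by (rule M.sigma_finite_measures)
 note [measurable] = insert.prems(3)
 have T[measurable]: "T j \<in> N j \<rightarrow>\<^sub>M M j" if "j \<in> insert i I" for j using insert.prems(1) that by auto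
 have [measurable]: "T i \<in> N i \<rightarrow>\<^sub>M M i" by (rule T) simp
 have R[measurable]: "(\<lambda>x. \<lambda>j\<in>I. T j (x j)) \<in> PiM I N \<rightarrow>\<^sub>M PiM I M"
 proof (rule measurable_restrict)
  fix j assume j: "j \<in> I"
  show "(\<lambda>x. T j (x j)) \<in> Pi\<^sub>M I N \<rightarrow>\<^sub>M M j" 
   by (rule measurable_compose[OF measurable_component_singleton[OF j]]) (use j T in auto)
 qed
 have [measurable]: "(\<lambda>x. \<lambda>j\<in>insert i I. T j (x j)) \<in> PiM (insert i I) N \<rightarrow>\<^sub>M PiM (insert i I) M"
 proof (rule measurable_restrict)
  fix j assume j: "j \<in> insert i I"
  show "(\<lambda>x. T j (x j)) \<in> Pi\<^sub>M (insert i I) N \<rightarrow>\<^sub>M M j" 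
   by (rule measurable_compose[OF measurable_component_singleton[OF j]]) (use j T in auto)
 qed
 have upd: "(\<lambda>j\<in>insert i I. T j (if j = i then y else x j)) = (\<lambda>j\<in>I. T j (x j))(i := T i y)" for x y
  using insert.hyps by (auto simp: fun_eq_iff)
 let ?F = "\<lambda>z. \<integral>\<^sup>+y. F (z(i := y)) \<partial>M i"
 have [measurable]: "?F \<in> borel_measurable (PiM I M)" by measurable
 have "(\<integral>\<^sup>+x. F (\<lambda>i\<in>insert i I. T i (x i)) \<partial>PiM (insert i I) N)
   = (\<integral>\<^sup>+x. \<integral>\<^sup>+y. F ((\<lambda>j\<in>I. T j (x j))(i := T i y)) \<partial>N i \<partial>PiM I N)"
  by (subst N.product_nn_integral_insert[OF insert.hyps(1,2)]) (simp_all add: upd)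
 also have "... = (\<integral>\<^sup>+x. c i * ?F (\<lambda>j\<in>I. T j (x j)) \<partial>PiM I N)"
 proof (rule nn_integral_cong)
  fix x assume x: "x \<in> space (PiM I N)"
  have sp: "(\<lambda>j\<in>I. T j (x j)) \<in> space (PiM I M)"
   using measurable_space[OF R x] .
  have [measurable]: "(\<lambda>y. F ((\<lambda>j\<in>I. T j (x j))(i := y))) \<in> borel_measurable (M i)"
   using sp by measurable
  show "(\<integral>\<^sup>+y. F ((\<lambda>j\<in>I. T j (x j))(i := T i y)) \<partial>N i) = c i * ?F (\<lambda>j\<in>I. T j (x j))"
   by (rule insert.prems(2)) auto
 qed
 also have "... = c i * (\<integral>\<^sup>+x. ?F (\<lambda>j\<in>I. T j (x j)) \<partial>PiM I N)"
  by (rule nn_integral_cmult) measurable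
 also have "... = c i * ((\<Prod>i\<in>I. c i) * (\<integral>\<^sup>+x. ?F x \<partial>PiM I M))"
  using insert.prems by (subst insert.IH) auto
 also have "(\<integral>\<^sup>+x. ?F x \<partial>PiM I M) = (\<integral>\<^sup>+x. F x \<partial>PiM (insert i I) M)"
  by (subst M.product_nn_integral_insert[OF insert.hyps(1,2)]) auto
 finally show ?case using insert.hyps by (simp add: mult.assoc)
qed

text \<open>The interval is exhausted by compact ones, where substitution is available, and monotone
  convergence does the rest. The limits of \<open>g\<close> at the ends make the images exhaust the
  positive half-line.\<close>

lemma nn_integral_substitution_half_line:
 fixes F :: "real => ennreal" and g g' :: "real => real"
 assumes [measurable]: "F \<in> borel_measurable borel" and ab: "a < b"
  and deriv: "\<And>x. a < x ==> x < b ==> (g has_real_derivative g' x) (at x)"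
  and cont: "continuous_on {a<..<b} g'"
  and pos: "\<And>x. a < x ==> x < b ==> 0 <= g' x" "\<And>x. a < x ==> x < b ==> 0 < g x"
  and lim0: "(g \<longlongrightarrow> 0) (at_right a)" and liminf: "filterlim g at_top (at_left b)"
 shows "(\<integral>\<^sup>+t. F t * indicator {0<..} t \<partial>lborel) =
  (\<integral>\<^sup>+y. F (g y) * ennreal (g' y) * indicator {a<..<b} y \<partial>lborel)"
proof -
 \<comment> \<open>The offset 3 gives \<open>s k < t k\<close> already at \<open>k = 0\<close>, as
   \<open>(b - a) / (k + 3)\<close> is less than half the length.\<close>
 define s where "s k = a + (b - a) / (real k + 3)" for k
 define t where "t k = b - (b - a) / (real k + 3)" for k
 have st: "a < s k" "s k < t k" "t k < b" for k
 proof -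
  have "(b - a) / (real k + 3) < (b - a) / 2" using ab by (intro divide_strict_left_mono) auto
  moreover have "(b - a) / (real k + 3) > 0" using ab by simp
  moreover have "(b - a) / 2 = b / 2 - a / 2" by (simp add: diff_divide_distrib)
  ultimately show "a < s k" "s k < t k" "t k < b" unfolding s_def t_def by linarith+
 qed
 have mono: "(b - a) / (real (Suc k) + 3) <= (b - a) / (real k + 3)" for k
  using ab by (intro divide_left_mono) auto
 have incs: "s (Suc k) <= s k" "t k <= t (Suc k)" for k
  using mono[of k] by (auto simp: s_def t_def)
 have lims: "s \<longlonglongrightarrow> a" "t \<longlonglongrightarrow> b" unfolding s_def t_def by real_asymp+
 have gm: "g x <= g y" if "a < x" "x <= y" "y < b" for x y
  using that by (intro deriv_nonneg_imp_mono[of x y g g']) (auto intro!: deriv pos)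
 have fs: "filterlim s (at_right a) sequentially"
  using lims(1) st by (intro filterlim_at_withinI) (auto simp: dist_real_def intro!: tendsto_imp_filterlim_at_right) 
 have ft: "filterlim t (at_left b) sequentially"
  using lims(2) st by (intro tendsto_imp_filterlim_at_left) auto
 have gs: "(\<lambda>k. g (s k)) \<longlonglongrightarrow> 0" by (rule filterlim_compose[OF lim0 fs])
 have gt: "filterlim (\<lambda>k. g (t k)) at_top sequentially" by (rule filterlim_compose[OF liminf ft])
 have U1: "(\<Union>k. {s k..t k}) = {a<..<b}"
 proof (intro Set.set_eqI iffI)
  fix x assume "x \<in> {a<..<b}"
  then have "eventually (\<lambda>k. s k < x) sequentially" "eventually (\<lambda>k. x < t k) sequentially"
   using order_tendstoD[OF lims(1)] order_tendstoD[OF lims(2)] by auto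
  then have "eventually (\<lambda>k. s k < x \<and> x < t k) sequentially" by eventually_elim auto
  then obtain k where "s k < x \<and> x < t k" by (auto dest!: eventually_happens)
  then show "x \<in> (\<Union>k. {s k..t k})" by (intro UN_I[of k]) auto
 next
  fix x assume "x \<in> (\<Union>k. {s k..t k})"
  then obtain k where "s k <= x" "x <= t k" by auto
  then show "x \<in> {a<..<b}" using st[of k] by auto
 qed
 have U2: "(\<Union>k. {g (s k)..g (t k)}) = {0<..}"
 proof (intro Set.set_eqI iffI)
  fix x :: real assume "x \<in> {0<..}"
  then have "eventually (\<lambda>k. g (s k) < x) sequentially" "eventually (\<lambda>k. x <= g (t k)) sequentially"
   using order_tendstoD[OF gs] gt by (auto simp: filterlim_at_top)
  then have "eventually (\<lambda>k. g (s k) < x \<and> x <= g (t k)) sequentially" by eventually_elim auto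
  then obtain k where "g (s k) < x \<and> x <= g (t k)" by (auto dest!: eventually_happens)
  then show "x \<in> (\<Union>k. {g (s k)..g (t k)})" by (intro UN_I[of k]) auto
 next
  fix x assume "x \<in> (\<Union>k. {g (s k)..g (t k)})"
  then obtain k where "g (s k) <= x" by auto
  then show "x \<in> {0<..}" using st[of k] pos(2)[of "s k"] by auto
 qed
 have inc1: "incseq (\<lambda>k. {s k..t k})"
  by (rule incseq_SucI) (use incs in \<open>auto intro: order_trans\<close>)
 have inc2: "incseq (\<lambda>k. {g (s k)..g (t k)})"
 proof (rule incseq_SucI)
  fix k
  have "g (s (Suc k)) <= g (s k)" "g (t k) <= g (t (Suc k))"
   using incs[of k] st[of k] st[of "Suc k"] by (auto intro!: gm)
  then show "{g (s k)..g (t k)} \<subseteq> {g (s (Suc k))..g (t (Suc k))}" by auto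
 qed
 have gcont: "continuous_on {a<..<b} g"
  by (rule DERIV_continuous_on[where D = g']) (rule has_field_derivative_at_within, rule deriv, auto)
 have [measurable]: "(\<lambda>y. indicator {a<..<b} y *\<^sub>R g y) \<in> borel_measurable borel"
  "(\<lambda>y. indicator {a<..<b} y *\<^sub>R g' y) \<in> borel_measurable borel"
  by (rule borel_measurable_continuous_on_indicator[OF _ gcont] borel_measurable_continuous_on_indicator[OF _ cont]; simp)+
 have meas: "(\<lambda>y. F (g y) * ennreal (g' y) * indicator {a<..<b} y) \<in> borel_measurable borel"
 proof -
  have "(\<lambda>y. F (g y) * ennreal (g' y) * indicator {a<..<b} y) =
   (\<lambda>y. F (indicator {a<..<b} y *\<^sub>R g y) * ennreal (indicator {a<..<b} y *\<^sub>R g' y) * indicator {a<..<b} y)"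
   by (auto simp: fun_eq_iff indicator_def)
  moreover have "... \<in> borel_measurable borel" by measurable
  ultimately show ?thesis by simp
 qed
 have aux: "(\<integral>\<^sup>+x. F x * indicator {g (s k)..g (t k)} x \<partial>lborel) =
   (\<integral>\<^sup>+y. F (g y) * ennreal (g' y) * indicator {s k..t k} y \<partial>lborel)" for k
  using st[of k] by (intro nn_integral_substitution_aux) (auto intro!: deriv pos continuous_on_subset[OF cont])
 have "(\<integral>\<^sup>+t. F t * indicator {0<..} t \<partial>lborel) = (\<integral>\<^sup>+u. F u * indicator (\<Union>k. {g (s k)..g (t k)}) u \<partial>lborel)"
  by (simp add: U2)
 also have "... = (SUP k. \<integral>\<^sup>+x. F x * indicator {g (s k)..g (t k)} x \<partial>lborel)"
  using SUP_emeasure_incseq[OF _ inc2, of "density lborel F"] 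
  by (simp add: emeasure_density image_subset_iff)
 also have "... = (SUP k. \<integral>\<^sup>+y. F (g y) * ennreal (g' y) * indicator {s k..t k} y \<partial>lborel)"
  by (simp add: aux)
 also have "... = (SUP k. \<integral>\<^sup>+y. (F (g y) * ennreal (g' y) * indicator {a<..<b} y) * indicator {s k..t k} y \<partial>lborel)"
 proof (intro SUP_cong refl nn_integral_cong)
  fix k y
  show "F (g y) * ennreal (g' y) * indicator {s k..t k} y = (F (g y) * ennreal (g' y) * indicator {a<..<b} y) * indicator {s k..t k} y"
   using st[of k] by (auto simp: indicator_def)
 qed
 also have "... = (\<integral>\<^sup>+y. (F (g y) * ennreal (g' y) * indicator {a<..<b} y) * indicator (\<Union>k. {s k..t k}) y \<partial>lborel)"
  using SUP_emeasure_incseq[OF _ inc1, of "density lborel (\<lambda>y. F (g y) * ennreal (g' y) * indicator {a<..<b} y)"] meas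
  by (simp add: emeasure_density image_subset_iff)
 also have "... = (\<integral>\<^sup>+y. F (g y) * ennreal (g' y) * indicator {a<..<b} y \<partial>lborel)"
  unfolding U1 by (intro nn_integral_cong) (auto simp: indicator_def)
 finally show ?thesis .
qed

section \<open>Interlacing sequences and the residues of their quotient\<close>

definition update_weight :: "nat => (nat => real) => (nat => real) => nat => real" where
 "update_weight n \<mu> l i = (\<Prod>j<n. l j - \<mu> i) / (\<Prod>j\<in>{..<n} - {i}. \<mu> j - \<mu> i)"

text \<open>Index 0 is the largest entry, so the side of the box at index 0 is unbounded
  above.\<close>

definition interlace_box :: "nat => (nat => real) => (nat => real) => bool" where
 "interlace_box n \<mu> l \<longleftrightarrow> (\<forall>j<n. \<mu> j < l j \<and> (0 < j --> l j < \<mu> (j - 1)))"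

definition vandermonde_prod :: "nat => (nat => real) => real" where
 "vandermonde_prod n l = (\<Prod>j<n. \<Prod>i<j. l i - l j)"

lemma vandermonde_prod_Suc: "vandermonde_prod (Suc n) l = vandermonde_prod n l * (\<Prod>i<n. l i - l n)"
 by (simp add: vandermonde_prod_def)

definition strict_dec :: "nat => (nat => real) => bool" where
 "strict_dec n \<mu> \<longleftrightarrow> (\<forall>j<n. \<forall>i<j. \<mu> j < \<mu> i)"

lemma strict_dec_Suc: "strict_dec (Suc n) \<mu> \<longleftrightarrow> strict_dec n \<mu> \<and> (\<forall>i<n. \<mu> n < \<mu> i)"
 by (auto simp: strict_dec_def less_Suc_eq)

lemma strict_dec_last_le: "strict_dec n \<mu> ==> i < n ==> \<mu> (n - 1) <= \<mu> i"
 unfolding strict_dec_def by (cases "i = n - 1") (auto intro!: less_imp_le)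

lemma vandermonde_prod_pos: "strict_dec n l ==> 0 < vandermonde_prod n l"
 by (auto simp: vandermonde_prod_def strict_dec_def intro!: prod_pos)

lemma interlace_box_Suc: "interlace_box (Suc n) \<mu> l \<longleftrightarrow>
 interlace_box n \<mu> l \<and> \<mu> n < l n \<and> (0 < n --> l n < \<mu> (n - 1))"
 by (auto simp: interlace_box_def less_Suc_eq)

lemma interlace_box_less:
 assumes "strict_dec n \<mu>" "interlace_box n \<mu> l" "i < j" "j < n"
 shows "l j < l i"
proof -
 have "l j < \<mu> (j - 1)" "\<mu> i < l i" using assms by (auto simp: interlace_box_def)
 moreover have "\<mu> (j - 1) <= \<mu> i" using assms(1,3,4) unfolding strict_dec_def
  by (cases "i = j - 1") (auto intro!: less_imp_le)
 ultimately show ?thesis by simp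
qed

lemma interlace_box_strict_dec: "strict_dec n \<mu> ==> interlace_box n \<mu> l ==> strict_dec n l"
 unfolding strict_dec_def using interlace_box_less[of n \<mu> l] by (auto simp: strict_dec_def)

text \<open>Appending a last pair multiplies each old weight by one factor that does not involve the
  other \<open>l j\<close>; the inductions below rest on this.\<close>

lemma update_weight_Suc_less:
 assumes "strict_dec (Suc n) \<mu>" "i < n"
 shows "update_weight (Suc n) \<mu> l i = update_weight n \<mu> l i * ((\<mu> i - l n) / (\<mu> i - \<mu> n))"
proof -
 have *: "{..<Suc n} - {i} = insert n ({..<n} - {i})" using assms by auto
 have nz: "\<mu> i - \<mu> n ~= 0" using assms by (auto simp: strict_dec_Suc)
 have "update_weight (Suc n) \<mu> l i = (\<Prod>j<n. l j - \<mu> i) * (l n - \<mu> i) / ((\<mu> n - \<mu> i) * (\<Prod>j\<in>{..<n} - {i}. \<mu> j - \<mu> i))"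
  unfolding update_weight_def * by simp
 also have "... = update_weight n \<mu> l i * ((l n - \<mu> i) / (\<mu> n - \<mu> i))"
  by (simp add: update_weight_def)
 also have "(l n - \<mu> i) / (\<mu> n - \<mu> i) = (\<mu> i - l n) / (\<mu> i - \<mu> n)"
  by (metis minus_diff_eq minus_divide_divide)
 finally show ?thesis .
qed

lemma update_weight_Suc_eq:
 "update_weight (Suc n) \<mu> l n = (l n - \<mu> n) * ((\<Prod>j<n. l j - \<mu> n) / (\<Prod>j<n. \<mu> j - \<mu> n))"
proof -
 have *: "{..<Suc n} - {n} = {..<n}" by auto
 show ?thesis unfolding update_weight_def * by simp
qed

text \<open>The partial fraction expansion of a quotient of monic polynomials of equal degree: the
  weights are minus its residues. It is stated over any real field because it serves at real points,
  for the eigenvectors, and at non-real ones, for the determinants.\<close>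

lemma secular_equation:
 fixes x :: "'a :: real_field"
 assumes "strict_dec n \<mu>" "\<And>j. j < n ==> x ~= of_real (\<mu> j)"
 shows "(\<Prod>j<n. x - of_real (l j)) / (\<Prod>j<n. x - of_real (\<mu> j)) =
  1 - (\<Sum>i<n. of_real (update_weight n \<mu> l i) / (x - of_real (\<mu> i)))"
 using assms
proof (induction n arbitrary: x)
 case 0 then show ?case by simp
next
 case (Suc n)
 let ?w = "\<lambda>i. of_real (update_weight n \<mu> l i) :: 'a"
 let ?m = "\<lambda>i. of_real (\<mu> i) :: 'a"
 let ?l = "of_real (l n) :: 'a"
 have d: "strict_dec n \<mu>" and lt: "\<And>i. i < n ==> \<mu> n < \<mu> i" using Suc.prems by (auto simp: strict_dec_Suc)
 have IH: "(\<Prod>j<n. x - of_real (l j)) / (\<Prod>j<n. x - ?m j) = 1 - (\<Sum>i<n. ?w i / (x - ?m i))"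
  using Suc.prems d by (intro Suc.IH) auto
 have nz: "?m i ~= ?m n" "?m n ~= ?m i" if "i < n" for i using lt[OF that] by auto
 have xn: "x ~= ?m i" if "i < Suc n" for i using Suc.prems that by auto
 have IHn: "(\<Prod>j<n. ?m n - of_real (l j)) / (\<Prod>j<n. ?m n - ?m j) = 1 - (\<Sum>i<n. ?w i / (?m n - ?m i))"
  using nz d by (intro Suc.IH) auto
 have ratio: "(\<Prod>j<n. l j - \<mu> n) / (\<Prod>j<n. \<mu> j - \<mu> n) = (\<Prod>j<n. \<mu> n - l j) / (\<Prod>j<n. \<mu> n - \<mu> j)"
  unfolding prod_dividef[symmetric] by (intro prod.cong refl) (metis minus_diff_eq minus_divide_divide)
 have wn: "of_real (update_weight (Suc n) \<mu> l n) = (?l - ?m n) * (1 - (\<Sum>i<n. ?w i / (?m n - ?m i)))"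
  unfolding update_weight_Suc_eq ratio by (simp add: IHn[symmetric])
 \<comment> \<open>Partial fractions of one product: the first piece carries the new weight at the
   old pole, the second collects at the new pole \<open>\<mu> n\<close>.\<close>
 have summand: "?w i / (x - ?m i) * ((x - ?l) / (x - ?m n)) =
   ?w i * ((?m i - ?l) / (?m i - ?m n)) / (x - ?m i) + (?l - ?m n) * (- ?w i / (?m n - ?m i)) / (x - ?m n)" if "i < n" for i
  using xn[of i] xn[of n] nz[OF that] that by (simp add: divide_simps) (simp add: algebra_simps)
 have "(\<Prod>j<Suc n. x - of_real (l j)) / (\<Prod>j<Suc n. x - ?m j) =
   (1 - (\<Sum>i<n. ?w i / (x - ?m i))) * ((x - ?l) / (x - ?m n))"
  by (simp add: IH[symmetric])
 also have "... = (x - ?l) / (x - ?m n) - (\<Sum>i<n. ?w i / (x - ?m i) * ((x - ?l) / (x - ?m n)))"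
  by (simp only: left_diff_distrib sum_distrib_right mult_1)
 also have "(\<Sum>i<n. ?w i / (x - ?m i) * ((x - ?l) / (x - ?m n))) =
   (\<Sum>i<n. of_real (update_weight (Suc n) \<mu> l i) / (x - ?m i)) + (?l - ?m n) * (\<Sum>i<n. - ?w i / (?m n - ?m i)) / (x - ?m n)"
 proof -
  have "(\<Sum>i<n. ?w i / (x - ?m i) * ((x - ?l) / (x - ?m n))) = (\<Sum>i<n. ?w i * ((?m i - ?l) / (?m i - ?m n)) / (x - ?m i) + (?l - ?m n) * (- ?w i / (?m n - ?m i)) / (x - ?m n))"
   by (intro sum.cong refl summand) auto
  then show ?thesis
   by (simp only: sum.distrib sum_distrib_left sum_divide_distrib) (simp add: update_weight_Suc_less[OF Suc.prems(1)])
 qed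
 also have "(x - ?l) / (x - ?m n) = 1 - (?l - ?m n) / (x - ?m n)"
  using xn[of n] by (simp add: divide_simps)
 finally show ?case
  unfolding sum.lessThan_Suc wn by (simp add: sum_negf algebra_simps diff_divide_distrib add_divide_distrib)
qed

text \<open>The coefficient of \<open>1 / x\<close> at infinity in the secular equation, that is,
  the increase of the trace. It turns the Gaussian exponent of a row into an exponent in
  \<open>l\<close>.\<close>

lemma sum_update_weight:
 assumes "strict_dec n \<mu>"
 shows "(\<Sum>i<n. update_weight n \<mu> l i) = (\<Sum>i<n. l i) - (\<Sum>i<n. \<mu> i)"
 using assms
proof (induction n)
 case (Suc n)
 have d: "strict_dec n \<mu>" and lt: "\<And>i. i < n ==> \<mu> n < \<mu> i" using Suc.prems by (auto simp: strict_dec_Suc)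
 have nz: "\<mu> i ~= \<mu> n" "\<mu> n ~= \<mu> i" if "i < n" for i using lt[OF that] by auto
 have ratio: "(\<Prod>j<n. l j - \<mu> n) / (\<Prod>j<n. \<mu> j - \<mu> n) = (\<Prod>j<n. \<mu> n - l j) / (\<Prod>j<n. \<mu> n - \<mu> j)"
  unfolding prod_dividef[symmetric] by (intro prod.cong refl) (metis minus_diff_eq minus_divide_divide)
 have wn: "update_weight (Suc n) \<mu> l n = (l n - \<mu> n) * (1 - (\<Sum>i<n. update_weight n \<mu> l i / (\<mu> n - \<mu> i)))"
  unfolding update_weight_Suc_eq ratio using secular_equation[OF d, of "\<mu> n" l] nz by auto
 have "(\<Sum>i<n. update_weight (Suc n) \<mu> l i) + update_weight (Suc n) \<mu> l n =
   (\<Sum>i<n. update_weight n \<mu> l i * ((\<mu> i - l n) / (\<mu> i - \<mu> n)) - (l n - \<mu> n) * (update_weight n \<mu> l i / (\<mu> n - \<mu> i))) + (l n - \<mu> n)"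
  unfolding wn by (simp add: update_weight_Suc_less[OF Suc.prems] right_diff_distrib sum_distrib_left sum_subtractf)
 also have "(\<Sum>i<n. update_weight n \<mu> l i * ((\<mu> i - l n) / (\<mu> i - \<mu> n)) - (l n - \<mu> n) * (update_weight n \<mu> l i / (\<mu> n - \<mu> i))) = (\<Sum>i<n. update_weight n \<mu> l i)"
 proof (intro sum.cong refl)
  fix i assume "i \<in> {..<n}"
  then show "update_weight n \<mu> l i * ((\<mu> i - l n) / (\<mu> i - \<mu> n)) - (l n - \<mu> n) * (update_weight n \<mu> l i / (\<mu> n - \<mu> i)) = update_weight n \<mu> l i"
   using nz[of i] by (simp add: divide_simps) (simp add: algebra_simps)
 qed
 finally show ?case using Suc.IH[OF d] by simp
qed simp

lemma update_weight_pos: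
 assumes "strict_dec n \<mu>" "interlace_box n \<mu> l" "i < n"
 shows "0 < update_weight n \<mu> l i"
 using assms
proof (induction n)
 case (Suc n)
 have d: "strict_dec n \<mu>" and lt: "\<And>i. i < n ==> \<mu> n < \<mu> i" using Suc.prems by (auto simp: strict_dec_Suc)
 have b: "interlace_box n \<mu> l" "\<mu> n < l n" using Suc.prems by (auto simp: interlace_box_Suc)
 show ?case
 proof (cases "i = n")
  case True
  have "\<mu> n < l j" if "j < n" for j using b(1) lt that unfolding interlace_box_def by (meson less_trans)
  then show ?thesis unfolding True update_weight_Suc_eq using b lt
   by (intro mult_pos_pos divide_pos_pos prod_pos) auto
 next
  case False
  then have i: "i < n" using Suc.prems by auto
  then have "l n < \<mu> i" using strict_dec_last_le[OF d i] Suc.prems(2) by (auto simp: interlace_box_Suc)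
  then show ?thesis unfolding update_weight_Suc_less[OF Suc.prems(1) i]
   using Suc.IH[OF d b(1) i] lt[OF i] by (intro mult_pos_pos divide_pos_pos) auto
 qed
qed simp


text \<open>The entry \<open>l n\<close> comes from the intermediate value theorem, the others from
  the induction hypothesis, applied to weights rescaled so as to undo the factor of
  \<open>update_weight_Suc_less\<close>.\<close>

lemma update_weight_surj:
 assumes "strict_dec n \<mu>" "\<And>i. i < n ==> 0 < r i"
 shows "\<exists>l. interlace_box n \<mu> l \<and> (\<forall>i<n. update_weight n \<mu> l i = r i)"
 using assms
proof (induction n arbitrary: r)
 case 0 then show ?case by (auto simp: interlace_box_def)
next
 case (Suc n)
 have d: "strict_dec n \<mu>" and lt: "\<And>i. i < n ==> \<mu> n < \<mu> i" using Suc.prems by (auto simp: strict_dec_Suc)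
 \<comment> \<open>The last weight as a function of the candidate \<open>y\<close> for
   \<open>l n\<close>, once the other weights are prescribed.\<close>
 define \<psi> where "\<psi> y = (y - \<mu> n) * (1 + (\<Sum>i<n. r i / (\<mu> i - y)))" for y
 have "\<exists>y. \<mu> n < y \<and> (0 < n --> y < \<mu> (n - 1)) \<and> \<psi> y = r n"
 proof (cases "n = 0")
  case True
  then show ?thesis using Suc.prems(2)[of 0] by (intro exI[of _ "\<mu> 0 + r 0"]) (auto simp: \<psi>_def)
 next
  case False
  let ?b = "\<mu> (n - 1)" and ?a = "\<mu> n"
  have ab: "?a < ?b" using lt False by auto
  have le: "?b <= \<mu> i" if "i < n" for i using d that by (intro strict_dec_last_le)
  \<comment> \<open>Chosen so that the single pole at \<open>\<mu> (n - 1)\<close> lifts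
    \<open>\<psi>\<close> above \<open>r n\<close> at the point that divides the interval in the
    ratio \<open>K\<close> to 1.\<close>
  define K where "K = r n / r (n - 1) + 1"
  have r1: "0 < r (n - 1)" "0 < r n" using Suc.prems(2) False by auto
  have K: "0 < K" "r n < r (n - 1) * K" using r1 by (auto simp: K_def field_simps intro!: add_pos_pos)
  define y1 where "y1 = (?a + K * ?b) / (1 + K)"
  have y1: "y1 - ?a = K * (?b - ?a) / (1 + K)" "?b - y1 = (?b - ?a) / (1 + K)" 
   using K by (auto simp: y1_def field_simps)
  have y1b: "?a < y1" "y1 < ?b"
  proof -
   have "0 < K * (?b - ?a) / (1 + K)" "0 < (?b - ?a) / (1 + K)" using K ab by auto
   then show "?a < y1" "y1 < ?b" unfolding y1[symmetric] by auto
  qed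
  have nn: "0 <= r i / (\<mu> i - y)" if "y < ?b" "i < n" for y i
   using le[OF that(2)] that Suc.prems(2)[of i] by auto
  have "\<psi> y1 \<ge> (y1 - ?a) * (r (n - 1) / (?b - y1))"
   unfolding \<psi>_def using y1b member_le_sum[of "n - 1" "{..<n}" "\<lambda>i. r i / (\<mu> i - y1)"] nn False
   by (intro mult_left_mono) auto
  also have "(y1 - ?a) * (r (n - 1) / (?b - y1)) = r (n - 1) * K"
  proof -
   have "(K * d / e) * (z / (d / e)) = z * K" if "0 < d" "0 < e" for d z e :: real
    using that by simp
   then show ?thesis unfolding y1 using ab K by simp
  qed
  finally have ge: "r n <= \<psi> y1" using K by simp
  have "continuous_on {?a..y1} \<psi>" unfolding \<psi>_def
   by (intro continuous_intros) (use le y1b in fastforce)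
  then obtain y where y: "?a <= y" "y <= y1" "\<psi> y = r n"
   using IVT'[of \<psi> ?a "r n" y1] ge y1b r1 by (auto simp: \<psi>_def)
  moreover have "y ~= ?a" using y(3) r1 by (auto simp: \<psi>_def)
  ultimately show ?thesis using y1b by (intro exI[of _ y]) auto
 qed
 then obtain y where y: "\<mu> n < y" "0 < n --> y < \<mu> (n - 1)" "\<psi> y = r n" by blast
 have le: "\<mu> (n - 1) <= \<mu> i" if "i < n" for i using d that by (intro strict_dec_last_le)
 have yi: "y < \<mu> i" if "i < n" for i using le[OF that] y(2) that by auto
 define r' where "r' i = r i * ((\<mu> i - \<mu> n) / (\<mu> i - y))" for i
 have "\<exists>l. interlace_box n \<mu> l \<and> (\<forall>i<n. update_weight n \<mu> l i = r' i)"
  using Suc.prems(2) yi lt by (intro Suc.IH[OF d]) (auto simp: r'_def)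
 then obtain l where l: "interlace_box n \<mu> l" "\<And>i. i < n ==> update_weight n \<mu> l i = r' i" by blast
 define l' where "l' = l(n := y)"
 have uw: "update_weight n \<mu> l' i = r' i" if "i < n" for i
  using l(2)[OF that] by (simp add: update_weight_def l'_def)
 have ratio: "(\<Prod>j<n. l' j - \<mu> n) / (\<Prod>j<n. \<mu> j - \<mu> n) = (\<Prod>j<n. \<mu> n - l' j) / (\<Prod>j<n. \<mu> n - \<mu> j)"
  unfolding prod_dividef[symmetric] by (intro prod.cong refl) (metis minus_diff_eq minus_divide_divide)
 have sec: "(\<Prod>j<n. l' j - \<mu> n) / (\<Prod>j<n. \<mu> j - \<mu> n) = 1 - (\<Sum>i<n. update_weight n \<mu> l' i / (\<mu> n - \<mu> i))"
  unfolding ratio using secular_equation[OF d, of "\<mu> n" l'] lt by fastforce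
 have "- (\<Sum>i<n. update_weight n \<mu> l' i / (\<mu> n - \<mu> i)) = (\<Sum>i<n. r i / (\<mu> i - y))"
  unfolding sum_negf[symmetric]
 proof (intro sum.cong refl)
  fix i assume "i \<in> {..<n}"
  then show "- (update_weight n \<mu> l' i / (\<mu> n - \<mu> i)) = r i / (\<mu> i - y)"
   using yi[of i] lt[of i] by (simp add: uw r'_def divide_simps) (simp add: algebra_simps)
 qed
 then have sum_eq: "1 - (\<Sum>i<n. update_weight n \<mu> l' i / (\<mu> n - \<mu> i)) = 1 + (\<Sum>i<n. r i / (\<mu> i - y))" by linarith
 have "update_weight (Suc n) \<mu> l' n = r n"
  unfolding update_weight_Suc_eq sec sum_eq using y(3) by (simp add: \<psi>_def l'_def)
 moreover have "update_weight (Suc n) \<mu> l' i = r i" if "i < n" for i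
  unfolding update_weight_Suc_less[OF Suc.prems(1) that] uw[OF that] using yi[OF that] lt[OF that]
  by (simp add: r'_def l'_def)
 moreover have "interlace_box (Suc n) \<mu> l'"
  using l(1) y by (auto simp: interlace_box_def l'_def less_Suc_eq)
 ultimately show ?case by (intro exI[of _ l']) (auto simp: less_Suc_eq)
qed

lemma measurable_update_weight [measurable]:
 "(\<lambda>l. update_weight n \<mu> l i) \<in> borel_measurable (PiM {..<n} (\<lambda>_. lborel))"
 unfolding update_weight_def by measurable

lemma measurable_interlace_box [measurable]:
 "Measurable.pred (PiM {..<n} (\<lambda>_. lborel)) (interlace_box n \<mu>)"
 unfolding interlace_box_def by measurable

lemma measurable_vandermonde_prod [measurable]:
 "vandermonde_prod n \<in> borel_measurable (PiM {..<n} (\<lambda>_. lborel))"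
proof -
 have "(\<lambda>l. \<Prod>j<n. \<Prod>i<j. l i - l j) \<in> borel_measurable (PiM {..<n} (\<lambda>_. lborel :: real measure))"
 proof (intro borel_measurable_prod borel_measurable_diff)
  fix j i assume "j \<in> {..<n}" "i \<in> {..<j}"
  then show "(\<lambda>l. l i) \<in> borel_measurable (Pi\<^sub>M {..<n} (\<lambda>_. lborel))"
   "(\<lambda>l. l j) \<in> borel_measurable (Pi\<^sub>M {..<n} (\<lambda>_. lborel))"
   by (auto intro!: measurable_component_singleton)
 qed
 then show ?thesis by (simp add: vandermonde_prod_def[abs_def])
qed

lemma nn_integral_PiM_scale:
 assumes "finite I" "\<And>i. i \<in> I ==> 0 < c i" and "F \<in> borel_measurable (PiM I (\<lambda>_. lborel :: real measure))"
 shows "ennreal (\<Prod>i\<in>I. c i) * (\<integral>\<^sup>+x. F (\<lambda>i\<in>I. c i * x i) \<partial>PiM I (\<lambda>_. lborel)) = (\<integral>\<^sup>+x. F x \<partial>PiM I (\<lambda>_. lborel))"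
proof -
 have "(\<integral>\<^sup>+x. F (\<lambda>i\<in>I. c i * x i) \<partial>PiM I (\<lambda>_. lborel)) = (\<Prod>i\<in>I. ennreal (1 / c i)) * (\<integral>\<^sup>+x. F x \<partial>PiM I (\<lambda>_. lborel))"
 proof (rule nn_integral_PiM_map)
  show "product_sigma_finite (\<lambda>_. lborel :: real measure)" "product_sigma_finite (\<lambda>_. lborel :: real measure)"
   by standard
  fix i and F :: "real => ennreal" assume i: "i \<in> I" and F: "F \<in> borel_measurable lborel"
  have "(\<integral>\<^sup>+y. F y \<partial>lborel) = ennreal (c i) * (\<integral>\<^sup>+y. F (c i * y) \<partial>lborel)"
   using nn_integral_real_affine[of F "c i" 0] F assms(2)[OF i] by simp
  then show "(\<integral>\<^sup>+y. F (c i * y) \<partial>lborel) = ennreal (1 / c i) * (\<integral>\<^sup>+y. F y \<partial>lborel)"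
   using assms(2)[OF i] by (simp add: mult.assoc[symmetric] ennreal_mult[symmetric])
 qed (use assms in auto)
 moreover have "ennreal (\<Prod>i\<in>I. c i) * (\<Prod>i\<in>I. ennreal (1 / c i)) = 1"
 proof -
  have "ennreal (\<Prod>i\<in>I. c i) * (\<Prod>i\<in>I. ennreal (1 / c i)) = (\<Prod>i\<in>I. ennreal (c i) * ennreal (1 / c i))"
   unfolding prod.distrib using assms by (simp add: prod_ennreal less_imp_le)
  also have "... = 1"
  proof (intro prod.neutral ballI)
   fix i assume "i \<in> I"
   then show "ennreal (c i) * ennreal (1 / c i) = 1"
    using assms(2)[of i] by (subst ennreal_mult'[symmetric]) auto
  qed
  finally show ?thesis .
 qed
 ultimately show ?thesis by (simp add: mult.assoc[symmetric])
qed

text \<open>As a function of \<open>y\<close> the last weight increases from 0 to infinity between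
  \<open>\<mu> n\<close> and \<open>\<mu> (n - 1)\<close>, so it is a change of variable onto the
  half-line; for \<open>n = 0\<close> it is a translation.\<close>

lemma secular_substitution:
 fixes F :: "real => ennreal"
 assumes [measurable]: "F \<in> borel_measurable borel" and d: "strict_dec (Suc n) \<mu>" and r: "\<And>i. i < n ==> 0 < r i"
 shows "(\<integral>\<^sup>+y. F ((y - \<mu> n) * (1 + (\<Sum>i<n. r i / (\<mu> i - y)))) * ennreal (1 + (\<Sum>i<n. r i * (\<mu> i - \<mu> n) / (\<mu> i - y)\<^sup>2)) *
   indicator {y. \<mu> n < y \<and> (0 < n --> y < \<mu> (n - 1))} y \<partial>lborel) = (\<integral>\<^sup>+t. F t * indicator {0<..} t \<partial>lborel)"
proof (cases "n = 0")
 case True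
 have "(\<integral>\<^sup>+t. F t * indicator {0<..} t \<partial>lborel) = (\<integral>\<^sup>+t. F (- \<mu> 0 + 1 * t) * indicator {0<..} (- \<mu> 0 + 1 * t) \<partial>lborel)"
  by (subst nn_integral_real_affine[where c = 1 and t = "- \<mu> 0"]) auto
 also have "... = (\<integral>\<^sup>+y. F ((y - \<mu> n) * (1 + (\<Sum>i<n. r i / (\<mu> i - y)))) * ennreal (1 + (\<Sum>i<n. r i * (\<mu> i - \<mu> n) / (\<mu> i - y)\<^sup>2)) *
   indicator {y. \<mu> n < y \<and> (0 < n --> y < \<mu> (n - 1))} y \<partial>lborel)"
  unfolding True by (intro nn_integral_cong) (auto simp: indicator_def)
 finally show ?thesis by simp
next
 case False
 let ?a = "\<mu> n" and ?b = "\<mu> (n - 1)"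
 have lt: "\<And>i. i < n ==> \<mu> n < \<mu> i" using d by (auto simp: strict_dec_Suc)
 have le: "?b <= \<mu> i" if "i < n" for i using d False that unfolding strict_dec_def
  by (cases "i = n - 1") (auto intro!: less_imp_le)
 have ab: "?a < ?b" using lt False by auto
 define \<psi> where "\<psi> y = (y - \<mu> n) * (1 + (\<Sum>i<n. r i / (\<mu> i - y)))" for y
 define \<psi>' where "\<psi>' y = 1 + (\<Sum>i<n. r i * (\<mu> i - \<mu> n) / (\<mu> i - y)\<^sup>2)" for y
 have pos: "0 < \<mu> i - y" if "i < n" "y < ?b" for i y using le[OF that(1)] that(2) by simp
 have dsum: "((\<lambda>y. \<Sum>i<n. r i / (\<mu> i - y)) has_real_derivative (\<Sum>i<n. r i / (\<mu> i - y)\<^sup>2)) (at y)" if "y < ?b" for y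
 proof -
  have "((\<lambda>z. r i / (\<mu> i - z)) has_real_derivative r i / (\<mu> i - y)\<^sup>2) (at y)" if "i \<in> {..<n}" for i
  proof -
   have "\<mu> i - y ~= 0" using pos[of i y] that \<open>y < ?b\<close> by auto
   then show ?thesis by (auto intro!: derivative_eq_intros simp: power2_eq_square)
  qed
  then show ?thesis by (rule DERIV_sum)
 qed
 have deriv: "(\<psi> has_real_derivative \<psi>' y) (at y)" if "y < ?b" for y
 proof -
  have "(\<psi> has_real_derivative (1 + (\<Sum>i<n. r i / (\<mu> i - y))) + (y - \<mu> n) * (\<Sum>i<n. r i / (\<mu> i - y)\<^sup>2)) (at y)"
  proof -
   have d1: "((\<lambda>y. 1 + (\<Sum>i<n. r i / (\<mu> i - y))) has_real_derivative (\<Sum>i<n. r i / (\<mu> i - y)\<^sup>2)) (at y)"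
    using DERIV_add[OF DERIV_const dsum[OF that]] by simp
   have d2: "((\<lambda>y. y - \<mu> n) has_real_derivative 1) (at y)" by (auto intro!: derivative_eq_intros)
   show ?thesis using DERIV_mult[OF d2 d1] unfolding \<psi>_def by (simp add: mult.commute)
  qed
  moreover have "(1 + (\<Sum>i<n. r i / (\<mu> i - y))) + (y - \<mu> n) * (\<Sum>i<n. r i / (\<mu> i - y)\<^sup>2) = \<psi>' y"
   unfolding \<psi>'_def sum_distrib_left add.assoc sum.distrib[symmetric]
  proof (intro arg_cong2[where f = "(+)"] refl sum.cong)
   fix i assume "i \<in> {..<n}"
   then show "r i / (\<mu> i - y) + (y - \<mu> n) * (r i / (\<mu> i - y)\<^sup>2) = r i * (\<mu> i - \<mu> n) / (\<mu> i - y)\<^sup>2"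
    using pos[of i y] that by (simp add: divide_simps power2_eq_square) (simp add: algebra_simps)
  qed
  ultimately show ?thesis by simp
 qed
 have "(\<integral>\<^sup>+t. F t * indicator {0<..} t \<partial>lborel) = (\<integral>\<^sup>+y. F (\<psi> y) * ennreal (\<psi>' y) * indicator {?a<..<?b} y \<partial>lborel)"
 proof (rule nn_integral_substitution_half_line)
  show "(\<psi> has_real_derivative \<psi>' x) (at x)" if "?a < x" "x < ?b" for x using deriv that by auto
  show "continuous_on {?a<..<?b} \<psi>'" unfolding \<psi>'_def 
   by (intro continuous_intros) (use le in fastforce)
  show "0 <= \<psi>' x" if "?a < x" "x < ?b" for x
   unfolding \<psi>'_def by (intro add_nonneg_nonneg sum_nonneg divide_nonneg_nonneg mult_nonneg_nonneg)
    (use r lt in \<open>auto intro: less_imp_le\<close>)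
  show "0 < \<psi> x" if "?a < x" "x < ?b" for x
   unfolding \<psi>_def using that r pos by (intro mult_pos_pos add_pos_nonneg sum_nonneg divide_nonneg_nonneg less_imp_le) auto
  have "isCont \<psi> ?a" using deriv[OF ab] by (rule DERIV_isCont)
  then show "(\<psi> \<longlongrightarrow> 0) (at_right ?a)"
   unfolding isCont_def by (rule tendsto_within_subset[where S = UNIV, simplified, THEN tendsto_eq_rhs]) (auto simp: \<psi>_def)
  have ev: "eventually (\<lambda>y. y \<in> {?a<..<?b}) (at_left ?b)" using eventually_at_left_real[OF ab] by simp
  \<comment> \<open>One pole suffices for divergence: the summand with index \<open>n - 1\<close> is
    a lower bound, all the others being nonnegative.\<close>
  have "filterlim (\<lambda>y. (y - ?a) * r (n - 1) / (?b - y)) at_top (at_left ?b)"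
  proof -
   have "filterlim (\<lambda>y. ((y - ?a) * r (n - 1)) * inverse (?b - y)) at_top (at_left ?b)"
   proof (rule filterlim_tendsto_pos_mult_at_top)
    show "((\<lambda>y. (y - ?a) * r (n - 1)) \<longlongrightarrow> (?b - ?a) * r (n - 1)) (at_left ?b)"
     by (intro tendsto_intros)
    show "0 < (?b - ?a) * r (n - 1)" using ab r[of "n - 1"] False by auto
    show "filterlim (\<lambda>y. inverse (?b - y)) at_top (at_left ?b)"
    proof (rule filterlim_inverse_at_top)
     show "((\<lambda>y. ?b - y) \<longlongrightarrow> 0) (at_left ?b)" by (auto intro!: tendsto_eq_intros)
     show "\<forall>\<^sub>F y in at_left ?b. 0 < ?b - y" using ev by eventually_elim auto
    qed
   qed
   then show ?thesis by (simp add: field_class.field_divide_inverse)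
  qed
  then show "filterlim \<psi> at_top (at_left ?b)"
  proof (rule filterlim_at_top_mono)
   show "\<forall>\<^sub>F y in at_left ?b. (y - ?a) * r (n - 1) / (?b - y) <= \<psi> y"
    using ev
   proof eventually_elim
    case (elim y)
    have "r (n - 1) / (?b - y) <= 1 + (\<Sum>i<n. r i / (\<mu> i - y))"
    proof -
     have "0 <= r i / (\<mu> i - y)" if "i < n" for i
      using r[OF that] pos[OF that, of y] elim by simp
     then have "r (n - 1) / (?b - y) <= (\<Sum>i<n. r i / (\<mu> i - y))"
      using False by (intro member_le_sum[of "n - 1" "{..<n}" "\<lambda>i. r i / (\<mu> i - y)"]) auto
     then show ?thesis by simp
    qed
    then show ?case unfolding \<psi>_def using elim
     by (simp only: times_divide_eq_right[symmetric]) (rule mult_left_mono, auto)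
   qed
  qed
 qed (use ab in auto)
 also have "... = (\<integral>\<^sup>+y. F (\<psi> y) * ennreal (\<psi>' y) * indicator {y. \<mu> n < y \<and> (0 < n --> y < \<mu> (n - 1))} y \<partial>lborel)"
  using False by (intro nn_integral_cong) (auto simp: indicator_def)
 finally show ?thesis by (simp add: \<psi>_def \<psi>'_def)
qed

text \<open>A Jacobian without multivariate calculus. With \<open>l n = y\<close> fixed, the first
  \<open>n\<close> weights are a coordinatewise rescaling of the weights of the shorter problem;
  with these fixed, the last weight is a one-dimensional substitution in \<open>y\<close>. Fubini
  passes from one view to the other.\<close>

lemma transport_nn_integral:
 assumes "strict_dec n \<mu>" and "G \<in> borel_measurable (PiM {..<n} (\<lambda>_. lborel))"
 shows "(\<integral>\<^sup>+l. G (\<lambda>i\<in>{..<n}. update_weight n \<mu> l i) * (ennreal (vandermonde_prod n l) * indicator {l. interlace_box n \<mu> l} l) \<partial>PiM {..<n} (\<lambda>_. lborel)) =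
  ennreal (vandermonde_prod n \<mu>) * (\<integral>\<^sup>+r. G r * indicator {r. \<forall>i<n. 0 < r i} r \<partial>PiM {..<n} (\<lambda>_. lborel))"
 using assms
proof (induction n arbitrary: G)
 case 0
 interpret product_sigma_finite "\<lambda>_::nat. lborel :: real measure" by standard
 show ?case
  by (simp add: PiM_empty nn_integral_count_space_finite vandermonde_prod_def interlace_box_def restrict_def)
next
 case (Suc n)
 interpret L: product_sigma_finite "\<lambda>_::nat. lborel :: real measure" by standard
 let ?P = "PiM {..<n} (\<lambda>_. lborel :: real measure)" and ?Q = "PiM {..<Suc n} (\<lambda>_. lborel :: real measure)"
 have Qi: "?Q = PiM (insert n {..<n}) (\<lambda>_. lborel)" by (simp add: lessThan_Suc)
 note [measurable] = Suc.prems(2)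
 have d: "strict_dec n \<mu>" and lt: "\<And>i. i < n ==> \<mu> n < \<mu> i" using Suc.prems by (auto simp: strict_dec_Suc)
 define A where "A = {y. \<mu> n < y \<and> (0 < n --> y < \<mu> (n - 1))}"
 have A[measurable]: "A \<in> sets borel" unfolding A_def by measurable
 have yA: "y < \<mu> i" "\<mu> n < y" if "y \<in> A" "i < n" for y i
  using that strict_dec_last_le[OF d that(2)] unfolding A_def by auto
 define \<psi> where "\<psi> r y = (y - \<mu> n) * (1 + (\<Sum>i<n. r i / (\<mu> i - y)))" for r y
 define \<psi>' where "\<psi>' r y = 1 + (\<Sum>i<n. r i * (\<mu> i - \<mu> n) / (\<mu> i - y)\<^sup>2)" for r y
 define c where "c y i = (\<mu> i - y) / (\<mu> i - \<mu> n)" for y i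
 \<comment> \<open>The ratio of the Vandermonde products of \<open>\<mu>\<close> at the lengths
   \<open>n + 1\<close> and \<open>n\<close>.\<close>
 define D where "D = (\<Prod>i<n. \<mu> i - \<mu> n)"
 have D0: "0 < D" unfolding D_def using lt by (intro prod_pos) auto
 \<comment> \<open>The integrand between the two substitutions: the first \<open>n\<close>
   coordinates are already weights, the last is still \<open>y\<close>.\<close>
 define H where "H = (\<lambda>z. G (z(n := \<psi> z (z n))) * (ennreal (D * \<psi>' z (z n)) * 
   (indicator {r. \<forall>i<n. 0 < r i} z * indicator A (z n))))"
 define B where "B = (\<lambda>l. ennreal (vandermonde_prod n l) * indicator {l. interlace_box n \<mu> l} l)"
 have [measurable]: "Measurable.pred ?Q (\<lambda>r. \<forall>i<n. 0 < r i)" by measurable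
 have psiM[measurable]: "(\<lambda>z. \<psi> z (z n)) \<in> borel_measurable ?Q" "(\<lambda>z. \<psi>' z (z n)) \<in> borel_measurable ?Q"
  unfolding \<psi>_def \<psi>'_def by measurable
 have upd[measurable]: "(\<lambda>z. z(n := \<psi> z (z n))) \<in> ?Q \<rightarrow>\<^sub>M ?Q"
  by (rule measurable_fun_upd[of _ "{..<Suc n}"]) (use psiM in auto)
 have HM[measurable]: "H \<in> borel_measurable ?Q" unfolding H_def by measurable
 define G' where "G' y r = G ((\<lambda>i\<in>{..<n}. c y i * r i)(n := \<psi> (\<lambda>i. c y i * r i) y)) * ennreal (D * (\<Prod>i<n. c y i) * \<psi>' (\<lambda>i. c y i * r i) y)" for y r
 let ?I = "\<lambda>l. G (\<lambda>i\<in>{..<Suc n}. update_weight (Suc n) \<mu> l i) * (ennreal (vandermonde_prod (Suc n) l) * indicator {l. interlace_box (Suc n) \<mu> l} l)"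
 have [measurable]: "(\<lambda>l. \<lambda>i\<in>{..<Suc n}. update_weight (Suc n) \<mu> l i) \<in> ?Q \<rightarrow>\<^sub>M ?Q"
  by (rule measurable_restrict) measurable
 have IM: "?I \<in> borel_measurable ?Q" by measurable
 have integrand: "?I (x(n := y)) = G' y (\<lambda>i\<in>{..<n}. update_weight n \<mu> x i) * B x * indicator A y"
  if "x \<in> space ?P" for x y
 proof (cases "interlace_box n \<mu> x \<and> y \<in> A")
  case False
  then show ?thesis
   by (auto simp: B_def A_def interlace_box_Suc indicator_def interlace_box_def)
 next
  case True
  then have b: "interlace_box n \<mu> x" and y: "y \<in> A" by auto
  let ?w = "\<lambda>i. update_weight n \<mu> x i"
  let ?x = "x(n := y)"
  have b': "interlace_box (Suc n) \<mu> ?x" using b y by (auto simp: interlace_box_def A_def less_Suc_eq)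
  have w': "update_weight n \<mu> ?x i = ?w i" for i by (simp add: update_weight_def)
  have w1: "update_weight (Suc n) \<mu> ?x i = c y i * ?w i" if "i < n" for i
   unfolding update_weight_Suc_less[OF Suc.prems(1) that] w' by (simp add: c_def)
  have ratio: "(\<Prod>j<n. x j - z) / (\<Prod>j<n. \<mu> j - z) = (\<Prod>j<n. z - x j) / (\<Prod>j<n. z - \<mu> j)" for z
   unfolding prod_dividef[symmetric] by (intro prod.cong refl) (metis minus_diff_eq minus_divide_divide)
  have sec: "(\<Prod>j<n. x j - z) / (\<Prod>j<n. \<mu> j - z) = 1 + (\<Sum>i<n. ?w i / (\<mu> i - z))" if "\<And>j. j < n ==> z ~= \<mu> j" for z
  proof -
   have "- (\<Sum>i<n. ?w i / (z - \<mu> i)) = (\<Sum>i<n. ?w i / (\<mu> i - z))"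
    unfolding sum_negf[symmetric] by (intro sum.cong refl) (metis minus_diff_eq minus_divide_right)
   then show ?thesis unfolding ratio using secular_equation[OF d, of z x] that by auto
  qed
  have cw: "c y i * ?w i / (\<mu> i - y) = ?w i / (\<mu> i - \<mu> n)" if "i < n" for i
   using yA[OF y that] by (simp add: c_def)
  have "update_weight (Suc n) \<mu> ?x n = (y - \<mu> n) * (1 + (\<Sum>i<n. ?w i / (\<mu> i - \<mu> n)))"
   unfolding update_weight_Suc_eq using sec[of "\<mu> n", OF less_imp_neq[OF lt]] by simp
  also have "... = \<psi> (\<lambda>i. c y i * ?w i) y" unfolding \<psi>_def by (simp add: cw)
  finally have w2: "update_weight (Suc n) \<mu> ?x n = \<psi> (\<lambda>i. c y i * ?w i) y" .
  have arg: "(\<lambda>i\<in>{..<Suc n}. update_weight (Suc n) \<mu> ?x i) =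
    (\<lambda>i\<in>{..<n}. c y i * (\<lambda>i\<in>{..<n}. ?w i) i)(n := \<psi> (\<lambda>i. c y i * (\<lambda>i\<in>{..<n}. ?w i) i) y)"
   using w1 w2 by (auto simp: fun_eq_iff \<psi>_def)
  have cw2: "c y i * ?w i * (\<mu> i - \<mu> n) / (\<mu> i - y)\<^sup>2 = ?w i / (\<mu> i - y)" if "i < n" for i
   using yA[OF y that] lt[OF that] by (simp add: c_def power2_eq_square)
  \<comment> \<open>Apart from the constant \<open>D\<close>, the secular equation at
    \<open>y\<close> splits the new Vandermonde factor into exactly the two Jacobians: the rescaling
    by \<open>c\<close> and the derivative \<open>\<psi>'\<close>.\<close>
  have "(\<Prod>i<n. x i - y) = (\<Prod>j<n. \<mu> j - y) * (1 + (\<Sum>i<n. ?w i / (\<mu> i - y)))"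
  proof -
   have "(\<Prod>j<n. \<mu> j - y) ~= 0" using yA[OF y] by fastforce
   then show ?thesis using sec[of y, OF less_imp_neq[OF yA(1)[OF y]]] by (simp add: divide_eq_eq mult.commute)
  qed
  also have "(\<Prod>j<n. \<mu> j - y) = D * (\<Prod>i<n. c y i)"
   unfolding D_def prod.distrib[symmetric]
  proof (intro prod.cong refl)
   fix i assume "i \<in> {..<n}"
   then show "\<mu> i - y = (\<mu> i - \<mu> n) * c y i" using lt[of i] by (simp add: c_def)
  qed
  also have "1 + (\<Sum>i<n. ?w i / (\<mu> i - y)) = \<psi>' (\<lambda>i. c y i * ?w i) y"
   unfolding \<psi>'_def by (simp add: cw2)
  also have "\<psi>' (\<lambda>i. c y i * ?w i) y = \<psi>' (\<lambda>i. c y i * (\<lambda>i\<in>{..<n}. ?w i) i) y" unfolding \<psi>'_def by simp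
  finally have vp: "(\<Prod>i<n. x i - y) = D * (\<Prod>i<n. c y i) * \<psi>' (\<lambda>i. c y i * (\<lambda>i\<in>{..<n}. ?w i) i) y" .
  have vv: "vandermonde_prod n ?x = vandermonde_prod n x" by (simp add: vandermonde_prod_def)
  have vn: "0 <= vandermonde_prod n x" using vandermonde_prod_pos[OF interlace_box_strict_dec[OF d b]] by simp
  have "ennreal (vandermonde_prod (Suc n) ?x) = ennreal (vandermonde_prod n x) * ennreal (\<Prod>i<n. x i - y)"
   using ennreal_mult'[OF vn] by (simp add: vandermonde_prod_Suc vv)
  then show ?thesis using b b' y unfolding arg G'_def B_def vp by (simp add: mult_ac)
 qed
 have GM[measurable]: "G' y \<in> borel_measurable ?P" for y 
 proof -
  have "(\<lambda>x. \<psi> (\<lambda>i. c y i * x i) y) \<in> borel_measurable ?P" "(\<lambda>x. \<psi>' (\<lambda>i. c y i * x i) y) \<in> borel_measurable ?P"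
   unfolding \<psi>_def \<psi>'_def by measurable
  moreover have "(\<lambda>x. (\<lambda>i\<in>{..<n}. c y i * x i)(n := \<psi> (\<lambda>i. c y i * x i) y)) \<in> ?P \<rightarrow>\<^sub>M ?Q"
   by (rule measurable_fun_upd[of _ "{..<n}"]) (auto simp: lessThan_Suc intro!: measurable_restrict calculation)
  ultimately show ?thesis unfolding G'_def by measurable
 qed
 have inner: "(\<integral>\<^sup>+x. ?I (x(n := y)) \<partial>?P) = ennreal (vandermonde_prod n \<mu>) * (\<integral>\<^sup>+r. H (r(n := y)) \<partial>?P)" for y
 proof (cases "y \<in> A")
  case False
  then show ?thesis by (simp add: integrand H_def cong: nn_integral_cong)
 next
  case True
  have cpos: "0 < c y i" if "i < n" for i using yA[OF True that] lt[OF that] by (simp add: c_def)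
  have "(\<integral>\<^sup>+x. ?I (x(n := y)) \<partial>?P) = (\<integral>\<^sup>+x. G' y (\<lambda>i\<in>{..<n}. update_weight n \<mu> x i) * B x \<partial>?P)"
   using True by (simp add: integrand cong: nn_integral_cong)
  also have "... = ennreal (vandermonde_prod n \<mu>) * (\<integral>\<^sup>+r. G' y r * indicator {r. \<forall>i<n. 0 < r i} r \<partial>?P)"
   unfolding B_def by (rule Suc.IH[OF d GM])
  also have "(\<integral>\<^sup>+r. G' y r * indicator {r. \<forall>i<n. 0 < r i} r \<partial>?P) =
   (\<integral>\<^sup>+r. ennreal (\<Prod>i<n. c y i) * H ((\<lambda>i\<in>{..<n}. c y i * r i)(n := y)) \<partial>?P)"
  proof (rule nn_integral_cong)
   fix r
   have *: "(\<forall>i<n. 0 < c y i * r i) \<longleftrightarrow> (\<forall>i<n. 0 < r i)" by (meson cpos mult_pos_pos zero_less_mult_pos)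
   have p0: "0 <= (\<Prod>i<n. c y i)" using cpos by (intro prod_nonneg) (auto intro: less_imp_le)
   define \<rho> where "\<rho> = (\<lambda>i\<in>{..<n}. c y i * r i)"
   have 1: "\<psi> (\<rho>(n := y)) y = \<psi> (\<lambda>i. c y i * r i) y" "\<psi>' (\<rho>(n := y)) y = \<psi>' (\<lambda>i. c y i * r i) y"
    unfolding \<psi>_def \<psi>'_def \<rho>_def by auto
   have 2: "(\<forall>i<n. 0 < (\<rho>(n := y)) i) \<longleftrightarrow> (\<forall>i<n. 0 < r i)" using * by (simp add: \<rho>_def)
   have 3: "ennreal (D * (\<Prod>i<n. c y i) * \<psi>' (\<lambda>i. c y i * r i) y) = 
    ennreal (\<Prod>i<n. c y i) * ennreal (D * \<psi>' (\<lambda>i. c y i * r i) y)"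
    by (subst ennreal_mult'[OF p0, symmetric]) (simp add: mult_ac)
   have 4: "(\<rho>(n := y)) n = y" "(\<rho>(n := y))(n := v) = \<rho>(n := v)" for v by auto
   show "G' y r * indicator {r. \<forall>i<n. 0 < r i} r = ennreal (\<Prod>i<n. c y i) * H ((\<lambda>i\<in>{..<n}. c y i * r i)(n := y))"
    unfolding G'_def H_def \<rho>_def[symmetric] 3 4 1 using True 2 by (simp add: indicator_def mult_ac del: fun_upd_apply)
  qed
  also have "... = ennreal (\<Prod>i<n. c y i) * (\<integral>\<^sup>+r. H ((\<lambda>i\<in>{..<n}. c y i * r i)(n := y)) \<partial>?P)"
  proof (rule nn_integral_cmult)
   have "(\<lambda>x. (\<lambda>i\<in>{..<n}. c y i * x i)(n := y)) \<in> ?P \<rightarrow>\<^sub>M ?Q"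
    by (rule measurable_fun_upd[of _ "{..<n}"]) (auto simp: lessThan_Suc intro!: measurable_restrict)
   then show "(\<lambda>r. H ((\<lambda>i\<in>{..<n}. c y i * r i)(n := y))) \<in> borel_measurable ?P" by measurable
  qed
  also have "... = (\<integral>\<^sup>+r. H (r(n := y)) \<partial>?P)"
  proof (rule nn_integral_PiM_scale[where F = "\<lambda>r. H (r(n := y))"])
   have "(\<lambda>x. x(n := y)) \<in> ?P \<rightarrow>\<^sub>M ?Q"
    by (rule measurable_fun_upd[of _ "{..<n}"]) (auto simp: lessThan_Suc)
   then show "(\<lambda>r. H (r(n := y))) \<in> borel_measurable ?P" by measurable
  qed (use cpos in auto)
  finally show ?thesis .
 qed
 have "(\<integral>\<^sup>+l. ?I l \<partial>?Q) = (\<integral>\<^sup>+y. \<integral>\<^sup>+x. ?I (x(n := y)) \<partial>?P \<partial>lborel)"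
  using IM unfolding Qi by (subst L.product_nn_integral_insert_rev) auto
 also have "... = (\<integral>\<^sup>+y. ennreal (vandermonde_prod n \<mu>) * (\<integral>\<^sup>+r. H (r(n := y)) \<partial>?P) \<partial>lborel)"
  by (simp only: inner)
 also have "... = ennreal (vandermonde_prod n \<mu>) * (\<integral>\<^sup>+y. (\<integral>\<^sup>+r. H (r(n := y)) \<partial>?P) \<partial>lborel)"
 proof (rule nn_integral_cmult)
  interpret sigma_finite_measure ?P by (rule L.sigma_finite) simp
  have "(\<lambda>(y, x). x(n := y)) \<in> lborel \<Otimes>\<^sub>M ?P \<rightarrow>\<^sub>M ?Q"
   by (auto simp: split_beta' lessThan_Suc intro!: measurable_fun_upd[of _ "{..<n}"])
  then have "(\<lambda>(y, x). H (x(n := y))) \<in> borel_measurable (lborel \<Otimes>\<^sub>M ?P)" by (simp add: split_beta') measurable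
  then show "(\<lambda>y. \<integral>\<^sup>+r. H (r(n := y)) \<partial>?P) \<in> borel_measurable lborel"
   by (rule borel_measurable_nn_integral_fst[where f = "\<lambda>(y, x). H (x(n := y))", simplified])
 qed
 also have "(\<integral>\<^sup>+y. (\<integral>\<^sup>+r. H (r(n := y)) \<partial>?P) \<partial>lborel) = (\<integral>\<^sup>+z. H z \<partial>?Q)"
  using HM unfolding Qi by (subst L.product_nn_integral_insert_rev) auto
 also have "... = (\<integral>\<^sup>+r. \<integral>\<^sup>+y. H (r(n := y)) \<partial>lborel \<partial>?P)"
  using HM unfolding Qi by (subst L.product_nn_integral_insert) auto
 also have "... = (\<integral>\<^sup>+r. \<integral>\<^sup>+y. ennreal D * (G (r(n := y)) * indicator {r. \<forall>i<Suc n. 0 < r i} (r(n := y))) \<partial>lborel \<partial>?P)"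
 proof (rule nn_integral_cong)
  fix r assume r: "r \<in> space ?P"
  have [measurable]: "(\<lambda>t. r(n := t)) \<in> borel \<rightarrow>\<^sub>M ?Q" 
   by (rule measurable_fun_upd[of _ "{..<n}"]) (use r in \<open>auto simp: lessThan_Suc\<close>)
  show "(\<integral>\<^sup>+y. H (r(n := y)) \<partial>lborel) = (\<integral>\<^sup>+y. ennreal D * (G (r(n := y)) * indicator {r. \<forall>i<Suc n. 0 < r i} (r(n := y))) \<partial>lborel)"
  proof (cases "\<forall>i<n. 0 < r i")
   case True
   have "(\<integral>\<^sup>+y. H (r(n := y)) \<partial>lborel) = (\<integral>\<^sup>+y. ennreal D * G (r(n := \<psi> r y)) * ennreal (\<psi>' r y) * indicator A y \<partial>lborel)"
   proof (rule nn_integral_cong)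
    fix y
    have "\<psi> (r(n := y)) y = \<psi> r y" "\<psi>' (r(n := y)) y = \<psi>' r y" "\<forall>i<n. 0 < (r(n := y)) i"
     using True unfolding \<psi>_def \<psi>'_def by auto
    moreover have "ennreal (D * \<psi>' r y) = ennreal D * ennreal (\<psi>' r y)" by (rule ennreal_mult'[OF less_imp_le[OF D0]])
    ultimately show "H (r(n := y)) = ennreal D * G (r(n := \<psi> r y)) * ennreal (\<psi>' r y) * indicator A y"
     unfolding H_def by (simp add: mult_ac del: fun_upd_apply) (simp add: indicator_def mult_ac)
   qed
   also have "... = (\<integral>\<^sup>+t. ennreal D * G (r(n := t)) * indicator {0<..} t \<partial>lborel)"
    unfolding \<psi>_def \<psi>'_def A_def using True by (intro secular_substitution Suc.prems(1)) auto
   also have "... = (\<integral>\<^sup>+y. ennreal D * (G (r(n := y)) * indicator {r. \<forall>i<Suc n. 0 < r i} (r(n := y))) \<partial>lborel)"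
    using True by (intro nn_integral_cong) (auto simp: indicator_def less_Suc_eq)
   finally show ?thesis .
  next
   case False
   then have *: "\<not> (\<forall>i<n. 0 < (r(n := y)) i)" "\<not> (\<forall>i<Suc n. 0 < (r(n := y)) i)" for y by (auto simp: less_Suc_eq)
   then show ?thesis unfolding H_def by (simp only: indicator_def mem_Collect_eq *) simp
  qed
 qed
 also have "... = (\<integral>\<^sup>+z. ennreal D * (G z * indicator {r. \<forall>i<Suc n. 0 < r i} z) \<partial>?Q)"
  unfolding Qi by (subst L.product_nn_integral_insert) (auto simp: lessThan_Suc[symmetric])
 also have "... = ennreal D * (\<integral>\<^sup>+z. G z * indicator {r. \<forall>i<Suc n. 0 < r i} z \<partial>?Q)"
  by (rule nn_integral_cmult) measurable
 finally show ?case
  unfolding vandermonde_prod_Suc D_def[symmetric] using ennreal_mult'[of "vandermonde_prod n \<mu>" D] vandermonde_prod_pos[OF d]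
  by (simp add: mult.assoc)
qed

section \<open>Gaussian vectors\<close>

no_notation vec_index (infixl "$" 100)
no_notation fps_nth (infixl "$" 75)
hide_const (open) Determinant.det Matrix.vec Matrix.row Matrix.col Matrix.mat

lemma nn_integral_PiM_density:
 fixes M N :: "'i => 'b measure"
 assumes M: "product_sigma_finite M" and N: "product_sigma_finite N" and "finite I"
  and d: "\<And>i. i \<in> I ==> N i = density (M i) (f i)" "\<And>i. i \<in> I ==> f i \<in> borel_measurable (M i)"
  and "F \<in> borel_measurable (PiM I M)"
 shows "(\<integral>\<^sup>+x. F x \<partial>PiM I N) = (\<integral>\<^sup>+x. (\<Prod>i\<in>I. f i (x i)) * F x \<partial>PiM I M)"
 using assms(3-)
proof (induction I arbitrary: F rule: finite_induct)
 case empty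
 then show ?case by (simp add: PiM_empty nn_integral_count_space_finite)
next
 case (insert i I)
 interpret M: product_sigma_finite M by fact
 interpret N: product_sigma_finite N by fact
 interpret Mi: sigma_finite_measure "M i" by (rule M.sigma_finite_measures)
 note [measurable] = insert.prems(3)
 have [measurable]: "f j \<in> borel_measurable (M j)" if "j \<in> insert i I" for j using insert.prems(2) that by auto
 have [measurable]: "f i \<in> borel_measurable (M i)" by (rule insert.prems) simp
 have sN: "sets (N j) = sets (M j)" if "j \<in> insert i I" for j using insert.prems(1)[OF that] by simp
 have sP: "sets (PiM (insert i I) N) = sets (PiM (insert i I) M)" "sets (PiM I N) = sets (PiM I M)"
  using sN by (auto intro!: sets_PiM_cong)
 have FN: "F \<in> borel_measurable (PiM (insert i I) N)" using insert.prems(3) sP by (simp cong: measurable_cong_sets)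
 have prodM[measurable]: "(\<lambda>x. \<Prod>j\<in>I. f j (x j)) \<in> borel_measurable (PiM I M)"
  by (intro borel_measurable_prod_ennreal measurable_compose[OF measurable_component_singleton]) auto
 have prodM2[measurable]: "(\<lambda>x. \<Prod>j\<in>insert i I. f j (x j)) \<in> borel_measurable (PiM (insert i I) M)"
  by (intro borel_measurable_prod_ennreal measurable_compose[OF measurable_component_singleton]) auto
 let ?F = "\<lambda>x. \<integral>\<^sup>+y. f i y * F (x(i := y)) \<partial>M i"
 have "(\<integral>\<^sup>+x. F x \<partial>PiM (insert i I) N) = (\<integral>\<^sup>+x. \<integral>\<^sup>+y. F (x(i := y)) \<partial>N i \<partial>PiM I N)"
  using insert.hyps FN by (intro N.product_nn_integral_insert) auto
 also have "... = (\<integral>\<^sup>+x. ?F x \<partial>PiM I N)"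
 proof (rule nn_integral_cong)
  fix x assume "x \<in> space (PiM I N)"
  then have x: "x \<in> space (PiM I M)" using sP(2) sets_eq_imp_space_eq by blast
  have "(\<lambda>y. F (x(i := y))) \<in> borel_measurable (M i)" using x by measurable
  then show "(\<integral>\<^sup>+y. F (x(i := y)) \<partial>N i) = ?F x"
   using insert.prems(1)[of i] by (simp add: nn_integral_density)
 qed
 also have "... = (\<integral>\<^sup>+x. (\<Prod>j\<in>I. f j (x j)) * ?F x \<partial>PiM I M)"
 proof (rule insert.IH)
  show "?F \<in> borel_measurable (PiM I M)" by measurable
 qed (use insert.prems in auto)
 also have "... = (\<integral>\<^sup>+x. \<integral>\<^sup>+y. (\<Prod>j\<in>I. f j (x j)) * (f i y * F (x(i := y))) \<partial>M i \<partial>PiM I M)"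
 proof (rule nn_integral_cong)
  fix x assume x: "x \<in> space (PiM I M)"
  have [measurable]: "(\<lambda>y. F (x(i := y))) \<in> borel_measurable (M i)" using x by measurable
  show "(\<Prod>j\<in>I. f j (x j)) * ?F x = (\<integral>\<^sup>+y. (\<Prod>j\<in>I. f j (x j)) * (f i y * F (x(i := y))) \<partial>M i)"
   by (rule nn_integral_cmult[symmetric]) measurable
 qed
 also have "... = (\<integral>\<^sup>+x. \<integral>\<^sup>+y. (\<Prod>j\<in>insert i I. f j ((x(i := y)) j)) * F (x(i := y)) \<partial>M i \<partial>PiM I M)"
 proof (intro nn_integral_cong)
  fix x y
  have "(\<Prod>j\<in>I. f j ((x(i := y)) j)) = (\<Prod>j\<in>I. f j (x j))" using insert.hyps by (intro prod.cong) auto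
  then show "(\<Prod>j\<in>I. f j (x j)) * (f i y * F (x(i := y))) = (\<Prod>j\<in>insert i I. f j ((x(i := y)) j)) * F (x(i := y))"
   using insert.hyps by (simp add: mult_ac del: fun_upd_apply) (simp add: mult_ac)
 qed
 also have "... = (\<integral>\<^sup>+x. (\<Prod>j\<in>insert i I. f j (x j)) * F x \<partial>PiM (insert i I) M)"
  using insert.hyps by (subst M.product_nn_integral_insert) auto
 finally show ?case .
qed

text \<open>A disc of radius \<open>sqrt a\<close> has area \<open>pi * a\<close>, and the
  half-lines \<open>{..a}\<close> generate the Borel sets.\<close>

lemma distr_cmod_power2_lborel:
 "distr lborel borel (\<lambda>y::complex. (cmod y)\<^sup>2) = density lborel (\<lambda>t. ennreal pi * indicator {0<..} t)"
proof (rule measure_eqI_generator_eq[where E = "range (\<lambda>a::real. {..a})" and \<Omega> = UNIV and A = "\<lambda>i::nat. {..real i}"])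
 have emL: "emeasure (distr lborel borel (\<lambda>y::complex. (cmod y)\<^sup>2)) {..a} = ennreal (pi * max 0 a)" for a
 proof -
  have "(\<lambda>y::complex. (cmod y)\<^sup>2) -` {..a} = (if a < 0 then {} else cball 0 (sqrt a))"
   by (auto simp: real_le_rsqrt sqrt_le_D real_sqrt_le_iff dest: order_trans[OF zero_le_power2])
    (metis norm_ge_zero real_le_rsqrt real_sqrt_abs real_sqrt_le_iff sqrt_le_D abs_of_nonneg power_mono real_sqrt_ge_zero real_sqrt_pow2 not_less)
  then show ?thesis by (auto simp: emeasure_distr emeasure_cball unit_ball_vol_2)
 qed
 show "emeasure (distr lborel borel (\<lambda>y::complex. (cmod y)\<^sup>2)) X = emeasure (density lborel (\<lambda>t. ennreal pi * indicator {0<..} t)) X"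
  if X': "X \<in> range (\<lambda>a::real. {..a})" for X
 proof -
  obtain a where X: "X = {..a}" using X' by (rule rangeE)
  have "emeasure (density lborel (\<lambda>t. ennreal pi * indicator {0<..} t)) {..a} = (\<integral>\<^sup>+t. ennreal pi * indicator {0<..a} t \<partial>lborel)"
   by (subst emeasure_density) (auto intro!: nn_integral_cong simp: indicator_def)
  also have "... = ennreal (pi * max 0 a)"
   by (subst nn_integral_cmult) (auto simp: ennreal_mult max_def)
  finally show ?thesis by (simp add: X emL)
 qed
 show "emeasure (distr lborel borel (\<lambda>y::complex. (cmod y)\<^sup>2)) {..real i} ~= \<infinity>" for i by (simp add: emL)
 show "(\<Union>i. {..real i}) = UNIV" using real_arch_simple by auto
 show "Int_stable (range (\<lambda>a::real. {..a}))" by (auto simp: Int_stable_def)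
qed (auto simp: borel_eq_atMost)

lemma nn_integral_cmod_power2:
 assumes [measurable]: "F \<in> borel_measurable borel"
 shows "(\<integral>\<^sup>+y. F ((cmod y)\<^sup>2) \<partial>lborel) = ennreal pi * (\<integral>\<^sup>+t. F t * indicator {0<..} t \<partial>lborel)"
proof -
 have "(\<integral>\<^sup>+y. F ((cmod y)\<^sup>2) \<partial>lborel) = (\<integral>\<^sup>+t. F t \<partial>distr lborel borel (\<lambda>y::complex. (cmod y)\<^sup>2))"
  by (subst nn_integral_distr) auto
 also have "... = (\<integral>\<^sup>+t. ennreal pi * (F t * indicator {0<..} t) \<partial>lborel)"
  unfolding distr_cmod_power2_lborel by (subst nn_integral_density) (auto simp: mult_ac intro!: nn_integral_cong)
 finally show ?thesis by (simp add: nn_integral_cmult)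
qed

definition exp_law :: "real => real measure" where
 "exp_law \<alpha> = density lborel (\<lambda>t. ennreal (\<alpha> * exp (- \<alpha> * t)) * indicator {0<..} t)"

text \<open>The rate is the inverse of the variance, so that the squared modulus has the law
  \<open>exp_law \<alpha>\<close>.\<close>

definition complex_gauss :: "real => complex measure" where
 "complex_gauss \<alpha> = density lborel (\<lambda>y. ennreal (\<alpha> / pi * exp (- \<alpha> * (cmod y)\<^sup>2)))"

lemma sets_exp_law [simp, measurable_cong]: "sets (exp_law \<alpha>) = sets borel" and space_exp_law [simp]: "space (exp_law \<alpha>) = UNIV"
 and sets_complex_gauss [simp, measurable_cong]: "sets (complex_gauss \<alpha>) = sets borel" and space_complex_gauss [simp]: "space (complex_gauss \<alpha>) = UNIV"
 by (auto simp: exp_law_def complex_gauss_def)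

lemma prob_space_exp_law: assumes "0 < \<alpha>" shows "prob_space (exp_law \<alpha>)"
proof -
 have "exp_law \<alpha> = density lborel (exponential_density \<alpha>)"
  unfolding exp_law_def
 proof (rule density_cong)
  show "AE t in lborel. ennreal (\<alpha> * exp (- \<alpha> * t)) * indicator {0<..} t = ennreal (exponential_density \<alpha> t)"
   using AE_lborel_singleton[of "0::real"] by eventually_elim (auto simp: exponential_density_def indicator_def mult_ac)
 qed auto
 then show ?thesis using prob_space_exponential_density[OF assms] by simp
qed

lemma nn_integral_complex_gauss_cmod:
 assumes [measurable]: "F \<in> borel_measurable borel" and "0 < \<alpha>"
 shows "(\<integral>\<^sup>+y. F ((cmod y)\<^sup>2) \<partial>complex_gauss \<alpha>) = (\<integral>\<^sup>+t. F t \<partial>exp_law \<alpha>)"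
proof -
 have "(\<integral>\<^sup>+y. F ((cmod y)\<^sup>2) \<partial>complex_gauss \<alpha>) = (\<integral>\<^sup>+y. ennreal (\<alpha> / pi * exp (- \<alpha> * (cmod y)\<^sup>2)) * F ((cmod y)\<^sup>2) \<partial>lborel)"
  unfolding complex_gauss_def by (subst nn_integral_density) auto
 also have "... = ennreal pi * (\<integral>\<^sup>+t. ennreal (\<alpha> / pi * exp (- \<alpha> * t)) * F t * indicator {0<..} t \<partial>lborel)"
  by (rule nn_integral_cmod_power2[where F = "\<lambda>t. ennreal (\<alpha> / pi * exp (- \<alpha> * t)) * F t"]) auto
 also have "... = (\<integral>\<^sup>+t. ennreal pi * (ennreal (\<alpha> / pi * exp (- \<alpha> * t)) * F t * indicator {0<..} t) \<partial>lborel)"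
  by (rule nn_integral_cmult[symmetric]) auto
 also have "... = (\<integral>\<^sup>+t. ennreal (\<alpha> * exp (- \<alpha> * t)) * indicator {0<..} t * F t \<partial>lborel)"
 proof (rule nn_integral_cong)
  fix t
  have "ennreal pi * ennreal (\<alpha> / pi * exp (- \<alpha> * t)) = ennreal (\<alpha> * exp (- \<alpha> * t))"
   by (subst ennreal_mult'[symmetric]) auto
  then show "ennreal pi * (ennreal (\<alpha> / pi * exp (- \<alpha> * t)) * F t * indicator {0<..} t) = ennreal (\<alpha> * exp (- \<alpha> * t)) * indicator {0<..} t * F t"
   by (metis mult.assoc mult.commute)
 qed
 also have "... = (\<integral>\<^sup>+t. F t \<partial>exp_law \<alpha>)"
  unfolding exp_law_def by (subst nn_integral_density) auto
 finally show ?thesis .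
qed

lemma prob_space_complex_gauss: assumes "0 < \<alpha>" shows "prob_space (complex_gauss \<alpha>)"
proof
 interpret prob_space "exp_law \<alpha>" by (rule prob_space_exp_law[OF assms])
 show "emeasure (complex_gauss \<alpha>) (space (complex_gauss \<alpha>)) = 1"
  using nn_integral_complex_gauss_cmod[of "\<lambda>_. 1" \<alpha>] assms emeasure_space_1 by simp
qed

definition gauss_vec :: "nat => real => (nat => complex) measure" where
 "gauss_vec n \<alpha> = PiM {..<n} (\<lambda>_. complex_gauss \<alpha>)"

lemma prob_space_gauss_vec: "0 < \<alpha> ==> prob_space (gauss_vec n \<alpha>)"
 unfolding gauss_vec_def by (intro prob_space_PiM prob_space_complex_gauss)

lemma sets_gauss_vec [measurable_cong]: "sets (gauss_vec n \<alpha>) = sets (PiM {..<n} (\<lambda>_. borel))"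
 and space_gauss_vec: "space (gauss_vec n \<alpha>) = {..<n} \<rightarrow>\<^sub>E UNIV"
 unfolding gauss_vec_def by (auto intro!: sets_PiM_cong simp: space_PiM)

lemma distr_gauss_vec_cmod:
 assumes "0 < \<alpha>"
 shows "distr (gauss_vec n \<alpha>) (PiM {..<n} (\<lambda>_. borel)) (\<lambda>y. \<lambda>i\<in>{..<n}. (cmod (y i))\<^sup>2) = PiM {..<n} (\<lambda>_. exp_law \<alpha>)"
proof (rule measure_eqI)
 interpret E: prob_space "exp_law \<alpha>" by (rule prob_space_exp_law[OF assms])
 interpret C: prob_space "complex_gauss \<alpha>" by (rule prob_space_complex_gauss[OF assms])
 show s: "sets (distr (gauss_vec n \<alpha>) (PiM {..<n} (\<lambda>_. borel)) (\<lambda>y. \<lambda>i\<in>{..<n}. (cmod (y i))\<^sup>2)) = sets (PiM {..<n} (\<lambda>_. exp_law \<alpha>))"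
  by (auto intro!: sets_PiM_cong)
 fix A assume "A \<in> sets (distr (gauss_vec n \<alpha>) (PiM {..<n} (\<lambda>_. borel)) (\<lambda>y. \<lambda>i\<in>{..<n}. (cmod (y i))\<^sup>2))"
 then have A[measurable]: "A \<in> sets (PiM {..<n} (\<lambda>_. borel))" by simp
 have A': "A \<in> sets (PiM {..<n} (\<lambda>_. exp_law \<alpha>))" using A s by simp
 have m: "(\<lambda>y. \<lambda>i\<in>{..<n}. (cmod (y i))\<^sup>2) \<in> gauss_vec n \<alpha> \<rightarrow>\<^sub>M PiM {..<n} (\<lambda>_. borel)"
  by measurable
 have "emeasure (distr (gauss_vec n \<alpha>) (PiM {..<n} (\<lambda>_. borel)) (\<lambda>y. \<lambda>i\<in>{..<n}. (cmod (y i))\<^sup>2)) A =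
  (\<integral>\<^sup>+y. indicator A (\<lambda>i\<in>{..<n}. (cmod (y i))\<^sup>2) \<partial>gauss_vec n \<alpha>)"
  using nn_integral_distr[OF m, of "indicator A"] A by simp
 also have "... = (\<Prod>i\<in>{..<n}. 1) * (\<integral>\<^sup>+r. indicator A r \<partial>PiM {..<n} (\<lambda>_. exp_law \<alpha>))"
  unfolding gauss_vec_def
 proof (rule nn_integral_PiM_map[where T = "\<lambda>_ y. (cmod y)\<^sup>2"])
  show "product_sigma_finite (\<lambda>_::nat. exp_law \<alpha>)" "product_sigma_finite (\<lambda>_::nat. complex_gauss \<alpha>)"
   by (auto simp: product_sigma_finite_def intro: E.sigma_finite_measure_axioms C.sigma_finite_measure_axioms)
  show "(\<integral>\<^sup>+y. F ((cmod y)\<^sup>2) \<partial>complex_gauss \<alpha>) = 1 * (\<integral>\<^sup>+y. F y \<partial>exp_law \<alpha>)" if "F \<in> borel_measurable (exp_law \<alpha>)" for F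
   using that assms by (simp add: nn_integral_complex_gauss_cmod cong: measurable_cong_sets)
 qed (use A' in auto)
 also have "... = emeasure (PiM {..<n} (\<lambda>_. exp_law \<alpha>)) A"
  using A' by simp
 finally show "emeasure (distr (gauss_vec n \<alpha>) (PiM {..<n} (\<lambda>_. borel)) (\<lambda>y. \<lambda>i\<in>{..<n}. (cmod (y i))\<^sup>2)) A = emeasure (PiM {..<n} (\<lambda>_. exp_law \<alpha>)) A" .
qed

section \<open>Unitary matrices of variable size and the invariance of Gaussian vectors\<close>

definition unitary_rows :: "nat => (nat => nat => complex) => bool" where
 "unitary_rows n v \<longleftrightarrow>
  (\<forall>i<n. \<forall>j<n. (\<Sum>k<n. v i k * cnj (v j k)) = (if i = j then 1 else 0)) \<and>
  (\<forall>i<n. \<forall>j<n. (\<Sum>k<n. v k i * cnj (v k j)) = (if i = j then 1 else 0))"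

definition apply_rows :: "nat => (nat => nat => complex) => (nat => complex) => nat => complex" where
 "apply_rows n v y = (\<lambda>i\<in>{..<n}. \<Sum>k<n. v i k * y k)"

definition adj_rows :: "(nat => nat => complex) => nat => nat => complex" where
 "adj_rows v i j = cnj (v j i)"

lemma unitary_rows_adj: "unitary_rows n v ==> unitary_rows n (adj_rows v)"
proof -
 assume u: "unitary_rows n v"
 have "(\<Sum>k<n. cnj (v k i) * v k j) = (if i = j then 1 else 0)" "(\<Sum>k<n. cnj (v i k) * v j k) = (if i = j then 1 else 0)" if "i < n" "j < n" for i j
  using u that unfolding unitary_rows_def by (auto simp: mult.commute)
 then show ?thesis unfolding unitary_rows_def adj_rows_def by simp
qed

lemma apply_rows_adj:
 assumes "unitary_rows n v" "i < n"
 shows "apply_rows n v (apply_rows n (adj_rows v) y) i = y i"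
proof -
 have "apply_rows n v (apply_rows n (adj_rows v) y) i = (\<Sum>k<n. \<Sum>l<n. v i k * cnj (v l k) * y l)"
  using assms(2) by (simp add: apply_rows_def adj_rows_def sum_distrib_left mult_ac)
 also have "... = (\<Sum>l<n. (\<Sum>k<n. v i k * cnj (v l k)) * y l)"
  by (subst sum.swap) (simp add: sum_distrib_right)
 also have "... = (\<Sum>l<n. (if i = l then 1 else 0) * y l)"
  using assms unfolding unitary_rows_def by (intro sum.cong) auto
 also have "... = y i" using assms(2) by (simp add: if_distrib[of "\<lambda>x. x * _"] cong: if_cong)
 finally show ?thesis .
qed

lemma norm_apply_rows:
 assumes "unitary_rows n v"
 shows "(\<Sum>i<n. (cmod (apply_rows n v y i))\<^sup>2) = (\<Sum>i<n. (cmod (y i))\<^sup>2)"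
proof -
 have "complex_of_real (\<Sum>i<n. (cmod (apply_rows n v y i))\<^sup>2) = (\<Sum>i<n. (\<Sum>k<n. v i k * y k) * (\<Sum>l<n. cnj (v i l) * cnj (y l)))"
  by (simp add: apply_rows_def complex_norm_square del: of_real_power)
 also have "... = (\<Sum>i<n. \<Sum>k<n. \<Sum>l<n. v i k * cnj (v i l) * (y k * cnj (y l)))"
  by (simp add: sum_product mult_ac)
 also have "... = (\<Sum>k<n. \<Sum>l<n. \<Sum>i<n. v i k * cnj (v i l) * (y k * cnj (y l)))"
  by (subst sum.swap) (rule sum.cong[OF refl sum.swap])
 also have "... = (\<Sum>k<n. \<Sum>l<n. (if k = l then 1 else 0) * (y k * cnj (y l)))"
  using assms unfolding unitary_rows_def by (intro sum.cong refl) (simp add: sum_distrib_right[symmetric])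
 also have "... = (\<Sum>k<n. y k * cnj (y k))"
  by (simp add: if_distrib[of "\<lambda>x. x * _"] cong: if_cong)
 also have "... = complex_of_real (\<Sum>i<n. (cmod (y i))\<^sup>2)"
  by (simp add: complex_norm_square del: of_real_power)
 finally show ?thesis by (simp only: of_real_eq_iff)
qed

lemma measurable_apply_rows: "apply_rows n v \<in> PiM {..<n} (\<lambda>_. borel) \<rightarrow>\<^sub>M PiM {..<n} (\<lambda>_. borel)"
 unfolding apply_rows_def[abs_def] by measurable

definition add_vec :: "nat => (nat => complex) => (nat => complex) => nat => complex" where
 "add_vec n a x = (\<lambda>i\<in>{..<n}. a i + x i)"

lemma measurable_add_vec:
 assumes "f \<in> N \<rightarrow>\<^sub>M PiM {..<n} (\<lambda>_. lborel)" "h \<in> N \<rightarrow>\<^sub>M PiM {..<n} (\<lambda>_. lborel)"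
 shows "(\<lambda>z. add_vec n (f z) (h z)) \<in> N \<rightarrow>\<^sub>M PiM {..<n} (\<lambda>_. lborel)"
 unfolding add_vec_def
proof (rule measurable_restrict)
 fix i assume "i \<in> {..<n}"
 then have "(\<lambda>z. f z i) \<in> borel_measurable N" "(\<lambda>z. h z i) \<in> borel_measurable N"
  using measurable_compose[OF assms(1) measurable_component_singleton] measurable_compose[OF assms(2) measurable_component_singleton]
  by fastforce+
 then show "(\<lambda>z. f z i + h z i) \<in> N \<rightarrow>\<^sub>M lborel" by simp
qed

lemma lborel_translation_nn_integral:
 fixes a :: "'a::euclidean_space"
 assumes "F \<in> borel_measurable borel"
 shows "(\<integral>\<^sup>+y. F (a + y) \<partial>lborel) = (\<integral>\<^sup>+y. F y \<partial>lborel)"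
 using assms by (subst (2) lborel_distr_plus[of a, symmetric]) (simp add: nn_integral_distr)

lemma nn_integral_PiM_translation:
 fixes a :: "nat => complex"
 assumes "F \<in> borel_measurable (PiM {..<n} (\<lambda>_. lborel))"
 shows "(\<integral>\<^sup>+x. F (\<lambda>i\<in>{..<n}. a i + x i) \<partial>PiM {..<n} (\<lambda>_. lborel)) = (\<integral>\<^sup>+x. F x \<partial>PiM {..<n} (\<lambda>_. lborel))"
proof -
 have s: "product_sigma_finite (\<lambda>_::nat. lborel :: complex measure)" by standard
 have "(\<integral>\<^sup>+x. F (\<lambda>i\<in>{..<n}. a i + x i) \<partial>PiM {..<n} (\<lambda>_. lborel)) = (\<Prod>i<n. 1) * (\<integral>\<^sup>+x. F x \<partial>PiM {..<n} (\<lambda>_. lborel))"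
  by (rule nn_integral_PiM_map[OF s s]) (use assms in \<open>auto simp: lborel_translation_nn_integral\<close>)
 then show ?thesis by simp
qed

text \<open>Both sides of the invariance below are compared through the double integral of
 \<open>g y * F (U x + y)\<close> with a Gaussian \<open>g\<close>; only translation invariance of Lebesgue measure
 and Fubini are needed.\<close>

lemma nn_integral_PiM_unitary:
 assumes u: "unitary_rows n v" and F: "F \<in> borel_measurable (PiM {..<n} (\<lambda>_. lborel))"
 shows "(\<integral>\<^sup>+x. F (apply_rows n v x) \<partial>PiM {..<n} (\<lambda>_. lborel)) = (\<integral>\<^sup>+x. F x \<partial>PiM {..<n} (\<lambda>_. lborel))"
proof -
 let ?P = "PiM {..<n} (\<lambda>_. lborel :: complex measure)"
 interpret L: product_sigma_finite "\<lambda>_::nat. lborel :: complex measure" by standard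
 interpret P: sigma_finite_measure ?P by (rule L.sigma_finite) simp
 interpret PP: pair_sigma_finite ?P ?P ..
 define g where "g y = (\<Prod>k<n. ennreal (exp (- (cmod (y k))\<^sup>2)))" for y :: "nat => complex"
 define pl where "pl = add_vec n"
 have pl: "pl a x = (\<lambda>i\<in>{..<n}. a i + x i)" for a x by (simp add: pl_def add_vec_def)
 let ?U = "apply_rows n v" and ?V = "apply_rows n (adj_rows v)"
 have sP: "sets ?P = sets (PiM {..<n} (\<lambda>_. borel))" by (auto intro!: sets_PiM_cong)
 note [measurable] = F
 have gM[measurable]: "g \<in> borel_measurable ?P" unfolding g_def by measurable
 have UM[measurable]: "?U \<in> ?P \<rightarrow>\<^sub>M ?P" "?V \<in> ?P \<rightarrow>\<^sub>M ?P"
  using measurable_apply_rows[of n] by (simp_all add: measurable_cong_sets[OF sP sP])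
 note plM2 = measurable_add_vec[of _ _ n, folded pl_def]
 have UMi: "(\<lambda>x. ?U x i) \<in> borel_measurable ?P" if "i < n" for i
  using measurable_compose[OF UM(1) measurable_component_singleton[of i]] that by simp
 have mm: "(\<lambda>x. \<lambda>i\<in>{..<n}. - ?U x i) \<in> ?P \<rightarrow>\<^sub>M ?P"
  by (rule measurable_restrict) (simp add: UMi)
 have tr: "(\<integral>\<^sup>+x. G (pl a x) \<partial>?P) = (\<integral>\<^sup>+x. G x \<partial>?P)" if "G \<in> borel_measurable ?P" for G a
  unfolding pl by (rule nn_integral_PiM_translation[OF that])
 have ext: "x = y" if "x \<in> space ?P" "y \<in> space ?P" "\<And>i. i < n ==> x i = y i" for x y
  by (rule PiE_ext[of x "{..<n}" "\<lambda>_. UNIV" y]) (use that in \<open>auto simp: space_PiM\<close>)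
 have UV: "?U (pl (?V y) x) = pl y (?U x)" for x y
 proof -
  have "(\<Sum>k<n. v i k * (?V y k + x k)) = y i + (\<Sum>k<n. v i k * x k)" if "i < n" for i
   using apply_rows_adj[OF u that, of y] that by (simp add: apply_rows_def distrib_left sum.distrib)
  then show ?thesis by (auto simp: pl apply_rows_def[of n v] fun_eq_iff)
 qed
 have UM0: "?U x \<in> space ?P" for x by (simp add: space_PiM apply_rows_def)
 have gexp: "g y = ennreal (exp (- (\<Sum>k<n. (cmod (y k))\<^sup>2)))" for y
  by (simp add: g_def prod_ennreal exp_sum sum_negf[symmetric])
 have gU: "g (\<lambda>i\<in>{..<n}. - ?U x i) = g x" for x
  unfolding gexp by (simp add: norm_apply_rows[OF u])
 define C where "C = (\<integral>\<^sup>+y. g y \<partial>?P)"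
 have C: "C ~= 0" "C ~= \<infinity>"
 proof -
  have "(\<integral>\<^sup>+y. ennreal (exp (- (cmod y)\<^sup>2)) \<partial>lborel) = ennreal pi"
  proof -
   interpret prob_space "complex_gauss 1" by (rule prob_space_complex_gauss) simp
   have "ennreal pi * 1 = ennreal pi * (\<integral>\<^sup>+y. ennreal (1 / pi * exp (- 1 * (cmod y)\<^sup>2)) \<partial>lborel)"
    using emeasure_space_1 by (simp add: complex_gauss_def emeasure_density)
   also have "... = (\<integral>\<^sup>+y. ennreal pi * ennreal (1 / pi * exp (- 1 * (cmod y)\<^sup>2)) \<partial>lborel)"
    by (rule nn_integral_cmult[symmetric]) auto
   also have "... = (\<integral>\<^sup>+y. ennreal (exp (- (cmod y)\<^sup>2)) \<partial>lborel)"
    by (intro nn_integral_cong) (simp add: ennreal_mult'[symmetric])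
   finally show ?thesis by simp
  qed
  then have "C = (\<Prod>k<n. ennreal pi)" unfolding C_def g_def by (subst L.product_nn_integral_prod) auto
  then show "C ~= 0" "C ~= \<infinity>" by (auto simp: ennreal_power)
 qed
 have "C * (\<integral>\<^sup>+x. F (?U x) \<partial>?P) = (\<integral>\<^sup>+y. g y * (\<integral>\<^sup>+x. F (?U x) \<partial>?P) \<partial>?P)"
  unfolding C_def by (rule nn_integral_multc[symmetric]) auto
 also have "... = (\<integral>\<^sup>+y. \<integral>\<^sup>+x. g y * F (pl y (?U x)) \<partial>?P \<partial>?P)"
 proof (rule nn_integral_cong)
  fix y assume y: "y \<in> space ?P"
  have "(\<integral>\<^sup>+x. F (?U x) \<partial>?P) = (\<integral>\<^sup>+x. F (?U (pl (?V y) x)) \<partial>?P)" by (rule tr[symmetric]) measurable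
  also have "... = (\<integral>\<^sup>+x. F (pl y (?U x)) \<partial>?P)" by (simp only: UV)
  finally have *: "(\<integral>\<^sup>+x. F (?U x) \<partial>?P) = (\<integral>\<^sup>+x. F (pl y (?U x)) \<partial>?P)" .
  have m: "(\<lambda>x. pl y (?U x)) \<in> ?P \<rightarrow>\<^sub>M ?P" using y UM(1) by (intro plM2) auto
  show "g y * (\<integral>\<^sup>+x. F (?U x) \<partial>?P) = (\<integral>\<^sup>+x. g y * F (pl y (?U x)) \<partial>?P)"
   unfolding * by (rule nn_integral_cmult[symmetric], rule measurable_compose[OF m F])
 qed
 also have "... = (\<integral>\<^sup>+x. \<integral>\<^sup>+y. g y * F (pl y (?U x)) \<partial>?P \<partial>?P)"
 proof (rule PP.Fubini')
  have "(\<lambda>z. pl (snd z) (?U (fst z))) \<in> ?P \<Otimes>\<^sub>M ?P \<rightarrow>\<^sub>M ?P" by (intro plM2) auto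
  then show "(\<lambda>(x, y). g y * F (pl y (?U x))) \<in> borel_measurable (?P \<Otimes>\<^sub>M ?P)"
   by (simp add: split_beta') measurable
 qed
 also have "... = (\<integral>\<^sup>+x. \<integral>\<^sup>+y. g (pl (\<lambda>i\<in>{..<n}. - ?U x i) y) * F y \<partial>?P \<partial>?P)"
 proof (rule nn_integral_cong)
  fix x assume x: "x \<in> space ?P"
  have m: "(\<lambda>i\<in>{..<n}. - ?U x i) \<in> space ?P" by (simp add: space_PiM)
  have 1: "(\<lambda>y. pl (\<lambda>i\<in>{..<n}. - ?U x i) y) \<in> ?P \<rightarrow>\<^sub>M ?P" using m by (intro plM2) auto
  have "(\<integral>\<^sup>+y. g (pl (\<lambda>i\<in>{..<n}. - ?U x i) y) * F y \<partial>?P) =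
   (\<integral>\<^sup>+y. g (pl (\<lambda>i\<in>{..<n}. - ?U x i) (pl (?U x) y)) * F (pl (?U x) y) \<partial>?P)"
   by (intro tr[symmetric] borel_measurable_times_ennreal measurable_compose[OF 1 gM] F)
  also have "... = (\<integral>\<^sup>+y. g y * F (pl y (?U x)) \<partial>?P)"
  proof (rule nn_integral_cong)
   fix y assume y: "y \<in> space ?P"
   have "pl (\<lambda>i\<in>{..<n}. - ?U x i) (pl (?U x) y) = y"
    by (rule ext) (use y in \<open>auto simp: pl space_PiM\<close>)
   moreover have "pl (?U x) y = pl y (?U x)" by (auto simp: pl add.commute)
   ultimately show "g (pl (\<lambda>i\<in>{..<n}. - ?U x i) (pl (?U x) y)) * F (pl (?U x) y) = g y * F (pl y (?U x))" by simp
  qed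
  finally show "(\<integral>\<^sup>+y. g y * F (pl y (?U x)) \<partial>?P) = (\<integral>\<^sup>+y. g (pl (\<lambda>i\<in>{..<n}. - ?U x i) y) * F y \<partial>?P)" by simp
 qed
 also have "... = (\<integral>\<^sup>+y. \<integral>\<^sup>+x. g (pl (\<lambda>i\<in>{..<n}. - ?U x i) y) * F y \<partial>?P \<partial>?P)"
 proof (rule PP.Fubini')
  have "(\<lambda>z. pl (\<lambda>i\<in>{..<n}. - ?U (snd z) i) (fst z)) \<in> ?P \<Otimes>\<^sub>M ?P \<rightarrow>\<^sub>M ?P"
   by (intro plM2) (auto intro: measurable_compose[OF measurable_snd mm])
  then show "(\<lambda>(y, x). g (pl (\<lambda>i\<in>{..<n}. - ?U x i) y) * F y) \<in> borel_measurable (?P \<Otimes>\<^sub>M ?P)"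
   by (simp add: split_beta') measurable
 qed
 also have "... = (\<integral>\<^sup>+y. C * F y \<partial>?P)"
 proof (rule nn_integral_cong)
  fix y assume y: "y \<in> space ?P"
  have [measurable]: "(\<lambda>x. pl (\<lambda>i\<in>{..<n}. - ?U x i) y) \<in> ?P \<rightarrow>\<^sub>M ?P"
   using y mm by (intro plM2) auto
  have "(\<integral>\<^sup>+x. g (pl (\<lambda>i\<in>{..<n}. - ?U x i) y) \<partial>?P) = (\<integral>\<^sup>+x. g (pl (\<lambda>i\<in>{..<n}. - ?U (pl (?V y) x) i) y) \<partial>?P)"
   by (rule tr[symmetric]) measurable
  also have "... = C" unfolding C_def
  proof (rule nn_integral_cong)
   fix x
   have "pl (\<lambda>i\<in>{..<n}. - ?U (pl (?V y) x) i) y = (\<lambda>i\<in>{..<n}. - ?U x i)"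
    unfolding UV by (auto simp: pl)
   then show "g (pl (\<lambda>i\<in>{..<n}. - ?U (pl (?V y) x) i) y) = g x" by (simp only: gU)
  qed
  finally have "(\<integral>\<^sup>+x. g (pl (\<lambda>i\<in>{..<n}. - ?U x i) y) \<partial>?P) = C" .
  then show "(\<integral>\<^sup>+x. g (pl (\<lambda>i\<in>{..<n}. - ?U x i) y) * F y \<partial>?P) = C * F y"
   by (simp add: nn_integral_multc)
 qed
 also have "... = C * (\<integral>\<^sup>+y. F y \<partial>?P)" by (rule nn_integral_cmult) measurable
 finally show ?thesis using C by (simp add: ennreal_mult_cancel_left)
qed

text \<open>Lebesgue measure is invariant, and the Gaussian density depends only on the sum of the
  squared moduli, which a unitary map keeps.\<close>

lemma distr_gauss_vec_unitary:
 assumes u: "unitary_rows n v" and a: "0 < \<alpha>"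
 shows "distr (gauss_vec n \<alpha>) (PiM {..<n} (\<lambda>_. borel)) (apply_rows n v) = gauss_vec n \<alpha>"
proof (rule measure_eqI)
 let ?P = "PiM {..<n} (\<lambda>_. lborel :: complex measure)"
 interpret C: prob_space "complex_gauss \<alpha>" by (rule prob_space_complex_gauss[OF a])
 have sP: "sets ?P = sets (PiM {..<n} (\<lambda>_. borel))" by (auto intro!: sets_PiM_cong)
 show s: "sets (distr (gauss_vec n \<alpha>) (PiM {..<n} (\<lambda>_. borel)) (apply_rows n v)) = sets (gauss_vec n \<alpha>)"
  by (simp add: sets_gauss_vec)
 fix A assume "A \<in> sets (distr (gauss_vec n \<alpha>) (PiM {..<n} (\<lambda>_. borel)) (apply_rows n v))"
 then have A[measurable]: "A \<in> sets (PiM {..<n} (\<lambda>_. borel))" by simp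
 have A'[measurable]: "A \<in> sets ?P" using A sP by simp
 define d where "d y = (\<Prod>k<n. ennreal (\<alpha> / pi * exp (- \<alpha> * (cmod (y k))\<^sup>2)))" for y :: "nat => complex"
 have [measurable]: "d \<in> borel_measurable ?P" unfolding d_def by measurable
 have dexp: "d y = ennreal ((\<alpha> / pi) ^ n * exp (- \<alpha> * (\<Sum>k<n. (cmod (y k))\<^sup>2)))" for y
 proof -
  have "(\<Prod>k<n. \<alpha> / pi * exp (- \<alpha> * (cmod (y k))\<^sup>2)) = (\<alpha> / pi) ^ n * exp (- \<alpha> * (\<Sum>k<n. (cmod (y k))\<^sup>2))"
   by (simp only: prod.distrib prod_constant card_lessThan exp_sum[OF finite_lessThan] sum_distrib_left)
  moreover have "d y = ennreal (\<Prod>k<n. \<alpha> / pi * exp (- \<alpha> * (cmod (y k))\<^sup>2))"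
   unfolding d_def using a by (intro prod_ennreal) auto
  ultimately show ?thesis by simp
 qed
 have dU: "d (apply_rows n v y) = d y" for y
  unfolding dexp by (simp add: norm_apply_rows[OF u])
 have dens: "(\<integral>\<^sup>+y. F y \<partial>gauss_vec n \<alpha>) = (\<integral>\<^sup>+y. d y * F y \<partial>?P)" if "F \<in> borel_measurable ?P" for F
  unfolding gauss_vec_def d_def
  by (rule nn_integral_PiM_density) (use that in \<open>auto simp: complex_gauss_def[symmetric] product_sigma_finite_def intro: C.sigma_finite_measure_axioms sigma_finite_lborel\<close>, simp add: complex_gauss_def)
 have UM[measurable]: "apply_rows n v \<in> ?P \<rightarrow>\<^sub>M ?P"
  using measurable_apply_rows[of n] by (simp_all add: measurable_cong_sets[OF sP sP])
 have UM2: "apply_rows n v \<in> gauss_vec n \<alpha> \<rightarrow>\<^sub>M PiM {..<n} (\<lambda>_. borel)"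
  using measurable_apply_rows[of n] by (simp add: measurable_cong_sets[OF sets_gauss_vec refl])
 have "emeasure (distr (gauss_vec n \<alpha>) (PiM {..<n} (\<lambda>_. borel)) (apply_rows n v)) A =
  (\<integral>\<^sup>+y. indicator A (apply_rows n v y) \<partial>gauss_vec n \<alpha>)"
  using nn_integral_distr[OF UM2, of "indicator A"] A by simp
 also have "... = (\<integral>\<^sup>+y. d y * indicator A (apply_rows n v y) \<partial>?P)" by (rule dens) measurable
 also have "... = (\<integral>\<^sup>+y. d (apply_rows n v y) * indicator A (apply_rows n v y) \<partial>?P)" by (simp only: dU)
 also have "... = (\<integral>\<^sup>+y. d y * indicator A y \<partial>?P)" by (rule nn_integral_PiM_unitary[OF u]) measurable
 also have "... = (\<integral>\<^sup>+y. indicator A y \<partial>gauss_vec n \<alpha>)" by (rule dens[symmetric]) measurable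
 also have "... = emeasure (gauss_vec n \<alpha>) A" using A by (simp add: sets_gauss_vec)
 finally show "emeasure (distr (gauss_vec n \<alpha>) (PiM {..<n} (\<lambda>_. borel)) (apply_rows n v)) A = emeasure (gauss_vec n \<alpha>) A" .
qed

text \<open>A vanishing coordinate would make a weight 0 and break strict interlacing; such rows
  form a null set.\<close>

lemma AE_gauss_vec_nonzero:
 assumes "0 < \<alpha>" "i < n"
 shows "AE y in gauss_vec n \<alpha>. y i ~= 0"
 unfolding gauss_vec_def
proof (rule AE_PiM_component)
 show "prob_space (complex_gauss \<alpha>)" by (rule prob_space_complex_gauss[OF assms(1)])
 show "AE x in complex_gauss \<alpha>. x ~= 0"
  unfolding complex_gauss_def by (subst AE_density) (use AE_lborel_singleton[of "0::complex"] in \<open>auto elim: eventually_mono\<close>)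
qed (use assms in auto)

section \<open>Adding a row to a diagonal matrix\<close>

text \<open>A right inverse of a square matrix is a left inverse; the detour through matrices with
  explicit dimensions is made for this fact.\<close>

lemma unitary_rowsI:
 assumes "\<And>i j. i < n ==> j < n ==> (\<Sum>k<n. v i k * cnj (v j k)) = (if i = j then 1 else 0)"
 shows "unitary_rows n v"
proof -
 define A where "A = Matrix.mat n n (\<lambda>(i, k). v i k)"
 define B where "B = Matrix.mat n n (\<lambda>(k, j). cnj (v j k))"
 have AB: "A * B = 1\<^sub>m n"
 proof (rule eq_matI)
  fix i j assume "i < dim_row (1\<^sub>m n)" "j < dim_col (1\<^sub>m n)"
  then have ij: "i < n" "j < n" by auto
  have "(A * B) $$ (i, j) = (\<Sum>k<n. v i k * cnj (v j k))"
   using ij by (simp add: A_def B_def scalar_prod_def lessThan_atLeast0)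
  then show "(A * B) $$ (i, j) = 1\<^sub>m n $$ (i, j)" using assms ij by simp
 qed (auto simp: A_def B_def)
 have BA: "B * A = 1\<^sub>m n"
  by (rule mat_mult_left_right_inverse[OF _ _ AB]) (auto simp: A_def B_def)
 have "(\<Sum>k<n. v k i * cnj (v k j)) = (if i = j then 1 else 0)" if "i < n" "j < n" for i j
 proof -
  have "(B * A) $$ (j, i) = (\<Sum>k<n. cnj (v k j) * v k i)"
   using that by (simp add: A_def B_def scalar_prod_def lessThan_atLeast0)
  then show ?thesis using that by (simp add: BA mult.commute) (metis)
 qed
 then show ?thesis using assms by (simp add: unitary_rows_def)
qed

text \<open>The rank-one determinant formula: \<open>u\<close> is the \<open>i\<close>-th column of
  the inverse of \<open>A\<close>. The added row is expanded in the rows of \<open>A\<close>, and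
  Cramer's rule reads off its \<open>i\<close>-th coefficient.\<close>

lemma det_row_update:
 fixes A :: "'a::field^'n^'n"
 assumes "det A ~= 0" and u: "A *v u = axis i 1"
 shows "det (\<chi> k j. A $ k $ j + (if k = i then \<rho> $ j else 0)) = det A * (1 + (\<Sum>j\<in>UNIV. \<rho> $ j * u $ j))"
proof -
 have inv: "invertible A" using assms(1) by (simp add: invertible_det_nz)
 then obtain B where B: "A ** B = mat 1" "B ** A = mat 1" unfolding invertible_def by blast
 have uB: "u = B *v axis i 1" using u B(2) by (metis matrix_vector_mul_assoc matrix_vector_mul_lid)
 have uj: "u $ j = B $ j $ i" for j unfolding uB by (simp add: matrix_vector_mult_def axis_def if_distrib cong: if_cong)
 define c where "c = \<rho> v* B"
 have ci: "c $ i = (\<Sum>j\<in>UNIV. \<rho> $ j * u $ j)" by (simp add: c_def vector_matrix_mult_def uj)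
 have cA: "c v* A = \<rho>" by (simp add: c_def vector_matrix_mul_assoc B)
 have rho: "\<rho> = (\<Sum>k\<in>UNIV. c $ k *s row k A)"
  unfolding cA[symmetric] by (simp add: Finite_Cartesian_Product.vec_eq_iff vector_matrix_mult_def Finite_Cartesian_Product.row_def mult.commute)
 have "det (\<chi> k j. A $ k $ j + (if k = i then \<rho> $ j else 0)) = det (\<chi> k. if k = i then row k A + \<rho> else row k A)"
  by (rule arg_cong[where f = det]) (simp add: Finite_Cartesian_Product.vec_eq_iff Finite_Cartesian_Product.row_def)
 also have "... = det (\<chi> k. if k = i then row k A else row k A) + det (\<chi> k. if k = i then \<rho> else row k A)"
  by (rule Determinants.det_row_add)
 also have "(\<chi> k. if k = i then row k A else row k A) = A" by (simp add: Finite_Cartesian_Product.vec_eq_iff Finite_Cartesian_Product.row_def)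
 also have "det (\<chi> k. if k = i then \<rho> else row k A) = c $ i * det A"
 proof -
  have "det (\<chi> k. if k = i then (\<Sum>k\<in>UNIV. c $ k *s row k A) else row k A) = c $ i * det A"
   by (rule cramer_lemma_transpose)
  then show ?thesis by (simp only: rho[symmetric])
 qed
 finally show ?thesis by (simp add: ci algebra_simps)
qed

text \<open>Up to the factor \<open>\<Prod>k<n. x - e k\<close>, its determinant is the
  characteristic polynomial of the \<open>n\<close> by \<open>n\<close> matrix \<open>diag e\<close>
  plus the Gram matrix of the rows in \<open>S\<close>. Only the row index is restricted to
  \<open>S\<close>, so that adding an element to \<open>S\<close> changes a single row.\<close>

definition gram_mat :: "(nat => real) => nat => 'p set => ('p::finite => nat => complex) => complex => complex^'p^'p" where
 "gram_mat e n S X x = (\<chi> i j. (if i = j then 1 else 0) -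
   (if i \<in> S then (\<Sum>k<n. X i k * cnj (X j k) / (x - of_real (e k))) else 0))"

text \<open>A simple positive spectrum of that \<open>n\<close> by \<open>n\<close> matrix with
  orthonormal eigenvectors. The determinant identity is asked off the real axis, away from all
  poles; the trace identity bounds the spectra when limits are taken.\<close>

definition diag_spectrum :: "(nat => real) => nat => 'p set => ('p::finite => nat => complex) => (nat => nat => complex) => (nat => real) => bool" where
 "diag_spectrum e n S X v \<mu> \<longleftrightarrow> strict_dec n \<mu> \<and> (\<forall>j<n. 0 < \<mu> j) \<and> unitary_rows n v \<and>
  (\<forall>j<n. \<forall>k<n. of_real (e k) * v j k + (\<Sum>i\<in>S. cnj (X i k) * (\<Sum>l<n. X i l * v j l)) = of_real (\<mu> j) * v j k) \<and>
  (\<forall>x. Im x ~= 0 --> (\<Prod>k<n. x - of_real (e k)) * det (gram_mat e n S X x) = (\<Prod>j<n. x - of_real (\<mu> j))) \<and>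
  (\<Sum>j<n. \<mu> j) = (\<Sum>j<n. e j) + (\<Sum>i\<in>S. \<Sum>k<n. (cmod (X i k))\<^sup>2)"

text \<open>A permutation that moves a point outside \<open>S\<close> contributes 0 on either side,
  and one that fixes all of them maps \<open>S\<close> to itself and so never meets a column outside
  \<open>S\<close> in a row of \<open>S\<close>.\<close>

lemma det_gram_mat_restrict:
 "det (gram_mat e n S X x) = det (\<chi> i j. (if i = j then 1 else 0) -
   (if i \<in> S \<and> j \<in> S then (\<Sum>k<n. X i k * cnj (X j k) / (x - of_real (e k))) else 0) :: complex^'p::finite^'p)"
 unfolding Determinants.det_def
proof (intro sum.cong refl arg_cong2[where f = "(*)"])
 fix p assume "p \<in> {p. p permutes (UNIV :: 'p set)}"
 then have p: "p permutes (UNIV :: 'p set)" by simp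
 let ?A = "gram_mat e n S X x"
 let ?B = "\<chi> i j. (if i = j then 1 else 0) -
   (if i \<in> S \<and> j \<in> S then (\<Sum>k<n. X i k * cnj (X j k) / (x - of_real (e k))) else 0) :: complex^'p^'p"
 show "(\<Prod>i\<in>UNIV. ?A $ i $ p i) = (\<Prod>i\<in>UNIV. ?B $ i $ p i)"
 proof (cases "\<exists>i. i \<notin> S \<and> p i ~= i")
  case True
  then obtain i where i: "i \<notin> S" "p i ~= i" by blast
  then have "?A $ i $ p i = 0" "?B $ i $ p i = 0" by (auto simp: gram_mat_def)
  then show ?thesis by (metis (mono_tags, lifting) UNIV_I finite prod_zero)
 next
  case False
  have "p i \<in> S" if "i \<in> S" for i
   using False that by (metis p permutes_inj injD)
  then show ?thesis using False by (intro prod.cong refl) (auto simp: gram_mat_def)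
 qed
qed

lemma det_gram_mat_cong:
 assumes "\<And>i k. i \<in> S ==> k < n ==> X i k = Y i k"
 shows "det (gram_mat e n S X x) = det (gram_mat e n S Y x)"
 unfolding det_gram_mat_restrict using assms
 by (intro arg_cong[where f = det]) (auto simp: Finite_Cartesian_Product.vec_eq_iff intro!: sum.cong)

lemma diag_spectrum_cong:
 assumes "\<And>i k. i \<in> S ==> k < n ==> X i k = Y i k"
 shows "diag_spectrum e n S X v \<mu> \<longleftrightarrow> diag_spectrum e n S Y v \<mu>"
proof -
 have "(\<Sum>i\<in>S. cnj (X i k) * (\<Sum>l<n. X i l * v j l)) = (\<Sum>i\<in>S. cnj (Y i k) * (\<Sum>l<n. Y i l * v j l))" if "k < n" for j k
  using assms that by (intro sum.cong refl arg_cong2[where f = "(*)"]) auto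
 moreover have "(\<Sum>i\<in>S. \<Sum>k<n. (cmod (X i k))\<^sup>2) = (\<Sum>i\<in>S. \<Sum>k<n. (cmod (Y i k))\<^sup>2)"
  using assms by (intro sum.cong refl) auto
 ultimately show ?thesis
  unfolding diag_spectrum_def using det_gram_mat_cong[of S n X Y] assms by auto
qed

lemma diag_spectrum_empty:
 assumes "strict_dec n e" "\<And>j. j < n ==> 0 < e j"
 shows "diag_spectrum e n {} X (\<lambda>j k. if j = k then 1 else 0) e"
proof -
 have "gram_mat e n {} X x = mat 1" for x by (simp add: gram_mat_def Finite_Cartesian_Product.mat_def)
 moreover have "unitary_rows n (\<lambda>j k. if j = k then 1 else 0)"
  by (rule unitary_rowsI) (simp add: if_distrib[of "\<lambda>x. x * _"] cong: if_cong)
 ultimately show ?thesis using assms by (auto simp: diag_spectrum_def)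
qed

lemma strict_dec_antimono: "strict_dec n \<mu> ==> i <= j ==> j < n ==> \<mu> j <= \<mu> i"
 unfolding strict_dec_def by (cases "i = j") (auto intro!: less_imp_le)

text \<open>A rank-one update in the eigenbasis. The new eigenvectors are resolvents of the old
  matrix applied to the new row; the secular equation makes them eigenvectors and orthogonal. The
  determinant follows from \<open>det_row_update\<close>.\<close>

lemma diag_spectrum_step:
 fixes X :: "'p::finite => nat => complex"
 assumes sp: "diag_spectrum e n S X v \<mu>" and iS: "i \<notin> S" and box: "interlace_box n \<mu> l"
  and w: "\<And>j. j < n ==> update_weight n \<mu> l j = (cmod (\<Sum>k<n. v j k * X i k))\<^sup>2"
  and c0: "\<And>j. j < n ==> (\<Sum>k<n. v j k * X i k) ~= 0"
 shows "\<exists>v'. diag_spectrum e n (insert i S) X v' l"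
proof -
 have dec: "strict_dec n \<mu>" and pos: "\<And>j. j < n ==> 0 < \<mu> j" and u: "unitary_rows n v"
  and eig: "\<And>j k. j < n ==> k < n ==> of_real (e k) * v j k + (\<Sum>i\<in>S. cnj (X i k) * (\<Sum>l<n. X i l * v j l)) = of_real (\<mu> j) * v j k"
  and dt: "\<And>x. Im x ~= 0 ==> (\<Prod>k<n. x - of_real (e k)) * det (gram_mat e n S X x) = (\<Prod>j<n. x - of_real (\<mu> j))"
  and tr: "(\<Sum>j<n. \<mu> j) = (\<Sum>j<n. e j) + (\<Sum>i\<in>S. \<Sum>k<n. (cmod (X i k))\<^sup>2)"
  using sp unfolding diag_spectrum_def by blast+
 define c where "c j = (\<Sum>k<n. v j k * X i k)" for j
 define r where "r j = update_weight n \<mu> l j" for j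
 have rc: "complex_of_real (r j) = c j * cnj (c j)" if "j < n" for j
  using w[OF that] by (simp add: r_def c_def[symmetric] complex_norm_square del: of_real_power)
 have rpos: "0 < r j" if "j < n" for j unfolding r_def by (rule update_weight_pos[OF dec box that])
 have decl: "strict_dec n l" by (rule interlace_box_strict_dec[OF dec box])
 have lmu: "l a ~= \<mu> j" if "a < n" "j < n" for a j
 proof (cases "j < a")
  case True
  then have "l a < \<mu> (a - 1)" "\<mu> (a - 1) <= \<mu> j"
   using box that strict_dec_antimono[OF dec, of j "a - 1"] by (auto simp: interlace_box_def)
  then show ?thesis by simp
 next
  case False
  then have "\<mu> a < l a" "\<mu> j <= \<mu> a"
   using box that strict_dec_antimono[OF dec, of a j] by (auto simp: interlace_box_def)
  then show ?thesis by simp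
 qed
 have orth1: "(\<Sum>k<n. v a k * cnj (v b k)) = (if a = b then 1 else 0)" if "a < n" "b < n" for a b
  using u that by (auto simp: unitary_rows_def)
 have orth2: "(\<Sum>j<n. v j a * cnj (v j b)) = (if a = b then 1 else 0)" if "a < n" "b < n" for a b
  using u that by (auto simp: unitary_rows_def)
 have expand: "(\<Sum>j<n. cnj (c j) * v j k) = cnj (X i k)" if "k < n" for k
 proof -
  have "(\<Sum>j<n. cnj (c j) * v j k) = (\<Sum>j<n. \<Sum>m<n. cnj (X i m) * (v j k * cnj (v j m)))"
   unfolding c_def cnj_sum complex_cnj_mult sum_distrib_right by (intro sum.cong refl) (simp add: mult_ac)
  also have "... = (\<Sum>m<n. \<Sum>j<n. cnj (X i m) * (v j k * cnj (v j m)))" by (rule sum.swap)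
  also have "... = (\<Sum>m<n. cnj (X i m) * (if k = m then 1 else 0))"
   using that by (intro sum.cong refl) (simp add: sum_distrib_left[symmetric] orth2)
  also have "... = cnj (X i k)" using that by (simp add: if_distrib cong: if_cong)
  finally show ?thesis .
 qed
 have rsum: "(\<Sum>j<n. r j) = (\<Sum>k<n. (cmod (X i k))\<^sup>2)"
 proof -
  have "(\<Sum>j<n. r j) = (\<Sum>j<n. (cmod (apply_rows n v (X i) j))\<^sup>2)"
   using w by (intro sum.cong refl) (simp add: r_def apply_rows_def)
  then show ?thesis by (simp add: norm_apply_rows[OF u])
 qed
 \<comment> \<open>The secular equation at its zero \<open>l a\<close>.\<close>
 have sec: "(\<Sum>j<n. r j / (l a - \<mu> j)) = 1" if "a < n" for a
 proof -
  have s: "(\<Prod>j<n. l a - of_real (l j)) / (\<Prod>j<n. l a - of_real (\<mu> j)) =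
    1 - (\<Sum>i<n. of_real (update_weight n \<mu> l i) / (l a - of_real (\<mu> i)))"
   by (rule secular_equation[OF dec]) (use lmu[OF that] in auto)
  have z: "(\<Prod>j<n. l a - of_real (l j)) = 0" using that by (intro prod_zero) auto
  show ?thesis using s unfolding z div_0 by (simp add: r_def)
 qed
 define Nq where "Nq a = (\<Sum>j<n. r j / (l a - \<mu> j)\<^sup>2)" for a
 have Nq: "0 < Nq a" if "a < n" for a
  unfolding Nq_def using rpos lmu[OF that] that by (intro sum_pos) auto
 \<comment> \<open>By partial fractions, orthogonality is the difference of the secular equations at
   \<open>l a\<close> and \<open>l b\<close>.\<close>
 have orthr: "(\<Sum>j<n. r j / ((l a - \<mu> j) * (l b - \<mu> j))) = (if a = b then Nq a else 0)" if ab: "a < n" "b < n" for a b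
 proof (cases "a = b")
  case True then show ?thesis by (simp add: Nq_def power2_eq_square)
 next
  case False
  then have ne: "l a ~= l b" using decl ab unfolding strict_dec_def by (metis less_irrefl linorder_neqE_nat)
  have "(\<Sum>j<n. r j / ((l a - \<mu> j) * (l b - \<mu> j))) * (l b - l a) = (\<Sum>j<n. r j / (l a - \<mu> j) - r j / (l b - \<mu> j))"
   unfolding sum_distrib_right
  proof (intro sum.cong refl)
   fix j assume "j \<in> {..<n}"
   then show "r j / ((l a - \<mu> j) * (l b - \<mu> j)) * (l b - l a) = r j / (l a - \<mu> j) - r j / (l b - \<mu> j)"
    using lmu[OF ab(1), of j] lmu[OF ab(2), of j] by (simp add: divide_simps) (simp add: algebra_simps)
  qed
  also have "... = 0" by (simp add: sum_subtractf sec ab)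
  finally show ?thesis using ne False by simp
 qed
 \<comment> \<open>By \<open>expand\<close>, the \<open>cnj (c j)\<close> are the coordinates of the
   conjugated row; this is the resolvent at \<open>l a\<close> applied to it, normalized.\<close>
 define v' where "v' a k = complex_of_real (1 / sqrt (Nq a)) * (\<Sum>j<n. cnj (c j) / of_real (l a - \<mu> j) * v j k)" for a k
 have "unitary_rows n v'"
 proof (rule unitary_rowsI)
  fix a b assume ab: "a < n" "b < n"
  have "(\<Sum>k<n. v' a k * cnj (v' b k)) = complex_of_real (1 / sqrt (Nq a) * (1 / sqrt (Nq b))) *
   (\<Sum>k<n. \<Sum>j<n. \<Sum>m<n. cnj (c j) / of_real (l a - \<mu> j) * (c m / of_real (l b - \<mu> m)) * (v j k * cnj (v m k)))"
   unfolding v'_def by (simp add: sum_product sum_distrib_left mult_ac)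
  also have "(\<Sum>k<n. \<Sum>j<n. \<Sum>m<n. cnj (c j) / of_real (l a - \<mu> j) * (c m / of_real (l b - \<mu> m)) * (v j k * cnj (v m k))) =
   (\<Sum>j<n. \<Sum>m<n. \<Sum>k<n. cnj (c j) / of_real (l a - \<mu> j) * (c m / of_real (l b - \<mu> m)) * (v j k * cnj (v m k)))"
   by (subst sum.swap) (rule sum.cong[OF refl sum.swap])
  also have "... = (\<Sum>j<n. \<Sum>m<n. cnj (c j) / of_real (l a - \<mu> j) * (c m / of_real (l b - \<mu> m)) * (if j = m then 1 else 0))"
   by (intro sum.cong refl) (simp only: sum_distrib_left[symmetric] orth1 lessThan_iff)
  also have "... = (\<Sum>j<n. of_real (r j / ((l a - \<mu> j) * (l b - \<mu> j))))"
   by (simp add: if_distrib rc mult_ac cong: if_cong)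
  also have "... = of_real (if a = b then Nq a else 0)"
   unfolding of_real_sum[symmetric] orthr[OF ab] ..
  also have "complex_of_real (1 / sqrt (Nq a) * (1 / sqrt (Nq b))) * ... = (if a = b then 1 else 0)"
   using Nq[OF ab(1)] by (auto simp flip: of_real_mult)
  finally show "(\<Sum>k<n. v' a k * cnj (v' b k)) = (if a = b then 1 else 0)" .
 qed
 moreover have "of_real (e k) * v' a k + (\<Sum>i\<in>insert i S. cnj (X i k) * (\<Sum>m<n. X i m * v' a m)) = of_real (l a) * v' a k"
  if ak: "a < n" "k < n" for a k
 proof -
  define N where "N = complex_of_real (1 / sqrt (Nq a))"
  define d where "d j = cnj (c j) / of_real (l a - \<mu> j)" for j
  have v'k: "v' a m = N * (\<Sum>j<n. d j * v j m)" for m by (simp add: v'_def N_def d_def)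
  have inner: "(\<Sum>m<n. X s m * v' a m) = N * (\<Sum>j<n. d j * (\<Sum>m<n. X s m * v j m))" for s
  proof -
   have "(\<Sum>m<n. X s m * v' a m) = (\<Sum>m<n. \<Sum>j<n. N * d j * (X s m * v j m))"
    by (simp add: v'k sum_distrib_left mult_ac)
   also have "... = (\<Sum>j<n. \<Sum>m<n. N * d j * (X s m * v j m))" by (rule sum.swap)
   finally show ?thesis by (simp add: sum_distrib_left mult.assoc)
  qed
  have "(\<Sum>j<n. d j * (\<Sum>m<n. X i m * v j m)) = (\<Sum>j<n. of_real (r j / (l a - \<mu> j)))"
   by (intro sum.cong refl) (simp add: d_def rc c_def mult.commute)
  also have "... = 1" unfolding of_real_sum[symmetric] sec[OF ak(1)] by simp
  finally have inner_i: "(\<Sum>m<n. X i m * v' a m) = N" by (simp add: inner)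
  have "(\<Sum>s\<in>S. cnj (X s k) * (\<Sum>m<n. X s m * v' a m)) = (\<Sum>s\<in>S. \<Sum>j<n. N * d j * (cnj (X s k) * (\<Sum>m<n. X s m * v j m)))"
   unfolding inner by (simp add: sum_distrib_left mult_ac)
  also have "... = (\<Sum>j<n. \<Sum>s\<in>S. N * d j * (cnj (X s k) * (\<Sum>m<n. X s m * v j m)))" by (rule sum.swap)
  also have "... = (\<Sum>j<n. N * d j * (\<Sum>s\<in>S. cnj (X s k) * (\<Sum>m<n. X s m * v j m)))" by (simp add: sum_distrib_left)
  finally have outer: "(\<Sum>s\<in>S. cnj (X s k) * (\<Sum>m<n. X s m * v' a m)) = (\<Sum>j<n. N * d j * (\<Sum>s\<in>S. cnj (X s k) * (\<Sum>m<n. X s m * v j m)))" .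
  have "of_real (e k) * v' a k + (\<Sum>s\<in>S. cnj (X s k) * (\<Sum>m<n. X s m * v' a m)) =
   (\<Sum>j<n. N * d j * (of_real (e k) * v j k + (\<Sum>s\<in>S. cnj (X s k) * (\<Sum>m<n. X s m * v j m))))"
   unfolding outer by (simp add: v'k distrib_left sum.distrib sum_distrib_left mult_ac)
  also have "... = (\<Sum>j<n. N * d j * (of_real (\<mu> j) * v j k))" using eig ak by (intro sum.cong refl) auto
  finally have "of_real (e k) * v' a k + (\<Sum>s\<in>insert i S. cnj (X s k) * (\<Sum>m<n. X s m * v' a m)) =
   (\<Sum>j<n. N * d j * (of_real (\<mu> j) * v j k)) + N * (\<Sum>j<n. cnj (c j) * v j k)"
   using iS ak by (simp add: inner_i expand algebra_simps)
  also have "... = (\<Sum>j<n. N * d j * (of_real (l a) * v j k))"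
   unfolding sum_distrib_left sum.distrib[symmetric]
  proof (intro sum.cong refl)
   fix j assume "j \<in> {..<n}"
   then have "complex_of_real (l a - \<mu> j) ~= 0" using lmu[OF ak(1), of j] by simp
   then have cj: "cnj (c j) = d j * of_real (l a - \<mu> j)" by (simp add: d_def)
   show "N * d j * (of_real (\<mu> j) * v j k) + N * (cnj (c j) * v j k) = N * d j * (of_real (l a) * v j k)"
    unfolding cj by (simp add: algebra_simps)
  qed
  also have "... = of_real (l a) * v' a k" by (simp add: v'k sum_distrib_left mult_ac)
  finally show ?thesis .
 qed
 moreover have "(\<Prod>k<n. x - of_real (e k)) * det (gram_mat e n (insert i S) X x) = (\<Prod>j<n. x - of_real (l j))"
  if x: "Im x ~= 0" for x
 proof -
  have xr: "x ~= of_real y" for y using x by auto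
  have nz: "(\<Prod>j<n. x - of_real (\<mu> j)) ~= 0" using xr by auto
  then have d0: "det (gram_mat e n S X x) ~= 0" using dt[OF x] by auto
  \<comment> \<open>The resolvent at \<open>x\<close> of the old matrix, applied to the conjugated
    row; \<open>zk\<close> is its defining equation.\<close>
  define z where "z k = (\<Sum>j<n. cnj (c j) / (x - of_real (\<mu> j)) * v j k)" for k
  have zk: "(x - of_real (e k)) * z k = cnj (X i k) + (\<Sum>s\<in>S. cnj (X s k) * (\<Sum>m<n. X s m * z m))" if k: "k < n" for k
  proof -
   define d where "d j = cnj (c j) / (x - of_real (\<mu> j))" for j
   have z': "z m = (\<Sum>j<n. d j * v j m)" for m by (simp add: z_def d_def)
   have inner: "(\<Sum>m<n. X s m * z m) = (\<Sum>j<n. d j * (\<Sum>m<n. X s m * v j m))" for s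
   proof -
    have "(\<Sum>m<n. X s m * z m) = (\<Sum>m<n. \<Sum>j<n. d j * (X s m * v j m))"
     by (simp add: z' sum_distrib_left mult_ac)
    also have "... = (\<Sum>j<n. \<Sum>m<n. d j * (X s m * v j m))" by (rule sum.swap)
    finally show ?thesis by (simp add: sum_distrib_left)
   qed
   have "(\<Sum>s\<in>S. cnj (X s k) * (\<Sum>m<n. X s m * z m)) = (\<Sum>s\<in>S. \<Sum>j<n. d j * (cnj (X s k) * (\<Sum>m<n. X s m * v j m)))"
    unfolding inner by (simp add: sum_distrib_left mult_ac)
   also have "... = (\<Sum>j<n. \<Sum>s\<in>S. d j * (cnj (X s k) * (\<Sum>m<n. X s m * v j m)))" by (rule sum.swap)
   also have "... = (\<Sum>j<n. d j * (\<Sum>s\<in>S. cnj (X s k) * (\<Sum>m<n. X s m * v j m)))" by (simp add: sum_distrib_left)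
   also have "... = (\<Sum>j<n. d j * (of_real (\<mu> j) * v j k - of_real (e k) * v j k))"
   proof (intro sum.cong refl arg_cong2[where f = "(*)"])
    fix j assume "j \<in> {..<n}"
    then show "(\<Sum>s\<in>S. cnj (X s k) * (\<Sum>m<n. X s m * v j m)) = of_real (\<mu> j) * v j k - of_real (e k) * v j k"
     using eig[OF _ k, of j] by (simp add: eq_diff_eq add.commute)
   qed
   finally have "cnj (X i k) + (\<Sum>s\<in>S. cnj (X s k) * (\<Sum>m<n. X s m * z m)) = 
     (\<Sum>j<n. cnj (c j) * v j k + d j * (of_real (\<mu> j) * v j k - of_real (e k) * v j k))"
    by (simp add: expand[OF k, symmetric] sum.distrib)
   also have "... = (\<Sum>j<n. (x - of_real (e k)) * (d j * v j k))"
   proof (intro sum.cong refl)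
    fix j
    have cj: "cnj (c j) = d j * (x - of_real (\<mu> j))" using xr[of "\<mu> j"] by (simp add: d_def)
    show "cnj (c j) * v j k + d j * (of_real (\<mu> j) * v j k - of_real (e k) * v j k) = (x - of_real (e k)) * (d j * v j k)"
     unfolding cj by (simp add: algebra_simps)
   qed
   finally show ?thesis by (simp add: z' sum_distrib_left)
  qed
  \<comment> \<open>The \<open>i\<close>-th column of the inverse of
    \<open>gram_mat e n S X x\<close>, expressed through \<open>z\<close>.\<close>
  define uu :: "complex^'p" where "uu = (\<chi> s. if s = i then 1 else if s \<in> S then (\<Sum>m<n. X s m * z m) else 0)"
  have row: "(\<Sum>j\<in>UNIV. (\<Sum>k<n. X s k * cnj (X j k) / (x - of_real (e k))) * uu $ j) = (\<Sum>k<n. X s k * z k)" for s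
  proof -
   have "(\<Sum>j\<in>UNIV. (\<Sum>k<n. X s k * cnj (X j k) / (x - of_real (e k))) * uu $ j) =
    (\<Sum>j\<in>UNIV. \<Sum>k<n. X s k / (x - of_real (e k)) * (cnj (X j k) * uu $ j))"
    unfolding sum_distrib_right by (intro sum.cong refl) (simp add: mult_ac)
   also have "... = (\<Sum>k<n. \<Sum>j\<in>UNIV. X s k / (x - of_real (e k)) * (cnj (X j k) * uu $ j))" by (rule sum.swap)
   also have "... = (\<Sum>k<n. X s k / (x - of_real (e k)) * (\<Sum>j\<in>UNIV. cnj (X j k) * uu $ j))" by (simp add: sum_distrib_left)
   also have "... = (\<Sum>k<n. X s k * z k)"
   proof (intro sum.cong refl)
    fix k assume "k \<in> {..<n}"
    then have k: "k < n" by simp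
    have "(\<Sum>j\<in>UNIV. cnj (X j k) * uu $ j) = (\<Sum>j\<in>insert i S. cnj (X j k) * uu $ j)"
     by (rule sum.mono_neutral_right) (auto simp: uu_def)
    also have "... = cnj (X i k) + (\<Sum>j\<in>S. cnj (X j k) * (\<Sum>m<n. X j m * z m))"
     using iS by (simp add: uu_def) (intro sum.cong refl, auto)
    also have "... = (x - of_real (e k)) * z k" by (rule zk[OF k, symmetric])
    finally show "X s k / (x - of_real (e k)) * (\<Sum>j\<in>UNIV. cnj (X j k) * uu $ j) = X s k * z k" using xr[of "e k"] by simp
   qed
   finally show ?thesis .
  qed
  have A: "gram_mat e n S X x *v uu = axis i 1"
  proof (rule Finite_Cartesian_Product.vec_eq_iff[THEN iffD2], intro allI)
   fix s
   have "(gram_mat e n S X x *v uu) $ s = uu $ s - (if s \<in> S then (\<Sum>k<n. X s k * z k) else 0)"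
    by (simp add: matrix_vector_mult_def gram_mat_def left_diff_distrib sum_subtractf row if_distrib[of "\<lambda>x. x * _"] cong: if_cong)
   also have "... = axis i 1 $ s" using iS by (auto simp: uu_def axis_def)
   finally show "(gram_mat e n S X x *v uu) $ s = axis i 1 $ s" .
  qed
  define \<rho> :: "complex^'p" where "\<rho> = (\<chi> j. - (\<Sum>k<n. X i k * cnj (X j k) / (x - of_real (e k))))"
  have "gram_mat e n (insert i S) X x = (\<chi> k j. gram_mat e n S X x $ k $ j + (if k = i then \<rho> $ j else 0))"
   using iS by (auto simp: gram_mat_def \<rho>_def Finite_Cartesian_Product.vec_eq_iff)
  then have "det (gram_mat e n (insert i S) X x) = det (gram_mat e n S X x) * (1 + (\<Sum>j\<in>UNIV. \<rho> $ j * uu $ j))"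
   using det_row_update[OF d0 A, of \<rho>] by simp
  also have "(\<Sum>j\<in>UNIV. \<rho> $ j * uu $ j) = - (\<Sum>k<n. X i k * z k)"
   using row[of i] by (simp add: \<rho>_def sum_negf)
  also have "(\<Sum>k<n. X i k * z k) = (\<Sum>j<n. of_real (r j) / (x - of_real (\<mu> j)))"
  proof -
   have "(\<Sum>k<n. X i k * z k) = (\<Sum>k<n. \<Sum>j<n. cnj (c j) / (x - of_real (\<mu> j)) * (v j k * X i k))"
    by (simp add: z_def sum_distrib_left mult_ac)
   also have "... = (\<Sum>j<n. \<Sum>k<n. cnj (c j) / (x - of_real (\<mu> j)) * (v j k * X i k))" by (rule sum.swap)
   also have "... = (\<Sum>j<n. cnj (c j) / (x - of_real (\<mu> j)) * c j)" by (simp add: sum_distrib_left c_def)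
   also have "... = (\<Sum>j<n. of_real (r j) / (x - of_real (\<mu> j)))" by (intro sum.cong refl) (simp add: rc mult.commute)
   finally show ?thesis .
  qed
  finally have "det (gram_mat e n (insert i S) X x) = det (gram_mat e n S X x) * (1 - (\<Sum>j<n. of_real (r j) / (x - of_real (\<mu> j))))" by simp
  also have "1 - (\<Sum>j<n. of_real (r j) / (x - of_real (\<mu> j))) = (\<Prod>j<n. x - of_real (l j)) / (\<Prod>j<n. x - of_real (\<mu> j))"
   unfolding r_def using secular_equation[OF dec, of x l] xr by auto
  finally have "(\<Prod>k<n. x - of_real (e k)) * det (gram_mat e n (insert i S) X x) =
   (\<Prod>j<n. x - of_real (\<mu> j)) * ((\<Prod>j<n. x - of_real (l j)) / (\<Prod>j<n. x - of_real (\<mu> j)))"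
   by (simp add: dt[OF x, symmetric] del: prod_dividef)
  then show ?thesis using nz by (simp del: prod_dividef)
 qed
 moreover have "(\<Sum>j<n. l j) = (\<Sum>j<n. e j) + (\<Sum>i\<in>insert i S. \<Sum>k<n. (cmod (X i k))\<^sup>2)"
  using sum_update_weight[OF dec, of l] iS rsum tr by (simp add: r_def)
 moreover have "0 < l j" if "j < n" for j
  using box pos[OF that] that unfolding interlace_box_def by (meson less_trans)
 ultimately show ?thesis using decl unfolding diag_spectrum_def by blast
qed

section \<open>Arbitrary rows as limits of generic ones\<close>

lemma bounded_tuple_subseq:
 fixes f :: "nat => nat => 'a::heine_borel"
 assumes "\<And>j. j < n ==> bounded (range (\<lambda>m. f m j))"
 shows "\<exists>l r. strict_mono r \<and> (\<forall>j<n. (\<lambda>m. f (r m) j) \<longlonglongrightarrow> l j)"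
 using assms
proof (induction n)
 case 0
 then show ?case by (intro exI[of _ undefined] exI[of _ "\<lambda>m. m"]) (auto simp: strict_mono_def)
next
 case (Suc n)
 then obtain l and r :: "nat => nat" where r: "strict_mono r" "\<And>j. j < n ==> (\<lambda>m. f (r m) j) \<longlonglongrightarrow> l j" by auto
 have "range (\<lambda>m. f (r m) n) \<subseteq> range (\<lambda>m. f m n)" by auto
 then have "bounded (range (\<lambda>m. f (r m) n))" using Suc.prems[of n] bounded_subset by blast
 then obtain y and s :: "nat => nat" where s: "strict_mono s" "((\<lambda>m. f (r m) n) \<circ> s) \<longlonglongrightarrow> y"
  using bounded_imp_convergent_subsequence by blast
 have "(\<lambda>m. f (r (s m)) j) \<longlonglongrightarrow> (l(n := y)) j" if "j < Suc n" for j
 proof (cases "j = n")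
  case True then show ?thesis using s(2) by (simp add: o_def)
 next
  case False
  then have "(\<lambda>m. f (r m) j) \<longlonglongrightarrow> l j" using r(2) that by auto
  from LIMSEQ_subseq_LIMSEQ[OF this s(1)] show ?thesis using False by (simp add: o_def)
 qed
 moreover have "strict_mono (\<lambda>m. r (s m))" using strict_mono_o[OF r(1) s(1)] by (simp add: o_def)
 ultimately show ?case by blast
qed

text \<open>The update treats rows without a vanishing coordinate in the current eigenbasis. Adding
  the same \<open>t\<close> to every coordinate produces such a row, for all but finitely many small
  \<open>t\<close>.\<close>

lemma diag_spectrum_dense:
 fixes X :: "'p::finite => nat => complex"
 assumes e: "strict_dec n e" "\<And>j. j < n ==> 0 < e j" and "0 < d"
 shows "\<exists>Y v \<mu>. diag_spectrum e n S Y v \<mu> \<and> (\<forall>i\<in>S. \<forall>k<n. cmod (Y i k - X i k) < d)"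
 using finite[of S]
proof (induction S rule: finite_induct)
 case empty
 then show ?case using diag_spectrum_empty[OF e] by blast
next
 case (insert i S)
 then obtain Y v \<mu> where sp: "diag_spectrum e n S Y v \<mu>" and near: "\<And>s k. s \<in> S ==> k < n ==> cmod (Y s k - X s k) < d" by blast
 have u: "unitary_rows n v" and dec: "strict_dec n \<mu>" using sp by (auto simp: diag_spectrum_def)
 have orth1: "(\<Sum>k<n. v a k * cnj (v b k)) = (if a = b then 1 else 0)" if "a < n" "b < n" for a b
  using u that by (auto simp: unitary_rows_def)
 have vle: "cmod (v j k) <= 1" if "j < n" "k < n" for j k
 proof -
  have "complex_of_real (\<Sum>k<n. (cmod (v j k))\<^sup>2) = 1"
   using orth1[OF that(1) that(1)] by (simp add: complex_norm_square del: of_real_power)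
  then have "(\<Sum>k<n. (cmod (v j k))\<^sup>2) = 1" by (simp only: of_real_eq_1_iff)
  moreover have "(cmod (v j k))\<^sup>2 <= (\<Sum>k<n. (cmod (v j k))\<^sup>2)" using that by (intro member_le_sum) auto
  ultimately show ?thesis by (simp add: power2_nonneg_ge_1_iff abs_square_le_1)
 qed
 define c where "c j = (\<Sum>k<n. v j k * X i k)" for j
 \<comment> \<open>The correction of an entry has \<open>n\<close> summands of modulus at most
   \<open>t\<close>, whence \<open>d / (n + 1)\<close>; the excluded \<open>t\<close> are those that
   cancel the real part of some coordinate.\<close>
 have "infinite ({0<..<d / (n + 1)} - (\<lambda>j. - Re (c j)) ` {..<n})"
  using \<open>0 < d\<close> by (intro Diff_infinite_finite) (auto intro!: infinite_Ioo)
 then have "{0<..<d / (n + 1)} - (\<lambda>j. - Re (c j)) ` {..<n} ~= {}" by (rule infinite_imp_nonempty)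
 then obtain t where "t \<in> {0<..<d / (n + 1)} - (\<lambda>j. - Re (c j)) ` {..<n}" by blast
 then have t: "0 < t" "t < d / (n + 1)" "t \<notin> (\<lambda>j. - Re (c j)) ` {..<n}"
  by simp_all
 define y where "y k = X i k + of_real t * (\<Sum>j<n. cnj (v j k))" for k
 have yc: "(\<Sum>k<n. v j k * y k) = c j + of_real t" if "j < n" for j
 proof -
  have "(\<Sum>k<n. v j k * (\<Sum>a<n. cnj (v a k))) = (\<Sum>a<n. \<Sum>k<n. v j k * cnj (v a k))"
   unfolding sum_distrib_left by (rule sum.swap)
  also have "... = 1" using that by (simp add: orth1)
  finally have *: "(\<Sum>k<n. v j k * (\<Sum>a<n. cnj (v a k))) = 1" .
  have "(\<Sum>k<n. v j k * y k) = c j + of_real t * (\<Sum>k<n. v j k * (\<Sum>a<n. cnj (v a k)))"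
   unfolding y_def c_def distrib_left sum.distrib by (simp add: sum_distrib_left mult_ac)
  then show ?thesis by (simp add: *)
 qed
 have nz: "(\<Sum>k<n. v j k * y k) ~= 0" if "j < n" for j
 proof
  assume "(\<Sum>k<n. v j k * y k) = 0"
  then have "Re (c j) + t = 0" using yc[OF that] by (metis Re_complex_of_real plus_complex.sel(1) zero_complex.sel(1))
  then have "t = - Re (c j)" by linarith
  then show False using t(3) that by blast
 qed
 obtain l where l: "interlace_box n \<mu> l" "\<And>j. j < n ==> update_weight n \<mu> l j = (cmod (\<Sum>k<n. v j k * y k))\<^sup>2"
  using update_weight_surj[OF dec, of "\<lambda>j. (cmod (\<Sum>k<n. v j k * y k))\<^sup>2"] nz by auto
 let ?Y = "Y(i := y)"
 have "diag_spectrum e n S ?Y v \<mu>" using sp insert.hyps by (subst diag_spectrum_cong[of S n _ Y]) auto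
 then have "\<exists>v'. diag_spectrum e n (insert i S) ?Y v' l"
  using insert.hyps l nz by (intro diag_spectrum_step) auto
 moreover have "cmod (?Y s k - X s k) < d" if "s \<in> insert i S" "k < n" for s k
 proof (cases "s = i")
  case True
  have "cmod (\<Sum>j<n. cnj (v j k)) <= (\<Sum>j<n. 1)"
   using vle that by (intro order_trans[OF norm_sum] sum_mono) auto
  then have "cmod (of_real t * (\<Sum>j<n. cnj (v j k))) <= t * n" using t by (simp add: norm_mult)
  also have "t * n < d"
  proof -
   have "t * (n + 1) < d" using t(2) by (simp add: field_simps)
   then show ?thesis using t(1) by (simp add: algebra_simps)
  qed
  finally show ?thesis using True by (simp add: y_def)
 next
  case False
  then show ?thesis using near that by auto
 qed
 ultimately show ?case by blast
qed

lemma tendsto_det [tendsto_intros]: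
 fixes A :: "'b => 'a::real_normed_field^'n^'n"
 assumes "\<And>i j. ((\<lambda>m. A m $ i $ j) \<longlongrightarrow> B $ i $ j) F"
 shows "((\<lambda>m. det (A m)) \<longlongrightarrow> det B) F"
 unfolding Determinants.det_def by (intro tendsto_intros assms)

text \<open>Compactness replaces diagonalization: the trace identity bounds the spectra of generic
  approximations, and a subsequence of them converges. Simplicity and eigenvectors do not pass to
  the limit, so only the values and their symmetric relations are claimed.\<close>

lemma diag_spectrum_values_exist:
 fixes X :: "'p::finite => nat => complex"
 assumes e: "strict_dec n e" "\<And>j. j < n ==> 0 < e j"
 shows "\<exists>l. (\<forall>j<n. 0 <= l j) \<and>
  (\<forall>x. Im x ~= 0 --> (\<Prod>k<n. x - of_real (e k)) * det (gram_mat e n UNIV X x) = (\<Prod>j<n. x - of_real (l j))) \<and>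
  (\<Sum>j<n. l j) = (\<Sum>j<n. e j) + (\<Sum>i\<in>UNIV. \<Sum>k<n. (cmod (X i k))\<^sup>2)"
proof -
 have "\<forall>m. \<exists>Y v \<mu>. diag_spectrum e n UNIV Y v \<mu> \<and> (\<forall>i\<in>UNIV. \<forall>k<n. cmod (Y i k - X i k) < 1 / Suc m)"
  by (intro allI diag_spectrum_dense e) auto
 note ex = this
 have "\<forall>m. \<exists>Z. diag_spectrum e n UNIV (fst Z) (fst (snd Z)) (snd (snd Z)) \<and> (\<forall>i\<in>UNIV. \<forall>k<n. cmod (fst Z i k - X i k) < 1 / Suc m)"
 proof
  fix m
  obtain Y v \<mu> where "diag_spectrum e n UNIV Y v \<mu> \<and> (\<forall>i\<in>UNIV. \<forall>k<n. cmod (Y i k - X i k) < 1 / Suc m)"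
   using ex by blast
  then show "\<exists>Z. diag_spectrum e n UNIV (fst Z) (fst (snd Z)) (snd (snd Z)) \<and> (\<forall>i\<in>UNIV. \<forall>k<n. cmod (fst Z i k - X i k) < 1 / Suc m)"
   by (intro exI[of _ "(Y, v, \<mu>)"]) simp
 qed
 then obtain Z where Z: "\<forall>m. diag_spectrum e n UNIV (fst (Z m)) (fst (snd (Z m))) (snd (snd (Z m))) \<and> (\<forall>i\<in>UNIV. \<forall>k<n. cmod (fst (Z m) i k - X i k) < 1 / Suc m)"
  by (rule choice[THEN exE])
 define Y v \<mu> where "Y m = fst (Z m)" and "v m = fst (snd (Z m))" and "\<mu> m = snd (snd (Z m))" for m
 have sp: "\<And>m. diag_spectrum e n UNIV (Y m) (v m) (\<mu> m)"
  and near: "\<And>m i k. k < n ==> cmod (Y m i k - X i k) < 1 / Suc m"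
  using Z by (auto simp: Y_def v_def \<mu>_def)
 have lim: "(\<lambda>m. Y m i k) \<longlonglongrightarrow> X i k" if "k < n" for i k
 proof (rule LIM_zero_cancel, rule Lim_null_comparison)
  show "(\<lambda>m. 1 / real (Suc m)) \<longlonglongrightarrow> 0" by (rule lim_1_over_real_power[of 1, simplified] LIMSEQ_Suc[OF lim_1_over_n])
  show "\<forall>\<^sub>F m in sequentially. cmod (Y m i k - X i k) <= 1 / real (Suc m)"
   using near[OF that] by (intro always_eventually allI less_imp_le) auto
 qed
 have tr: "(\<Sum>j<n. \<mu> m j) = (\<Sum>j<n. e j) + (\<Sum>i\<in>UNIV. \<Sum>k<n. (cmod (Y m i k))\<^sup>2)" for m using sp by (auto simp: diag_spectrum_def)
 have pos: "0 < \<mu> m j" if "j < n" for m j using sp that by (auto simp: diag_spectrum_def)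
 have "(\<lambda>m. \<Sum>j<n. \<mu> m j) \<longlonglongrightarrow> (\<Sum>j<n. e j) + (\<Sum>i\<in>UNIV. \<Sum>k<n. (cmod (X i k))\<^sup>2)"
  unfolding tr by (intro tendsto_intros lim) auto
 note trlim = this
 have "Bseq (\<lambda>m. \<Sum>j<n. \<mu> m j)" by (rule convergent_imp_Bseq) (rule convergentI, rule trlim)
 then obtain B where B: "\<And>m. norm (\<Sum>j<n. \<mu> m j) <= B" by (auto simp: Bseq_def)
 have "\<bar>\<mu> m j\<bar> <= B" if "j < n" for m j
 proof -
  have "\<mu> m j <= (\<Sum>j<n. \<mu> m j)" using that pos by (intro member_le_sum) (auto intro: less_imp_le)
  then show ?thesis using B[of m] pos[OF that, of m] by auto
 qed
 then have "bounded (range (\<lambda>m. \<mu> m j))" if "j < n" for j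
  using that by (intro boundedI[of _ B]) auto
 then obtain l r where r: "strict_mono r" and l: "\<And>j. j < n ==> (\<lambda>m. \<mu> (r m) j) \<longlonglongrightarrow> l j"
  using bounded_tuple_subseq[of n \<mu>] by blast
 have lim': "(\<lambda>m. Y (r m) i k) \<longlonglongrightarrow> X i k" if "k < n" for i k
  using LIMSEQ_subseq_LIMSEQ[OF lim[OF that] r] by (simp add: o_def)
 have "(\<Prod>k<n. x - of_real (e k)) * det (gram_mat e n UNIV X x) = (\<Prod>j<n. x - of_real (l j))" if x: "Im x ~= 0" for x
 proof -
  have xr: "x ~= of_real y" for y using x by auto
  have "(\<lambda>m. (\<Prod>k<n. x - of_real (e k)) * det (gram_mat e n UNIV (Y (r m)) x)) \<longlonglongrightarrow>
    (\<Prod>k<n. x - of_real (e k)) * det (gram_mat e n UNIV X x)"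
  proof (rule tendsto_mult[OF tendsto_const tendsto_det])
   fix i j
   show "(\<lambda>m. gram_mat e n UNIV (Y (r m)) x $ i $ j) \<longlonglongrightarrow> gram_mat e n UNIV X x $ i $ j"
   proof -
    have g: "gram_mat e n UNIV Z x $ i $ j = (if i = j then 1 else 0) - (\<Sum>k<n. Z i k * cnj (Z j k) / (x - of_real (e k)))" for Z
     by (simp add: gram_mat_def)
    show ?thesis unfolding g using xr by (intro tendsto_diff tendsto_const tendsto_sum tendsto_divide tendsto_mult tendsto_cnj lim') auto
   qed
  qed
  then have 1: "(\<lambda>m. \<Prod>j<n. x - of_real (\<mu> (r m) j)) \<longlonglongrightarrow> (\<Prod>k<n. x - of_real (e k)) * det (gram_mat e n UNIV X x)"
   using sp x by (auto simp: diag_spectrum_def)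
  have 2: "(\<lambda>m. \<Prod>j<n. x - of_real (\<mu> (r m) j)) \<longlonglongrightarrow> (\<Prod>j<n. x - of_real (l j))"
   by (intro tendsto_intros l) auto
  show ?thesis by (rule LIMSEQ_unique[OF 1 2])
 qed
 moreover have "(\<Sum>j<n. l j) = (\<Sum>j<n. e j) + (\<Sum>i\<in>UNIV. \<Sum>k<n. (cmod (X i k))\<^sup>2)"
 proof (rule LIMSEQ_unique)
  show "(\<lambda>m. \<Sum>j<n. \<mu> (r m) j) \<longlonglongrightarrow> (\<Sum>j<n. l j)" by (intro tendsto_intros l) auto
  show "(\<lambda>m. \<Sum>j<n. \<mu> (r m) j) \<longlonglongrightarrow> (\<Sum>j<n. e j) + (\<Sum>i\<in>UNIV. \<Sum>k<n. (cmod (X i k))\<^sup>2)"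
   using LIMSEQ_subseq_LIMSEQ[OF trlim r] by (simp add: o_def)
 qed
 moreover have "0 <= l j" if "j < n" for j
  by (rule LIMSEQ_le_const[OF l[OF that]]) (use pos[OF that] in \<open>auto intro: less_imp_le\<close>)
 ultimately show ?thesis by blast
qed

section \<open>Alternants and exponential averages\<close>

definition exp_avg :: "real => (real => complex) => real => complex" where
 "exp_avg \<alpha> f x = (\<integral>s. f (x + s) \<partial>exp_law \<alpha>)"

text \<open>The bound is asked on the half-line only, where the spectra lie; a
  \<open>\<kappa>\<close> below the rate makes the averages converge.\<close>

definition exp_growth :: "real => (real => complex) => bool" where
 "exp_growth \<kappa> f \<longleftrightarrow> f \<in> borel_measurable borel \<and> (\<exists>C. \<forall>x\<ge>0. cmod (f x) <= C * exp (\<kappa> * x))"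

definition alternant :: "nat => (nat => real => complex) => (nat => real) => complex" where
 "alternant n h l = Determinant.det (Matrix.mat n n (\<lambda>(b, a). h a (l b)))"

definition alternant_ratio :: "nat => (nat => real => complex) => (nat => real) => complex" where
 "alternant_ratio n h l = alternant n h l / of_real (vandermonde_prod n l)"

lemma alternant_Leibniz:
 "alternant n h l = (\<Sum>p | p permutes {..<n}. signof p * (\<Prod>b<n. h (p b) (l b)))"
proof -
 have "Determinant.det (Matrix.mat n n (\<lambda>(b, a). h a (l b))) = 
  (\<Sum>p | p permutes {0..<n}. signof p * (\<Prod>i = 0..<n. Matrix.mat n n (\<lambda>(b, a). h a (l b)) $$ (i, p i)))"
  by (rule det_def') simp
 also have "... = (\<Sum>p | p permutes {0..<n}. signof p * (\<Prod>i = 0..<n. h (p i) (l i)))"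
 proof (intro sum.cong refl arg_cong2[where f = "(*)"] prod.cong)
  fix p i assume "p \<in> {p. p permutes {0..<n}}" "i \<in> {0..<n}"
  then have "i < n" "p i < n" using permutes_in_image[of p "{0..<n}" i] by auto
  then show "Matrix.mat n n (\<lambda>(b, a). h a (l b)) $$ (i, p i) = h (p i) (l i)" by simp
 qed
 finally show ?thesis by (simp add: alternant_def lessThan_atLeast0)
qed

text \<open>On \<open>A\<close> the integrand is dominated by a multiple of the exponential density
  of rate \<open>\<alpha> - \<kappa>\<close>.\<close>

lemma set_integrable_exp_growth:
 assumes h: "exp_growth \<kappa> h" and "\<kappa> < \<alpha>" and "0 <= m" and A: "A \<in> sets borel" "A \<subseteq> {m..}"
 shows "integrable lborel (\<lambda>x. indicator A x *\<^sub>R (of_real (\<alpha> * exp (- \<alpha> * (x - m))) * h x))"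
proof -
 obtain C where [measurable]: "h \<in> borel_measurable borel" and C: "\<And>x. 0 <= x ==> cmod (h x) <= C * exp (\<kappa> * x)"
  using h by (auto simp: exp_growth_def)
 note [measurable] = A(1)
 have C0: "0 <= C" using C[of 0] norm_ge_zero[of "h 0"] by (simp del: norm_ge_zero)
 let ?\<beta> = "\<alpha> - \<kappa>"
 interpret E: prob_space "density lborel (exponential_density ?\<beta>)"
  by (rule prob_space_exponential_density) (use assms in simp)
 have "(\<integral>\<^sup>+x. ennreal (exponential_density ?\<beta> x) \<partial>lborel) = 1"
  using E.emeasure_space_1 by (simp add: emeasure_density)
 then have int: "integrable lborel (exponential_density ?\<beta>)"
  using assms by (intro integrableI_nonneg) (auto simp: exponential_density_nonneg)
 define D where "D = \<bar>\<alpha>\<bar> * exp (\<alpha> * m) * C / ?\<beta>"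
 show ?thesis
 proof (rule Bochner_Integration.integrable_bound)
  show "integrable lborel (\<lambda>x. D * exponential_density ?\<beta> x)" using int by simp
  show "AE x in lborel. norm (indicator A x *\<^sub>R (of_real (\<alpha> * exp (- \<alpha> * (x - m))) * h x)) <= norm (D * exponential_density ?\<beta> x)"
  proof (intro AE_I2)
   fix x
   show "norm (indicator A x *\<^sub>R (of_real (\<alpha> * exp (- \<alpha> * (x - m))) * h x)) <= norm (D * exponential_density ?\<beta> x)"
   proof (cases "x \<in> A")
    case True
    have "x \<in> {m..}" using A(2) True by (rule subsetD)
    then have x: "0 <= x" using assms(3) by simp
    have "norm (indicator A x *\<^sub>R (of_real (\<alpha> * exp (- \<alpha> * (x - m))) * h x)) = \<bar>\<alpha>\<bar> * exp (- \<alpha> * (x - m)) * cmod (h x)"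
     using True by (simp add: norm_mult)
    also have "... <= \<bar>\<alpha>\<bar> * exp (- \<alpha> * (x - m)) * (C * exp (\<kappa> * x))"
     using C[OF x] by (intro mult_left_mono) auto
    also have "... = \<bar>\<alpha>\<bar> * exp (\<alpha> * m) * C * (exp (- \<alpha> * x) * exp (\<kappa> * x))"
     by (simp add: right_diff_distrib exp_diff exp_minus field_simps)
    also have "exp (- \<alpha> * x) * exp (\<kappa> * x) = exp (- x * ?\<beta>)"
     by (simp add: exp_add[symmetric] algebra_simps)
    also have "\<bar>\<alpha>\<bar> * exp (\<alpha> * m) * C * exp (- x * ?\<beta>) = D * exponential_density ?\<beta> x"
     using x assms by (simp add: D_def exponential_density_def)
    also have "... <= norm (D * exponential_density ?\<beta> x)" by simp
    finally show ?thesis .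
   qed simp
  qed
 qed measurable
qed

lemma exp_avg_lborel:
 assumes "h \<in> borel_measurable borel" "0 < \<alpha>"
 shows "exp_avg \<alpha> h m = (\<integral>x. indicator {m<..} x *\<^sub>R (of_real (\<alpha> * exp (- \<alpha> * (x - m))) * h x) \<partial>lborel)"
proof -
 note [measurable] = assms(1)
 have "exp_avg \<alpha> h m = (\<integral>s. h (m + s) \<partial>density lborel (\<lambda>s. ennreal (indicator {0<..} s * (\<alpha> * exp (- \<alpha> * s)))))"
  unfolding exp_avg_def exp_law_def
  by (intro arg_cong2[where f = "integral\<^sup>L"] refl density_cong) (auto simp: indicator_def)
 also have "... = (\<integral>s. (indicator {0<..} s * (\<alpha> * exp (- \<alpha> * s))) *\<^sub>R h (m + s) \<partial>lborel)"
  using assms(2) by (intro integral_density) (auto intro!: AE_I2)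
 also have "... = (\<integral>x. (indicator {0<..} (- m + 1 * x) * (\<alpha> * exp (- \<alpha> * (- m + 1 * x)))) *\<^sub>R h (m + (- m + 1 * x)) \<partial>lborel)"
  by (subst lborel_integral_real_affine[where c = 1 and t = "- m"]) auto
 also have "... = (\<integral>x. indicator {m<..} x *\<^sub>R (of_real (\<alpha> * exp (- \<alpha> * (x - m))) * h x) \<partial>lborel)"
  by (intro Bochner_Integration.integral_cong refl) (auto simp: indicator_def scaleR_conv_of_real algebra_simps)
 finally show ?thesis .
qed

lemma integrable_exp_law:
 assumes h: "exp_growth \<kappa> h" and "\<kappa> < \<alpha>" "0 < \<alpha>" "0 <= m"
 shows "integrable (exp_law \<alpha>) (\<lambda>s. h (m + s))"
proof -
 have [measurable]: "h \<in> borel_measurable borel" using h by (simp add: exp_growth_def)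
 have e: "exp_law \<alpha> = density lborel (\<lambda>s. ennreal (indicator {0<..} s * (\<alpha> * exp (- \<alpha> * s))))"
  unfolding exp_law_def by (intro density_cong) (auto simp: indicator_def)
 have "integrable lborel (\<lambda>x. indicator {m<..} (m + 1 * x) *\<^sub>R (of_real (\<alpha> * exp (- \<alpha> * ((m + 1 * x) - m))) * h (m + 1 * x)))"
 proof (rule lborel_integrable_real_affine[where f = "\<lambda>x. indicator {m<..} x *\<^sub>R (of_real (\<alpha> * exp (- \<alpha> * (x - m))) * h x)"])
  show "integrable lborel (\<lambda>x. indicator {m<..} x *\<^sub>R (of_real (\<alpha> * exp (- \<alpha> * (x - m))) * h x))"
   by (rule set_integrable_exp_growth[OF h assms(2,4)]) auto
 qed simp
 then have "integrable lborel (\<lambda>s. (indicator {0<..} s * (\<alpha> * exp (- \<alpha> * s))) *\<^sub>R h (m + s))"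
  by (rule Bochner_Integration.integrable_cong[THEN iffD1, rotated 2]) (auto simp: indicator_def scaleR_conv_of_real)
 then show ?thesis unfolding e using assms(3) by (subst integrable_density) (auto intro!: AE_I2)
qed

text \<open>The growth rate survives an average, so averages can be iterated with one
  \<open>\<kappa>\<close>.\<close>

lemma exp_growth_exp_avg:
 assumes h: "exp_growth \<kappa> h" and \<alpha>: "\<kappa> < \<alpha>" "0 < \<alpha>"
 shows "exp_growth \<kappa> (exp_avg \<alpha> h)"
proof -
 obtain C where [measurable]: "h \<in> borel_measurable borel" and C: "\<And>x. 0 <= x ==> cmod (h x) <= C * exp (\<kappa> * x)"
  using h by (auto simp: exp_growth_def)
 interpret prob_space "exp_law \<alpha>" by (rule prob_space_exp_law[OF \<alpha>(2)])
 have "exp_growth \<kappa> (\<lambda>s. of_real (exp (\<kappa> * s)))" unfolding exp_growth_def by (auto intro!: exI[of _ 1])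
 from integrable_norm[OF integrable_exp_law[OF this \<alpha>, of 0]]
 have int: "integrable (exp_law \<alpha>) (\<lambda>s. exp (\<kappa> * s))" by simp
 have "(\<lambda>x. exp_avg \<alpha> h x) \<in> borel_measurable borel" unfolding exp_avg_def by measurable
 moreover have "cmod (exp_avg \<alpha> h x) <= (C * (\<integral>s. exp (\<kappa> * s) \<partial>exp_law \<alpha>)) * exp (\<kappa> * x)" if x: "0 <= x" for x
 proof -
  have ae: "AE s in exp_law \<alpha>. 0 <= s" unfolding exp_law_def by (subst AE_density) (auto simp: indicator_def)
  have "cmod (exp_avg \<alpha> h x) <= (\<integral>s. cmod (h (x + s)) \<partial>exp_law \<alpha>)"
   unfolding exp_avg_def by (rule integral_norm_bound)
  also have "... <= (\<integral>s. (C * exp (\<kappa> * x)) * exp (\<kappa> * s) \<partial>exp_law \<alpha>)"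
  proof (rule integral_mono_AE)
   show "integrable (exp_law \<alpha>) (\<lambda>s. cmod (h (x + s)))"
    by (intro integrable_norm integrable_exp_law[OF h \<alpha> x])
   show "integrable (exp_law \<alpha>) (\<lambda>s. C * exp (\<kappa> * x) * exp (\<kappa> * s))" using int by simp
   show "AE s in exp_law \<alpha>. cmod (h (x + s)) <= C * exp (\<kappa> * x) * exp (\<kappa> * s)"
    using ae
   proof eventually_elim
    case (elim s)
    then show ?case using C[of "x + s"] x by (simp add: distrib_left exp_add mult.assoc)
   qed
  qed
  also have "... = (C * (\<integral>s. exp (\<kappa> * s) \<partial>exp_law \<alpha>)) * exp (\<kappa> * x)" by simp
  finally show ?thesis .
 qed
 ultimately show ?thesis unfolding exp_growth_def by blast
qed


text \<open>The average over one side of the interlacing box, under the exponential law started at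
  its lower end.\<close>

definition box_avg :: "real => (nat => real) => (real => complex) => nat => complex" where
 "box_avg \<alpha> \<mu> f b = (\<integral>x. indicator {x. \<mu> b < x \<and> (0 < b --> x < \<mu> (b - 1))} x *\<^sub>R (of_real (\<alpha> * exp (- \<alpha> * (x - \<mu> b))) * f x) \<partial>lborel)"

text \<open>The exponential law has no memory: what lies above \<open>\<mu> (b - 1)\<close> is a
  damped copy of the average started there.\<close>

lemma box_avg_eq:
 assumes h: "exp_growth \<kappa> h" and \<alpha>: "\<kappa> < \<alpha>" "0 < \<alpha>" and \<mu>: "strict_dec n \<mu>" "\<And>j. j < n ==> 0 < \<mu> j" and b: "b < n"
 shows "box_avg \<alpha> \<mu> h b = exp_avg \<alpha> h (\<mu> b) - (if 0 < b then of_real (exp (- \<alpha> * (\<mu> (b - 1) - \<mu> b))) * exp_avg \<alpha> h (\<mu> (b - 1)) else 0)"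
proof -
 have [measurable]: "h \<in> borel_measurable borel" using h by (simp add: exp_growth_def)
 note av = exp_avg_lborel[OF _ \<alpha>(2), of h]
 show ?thesis
 proof (cases "b = 0")
  case True
  then show ?thesis by (simp add: av box_avg_def greaterThan_def)
 next
  case False
  let ?m = "\<mu> b" and ?M = "\<mu> (b - 1)"
  have lt: "?m < ?M" using \<mu>(1) b False unfolding strict_dec_def by auto
  let ?f = "\<lambda>x. of_real (\<alpha> * exp (- \<alpha> * (x - ?m))) * h x :: complex"
  have int: "integrable lborel (\<lambda>x. indicator A x *\<^sub>R ?f x)" if "A \<in> sets borel" "A \<subseteq> {?m..}" for A
   by (rule set_integrable_exp_growth[OF h \<alpha>(1) _ that]) (use \<mu>(2)[OF b] in simp)
  have "exp_avg \<alpha> h ?m = (\<integral>x. indicator {?m<..} x *\<^sub>R ?f x \<partial>lborel)" by (rule av) simp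
  also have "... = (\<integral>x. indicator {x. ?m < x \<and> (0 < b --> x < ?M)} x *\<^sub>R ?f x + indicator {?M<..} x *\<^sub>R ?f x \<partial>lborel)"
  proof (rule integral_cong_AE)
   show "AE x in lborel. indicator {?m<..} x *\<^sub>R ?f x = indicator {x. ?m < x \<and> (0 < b --> x < ?M)} x *\<^sub>R ?f x + indicator {?M<..} x *\<^sub>R ?f x"
    using AE_lborel_singleton[of ?M] by eventually_elim (use lt False in \<open>auto simp: indicator_def\<close>)
  qed measurable
  also have "... = box_avg \<alpha> \<mu> h b + (\<integral>x. indicator {?M<..} x *\<^sub>R ?f x \<partial>lborel)"
  proof -
   have "{x. ?m < x \<and> (0 < b --> x < ?M)} \<in> sets borel" by measurable
   then have "integrable lborel (\<lambda>x. indicator {x. ?m < x \<and> (0 < b --> x < ?M)} x *\<^sub>R ?f x)"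
    by (rule int) auto
   moreover have "integrable lborel (\<lambda>x. indicator {?M<..} x *\<^sub>R ?f x)" by (rule int) (use lt in auto)
   ultimately show ?thesis unfolding box_avg_def by (rule Bochner_Integration.integral_add)
  qed
  also have "(\<integral>x. indicator {?M<..} x *\<^sub>R ?f x \<partial>lborel) = (\<integral>x. of_real (exp (- \<alpha> * (?M - ?m))) * (indicator {?M<..} x *\<^sub>R (of_real (\<alpha> * exp (- \<alpha> * (x - ?M))) * h x)) \<partial>lborel)"
  proof (rule Bochner_Integration.integral_cong)
   fix x
   have "exp (- \<alpha> * (x - ?m)) = exp (- \<alpha> * (?M - ?m)) * exp (- \<alpha> * (x - ?M))" by (simp add: exp_add[symmetric] algebra_simps)
   then show "indicator {?M<..} x *\<^sub>R ?f x = of_real (exp (- \<alpha> * (?M - ?m))) * (indicator {?M<..} x *\<^sub>R (of_real (\<alpha> * exp (- \<alpha> * (x - ?M))) * h x))"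
    by (simp add: scaleR_conv_of_real)
  qed simp
  also have "... = of_real (exp (- \<alpha> * (?M - ?m))) * exp_avg \<alpha> h ?M"
  proof -
   have a: "exp_avg \<alpha> h ?M = (\<integral>x. indicator {?M<..} x *\<^sub>R (of_real (\<alpha> * exp (- \<alpha> * (x - ?M))) * h x) \<partial>lborel)"
    by (rule av) simp
   show ?thesis unfolding a by (rule integral_mult_right_zero)
  qed
  finally show ?thesis using False by simp
 qed
qed

text \<open>By \<open>box_avg_eq\<close> each row combines two neighbouring rows of full averages,
  with coefficient 1 on the diagonal; the unitriangular factor \<open>L\<close> leaves the
  determinant unchanged.\<close>

lemma det_box_avg:
 assumes h: "\<And>a. a < n ==> exp_growth \<kappa> (h a)" and \<alpha>: "\<kappa> < \<alpha>" "0 < \<alpha>" and \<mu>: "strict_dec n \<mu>" "\<And>j. j < n ==> 0 < \<mu> j"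
 shows "Determinant.det (Matrix.mat n n (\<lambda>(b, a). box_avg \<alpha> \<mu> (h a) b)) = alternant n (\<lambda>a. exp_avg \<alpha> (h a)) \<mu>"
proof -
 define L :: "complex mat" where "L = Matrix.mat n n (\<lambda>(b, c). if b = c then 1 else if b = Suc c then - of_real (exp (- \<alpha> * (\<mu> c - \<mu> b))) else 0)"
 define T where "T = Matrix.mat n n (\<lambda>(b, a). exp_avg \<alpha> (h a) (\<mu> b))"
 have LT: "Matrix.mat n n (\<lambda>(b, a). box_avg \<alpha> \<mu> (h a) b) = L * T"
 proof (rule eq_matI)
  fix b a assume "b < dim_row (L * T)" "a < dim_col (L * T)"
  then have ba: "b < n" "a < n" by (auto simp: L_def T_def)
  have "(L * T) $$ (b, a) = (\<Sum>c<n. (if b = c then 1 else if b = Suc c then - of_real (exp (- \<alpha> * (\<mu> c - \<mu> b))) else 0) * exp_avg \<alpha> (h a) (\<mu> c))"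
   using ba by (simp add: L_def T_def scalar_prod_def lessThan_atLeast0)
  also have "... = (\<Sum>c<n. (if c = b then exp_avg \<alpha> (h a) (\<mu> b) else 0) + (if 0 < b \<and> c = b - 1 then - of_real (exp (- \<alpha> * (\<mu> (b - 1) - \<mu> b))) * exp_avg \<alpha> (h a) (\<mu> (b - 1)) else 0))"
   by (intro sum.cong refl) auto
  also have "... = box_avg \<alpha> \<mu> (h a) b"
   unfolding sum.distrib box_avg_eq[OF h[OF ba(2)] \<alpha> \<mu> ba(1), simplified] using ba
   by (cases "b = 0") (auto simp: sum.delta)
  finally show "Matrix.mat n n (\<lambda>(b, a). box_avg \<alpha> \<mu> (h a) b) $$ (b, a) = (L * T) $$ (b, a)" using ba by simp
 qed (auto simp: L_def T_def)
 have "Determinant.det L = prod_list (diag_mat L)"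
  by (rule det_lower_triangular[of n]) (auto simp: L_def)
 also have "... = 1" by (simp add: prod_list_diag_prod L_def)
 finally have "Determinant.det (L * T) = Determinant.det T"
  by (subst det_mult[of _ n]) (auto simp: L_def T_def)
 then show ?thesis unfolding LT by (simp add: T_def alternant_def)
qed

text \<open>The box is a product of intervals, so each Leibniz term integrates to a product of
  one-dimensional averages.\<close>

lemma integral_box_alternant:
 assumes h: "\<And>a. a < n ==> exp_growth \<kappa> (h a)" and \<alpha>: "\<kappa> < \<alpha>" "0 < \<alpha>" and \<mu>: "strict_dec n \<mu>" "\<And>j. j < n ==> 0 < \<mu> j"
 shows "(\<integral>l. indicator {l. interlace_box n \<mu> l} l *\<^sub>R (of_real (\<alpha> ^ n * exp (- \<alpha> * ((\<Sum>b<n. l b) - (\<Sum>b<n. \<mu> b)))) * alternant n h l) \<partial>PiM {..<n} (\<lambda>_. lborel)) =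
  alternant n (\<lambda>a. exp_avg \<alpha> (h a)) \<mu>"
proof -
 interpret L: product_sigma_finite "\<lambda>_::nat. lborel :: real measure" by standard
 let ?P = "PiM {..<n} (\<lambda>_. lborel :: real measure)"
 define B where "B b = {x. \<mu> b < x \<and> (0 < b --> x < \<mu> (b - 1))}" for b
 have BM[measurable]: "B b \<in> sets borel" for b unfolding B_def by measurable
 define \<phi> where "\<phi> a b x = indicator (B b) x *\<^sub>R (of_real (\<alpha> * exp (- \<alpha> * (x - \<mu> b))) * h a x)" for a b x
 have int: "integrable lborel (\<phi> a b)" if "a < n" "b < n" for a b
  unfolding \<phi>_def by (rule set_integrable_exp_growth[OF h[OF that(1)] \<alpha>(1) _ BM]) (use \<mu>(2)[OF that(2)] in \<open>auto simp: B_def\<close>)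
 have ind: "indicator {l. interlace_box n \<mu> l} l = (\<Prod>b<n. indicator (B b) (l b) :: real)" for l
  by (auto simp: interlace_box_def B_def indicator_def)
 have "indicator {l. interlace_box n \<mu> l} l *\<^sub>R (of_real (\<alpha> ^ n * exp (- \<alpha> * ((\<Sum>b<n. l b) - (\<Sum>b<n. \<mu> b)))) * alternant n h l) =
  (\<Sum>p | p permutes {..<n}. signof p * (\<Prod>b<n. \<phi> (p b) b (l b)))" for l
 proof -
  have "\<alpha> ^ n * exp (- \<alpha> * ((\<Sum>b<n. l b) - (\<Sum>b<n. \<mu> b))) = (\<Prod>b<n. \<alpha> * exp (- \<alpha> * (l b - \<mu> b)))"
   by (simp only: prod.distrib prod_constant card_lessThan exp_sum[OF finite_lessThan, symmetric] sum_distrib_left[symmetric] sum_subtractf)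
  then have e1: "complex_of_real (\<alpha> ^ n * exp (- \<alpha> * ((\<Sum>b<n. l b) - (\<Sum>b<n. \<mu> b)))) = (\<Prod>b<n. of_real (\<alpha> * exp (- \<alpha> * (l b - \<mu> b))))"
   by (simp only: of_real_prod)
  show ?thesis
   unfolding ind alternant_Leibniz \<phi>_def e1
   by (simp add: scaleR_conv_of_real prod.distrib sum_distrib_left mult_ac)
 qed
 then have "(\<integral>l. indicator {l. interlace_box n \<mu> l} l *\<^sub>R (of_real (\<alpha> ^ n * exp (- \<alpha> * ((\<Sum>b<n. l b) - (\<Sum>b<n. \<mu> b)))) * alternant n h l) \<partial>?P) =
  (\<integral>l. (\<Sum>p | p permutes {..<n}. signof p * (\<Prod>b<n. \<phi> (p b) b (l b))) \<partial>?P)" by simp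
 also have "... = (\<Sum>p | p permutes {..<n}. signof p * (\<integral>l. (\<Prod>b<n. \<phi> (p b) b (l b)) \<partial>?P))"
 proof (subst Bochner_Integration.integral_sum)
  fix p assume "p \<in> {p. p permutes {..<n}}"
  then have "p b < n" if "b < n" for b using that permutes_in_image[of p "{..<n}" b] by auto
  then show "integrable ?P (\<lambda>l. signof p * (\<Prod>b<n. \<phi> (p b) b (l b)))"
   by (intro integrable_mult_right L.product_integrable_prod int) auto
 qed simp
 also have "... = (\<Sum>p | p permutes {..<n}. signof p * (\<Prod>b<n. box_avg \<alpha> \<mu> (h (p b)) b))"
 proof (intro sum.cong refl arg_cong2[where f = "(*)"])
  fix p assume "p \<in> {p. p permutes {..<n}}"
  then have "p b < n" if "b < n" for b using that permutes_in_image[of p "{..<n}" b] by auto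
  then have "(\<integral>l. (\<Prod>b<n. \<phi> (p b) b (l b)) \<partial>?P) = (\<Prod>b<n. integral\<^sup>L lborel (\<phi> (p b) b))"
   by (intro L.product_integral_prod int) auto
  then show "(\<integral>l. (\<Prod>b<n. \<phi> (p b) b (l b)) \<partial>?P) = (\<Prod>b<n. box_avg \<alpha> \<mu> (h (p b)) b)"
   by (simp add: box_avg_def \<phi>_def[abs_def] B_def)
 qed
 also have "... = Determinant.det (Matrix.mat n n (\<lambda>(b, a). box_avg \<alpha> \<mu> (h a) b))"
 proof -
  have "Determinant.det (Matrix.mat n n (\<lambda>(b, a). box_avg \<alpha> \<mu> (h a) b)) =
   (\<Sum>p | p permutes {0..<n}. signof p * (\<Prod>i = 0..<n. Matrix.mat n n (\<lambda>(b, a). box_avg \<alpha> \<mu> (h a) b) $$ (i, p i)))"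
   by (rule det_def') simp
  also have "... = (\<Sum>p | p permutes {0..<n}. signof p * (\<Prod>i = 0..<n. box_avg \<alpha> \<mu> (h (p i)) i))"
  proof (intro sum.cong refl arg_cong2[where f = "(*)"] prod.cong)
   fix p i assume "p \<in> {p. p permutes {0..<n}}" "i \<in> {0..<n}"
   then have "i < n" "p i < n" using permutes_in_image[of p "{0..<n}" i] by auto
   then show "Matrix.mat n n (\<lambda>(b, a). box_avg \<alpha> \<mu> (h a) b) $$ (i, p i) = box_avg \<alpha> \<mu> (h (p i)) i" by simp
  qed
  finally show ?thesis by (simp add: lessThan_atLeast0)
 qed
 also have "... = alternant n (\<lambda>a. exp_avg \<alpha> (h a)) \<mu>" by (rule det_box_avg[OF h \<alpha> \<mu>])
 finally show ?thesis .
qed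

section \<open>Averaging over one Gaussian row, then over all of them\<close>

lemma distr_update_weight:
 assumes "strict_dec n \<mu>"
 shows "distr (density (PiM {..<n} (\<lambda>_. lborel)) (\<lambda>l. ennreal (indicator {l. interlace_box n \<mu> l} l * vandermonde_prod n l)))
   (PiM {..<n} (\<lambda>_. lborel)) (\<lambda>l. \<lambda>i\<in>{..<n}. update_weight n \<mu> l i) =
  density (PiM {..<n} (\<lambda>_. lborel)) (\<lambda>r. ennreal (vandermonde_prod n \<mu>) * indicator {r. \<forall>i<n. 0 < r i} r)" (is "?L = ?R")
proof (rule measure_eqI)
 let ?P = "PiM {..<n} (\<lambda>_. lborel :: real measure)"
 let ?uw = "\<lambda>l. \<lambda>i\<in>{..<n}. update_weight n \<mu> l i"
 let ?d = "\<lambda>l. ennreal (indicator {l. interlace_box n \<mu> l} l * vandermonde_prod n l)"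
 show "sets ?L = sets ?R" by simp
 fix A assume "A \<in> sets ?L"
 then have [measurable]: "A \<in> sets ?P" by simp
 have dM: "?d \<in> borel_measurable ?P" by measurable
 have uM[measurable]: "?uw \<in> ?P \<rightarrow>\<^sub>M ?P" by (rule measurable_restrict) simp
 have [measurable]: "Measurable.pred ?P (\<lambda>r. \<forall>i<n. 0 < r i)" by measurable
 have "emeasure ?L A = emeasure (density ?P ?d) (?uw -` A \<inter> space ?P)"
  by (subst emeasure_distr) auto
 also have "... = (\<integral>\<^sup>+l. ?d l * indicator (?uw -` A \<inter> space ?P) l \<partial>?P)"
  by (rule emeasure_density[OF dM]) (rule measurable_sets[OF uM], simp)
 also have "... = (\<integral>\<^sup>+l. indicator A (?uw l) * (ennreal (vandermonde_prod n l) * indicator {l. interlace_box n \<mu> l} l) \<partial>?P)"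
  by (intro nn_integral_cong) (auto simp: indicator_def)
 also have "... = ennreal (vandermonde_prod n \<mu>) * (\<integral>\<^sup>+r. indicator A r * indicator {r. \<forall>i<n. 0 < r i} r \<partial>?P)"
  by (rule transport_nn_integral[OF assms]) measurable
 also have "... = (\<integral>\<^sup>+r. ennreal (vandermonde_prod n \<mu>) * (indicator A r * indicator {r. \<forall>i<n. 0 < r i} r) \<partial>?P)"
  by (rule nn_integral_cmult[symmetric]) measurable
 also have "... = (\<integral>\<^sup>+r. (ennreal (vandermonde_prod n \<mu>) * indicator {r. \<forall>i<n. 0 < r i} r) * indicator A r \<partial>?P)"
  by (simp add: mult_ac)
 also have "... = emeasure ?R A"
  by (rule emeasure_density[symmetric]) measurable
 finally show "emeasure ?L A = emeasure ?R A" .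
qed

text \<open>The factor \<open>V\<close> is multiplied in and divided out to expose the image measure
  of \<open>distr_update_weight\<close>.\<close>

lemma PiM_exp_law:
 assumes "0 < \<alpha>" "0 < V"
 shows "PiM {..<n} (\<lambda>_. exp_law \<alpha>) = density (density (PiM {..<n} (\<lambda>_. lborel)) (\<lambda>r. ennreal V * indicator {r. \<forall>i<n. 0 < r i} r))
   (\<lambda>r. ennreal (\<alpha> ^ n * exp (- \<alpha> * (\<Sum>i<n. r i)) / V))" (is "?L = ?R")
proof (rule measure_eqI)
 let ?P = "PiM {..<n} (\<lambda>_. lborel :: real measure)"
 interpret E: prob_space "exp_law \<alpha>" by (rule prob_space_exp_law[OF assms(1)])
 have sP: "sets (PiM {..<n} (\<lambda>_. exp_law \<alpha>)) = sets ?P" by (auto intro!: sets_PiM_cong)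
 show "sets ?L = sets ?R" using sP by simp
 fix A assume "A \<in> sets ?L"
 then have A: "A \<in> sets (PiM {..<n} (\<lambda>_. exp_law \<alpha>))" and [measurable]: "A \<in> sets ?P" using sP by auto
 have [measurable]: "Measurable.pred ?P (\<lambda>r. \<forall>i<n. 0 < r i)" by measurable
 have "emeasure ?L A = (\<integral>\<^sup>+r. indicator A r \<partial>PiM {..<n} (\<lambda>_. exp_law \<alpha>))" using A by simp
 also have "... = (\<integral>\<^sup>+r. (\<Prod>i<n. ennreal (\<alpha> * exp (- \<alpha> * r i)) * indicator {0<..} (r i)) * indicator A r \<partial>?P)"
 proof (rule nn_integral_PiM_density)
  show "product_sigma_finite (\<lambda>_::nat. lborel :: real measure)" by standard
  show "product_sigma_finite (\<lambda>_::nat. exp_law \<alpha>)" by (simp add: product_sigma_finite_def E.sigma_finite_measure_axioms)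
 qed (auto simp: exp_law_def)
 also have "... = (\<integral>\<^sup>+r. ((ennreal V * indicator {r. \<forall>i<n. 0 < r i} r) * ennreal (\<alpha> ^ n * exp (- \<alpha> * (\<Sum>i<n. r i)) / V)) * indicator A r \<partial>?P)"
 proof (intro nn_integral_cong arg_cong2[where f = "(*)"] refl)
  fix r :: "nat => real"
  have "(\<Prod>i<n. ennreal (\<alpha> * exp (- \<alpha> * r i)) * indicator {0<..} (r i)) = (\<Prod>i<n. ennreal (\<alpha> * exp (- \<alpha> * r i))) * (\<Prod>i<n. indicator {0<..} (r i))"
   by (rule prod.distrib)
  also have "(\<Prod>i<n. ennreal (\<alpha> * exp (- \<alpha> * r i))) = ennreal (\<Prod>i<n. \<alpha> * exp (- \<alpha> * r i))"
   using assms by (intro prod_ennreal) auto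
  also have "(\<Prod>i<n. \<alpha> * exp (- \<alpha> * r i)) = V * (\<alpha> ^ n * exp (- \<alpha> * (\<Sum>i<n. r i)) / V)"
   using assms by (simp only: prod.distrib prod_constant card_lessThan exp_sum[OF finite_lessThan, symmetric] sum_distrib_left[symmetric]) simp
  also have "ennreal ... = ennreal V * ennreal (\<alpha> ^ n * exp (- \<alpha> * (\<Sum>i<n. r i)) / V)"
   using assms by (intro ennreal_mult) auto
  also have "(\<Prod>i<n. indicator {0<..} (r i)) = (indicator {r. \<forall>i<n. 0 < r i} r :: ennreal)"
   by (auto simp: indicator_def)
  finally show "(\<Prod>i<n. ennreal (\<alpha> * exp (- \<alpha> * r i)) * indicator {0<..} (r i)) = (ennreal V * indicator {r. \<forall>i<n. 0 < r i} r) * ennreal (\<alpha> ^ n * exp (- \<alpha> * (\<Sum>i<n. r i)) / V)"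
   by (simp add: mult_ac)
 qed
 also have "... = emeasure ?R A"
  by (subst density_density_eq) (auto simp: emeasure_density)
 finally show "emeasure ?L A = emeasure ?R A" .
qed

text \<open>Unitary invariance lets the row be read in the eigenbasis, where \<open>\<phi>\<close>
  depends on the squared moduli only, and these are parametrized by \<open>l\<close>. The Jacobian
  cancels the denominator of \<open>alternant_ratio\<close> at \<open>l\<close> and leaves the one
  at \<open>\<mu>\<close>. The values of \<open>\<phi>\<close> are prescribed only on rows that lead
  to a simple spectrum, which is almost everywhere.\<close>

lemma gauss_vec_alternant_ratio:
 fixes X :: "'p::finite => nat => complex"
 assumes sp: "diag_spectrum e n S X v \<mu>" and iS: "i \<notin> S"
  and h: "\<And>a. a < n ==> exp_growth \<kappa> (h a)" and \<alpha>: "\<kappa> < \<alpha>" "0 < \<alpha>"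
  and \<phi>M: "\<phi> \<in> borel_measurable (PiM {..<n} (\<lambda>_. borel))"
  and \<phi>: "\<And>y v' l. y \<in> space (PiM {..<n} (\<lambda>_. borel :: complex measure)) ==> diag_spectrum e n (insert i S) (X(i := y)) v' l ==> \<phi> y = alternant_ratio n h l"
 shows "(\<integral>y. \<phi> y \<partial>gauss_vec n \<alpha>) = alternant_ratio n (\<lambda>a. exp_avg \<alpha> (h a)) \<mu>"
proof -
 have u: "unitary_rows n v" and dec: "strict_dec n \<mu>" and pos: "\<And>j. j < n ==> 0 < \<mu> j" using sp by (auto simp: diag_spectrum_def)
 let ?U = "apply_rows n (adj_rows v)"
 let ?P = "PiM {..<n} (\<lambda>_. lborel :: real measure)"
 let ?B = "PiM {..<n} (\<lambda>_. borel :: complex measure)"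
 have u': "unitary_rows n (adj_rows v)" by (rule unitary_rows_adj[OF u])
 have UM[measurable]: "?U \<in> ?B \<rightarrow>\<^sub>M ?B" by (rule measurable_apply_rows)
 have gB: "measurable (gauss_vec n \<alpha>) N = measurable ?B N" for N :: "'z measure" by (rule measurable_cong_sets[OF sets_gauss_vec refl])
 have at_box: "\<phi> (?U c) = alternant_ratio n h l"
  if "\<And>j. j < n ==> c j ~= 0" "interlace_box n \<mu> l" "\<And>j. j < n ==> update_weight n \<mu> l j = (cmod (c j))\<^sup>2" for c l
 proof -
  have c: "(\<Sum>k<n. v j k * ?U c k) = c j" if "j < n" for j
   using apply_rows_adj[OF u that, of c] that by (simp add: apply_rows_def[of n v])
  have "diag_spectrum e n S (X(i := ?U c)) v \<mu>" using sp iS by (subst diag_spectrum_cong[of S n _ X]) auto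
  then have "\<exists>v'. diag_spectrum e n (insert i S) (X(i := ?U c)) v' l"
   using that iS by (intro diag_spectrum_step) (auto simp: c)
  then show ?thesis using \<phi>[of "?U c"] by (auto simp: space_PiM apply_rows_def)
 qed
 \<comment> \<open>The representative row whose coordinates are the nonnegative square
   roots.\<close>
 define \<Phi> where "\<Phi> r = \<phi> (?U (\<lambda>i\<in>{..<n}. complex_of_real (sqrt (r i))))" for r
 have \<Phi>M: "\<Phi> \<in> borel_measurable ?P"
 proof -
  have "(\<lambda>r. \<lambda>i\<in>{..<n}. complex_of_real (sqrt (r i))) \<in> ?P \<rightarrow>\<^sub>M ?B" by measurable
  from measurable_compose[OF measurable_compose[OF this UM] \<phi>M] show ?thesis by (simp add: \<Phi>_def[abs_def])
 qed
 \<comment> \<open>Both rows have the same squared moduli, so one and the same \<open>l\<close>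
   belongs to both.\<close>
 have sq: "\<phi> (?U c) = \<Phi> (\<lambda>i\<in>{..<n}. (cmod (c i))\<^sup>2)" if "\<And>j. j < n ==> c j ~= 0" for c
 proof -
  have "\<exists>l. interlace_box n \<mu> l \<and> (\<forall>j<n. update_weight n \<mu> l j = (cmod (c j))\<^sup>2)"
   by (rule update_weight_surj[OF dec]) (use that in auto)
  then obtain l where l: "interlace_box n \<mu> l" "\<And>j. j < n ==> update_weight n \<mu> l j = (cmod (c j))\<^sup>2" by blast
  have "\<phi> (?U c) = alternant_ratio n h l" by (rule at_box[OF that l])
  moreover have "\<phi> (?U (\<lambda>i\<in>{..<n}. complex_of_real (sqrt ((\<lambda>i\<in>{..<n}. (cmod (c i))\<^sup>2) i)))) = alternant_ratio n h l"
   by (rule at_box[OF _ l(1)]) (use that l in auto)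
  ultimately show ?thesis by (simp add: \<Phi>_def)
 qed
 let ?uw = "\<lambda>l. \<lambda>i\<in>{..<n}. update_weight n \<mu> l i"
 let ?sq = "\<lambda>y. \<lambda>i\<in>{..<n}. (cmod (y i :: complex))\<^sup>2"
 have \<Phi>uw: "\<Phi> (?uw l) = alternant_ratio n h l" if "interlace_box n \<mu> l" for l
 proof -
  have p: "0 < update_weight n \<mu> l j" if "j < n" for j by (rule update_weight_pos[OF dec \<open>interlace_box n \<mu> l\<close> that])
  show ?thesis unfolding \<Phi>_def by (rule at_box[OF _ that]) (use p in \<open>auto simp: less_imp_le\<close>, fastforce)
 qed
 have sPB: "sets ?P = sets (PiM {..<n} (\<lambda>_. borel))" by (auto intro!: sets_PiM_cong)
 define V where "V = vandermonde_prod n \<mu>"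
 have V: "0 < V" unfolding V_def by (rule vandermonde_prod_pos[OF dec])
 define w where "w r = \<alpha> ^ n * exp (- \<alpha> * (\<Sum>i<n. r i)) / V" for r
 have wM[measurable]: "w \<in> borel_measurable ?P" unfolding w_def by measurable
 define D where "D = density ?P (\<lambda>l. ennreal (indicator {l. interlace_box n \<mu> l} l * vandermonde_prod n l))"
 have uwM: "?uw \<in> ?P \<rightarrow>\<^sub>M ?P" by (rule measurable_restrict) simp
 have "(\<integral>y. \<phi> y \<partial>gauss_vec n \<alpha>) = (\<integral>y. \<phi> y \<partial>distr (gauss_vec n \<alpha>) ?B ?U)"
  by (simp add: distr_gauss_vec_unitary[OF u' \<alpha>(2)])
 also have "... = (\<integral>c. \<phi> (?U c) \<partial>gauss_vec n \<alpha>)"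
  by (rule integral_distr) (use \<phi>M UM in \<open>auto simp: gB\<close>)
 also have "... = (\<integral>c. \<Phi> (?sq c) \<partial>gauss_vec n \<alpha>)"
 proof (rule integral_cong_AE)
  show "(\<lambda>c. \<phi> (?U c)) \<in> borel_measurable (gauss_vec n \<alpha>)" unfolding gB by (rule measurable_compose[OF UM \<phi>M])
  have "?sq \<in> ?B \<rightarrow>\<^sub>M ?P" by (rule measurable_restrict) simp
  then show "(\<lambda>c. \<Phi> (?sq c)) \<in> borel_measurable (gauss_vec n \<alpha>)" unfolding gB by (rule measurable_compose[OF _ \<Phi>M])
  have "AE c in gauss_vec n \<alpha>. \<forall>j\<in>{..<n}. c j ~= 0"
   by (rule AE_finite_allI) (auto intro: AE_gauss_vec_nonzero[OF \<alpha>(2)])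
  then show "AE c in gauss_vec n \<alpha>. \<phi> (?U c) = \<Phi> (?sq c)" by eventually_elim (auto intro: sq)
 qed
 also have "... = (\<integral>r. \<Phi> r \<partial>distr (gauss_vec n \<alpha>) (PiM {..<n} (\<lambda>_. borel)) ?sq)"
 proof (rule integral_distr[symmetric])
  show "?sq \<in> gauss_vec n \<alpha> \<rightarrow>\<^sub>M Pi\<^sub>M {..<n} (\<lambda>_. borel)" unfolding gB by measurable
  show "\<Phi> \<in> borel_measurable (Pi\<^sub>M {..<n} (\<lambda>_. borel))" using \<Phi>M by (simp add: measurable_cong_sets[OF sPB refl])
 qed
 also have "... = (\<integral>r. \<Phi> r \<partial>PiM {..<n} (\<lambda>_. exp_law \<alpha>))" by (simp add: distr_gauss_vec_cmod[OF \<alpha>(2)])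
 also have "... = (\<integral>r. \<Phi> r \<partial>density (distr D ?P ?uw) (\<lambda>r. ennreal (w r)))"
  unfolding PiM_exp_law[OF \<alpha>(2) V] w_def D_def distr_update_weight[OF dec] V_def ..
 also have "... = (\<integral>r. w r *\<^sub>R \<Phi> r \<partial>distr D ?P ?uw)"
  by (rule integral_density) (use \<Phi>M wM V \<alpha> in \<open>auto simp: w_def intro!: AE_I2\<close>)
 also have "... = (\<integral>l. w (?uw l) *\<^sub>R \<Phi> (?uw l) \<partial>D)"
  by (rule integral_distr) (use uwM \<Phi>M wM in \<open>auto simp: D_def\<close>)
 also have "... = (\<integral>l. (indicator {l. interlace_box n \<mu> l} l * vandermonde_prod n l) *\<^sub>R (w (?uw l) *\<^sub>R \<Phi> (?uw l)) \<partial>?P)"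
  unfolding D_def
 proof (rule integral_density)
  show "(\<lambda>l. w (?uw l) *\<^sub>R \<Phi> (?uw l)) \<in> borel_measurable ?P"
   by (intro borel_measurable_scaleR measurable_compose[OF uwM wM] measurable_compose[OF uwM \<Phi>M])
  show "AE l in ?P. 0 <= indicator {l. interlace_box n \<mu> l} l * vandermonde_prod n l"
   using vandermonde_prod_pos[OF interlace_box_strict_dec[OF dec]] by (intro AE_I2) (auto simp: indicator_def less_imp_le)
 qed measurable
 also have "... = (\<integral>l. (indicator {l. interlace_box n \<mu> l} l *\<^sub>R (of_real (\<alpha> ^ n * exp (- \<alpha> * ((\<Sum>b<n. l b) - (\<Sum>b<n. \<mu> b)))) * alternant n h l)) / of_real V \<partial>?P)"
 proof (rule Bochner_Integration.integral_cong[OF refl])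
  fix l
  show "(indicator {l. interlace_box n \<mu> l} l * vandermonde_prod n l) *\<^sub>R (w (?uw l) *\<^sub>R \<Phi> (?uw l)) =
   (indicator {l. interlace_box n \<mu> l} l *\<^sub>R (of_real (\<alpha> ^ n * exp (- \<alpha> * ((\<Sum>b<n. l b) - (\<Sum>b<n. \<mu> b)))) * alternant n h l)) / of_real V"
  proof (cases "interlace_box n \<mu> l")
   case True
   have "0 < vandermonde_prod n l" by (rule vandermonde_prod_pos[OF interlace_box_strict_dec[OF dec True]])
   moreover have "w (?uw l) = \<alpha> ^ n * exp (- \<alpha> * ((\<Sum>b<n. l b) - (\<Sum>b<n. \<mu> b))) / V"
    using sum_update_weight[OF dec, of l] by (simp add: w_def)
   ultimately show ?thesis using True
    by (simp add: \<Phi>uw alternant_ratio_def scaleR_conv_of_real)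
  qed simp
 qed
 also have "... = (\<integral>l. (indicator {l. interlace_box n \<mu> l} l *\<^sub>R (of_real (\<alpha> ^ n * exp (- \<alpha> * ((\<Sum>b<n. l b) - (\<Sum>b<n. \<mu> b)))) * alternant n h l)) \<partial>?P) / of_real V"
  by (rule integral_divide_zero)
 also have "... = alternant_ratio n (\<lambda>a. exp_avg \<alpha> (h a)) \<mu>"
  using integral_box_alternant[of n \<kappa> h \<alpha> \<mu>] h \<alpha> dec pos by (simp add: alternant_ratio_def V_def)
 finally show ?thesis .
qed

text \<open>The last row of the list is integrated first, its mean being known from the spectrum of
  the rows before it; hence the reverse induction and \<open>foldr\<close>. As \<open>F\<close> is
  prescribed only where the spectrum is simple, its bound and measurability are carried along for
  Fubini.\<close>

lemma gauss_rows_alternant_ratio: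
 fixes rate :: "'p::finite => real" and F :: "('p => nat => complex) => complex"
 assumes e: "strict_dec n e" "\<And>j. j < n ==> 0 < e j"
  and rate: "\<And>i. \<kappa> < rate i" "\<And>i. 0 < rate i"
  and "distinct is" and "\<And>a. a < n ==> exp_growth \<kappa> (h a)"
  and "F \<in> borel_measurable (PiM (set is) (\<lambda>_. PiM {..<n} (\<lambda>_. borel)))" and "\<And>X. cmod (F X) <= C"
  and "\<And>X v l. X \<in> space (PiM (set is) (\<lambda>_. PiM {..<n} (\<lambda>_. borel :: complex measure))) ==> diag_spectrum e n (set is) X v l ==> F X = alternant_ratio n h l"
 shows "(\<integral>X. F X \<partial>PiM (set is) (\<lambda>i. gauss_vec n (rate i))) = alternant_ratio n (\<lambda>a. foldr (\<lambda>i. exp_avg (rate i)) is (h a)) e"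
 using assms(5-)
proof (induction "is" arbitrary: F h rule: rev_induct)
 case Nil
 have [simp]: "space (PiM {} M) = {\<lambda>_. undefined}" for M :: "'p => (nat => complex) measure" by (simp add: space_PiM)
 have "(\<integral>X. F X \<partial>PiM {} (\<lambda>i. gauss_vec n (rate i))) = F (\<lambda>_. undefined)"
  by (simp add: PiM_empty lebesgue_integral_count_space_finite)
 then show ?case using Nil.prems(5)[of "\<lambda>_. undefined"] diag_spectrum_empty[OF e] by auto
next
 case (snoc i js)
 let ?M = "\<lambda>i. gauss_vec n (rate i)"
 let ?B = "\<lambda>_::'p. PiM {..<n} (\<lambda>_. borel :: complex measure)"
 interpret P: prob_space "gauss_vec n (rate j)" for j by (rule prob_space_gauss_vec[OF rate(2)])
 interpret product_sigma_finite ?M by standard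
 interpret PP: prob_space "PiM I ?M" for I by (rule prob_space_PiM) (rule P.prob_space_axioms)
 have i: "i \<notin> set js" and d: "distinct js" using snoc.prems(1) by auto
 have sM: "sets (PiM I ?M) = sets (PiM I ?B)" for I by (intro sets_PiM_cong refl) (simp add: sets_gauss_vec)
 have sm: "measurable (PiM I ?M) N = measurable (PiM I ?B) N" for I and N :: "complex measure" by (rule measurable_cong_sets[OF sM refl])
 have FM: "F \<in> borel_measurable (PiM (insert i (set js)) ?B)" using snoc.prems(3) by simp
 have FM': "F \<in> borel_measurable (PiM (insert i (set js)) ?M)" using FM by (simp add: sm)
 define F' where "F' X = (\<integral>y. F (X(i := y)) \<partial>?M i)" for X
 have "integrable (PiM (insert i (set js)) ?M) F"
  by (rule PP.integrable_const_bound[where B = C]) (use snoc.prems(4) FM' in auto)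
 then have "(\<integral>X. F X \<partial>PiM (set (js @ [i])) ?M) = (\<integral>X. F' X \<partial>PiM (set js) ?M)"
  using i by (simp add: product_integral_insert F'_def)
 also have "... = alternant_ratio n (\<lambda>a. foldr (\<lambda>i. exp_avg (rate i)) js (exp_avg (rate i) (h a))) e"
 proof (rule snoc.IH[OF d])
  show "exp_growth \<kappa> (exp_avg (rate i) (h a))" if "a < n" for a
   by (rule exp_growth_exp_avg[OF snoc.prems(2)[OF that] rate])
  have "(\<lambda>(X, y). X(i := y)) \<in> PiM (set js) ?M \<Otimes>\<^sub>M ?M i \<rightarrow>\<^sub>M PiM (insert i (set js)) ?M"
   by (rule measurable_add_dim)
  from measurable_compose[OF this FM'] have "(\<lambda>(X, y). F (X(i := y))) \<in> borel_measurable (PiM (set js) ?M \<Otimes>\<^sub>M ?M i)"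
   by (simp add: split_beta')
  then have "F' \<in> borel_measurable (PiM (set js) ?M)"
   unfolding F'_def by (rule P.borel_measurable_lebesgue_integral)
  then show "F' \<in> borel_measurable (PiM (set js) ?B)" by (simp add: sm)
  have "cmod (F' X) <= C" for X
  proof -
   have "0 <= C" using snoc.prems(4) norm_ge_zero order_trans by blast
   then show ?thesis
   proof (cases "integrable (?M i) (\<lambda>y. F (X(i := y)))")
    case True
    have "cmod (F' X) <= (\<integral>y. cmod (F (X(i := y))) \<partial>?M i)" unfolding F'_def by (rule integral_norm_bound)
    also have "... <= (\<integral>y. C \<partial>?M i)" by (rule integral_mono) (use True snoc.prems(4) in auto)
    finally show ?thesis by (simp add: P.prob_space)
   next
    case False
    then show ?thesis using \<open>0 <= C\<close> by (simp add: F'_def not_integrable_integral_eq)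
   qed
  qed
  then show "cmod (F' X) <= C" for X .
  fix X v l assume X: "X \<in> space (PiM (set js) ?B)" and sp: "diag_spectrum e n (set js) X v l"
  show "F' X = alternant_ratio n (\<lambda>a. exp_avg (rate i) (h a)) l"
   unfolding F'_def
  proof (rule gauss_vec_alternant_ratio[OF sp i snoc.prems(2) rate])
   have upd: "(\<lambda>y. X(i := y)) \<in> ?B i \<rightarrow>\<^sub>M PiM (insert i (set js)) ?B"
    by (rule measurable_fun_upd[of _ "set js"]) (use X in auto)
   show "(\<lambda>y. F (X(i := y))) \<in> borel_measurable (?B i)" by (rule measurable_compose[OF upd FM])
   show "F (X(i := y)) = alternant_ratio n h l'" if "y \<in> space (?B i)" "diag_spectrum e n (insert i (set js)) (X(i := y)) v' l'" for y v' l'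
    using measurable_space[OF upd that(1)] that(2) by (intro snoc.prems(5)[of _ v']) (simp_all del: fun_upd_apply)
  qed
 qed
 finally show ?case by simp
qed

section \<open>Contour integrals and hypoexponential densities\<close>

definition pole_product :: "real list => complex => complex" where
 "pole_product rs z = (\<Prod>r\<leftarrow>rs. 1 / (of_real r - z))"

lemma pole_product_simps [simp]:
 "pole_product [] z = 1" "pole_product (r # rs) z = 1 / (of_real r - z) * pole_product rs z"
 by (simp_all add: pole_product_def)

text \<open>An inverse Laplace transform; each power of \<open>z\<close> is one more derivative in
  \<open>t\<close>, up to sign.\<close>

definition laplace_contour :: "(real => complex) => real list => nat => real => complex" where
 "laplace_contour g rs m t = contour_integral g (\<lambda>z. z ^ m * exp (- of_real t * z) * pole_product rs z)"

text \<open>It survives dropping poles from the list, so that inductions over the list can keep one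
  contour.\<close>

definition encloses :: "(real => complex) => real => real list => bool" where
 "encloses g q rs \<longleftrightarrow> 0 < q \<and> ccw_contour g \<and> path_image g \<subseteq> {z. q < Re z} \<and>
   (\<forall>r\<in>set rs. q < r \<and> of_real r \<in> inside (path_image g))"

lemma encloses_Cons: "encloses g q (r # rs) \<longleftrightarrow> q < r \<and> of_real r \<in> inside (path_image g) \<and> encloses g q rs"
 by (auto simp: encloses_def)

lemma encloses_winding: "encloses g q rs ==> r \<in> set rs ==> winding_number g (of_real r) = 1"
 by (auto simp: encloses_def ccw_contour_def)

lemma encloses_off_path: "encloses g q rs ==> r \<in> set rs ==> of_real r \<notin> path_image g"
 using inside_no_overlap[of "path_image g"] unfolding encloses_def by blast

lemma holomorphic_pole_product:
 assumes "\<And>r. r \<in> set rs ==> of_real r \<notin> A"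
 shows "pole_product rs holomorphic_on A"
 using assms
proof (induction rs)
 case (Cons r rs)
 have "(\<lambda>z. 1 / (of_real r - z) * pole_product rs z) holomorphic_on A"
  using Cons by (intro holomorphic_intros Cons.IH) auto
 then show ?case by (simp add: pole_product_def[abs_def])
qed (simp add: pole_product_def[abs_def])

lemma norm_pole_product_le:
 assumes "\<And>r. r \<in> set rs ==> d <= cmod (of_real r - z)" "0 < d"
 shows "cmod (pole_product rs z) <= (1 / d) ^ length rs"
 using assms
proof (induction rs)
 case (Cons r rs)
 have "cmod (1 / (of_real r - z)) <= 1 / d"
  using Cons.prems(1)[of r] Cons.prems(2) by (simp add: norm_divide frac_le)
 then have "cmod (1 / (of_real r - z)) * cmod (pole_product rs z) <= (1 / d) * (1 / d) ^ length rs"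
  using Cons by (intro mult_mono) auto
 then show ?case by (simp only: pole_product_simps norm_mult length_Cons power_Suc)
qed simp

text \<open>Bounding contour integrals of holomorphic functions takes estimates on an open
  neighbourhood of the path; compactness of the path gives one that keeps a uniform distance from
  the poles.\<close>

lemma contour_domain:
 assumes "encloses g q rs"
 obtains S d R where "open S" "path_image g \<subseteq> S" "0 < d" "0 < R"
  "\<And>z. z \<in> S ==> q < Re z" "\<And>z. z \<in> S ==> cmod z <= R"
  "\<And>z r. z \<in> S ==> r \<in> set rs ==> d <= cmod (of_real r - z)"
proof -
 have v: "valid_path g" and path: "path_image g \<subseteq> {z. q < Re z}" using assms by (auto simp: encloses_def ccw_contour_def)
 have cpt: "compact (path_image g)" using v by (simp add: compact_valid_path_image)
 then obtain R where R: "0 < R" "\<And>z. z \<in> path_image g ==> cmod z < R"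
  by (metis bounded_pos_less compact_imp_bounded)
 define T where "T = complex_of_real ` set rs"
 have T: "compact T" "T \<inter> path_image g = {}"
  using encloses_off_path[OF assms] by (auto simp: T_def finite_imp_compact)
 obtain d where d: "0 < d" "\<And>x y. x \<in> T ==> y \<in> path_image g ==> d <= dist x y"
  using separate_compact_closed[OF T(1) compact_imp_closed[OF cpt] T(2)] by blast
 define S where "S = {z. q < Re z} \<inter> ball 0 R \<inter> (\<Inter>x\<in>T. - cball x (d / 2))"
 have o1: "open S" unfolding S_def
  by (intro open_Int open_ball open_INT) (auto simp: T_def open_halfspace_Re_gt)
 have o2: "path_image g \<subseteq> S"
 proof
  fix y assume y: "y \<in> path_image g"
  have "y \<notin> cball x (d / 2)" if "x \<in> T" for x using d(2)[OF that y] d(1) by simp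
  then show "y \<in> S" using y path R(2)[OF y] by (auto simp: S_def)
 qed
 have o3: "d / 2 <= cmod (of_real r - z)" if "z \<in> S" "r \<in> set rs" for z r
 proof -
  have "z \<notin> cball (of_real r) (d / 2)" using that by (auto simp: S_def T_def)
  then show ?thesis by (simp add: dist_norm)
 qed
 show ?thesis by (rule that[OF o1 o2 _ R(1) _ _ o3]) (use d(1) in \<open>simp_all add: S_def\<close>)
qed

text \<open>The constants \<open>L\<close> and \<open>R\<close> do not depend on the integrand; this
  makes the later bounds uniform in \<open>t\<close> and in the power of \<open>z\<close>.\<close>

lemma contour_bound:
 assumes "encloses g q rs"
 obtains L R where "0 < L" "0 < R"
  "\<And>(\<phi> :: complex => complex) B. \<phi> holomorphic_on UNIV ==> (\<And>z. q < Re z ==> cmod z <= R ==> cmod (\<phi> z) <= B) ==>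
    cmod (contour_integral g (\<lambda>z. \<phi> z * pole_product rs z)) <= L * B"
  "\<And>\<phi> :: complex => complex. \<phi> holomorphic_on UNIV ==> (\<lambda>z. \<phi> z * pole_product rs z) contour_integrable_on g"
proof -
 have v: "valid_path g" using assms by (auto simp: encloses_def ccw_contour_def)
 obtain S d R where S: "open S" "path_image g \<subseteq> S" "0 < d" "0 < R"
  "\<And>z. z \<in> S ==> q < Re z" "\<And>z. z \<in> S ==> cmod z <= R"
  "\<And>z r. z \<in> S ==> r \<in> set rs ==> d <= cmod (of_real r - z)" by (rule contour_domain[OF assms]) blast
 obtain L where L: "0 < L" "\<And>f B. f holomorphic_on S ==> (\<And>z. z \<in> S ==> norm (f z) <= B) ==> norm (contour_integral g f) <= L * B"
  using contour_integral_bound_exists[OF S(1) v S(2)] by blast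
 have off: "of_real r \<notin> S" if "r \<in> set rs" for r using S(7)[of "of_real r" r] that S(3) by auto
 have hol: "(\<lambda>z. \<phi> z * pole_product rs z) holomorphic_on S" if "\<phi> holomorphic_on UNIV" for \<phi>
  by (intro holomorphic_intros holomorphic_pole_product) (use that off holomorphic_on_subset in auto)
 show ?thesis
 proof (rule that[of "L * (1 / d) ^ length rs" R])
  show "0 < L * (1 / d) ^ length rs" using L S by simp
  fix \<phi> :: "complex => complex" assume \<phi>: "\<phi> holomorphic_on UNIV"
  show "(\<lambda>z. \<phi> z * pole_product rs z) contour_integrable_on g"
   by (rule contour_integrable_holomorphic_simple[OF hol[OF \<phi>] S(1) v S(2)])
  fix B assume B: "\<And>z. q < Re z ==> cmod z <= R ==> cmod (\<phi> z) <= B"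
  have "norm (contour_integral g (\<lambda>z. \<phi> z * pole_product rs z)) <= L * (B * (1 / d) ^ length rs)"
  proof (rule L(2)[OF hol[OF \<phi>]])
   fix z assume z: "z \<in> S"
   have "cmod (pole_product rs z) <= (1 / d) ^ length rs" by (rule norm_pole_product_le) (use S z in auto)
   then show "cmod (\<phi> z * pole_product rs z) <= B * (1 / d) ^ length rs"
    unfolding norm_mult using B[of z] S z by (intro mult_mono) (auto intro: order_trans[OF norm_ge_zero])
  qed
  then show "cmod (contour_integral g (\<lambda>z. \<phi> z * pole_product rs z)) <= L * (1 / d) ^ length rs * B" by (simp add: mult_ac)
 qed (use S in auto)
qed

text \<open>Near the contour the real part exceeds \<open>q\<close>, whence the decay
  \<open>exp (- q * u)\<close>; the remainder is that of the Taylor polynomial of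
  \<open>exp (x * z)\<close>.\<close>

lemma laplace_contour_taylor:
 assumes "encloses g q rs"
 shows "\<exists>L R. 0 < L \<and> 0 < R \<and> (\<forall>u\<ge>0. (\<forall>m. cmod (laplace_contour g rs m u) <= L * R ^ m * exp (- q * u)) \<and>
  (\<forall>k n x. cmod (laplace_contour g rs k (u - x) - (\<Sum>m\<le>n. of_real (x ^ m / fact m) * laplace_contour g rs (k + m) u)) \<le>
    L * R ^ k * exp (- q * u) * (exp (\<bar>x\<bar> * R) * (\<bar>x\<bar> * R) ^ Suc n)))"
proof -
 obtain L R where L: "0 < L" "0 < R"
  and bound: "\<And>(\<phi> :: complex => complex) B. \<phi> holomorphic_on UNIV ==> (\<And>z. q < Re z ==> cmod z <= R ==> cmod (\<phi> z) <= B) ==>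
    cmod (contour_integral g (\<lambda>z. \<phi> z * pole_product rs z)) <= L * B"
  and int: "\<And>\<phi> :: complex => complex. \<phi> holomorphic_on UNIV ==> (\<lambda>z. \<phi> z * pole_product rs z) contour_integrable_on g"
  by (rule contour_bound[OF assms]) blast
 have expb: "cmod (exp (- of_real u * z)) <= exp (- q * u)" if "0 <= u" "q < Re z" for u z
 proof -
  have "u * q <= u * Re z" using that by (intro mult_left_mono) auto
  then show ?thesis by (simp add: mult.commute)
 qed
 have 1: "cmod (laplace_contour g rs m u) <= L * (R ^ m * exp (- q * u))" if "0 <= u" for u m
  unfolding laplace_contour_def
 proof (rule bound)
  fix z assume z: "q < Re z" "cmod z <= R"
  show "cmod (z ^ m * exp (- of_real u * z)) <= R ^ m * exp (- q * u)"
   unfolding norm_mult norm_power using z expb[OF that z(1)] L by (intro mult_mono power_mono) auto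
 qed (intro holomorphic_intros)
 have 2: "cmod (laplace_contour g rs k (u - x) - (\<Sum>m\<le>n. of_real (x ^ m / fact m) * laplace_contour g rs (k + m) u)) \<le>
   L * (R ^ k * exp (- q * u) * (exp (\<bar>x\<bar> * R) * (\<bar>x\<bar> * R) ^ Suc n))" if u: "0 <= u" for u x n k
 proof -
  define \<phi> where "\<phi> z = z ^ k * exp (- of_real u * z) * (exp (of_real x * z) - (\<Sum>m\<le>n. (of_real x * z) ^ m / fact m))" for z :: complex
  have hol: "\<phi> holomorphic_on UNIV" unfolding \<phi>_def by (intro holomorphic_intros) auto
  have "(\<lambda>z. \<phi> z * pole_product rs z) = (\<lambda>z. z ^ k * exp (- of_real (u - x) * z) * pole_product rs z -
    (\<Sum>m\<le>n. of_real (x ^ m / fact m) * (z ^ (k + m) * exp (- of_real u * z) * pole_product rs z)))"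
  proof
   fix z :: complex
   have "exp (- of_real (u - x) * z) = exp (- of_real u * z) * exp (of_real x * z)" by (simp add: exp_add[symmetric] algebra_simps)
   then show "\<phi> z * pole_product rs z = z ^ k * exp (- of_real (u - x) * z) * pole_product rs z -
    (\<Sum>m\<le>n. of_real (x ^ m / fact m) * (z ^ (k + m) * exp (- of_real u * z) * pole_product rs z))"
    by (simp add: \<phi>_def algebra_simps sum_distrib_left sum_distrib_right power_mult_distrib power_add)
  qed
  moreover have "contour_integral g ... = laplace_contour g rs k (u - x) - (\<Sum>m\<le>n. of_real (x ^ m / fact m) * laplace_contour g rs (k + m) u)"
  proof -
   have h: "((\<lambda>z. z ^ m * exp (- of_real t * z) * pole_product rs z) has_contour_integral laplace_contour g rs m t) g" for m t
    unfolding laplace_contour_def by (rule has_contour_integral_integral, rule int) (intro holomorphic_intros)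
   have "((\<lambda>z. \<Sum>m\<le>n. of_real (x ^ m / fact m) * (z ^ (k + m) * exp (- of_real u * z) * pole_product rs z)) has_contour_integral
     (\<Sum>m\<le>n. of_real (x ^ m / fact m) * laplace_contour g rs (k + m) u)) g"
    by (rule has_contour_integral_sum[OF finite_atMost], rule has_contour_integral_lmul, rule h)
   from has_contour_integral_diff[OF h[of k "u - x"] this] show ?thesis by (rule contour_integral_unique)
  qed
  ultimately have "laplace_contour g rs k (u - x) - (\<Sum>m\<le>n. of_real (x ^ m / fact m) * laplace_contour g rs (k + m) u) =
    contour_integral g (\<lambda>z. \<phi> z * pole_product rs z)" by simp
  also have "cmod ... <= L * (R ^ k * exp (- q * u) * (exp (\<bar>x\<bar> * R) * (\<bar>x\<bar> * R) ^ Suc n))"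
  proof (rule bound[OF hol])
   fix z assume z: "q < Re z" "cmod z <= R"
   have "cmod (exp (of_real x * z) - (\<Sum>m\<le>n. (of_real x * z) ^ m / fact m)) <= exp (cmod (of_real x * z)) * cmod (of_real x * z) ^ Suc n / fact n"
    by (rule Taylor_exp_field)
   also have "... <= exp (cmod (of_real x * z)) * cmod (of_real x * z) ^ Suc n / 1"
    by (intro divide_left_mono) auto
   also have "... <= exp (\<bar>x\<bar> * R) * (\<bar>x\<bar> * R) ^ Suc n"
    using z L unfolding norm_mult div_by_1 by (intro mult_mono power_mono) (auto intro!: mult_left_mono)
   finally show "cmod (\<phi> z) <= R ^ k * exp (- q * u) * (exp (\<bar>x\<bar> * R) * (\<bar>x\<bar> * R) ^ Suc n)"
    unfolding \<phi>_def norm_mult norm_power using expb[OF u z(1)] z(2) L by (intro mult_mono power_mono) auto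
  qed
  finally show ?thesis .
 qed
 show ?thesis using 1 2 L by (intro exI[of _ L] exI[of _ R]) (auto simp: mult.assoc)
qed

lemma laplace_contour_deriv:
 assumes "encloses g q rs" "0 <= u"
 shows "((\<lambda>t. laplace_contour g rs k t) has_vector_derivative - laplace_contour g rs (Suc k) u) (at u)"
proof -
 obtain L R where L: "0 < L" "0 < R" and taylor: "\<And>x. cmod (laplace_contour g rs k (u - x) - (\<Sum>m\<le>1. of_real (x ^ m / fact m) * laplace_contour g rs (k + m) u)) \<le>
    L * R ^ k * exp (- q * u) * (exp (\<bar>x\<bar> * R) * (\<bar>x\<bar> * R) ^ Suc 1)"
  using laplace_contour_taylor[OF assms(1)] assms(2) by blast
 define C where "C = L * R ^ k * exp (- q * u) * exp R * R ^ 2"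
 have C: "0 < C" using L by (simp add: C_def)
 show ?thesis
  unfolding has_vector_derivative_def has_derivative_at_alt
 proof (intro conjI allI impI)
  show "bounded_linear (\<lambda>h. h *\<^sub>R - laplace_contour g rs (Suc k) u)" by (rule bounded_linear_scaleR_left)
  fix e :: real assume "0 < e"
  show "\<exists>d>0. \<forall>y. norm (y - u) < d --> norm (laplace_contour g rs k y - laplace_contour g rs k u - (y - u) *\<^sub>R - laplace_contour g rs (Suc k) u) <= e * norm (y - u)"
  proof (intro exI[of _ "min 1 (e / C)"] conjI allI impI)
   show "0 < min 1 (e / C)" using C \<open>0 < e\<close> by simp
   fix y assume y: "norm (y - u) < min 1 (e / C)"
   let ?x = "u - y"
   have x: "\<bar>?x\<bar> <= 1" "C * \<bar>?x\<bar> <= e" using y C by (auto simp: field_simps abs_minus_commute)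
   have "norm (laplace_contour g rs k y - laplace_contour g rs k u - (y - u) *\<^sub>R - laplace_contour g rs (Suc k) u) =
    cmod (laplace_contour g rs k (u - ?x) - (\<Sum>m\<le>1. of_real (?x ^ m / fact m) * laplace_contour g rs (k + m) u))"
    by (simp add: scaleR_conv_of_real algebra_simps)
   also have "... <= L * R ^ k * exp (- q * u) * (exp (\<bar>?x\<bar> * R) * (\<bar>?x\<bar> * R) ^ Suc 1)" by (rule taylor)
   also have "... <= L * R ^ k * exp (- q * u) * (exp R * (\<bar>?x\<bar> * R) ^ Suc 1)"
    using L x by (intro mult_left_mono mult_right_mono) (auto simp: mult_left_le_one_le)
   also have "... = (C * \<bar>?x\<bar>) * \<bar>?x\<bar>" by (simp add: C_def power2_eq_square)
   also have "... <= e * \<bar>?x\<bar>" using x by (intro mult_right_mono) auto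
   finally show "norm (laplace_contour g rs k y - laplace_contour g rs k u - (y - u) *\<^sub>R - laplace_contour g rs (Suc k) u) <= e * norm (y - u)"
    by (simp add: abs_minus_commute)
  qed
 qed
qed

text \<open>Cauchy's formula; the sign comes from the pole factor being \<open>1 / (r - z)\<close>,
  not \<open>1 / (z - r)\<close>.\<close>

lemma laplace_contour_single:
 assumes "encloses g q [r]"
 shows "laplace_contour g [r] 0 t = - (2 * of_real pi * \<i>) * exp (- of_real t * of_real r)"
proof -
 have v: "valid_path g" "pathfinish g = pathstart g" using assms by (auto simp: encloses_def ccw_contour_def)
 have "((\<lambda>w. exp (- of_real t * w) / (w - of_real r)) has_contour_integral (complex_of_real (2 * pi) * \<i> * winding_number g (of_real r) * exp (- of_real t * of_real r))) g"
  by (rule Cauchy_integral_formula_convex_simple[of UNIV])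
   (use v encloses_off_path[OF assms] in \<open>auto intro!: holomorphic_intros\<close>)
 then have "((\<lambda>w. - (exp (- of_real t * w) / (w - of_real r))) has_contour_integral - (2 * of_real pi * \<i> * exp (- of_real t * of_real r))) g"
  using encloses_winding[OF assms] by (auto dest: has_contour_integral_neg)
 moreover have "(\<lambda>w. - (exp (- of_real t * w) / (w - of_real r))) = (\<lambda>z. z ^ 0 * exp (- of_real t * z) * pole_product [r] z)"
 proof
  fix w :: complex
  have "1 / (of_real r - w) = - (1 / (w - of_real r))" by (metis minus_diff_eq minus_divide_right)
  then show "- (exp (- of_real t * w) / (w - of_real r)) = w ^ 0 * exp (- of_real t * w) * pole_product [r] w" by simp
 qed
 ultimately have "((\<lambda>z. z ^ 0 * exp (- of_real t * z) * pole_product [r] z) has_contour_integral - (2 * of_real pi * \<i> * exp (- of_real t * of_real r))) g"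
  by simp
 then show ?thesis unfolding laplace_contour_def by (simp add: contour_integral_unique)
qed

text \<open>The factor \<open>r - z\<close> cancels the pole at \<open>r\<close>. Read in
  \<open>t\<close>, this is the first-order linear equation that governs the addition of an
  exponential variable.\<close>

lemma laplace_contour_Cons:
 assumes "encloses g q (r # rs)"
 shows "of_real r * laplace_contour g (r # rs) 0 t - laplace_contour g (r # rs) 1 t = laplace_contour g rs 0 t"
proof -
 obtain L :: real and R where int: "\<And>\<phi> :: complex => complex. \<phi> holomorphic_on UNIV ==> (\<lambda>z. \<phi> z * pole_product (r # rs) z) contour_integrable_on g"
  by (rule contour_bound[OF assms]) blast
 have i: "(\<lambda>z. z ^ m * exp (- of_real t * z) * pole_product (r # rs) z) contour_integrable_on g" for m
  by (rule int) (intro holomorphic_intros)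
 have "of_real r * laplace_contour g (r # rs) 0 t - laplace_contour g (r # rs) 1 t =
  contour_integral g (\<lambda>z. of_real r * (z ^ 0 * exp (- of_real t * z) * pole_product (r # rs) z) - z ^ 1 * exp (- of_real t * z) * pole_product (r # rs) z)"
  unfolding laplace_contour_def
  by (subst contour_integral_diff[OF contour_integrable_lmul[OF i] i]) (simp only: contour_integral_lmul[OF i])
 also have "... = contour_integral g (\<lambda>z. z ^ 0 * exp (- of_real t * z) * pole_product rs z)"
 proof (rule contour_integral_cong[OF refl])
  fix z assume "z \<in> path_image g"
  then have "of_real r - z ~= 0" using encloses_off_path[OF assms, of r] by auto
  then show "of_real r * (z ^ 0 * exp (- of_real t * z) * pole_product (r # rs) z) - z ^ 1 * exp (- of_real t * z) * pole_product (r # rs) z =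
    z ^ 0 * exp (- of_real t * z) * pole_product rs z"
  proof -
   define c where "c = 1 / (of_real r - z)"
   have "of_real r * (z ^ 0 * exp (- of_real t * z) * pole_product (r # rs) z) - z ^ 1 * exp (- of_real t * z) * pole_product (r # rs) z =
    ((of_real r - z) * c) * (exp (- of_real t * z) * pole_product rs z)"
    unfolding pole_product_simps c_def[symmetric] by (simp add: algebra_simps)
   also have "(of_real r - z) * c = 1" using \<open>of_real r - z ~= 0\<close> by (simp add: c_def)
   finally show ?thesis by simp
  qed
 qed
 finally show ?thesis by (simp add: laplace_contour_def)
qed

text \<open>With two poles or more the integrand decays at least like the inverse square of the
  modulus, and by residues the contour can be replaced by any large circle.\<close>

lemma laplace_contour_zero:
 assumes e: "encloses g q rs" and len: "2 <= length rs"
 shows "laplace_contour g rs 0 0 = 0"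
proof -
 have v: "valid_path g" "pathfinish g = pathstart g" using e by (auto simp: encloses_def ccw_contour_def)
 define P where "P = complex_of_real ` set rs"
 define I where "I = contour_integral g (pole_product rs)"
 define m where "m = Max (insert 1 ((\<lambda>r. \<bar>r\<bar>) ` set rs))"
 have m: "1 <= m" "\<And>r. r \<in> set rs ==> \<bar>r\<bar> <= m" by (auto simp: m_def)
 have hol: "pole_product rs holomorphic_on UNIV - P" by (rule holomorphic_pole_product) (auto simp: P_def)
 have fin: "finite P" by (simp add: P_def)
 have res: "I = 2 * of_real pi * \<i> * (\<Sum>p\<in>P. residue (pole_product rs) p)"
 proof -
  have "I = complex_of_real (2 * pi) * \<i> * (\<Sum>p\<in>P. winding_number g p * residue (pole_product rs) p)"
   unfolding I_def by (rule Residue_theorem[OF _ _ fin hol v]) (use encloses_off_path[OF e] in \<open>auto simp: P_def\<close>)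
  also have "(\<Sum>p\<in>P. winding_number g p * residue (pole_product rs) p) = (\<Sum>p\<in>P. residue (pole_product rs) p)"
   using encloses_winding[OF e] by (intro sum.cong refl) (auto simp: P_def)
  finally show ?thesis by simp
 qed
 have circle: "I = contour_integral (circlepath 0 R) (pole_product rs)" if R: "m < R" for R
 proof -
  have sub: "path_image (circlepath 0 R) \<subseteq> UNIV - P"
   using R m by (fastforce simp: P_def)
  have "contour_integral (circlepath 0 R) (pole_product rs) = complex_of_real (2 * pi) * \<i> * (\<Sum>p\<in>P. winding_number (circlepath 0 R) p * residue (pole_product rs) p)"
   by (rule Residue_theorem[OF _ _ fin hol _ _ sub]) auto
  also have "(\<Sum>p\<in>P. winding_number (circlepath 0 R) p * residue (pole_product rs) p) = (\<Sum>p\<in>P. residue (pole_product rs) p)"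
  proof (intro sum.cong refl)
   fix p assume "p \<in> P"
   then obtain r where "r \<in> set rs" "p = of_real r" by (auto simp: P_def)
   then have "cmod (p - 0) < R" using m(2)[of r] R by simp
   then show "winding_number (circlepath 0 R) p * residue (pole_product rs) p = residue (pole_product rs) p"
    by (simp add: winding_number_circlepath)
  qed
  finally show ?thesis by (simp add: res)
 qed
 \<comment> \<open>Beyond \<open>m + 1\<close> the quantity \<open>1 / (R - m)\<close> is below 1,
   so the exponent \<open>length rs\<close> can be lowered to 2.\<close>
 have bound: "cmod I <= 2 * pi * R * (1 / (R - m)) ^ 2" if R: "m + 1 < R" for R
 proof -
  have sub: "path_image (circlepath 0 R) \<subseteq> UNIV - P"
   using R m by (fastforce simp: P_def)
  have "pole_product rs contour_integrable_on circlepath 0 R"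
   by (rule contour_integrable_continuous_circlepath, rule holomorphic_on_imp_continuous_on, rule holomorphic_on_subset[OF hol sub])
  then have "(pole_product rs has_contour_integral I) (circlepath 0 R)"
   using circle[of R] R by (simp add: has_contour_integral_integral)
  then have "cmod I <= (1 / (R - m)) ^ 2 * (2 * pi * R)"
  proof (rule has_contour_integral_bound_circlepath)
   fix x :: complex assume x: "cmod (x - 0) = R"
   have d: "R - m <= cmod (of_real r - x)" if "r \<in> set rs" for r
    using m(2)[OF that] x norm_triangle_ineq2[of x "of_real r"] by (simp add: norm_minus_commute)
   have "cmod (pole_product rs x) <= (1 / (R - m)) ^ length rs"
    by (rule norm_pole_product_le[OF d]) (use R in auto)
   also have "... <= (1 / (R - m)) ^ 2" using R len by (intro power_decreasing) (auto simp: divide_simps)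
   finally show "cmod (pole_product rs x) <= (1 / (R - m)) ^ 2" .
  qed (use R m in auto)
  then show ?thesis by (simp add: mult_ac)
 qed
 have "((\<lambda>R. 2 * pi * R * (1 / (R - m)) ^ 2) \<longlongrightarrow> 0) at_top" by real_asymp
 moreover have "eventually (\<lambda>R. cmod I <= 2 * pi * R * (1 / (R - m)) ^ 2) at_top"
  using eventually_gt_at_top[of "m + 1"] by eventually_elim (rule bound)
 ultimately have "cmod I <= 0" by (rule tendsto_lowerbound) simp
 then show ?thesis by (simp add: I_def laplace_contour_def)
qed

section \<open>Fredholm determinants of finite rank operators\<close>

text \<open>Sylvester's identity: both products of the block matrices \<open>P\<close> and
  \<open>M\<close> are block triangular, with the two sides as their determinants.\<close>

lemma det_one_plus_mult_commute:
 fixes A B :: "'a :: idom mat"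
 assumes A: "A \<in> carrier_mat N r" and B: "B \<in> carrier_mat r N"
 shows "Determinant.det (1\<^sub>m N + A * B) = Determinant.det (1\<^sub>m r + B * A)"
proof -
 define P where "P = four_block_mat (1\<^sub>m N) A (0\<^sub>m r N) (1\<^sub>m r)"
 define M where "M = four_block_mat (1\<^sub>m N) (- A) B (1\<^sub>m r)"
 have car: "P \<in> carrier_mat (N + r) (N + r)" "M \<in> carrier_mat (N + r) (N + r)"
  using A B by (auto simp: P_def M_def)
 have AB: "A * B \<in> carrier_mat N N" and BA: "B * A \<in> carrier_mat r r" using A B by auto
 have detP: "Determinant.det P = 1"
  unfolding P_def by (subst det_four_block_mat_lower_left_zero[of _ N _ r]) (use A in auto)
 have "P * M = four_block_mat (1\<^sub>m N * 1\<^sub>m N + A * B) (1\<^sub>m N * (- A) + A * 1\<^sub>m r) (0\<^sub>m r N * 1\<^sub>m N + 1\<^sub>m r * B) (0\<^sub>m r N * (- A) + 1\<^sub>m r * 1\<^sub>m r)"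
  unfolding P_def M_def by (rule mult_four_block_mat) (use A B in auto)
 also have "... = four_block_mat (1\<^sub>m N + A * B) (0\<^sub>m N r) B (1\<^sub>m r)"
 proof -
  have "- A + A = 0\<^sub>m N r" using A by (intro eq_matI) auto
  moreover have "0\<^sub>m r N * (- A) + 1\<^sub>m r = 1\<^sub>m r" using A by (intro eq_matI) (auto simp: scalar_prod_def)
  ultimately show ?thesis using A B AB by simp
 qed
 finally have PM: "Determinant.det (P * M) = Determinant.det (1\<^sub>m N + A * B)"
  by (simp only:) (subst det_four_block_mat_upper_right_zero[of _ N _ r], use A B AB in auto)
 have "M * P = four_block_mat (1\<^sub>m N * 1\<^sub>m N + - A * 0\<^sub>m r N) (1\<^sub>m N * A + - A * 1\<^sub>m r) (B * 1\<^sub>m N + 1\<^sub>m r * 0\<^sub>m r N) (B * A + 1\<^sub>m r * 1\<^sub>m r)"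
  unfolding P_def M_def by (rule mult_four_block_mat) (use A B in auto)
 also have "... = four_block_mat (1\<^sub>m N) (0\<^sub>m N r) B (1\<^sub>m r + B * A)"
 proof -
  have "A + - A = 0\<^sub>m N r" using A by (intro eq_matI) auto
  moreover have "1\<^sub>m N + - A * 0\<^sub>m r N = 1\<^sub>m N" using A by (intro eq_matI) (auto simp: scalar_prod_def)
  moreover have "B * A + 1\<^sub>m r = 1\<^sub>m r + B * A" using BA by (intro comm_add_mat[of _ r r]) auto
  ultimately show ?thesis using A B BA by simp
 qed
 finally have MP: "Determinant.det (M * P) = Determinant.det (1\<^sub>m r + B * A)"
  by (simp only:) (subst det_four_block_mat_upper_right_zero[of _ N _ r], use A B BA in auto)
 have "Determinant.det (P * M) = Determinant.det (M * P)"
  by (simp add: det_mult[OF car] det_mult[OF car(2,1)])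
 then show ?thesis using PM MP by simp
qed

lemma det_mat_Leibniz:
 "Determinant.det (Matrix.mat n n (\<lambda>(i, j). a i j)) = (\<Sum>p | p permutes {..<n}. signof p * (\<Prod>i<n. a i (p i)))"
proof -
 have "Determinant.det (Matrix.mat n n (\<lambda>(i, j). a i j)) =
  (\<Sum>p | p permutes {0..<n}. signof p * (\<Prod>i = 0..<n. Matrix.mat n n (\<lambda>(i, j). a i j) $$ (i, p i)))"
  by (rule det_def') simp
 also have "... = (\<Sum>p | p permutes {0..<n}. signof p * (\<Prod>i = 0..<n. a i (p i)))"
 proof (intro sum.cong refl arg_cong2[where f = "(*)"] prod.cong)
  fix p i assume "p \<in> {p. p permutes {0..<n}}" "i \<in> {0..<n}"
  then have "i < n" "p i < n" using permutes_in_image[of p "{0..<n}" i] by auto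
  then show "Matrix.mat n n (\<lambda>(i, j). a i j) $$ (i, p i) = a i (p i)" by simp
 qed
 finally show ?thesis by (simp add: lessThan_atLeast0)
qed

lemma tendsto_det_mat:
 fixes a :: "'b => nat => nat => complex"
 assumes "\<And>i j. i < n ==> j < n ==> ((\<lambda>m. a m i j) \<longlongrightarrow> b i j) F"
 shows "((\<lambda>m. Determinant.det (Matrix.mat n n (\<lambda>(i, j). a m i j))) \<longlongrightarrow> Determinant.det (Matrix.mat n n (\<lambda>(i, j). b i j))) F"
 unfolding det_mat_Leibniz
proof (intro tendsto_sum tendsto_mult tendsto_const tendsto_prod)
 fix p i assume "p \<in> {p. p permutes {..<n}}" "i \<in> {..<n}"
 then have "i < n" "p i < n" using permutes_in_image[of p "{..<n}" i] by auto
 then show "((\<lambda>m. a m i (p i)) \<longlongrightarrow> b i (p i)) F" by (rule assms)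
qed

section \<open>The inner product on square-integrable functions\<close>

lemma measurable_cnj [measurable]: "cnj \<in> borel_measurable borel"
 by (intro borel_measurable_continuous_onI continuous_intros)

lemma L2_integrable_mult:
 assumes "g \<in> L2" "h \<in> L2"
 shows "integrable half_line (\<lambda>x. cmod (g x) * cmod (h x))" "integrable half_line (\<lambda>x. cnj (g x) * h x)"
proof -
 have [measurable]: "g \<in> borel_measurable half_line" "h \<in> borel_measurable half_line" using assms by (auto simp: L2_def)
 have i: "integrable half_line (\<lambda>x. (cmod (g x))\<^sup>2 + (cmod (h x))\<^sup>2)"
  using assms by (intro Bochner_Integration.integrable_add) (auto simp: L2_def)
 have le: "cmod (g x) * cmod (h x) <= (cmod (g x))\<^sup>2 + (cmod (h x))\<^sup>2" for x
 proof -
  have "0 <= (cmod (g x) - cmod (h x))\<^sup>2" by simp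
  then have "2 * (cmod (g x) * cmod (h x)) <= (cmod (g x))\<^sup>2 + (cmod (h x))\<^sup>2" by (simp add: power2_diff)
  moreover have "0 <= cmod (g x) * cmod (h x)" by simp
  ultimately show ?thesis by linarith
 qed
 show "integrable half_line (\<lambda>x. cmod (g x) * cmod (h x))"
  by (rule Bochner_Integration.integrable_bound[OF i]) (use le in auto)
 show "integrable half_line (\<lambda>x. cnj (g x) * h x)"
  by (rule Bochner_Integration.integrable_bound[OF i]) (use le in \<open>auto simp: norm_mult\<close>)
qed

lemma L2_add: assumes "g \<in> L2" "h \<in> L2" shows "(\<lambda>x. g x + h x) \<in> L2"
proof -
 have [measurable]: "g \<in> borel_measurable half_line" "h \<in> borel_measurable half_line" using assms by (auto simp: L2_def)
 have i: "integrable half_line (\<lambda>x. 2 * ((cmod (g x))\<^sup>2 + (cmod (h x))\<^sup>2))"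
  using assms by (intro integrable_mult_right Bochner_Integration.integrable_add) (auto simp: L2_def)
 have "(cmod (g x + h x))\<^sup>2 <= 2 * ((cmod (g x))\<^sup>2 + (cmod (h x))\<^sup>2)" for x
 proof -
  have "(cmod (g x + h x))\<^sup>2 <= (cmod (g x) + cmod (h x))\<^sup>2" by (intro power_mono norm_triangle_ineq) auto
  also have "... <= 2 * ((cmod (g x))\<^sup>2 + (cmod (h x))\<^sup>2)"
   using zero_le_power2[of "cmod (g x) - cmod (h x)"] by (simp add: power2_sum power2_diff)
  finally show ?thesis .
 qed
 then have "integrable half_line (\<lambda>x. (cmod (g x + h x))\<^sup>2)"
  by (intro Bochner_Integration.integrable_bound[OF i]) auto
 then show ?thesis by (simp add: L2_def)
qed

lemma L2_scale: assumes "h \<in> L2" shows "(\<lambda>x. c * h x) \<in> L2"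
 using assms by (auto simp: L2_def norm_mult power_mult_distrib)

lemma L2_zero: "(\<lambda>x. 0) \<in> L2" by (simp add: L2_def)

lemma L2_sum: "finite I ==> (\<And>i. i \<in> I ==> f i \<in> L2) ==> (\<lambda>x. \<Sum>i\<in>I. f i x) \<in> L2"
 by (induction I rule: finite_induct) (auto simp: L2_zero intro: L2_add)

lemma L2_inner_add_right: "g \<in> L2 ==> h \<in> L2 ==> k \<in> L2 ==> L2_inner g (\<lambda>x. h x + k x) = L2_inner g h + L2_inner g k"
 unfolding L2_inner_def by (subst Bochner_Integration.integral_add[symmetric]) (auto simp: L2_integrable_mult distrib_left)

lemma L2_inner_scale_right: "L2_inner g (\<lambda>x. c * h x) = c * L2_inner g h"
 unfolding L2_inner_def by (subst integral_mult_right_zero[symmetric]) (simp add: mult_ac)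

lemma L2_inner_zero_right: "L2_inner g (\<lambda>x. 0) = 0" by (simp add: L2_inner_def)

lemma L2_inner_sum_right:
 "finite I ==> g \<in> L2 ==> (\<And>i. i \<in> I ==> f i \<in> L2) ==> L2_inner g (\<lambda>x. \<Sum>i\<in>I. f i x) = (\<Sum>i\<in>I. L2_inner g (f i))"
 by (induction I rule: finite_induct) (auto simp: L2_inner_zero_right L2_inner_add_right L2_sum)

lemma L2_norm_power2: "(L2_norm h)\<^sup>2 = (\<integral>x. (cmod (h x))\<^sup>2 \<partial>half_line)"
 by (simp add: L2_norm_def)

text \<open>The arithmetic-geometric mean inequality with a free weight \<open>t\<close>, chosen
  optimally if both norms are positive and extreme if one of them is 0.\<close>

lemma L2_Cauchy_Schwarz:
 assumes g: "g \<in> L2" and h: "h \<in> L2"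
 shows "cmod (L2_inner g h) <= L2_norm g * L2_norm h"
proof -
 let ?c = "cmod (L2_inner g h)" and ?A = "L2_norm g" and ?B = "L2_norm h"
 have AB: "0 <= ?A" "0 <= ?B" by (simp_all add: L2_norm_def)
 have ig: "integrable half_line (\<lambda>x. (cmod (g x))\<^sup>2)" and ih: "integrable half_line (\<lambda>x. (cmod (h x))\<^sup>2)"
  using g h by (auto simp: L2_def)
 have key: "2 * ?c <= t * ?A\<^sup>2 + ?B\<^sup>2 / t" if t: "0 < t" for t
 proof -
  have pt: "2 * (cmod (g x) * cmod (h x)) <= t * (cmod (g x))\<^sup>2 + (cmod (h x))\<^sup>2 / t" for x
  proof -
   have "0 <= (t * cmod (g x) - cmod (h x))\<^sup>2 / t" using t by simp
   also have "... = t * (cmod (g x))\<^sup>2 + (cmod (h x))\<^sup>2 / t - 2 * (cmod (g x) * cmod (h x))"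
    using t by (simp add: power2_eq_square field_simps)
   finally show ?thesis by simp
  qed
  have "?c <= (\<integral>x. cmod (cnj (g x) * h x) \<partial>half_line)" unfolding L2_inner_def by (rule integral_norm_bound)
  then have "2 * ?c <= (\<integral>x. 2 * (cmod (g x) * cmod (h x)) \<partial>half_line)" by (simp add: norm_mult)
  also have "... <= (\<integral>x. t * (cmod (g x))\<^sup>2 + (cmod (h x))\<^sup>2 / t \<partial>half_line)"
   by (rule integral_mono) (use L2_integrable_mult[OF g h] ig ih pt in auto)
  also have "... = t * ?A\<^sup>2 + ?B\<^sup>2 / t"
   unfolding L2_norm_power2 using ig ih by (subst Bochner_Integration.integral_add) auto
  finally show ?thesis .
 qed
 show ?thesis
 proof (cases "0 < ?A \<and> 0 < ?B")
  case True
  then have "2 * ?c <= ?B / ?A * ?A\<^sup>2 + ?B\<^sup>2 / (?B / ?A)" by (intro key) auto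
  also have "... = 2 * (?A * ?B)" using True by (simp add: power2_eq_square)
  finally show ?thesis by simp
 next
  case False
  have "?c <= e" if e: "0 < e" for e
  proof (cases "?A = 0")
   case True
   have "2 * ?c <= ?B\<^sup>2 / ((?B\<^sup>2 + 1) / e)" using key[of "(?B\<^sup>2 + 1) / e"] e True by (simp add: add_nonneg_pos)
   also have "... <= e" using e by (simp add: divide_simps add_nonneg_pos)
   finally show ?thesis using norm_ge_zero[of "L2_inner g h"] by linarith
  next
   case A: False
   then have "?B = 0" using False AB by auto
   then have "2 * ?c <= e / (?A\<^sup>2 + 1) * ?A\<^sup>2" using key[of "e / (?A\<^sup>2 + 1)"] e by (simp add: add_nonneg_pos)
   also have "... <= e" using e by (simp add: divide_simps add_nonneg_pos)
   finally show ?thesis using norm_ge_zero[of "L2_inner g h"] by linarith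
  qed
  then have "?c <= 0" by (rule field_le_epsilon[where y = 0, simplified])
  then show ?thesis using AB by (meson mult_nonneg_nonneg order_trans)
 qed
qed

text \<open>The remainder of the expansion of \<open>h\<close> tends to 0 in norm, and pairing with
  \<open>g\<close> is continuous.\<close>

lemma L2_Parseval:
 assumes e: "orthonormal_basis e" and g: "g \<in> L2" and h: "h \<in> L2"
 shows "(\<lambda>N. \<Sum>i<N. L2_inner g (e i) * L2_inner (e i) h) \<longlonglongrightarrow> L2_inner g h"
proof -
 have eL: "e i \<in> L2" for i using e by (auto simp: orthonormal_basis_def)
 define r where "r N x = h x - (\<Sum>i<N. L2_inner (e i) h * e i x)" for N x
 have rN: "r N = (\<lambda>x. h x + (\<Sum>i<N. (- L2_inner (e i) h) * e i x))" for N by (simp add: r_def sum_negf fun_eq_iff)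
 have sL: "(\<lambda>x. \<Sum>i<N. (- L2_inner (e i) h) * e i x) \<in> L2" for N by (intro L2_sum L2_scale eL) auto
 have rL: "r N \<in> L2" for N unfolding rN by (rule L2_add[OF h sL])
 have lim: "(\<lambda>N. L2_norm (r N)) \<longlonglongrightarrow> 0" using e h by (auto simp: orthonormal_basis_def r_def[abs_def])
 have inner: "L2_inner g (r N) = L2_inner g h - (\<Sum>i<N. L2_inner g (e i) * L2_inner (e i) h)" for N
 proof -
  have "L2_inner g (r N) = L2_inner g h + (\<Sum>i<N. L2_inner g (\<lambda>x. (- L2_inner (e i) h) * e i x))"
   unfolding rN by (subst L2_inner_add_right[OF g h sL]) (simp only: L2_inner_sum_right[OF finite_lessThan g L2_scale[OF eL]])
  then show ?thesis by (simp only: L2_inner_scale_right) (simp add: sum_negf mult.commute)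
 qed
 have "(\<lambda>N. L2_inner g (r N)) \<longlonglongrightarrow> 0"
 proof (rule Lim_null_comparison)
  show "\<forall>\<^sub>F N in sequentially. norm (L2_inner g (r N)) <= L2_norm g * L2_norm (r N)"
   using L2_Cauchy_Schwarz[OF g rL] by auto
  show "(\<lambda>N. L2_norm g * L2_norm (r N)) \<longlonglongrightarrow> 0" using tendsto_mult_right_zero[OF lim] by simp
 qed
 then have "(\<lambda>N. L2_inner g h - L2_inner g (r N)) \<longlonglongrightarrow> L2_inner g h - 0" by (intro tendsto_intros)
 then show ?thesis by (simp add: inner)
qed

text \<open>The leading \<open>N\<close> by \<open>N\<close> matrix is the identity plus a product
  through dimension \<open>r\<close>. Exchanging the factors gives a determinant of fixed size
  \<open>r\<close>, whose entries converge by Parseval.\<close>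

lemma finite_rank_fredholm_det:
 fixes u v :: "nat => real => complex"
 assumes u: "\<And>b. b < r ==> u b \<in> L2" and v: "\<And>b. b < r ==> v b \<in> L2"
  and T: "\<And>h x. h \<in> L2 ==> T h x = h x + (\<Sum>b<r. L2_inner (v b) h * u b x)"
 shows "has_fredholm_det T (Determinant.det (Matrix.mat r r (\<lambda>(b, c). (if b = c then 1 else 0) + L2_inner (v b) (u c))))"
 unfolding has_fredholm_det_def
proof (intro conjI allI impI)
 \<comment> \<open>The definition of trace class asks for an infinite series, so the finite sum is
   padded with zeros.\<close>
 define u' where "u' k = (if k < r then u k else (\<lambda>_. 0))" for k
 define v' where "v' k = (if k < r then v k else (\<lambda>_. 0))" for k
 have n0: "L2_norm (\<lambda>x. 0) = 0" by (simp add: L2_norm_def)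
 have eqs: "(\<Sum>k<N. L2_inner (v' k) h * u' k x) = (\<Sum>b<r. L2_inner (v b) h * u b x)" if "r <= N" for N h x
 proof -
  have "(\<Sum>k<N. L2_inner (v' k) h * u' k x) = (\<Sum>k<r. L2_inner (v' k) h * u' k x)"
   using that by (intro sum.mono_neutral_right) (auto simp: u'_def)
  then show ?thesis by (simp add: u'_def v'_def)
 qed
 show "trace_class (\<lambda>h x. T h x - h x)"
 proof -
  have uv: "u' k \<in> L2" "v' k \<in> L2" for k using u v by (auto simp: u'_def v'_def L2_zero)
  have s: "summable (\<lambda>k. L2_norm (u' k) * L2_norm (v' k))"
   by (rule summable_finite[of "{..<r}"]) (auto simp: u'_def n0)
  have A: "(\<lambda>x. T h x - h x) \<in> L2" if h: "h \<in> L2" for h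
  proof -
   have "(\<lambda>x. T h x - h x) = (\<lambda>x. \<Sum>b<r. L2_inner (v b) h * u b x)" by (simp add: T[OF h])
   moreover have "(\<lambda>x. \<Sum>b<r. L2_inner (v b) h * u b x) \<in> L2" by (intro L2_sum L2_scale u) auto
   ultimately show ?thesis by simp
  qed
  have lim: "(\<lambda>N. L2_norm (\<lambda>x. T h x - h x - (\<Sum>k<N. L2_inner (v' k) h * u' k x))) \<longlonglongrightarrow> 0" if h: "h \<in> L2" for h
  proof (rule tendsto_eventually)
   show "eventually (\<lambda>N. L2_norm (\<lambda>x. T h x - h x - (\<Sum>k<N. L2_inner (v' k) h * u' k x)) = 0) sequentially"
    using eventually_ge_at_top[of r] by eventually_elim (simp add: eqs T[OF h] n0)
  qed
  show ?thesis unfolding trace_class_def by (intro exI[of _ u'] exI[of _ v'] conjI allI ballI uv s A lim)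
 qed
 fix e assume e: "orthonormal_basis e"
 have eL: "e i \<in> L2" and orth: "L2_inner (e i) (e j) = (if i = j then 1 else 0)" for i j
  using e by (auto simp: orthonormal_basis_def)
 have inner: "L2_inner (e i) (T (e j)) = (if i = j then 1 else 0) + (\<Sum>b<r. L2_inner (e i) (u b) * L2_inner (v b) (e j))" for i j
 proof -
  have "T (e j) = (\<lambda>x. e j x + (\<Sum>b<r. L2_inner (v b) (e j) * u b x))" by (simp add: T[OF eL] fun_eq_iff)
  moreover have "(\<lambda>x. \<Sum>b<r. L2_inner (v b) (e j) * u b x) \<in> L2" by (intro L2_sum L2_scale u) auto
  ultimately have "L2_inner (e i) (T (e j)) = L2_inner (e i) (e j) + L2_inner (e i) (\<lambda>x. \<Sum>b<r. L2_inner (v b) (e j) * u b x)"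
   by (simp only: L2_inner_add_right[OF eL eL])
  also have "L2_inner (e i) (\<lambda>x. \<Sum>b<r. L2_inner (v b) (e j) * u b x) = (\<Sum>b<r. L2_inner (e i) (\<lambda>x. L2_inner (v b) (e j) * u b x))"
   by (rule L2_inner_sum_right) (auto intro: L2_scale u eL)
  also have "... = (\<Sum>b<r. L2_inner (e i) (u b) * L2_inner (v b) (e j))"
   unfolding L2_inner_scale_right by (simp only: mult.commute)
  finally show ?thesis by (simp only: orth)
 qed
 have det: "(\<Sum>s | s permutes {..<N}. of_int (sign s) * (\<Prod>i<N. L2_inner (e i) (T (e (s i))))) =
   Determinant.det (Matrix.mat r r (\<lambda>(b, c). (if b = c then 1 else 0) + (\<Sum>i<N. L2_inner (v b) (e i) * L2_inner (e i) (u c))))" for N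
 proof -
  define A where "A = Matrix.mat N r (\<lambda>(i, b). L2_inner (e i) (u b))"
  define B where "B = Matrix.mat r N (\<lambda>(b, j). L2_inner (v b) (e j))"
  have "(\<Sum>s | s permutes {..<N}. of_int (sign s) * (\<Prod>i<N. L2_inner (e i) (T (e (s i))))) =
   Determinant.det (Matrix.mat N N (\<lambda>(i, j). L2_inner (e i) (T (e j))))" by (simp add: det_mat_Leibniz)
  also have "Matrix.mat N N (\<lambda>(i, j). L2_inner (e i) (T (e j))) = 1\<^sub>m N + A * B"
   by (rule eq_matI) (auto simp: A_def B_def inner scalar_prod_def lessThan_atLeast0)
  also have "Determinant.det (1\<^sub>m N + A * B) = Determinant.det (1\<^sub>m r + B * A)"
   by (rule det_one_plus_mult_commute) (auto simp: A_def B_def)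
  also have "1\<^sub>m r + B * A = Matrix.mat r r (\<lambda>(b, c). (if b = c then 1 else 0) + (\<Sum>i<N. L2_inner (v b) (e i) * L2_inner (e i) (u c)))"
   by (rule eq_matI) (auto simp: A_def B_def scalar_prod_def lessThan_atLeast0)
  finally show ?thesis .
 qed
 show "(\<lambda>N. \<Sum>s | s permutes {..<N}. of_int (sign s) * (\<Prod>i<N. L2_inner (e i) (T (e (s i))))) \<longlonglongrightarrow>
   Determinant.det (Matrix.mat r r (\<lambda>(b, c). (if b = c then 1 else 0) + L2_inner (v b) (u c)))"
  unfolding det by (intro tendsto_det_mat tendsto_add tendsto_const L2_Parseval e v u)
qed

section \<open>Bounded Borel functions as Baire functions\<close>

text \<open>The expectation formula is not linear in \<open>f\<close>, so the functions satisfying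
  it need not form a vector space. This class is generated by bounded pointwise limits alone, under
  which the formula is preserved.\<close>

inductive baire :: "(real => real) => bool" where
 baire_cont: "continuous_on UNIV g ==> (\<And>x. \<bar>g x\<bar> <= B) ==> baire g"
| baire_lim: "(\<And>k. baire (F k)) ==> (\<And>k x. \<bar>F k x\<bar> <= B) ==> (\<And>x. (\<lambda>k :: nat. F k x) \<longlonglongrightarrow> f x) ==> baire f"

lemma baire_bounded: "baire f ==> \<exists>B. \<forall>x. \<bar>f x\<bar> <= B"
proof (induction rule: baire.induct)
 case (baire_lim F B f)
 have "\<bar>f x\<bar> <= B" for x
  by (rule LIMSEQ_le_const2[OF tendsto_rabs[OF baire_lim.hyps(3)]]) (use baire_lim.hyps(2) in auto)
 then show ?case by blast
qed blast

lemma baire_measurable: "baire f ==> f \<in> borel_measurable borel"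
proof (induction rule: baire.induct)
 case (baire_lim F B f)
 show ?case by (rule borel_measurable_LIMSEQ_real[OF baire_lim.hyps(3) baire_lim.IH])
qed (rule borel_measurable_continuous_onI)

text \<open>One induction per argument: the inner one fixes a continuous first function, the outer
  one passes to limits in it. Compactness bounds \<open>h\<close> on the ranges that occur.\<close>

lemma baire_combine:
 fixes h :: "real => real => real"
 assumes h: "continuous_on UNIV (\<lambda>z. h (fst z) (snd z))" and f: "baire f" and g: "baire g"
 shows "baire (\<lambda>x. h (f x) (g x))"
proof -
 have bd: "\<exists>C. \<forall>x y. \<bar>x\<bar> <= A --> \<bar>y\<bar> <= B --> \<bar>h x y\<bar> <= C" for A B
 proof -
  have "compact ((\<lambda>z. h (fst z) (snd z)) ` (cball 0 A \<times> cball 0 B))"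
   by (intro compact_continuous_image compact_Times compact_cball continuous_on_subset[OF h]) simp
  then have "bounded ((\<lambda>z. h (fst z) (snd z)) ` (cball 0 A \<times> cball 0 B))" by (rule compact_imp_bounded)
  then obtain C where C: "\<forall>v\<in>(\<lambda>z. h (fst z) (snd z)) ` (cball 0 A \<times> cball 0 B). norm v <= C"
   unfolding bounded_iff by (rule exE)
  have "\<bar>h x y\<bar> <= C" if "\<bar>x\<bar> <= A" "\<bar>y\<bar> <= B" for x y
  proof -
   have "(x, y) \<in> cball 0 A \<times> cball 0 B" using that by (simp add: dist_real_def)
   then show ?thesis using bspec[OF C imageI, of "(x, y)"] by simp
  qed
  then show ?thesis by blast
 qed
 have lim: "(\<lambda>k. h (u k) (v k)) \<longlonglongrightarrow> h a b" if "u \<longlonglongrightarrow> a" "v \<longlonglongrightarrow> b" for u v :: "nat => real" and a b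
  using continuous_on_tendsto_compose[OF h tendsto_Pair[OF that]] by simp
 have 1: "baire (\<lambda>x. h (f x) (g x))" if f: "continuous_on UNIV f" "\<And>x. \<bar>f x\<bar> <= A" and "baire g" for f A g
  using \<open>baire g\<close>
 proof (induction rule: baire.induct)
  case (baire_cont g B)
  obtain C where C: "\<And>x y. \<bar>x\<bar> <= A ==> \<bar>y\<bar> <= B ==> \<bar>h x y\<bar> <= C" using bd by blast
  show ?case
  proof (rule baire.baire_cont)
   show "continuous_on UNIV (\<lambda>x. h (f x) (g x))"
    using continuous_on_compose2[OF h continuous_on_Pair[OF f(1) baire_cont(1)]] by simp
   show "\<bar>h (f x) (g x)\<bar> <= C" for x by (rule C[OF f(2) baire_cont(2)])
  qed
 next
  case (baire_lim F B g)
  obtain C where C: "\<And>x y. \<bar>x\<bar> <= A ==> \<bar>y\<bar> <= B ==> \<bar>h x y\<bar> <= C" using bd by blast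
  show ?case
  proof (rule baire.baire_lim[OF baire_lim.IH])
   show "\<bar>h (f x) (F k x)\<bar> <= C" for k x by (rule C[OF f(2) baire_lim.hyps(2)])
   show "(\<lambda>k. h (f x) (F k x)) \<longlonglongrightarrow> h (f x) (g x)" for x by (rule lim[OF tendsto_const baire_lim.hyps(3)])
  qed
 qed
 show ?thesis
  using f
 proof (induction rule: baire.induct)
  case (baire_cont f A)
  then show ?case using 1 g by blast
 next
  case (baire_lim F A f)
  obtain B where B: "\<And>x. \<bar>g x\<bar> <= B" using baire_bounded[OF g] by blast
  obtain C where C: "\<And>x y. \<bar>x\<bar> <= A ==> \<bar>y\<bar> <= B ==> \<bar>h x y\<bar> <= C" using bd by blast
  show ?case
  proof (rule baire.baire_lim[OF baire_lim.IH])
   show "\<bar>h (F k x) (g x)\<bar> <= C" for k x by (rule C[OF baire_lim.hyps(2) B])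
   show "(\<lambda>k. h (F k x) (g x)) \<longlonglongrightarrow> h (f x) (g x)" for x by (rule lim[OF baire_lim.hyps(3) tendsto_const])
  qed
 qed
qed

lemma baire_const: "baire (\<lambda>x. c)"
 by (rule baire_cont[of _ "\<bar>c\<bar>"]) auto

lemma baire_sum:
 assumes "finite I" "\<And>i. i \<in> I ==> baire (g i)"
 shows "baire (\<lambda>x. \<Sum>i\<in>I. c i * g i x)"
 using assms
proof (induction I rule: finite_induct)
 case (insert j I)
 have "baire (\<lambda>x. c j * g j x + (\<Sum>i\<in>I. c i * g i x))"
 proof (rule baire_combine[where h = "\<lambda>a b. c j * a + b"])
  show "continuous_on UNIV (\<lambda>z :: real \<times> real. c j * fst z + snd z)" by (intro continuous_intros)
 qed (use insert in auto)
 then show ?case using insert.hyps by simp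
qed (simp add: baire_const)

text \<open>Open sets are limits of truncated multiples of the distance to the complement;
  complements and countable unions follow with differences, maxima and a limit.\<close>

lemma baire_indicator:
 assumes "A \<in> sets borel"
 shows "baire (indicator A)"
proof -
 have "A \<in> sigma_sets UNIV {S. open S}" using assms by (simp add: borel_def)
 then show ?thesis
 proof (induction rule: sigma_sets.induct)
  case (Basic U)
  then have U: "open U" by simp
  show ?case
  proof (cases "U = UNIV")
   \<comment> \<open>\<open>infdist\<close> to the empty set is 0, which is why the whole space is
     treated apart.\<close>
   case False
   then have ne: "- U ~= {}" by auto
   show ?thesis
   proof (rule baire_lim)
    show "baire (\<lambda>x. min 1 (real k * infdist x (- U)))" for k
     by (rule baire_cont[of _ 1]) (auto intro!: continuous_intros simp: infdist_nonneg)
    show "\<bar>min 1 (real k * infdist x (- U))\<bar> <= 1" for k x by (simp add: infdist_nonneg)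
    show "(\<lambda>k. min 1 (real k * infdist x (- U))) \<longlonglongrightarrow> indicator U x" for x
    proof (cases "x \<in> U")
     case True
     then have p: "0 < infdist x (- U)" using U ne by (intro infdist_pos_not_in_closed) auto
     obtain K where K: "1 < real K * infdist x (- U)" using reals_Archimedean3[OF p] by blast
     have "min 1 (real k * infdist x (- U)) = 1" if "K <= k" for k
      using K mult_right_mono[of "real K" "real k" "infdist x (- U)"] that p by linarith
     then have "eventually (\<lambda>k. min 1 (real k * infdist x (- U)) = 1) sequentially" by (auto simp: eventually_sequentially)
     then show ?thesis using True by (simp add: tendsto_eventually)
    qed simp
   qed
  qed (simp add: baire_const)
 next
  case Empty
  then show ?case by (simp add: baire_const)
 next
  case (Compl A)
  have c: "continuous_on UNIV (\<lambda>z :: real \<times> real. fst z - snd z)" by (intro continuous_intros)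
  have "baire (\<lambda>x. 1 - indicator A x)"
   by (rule baire_combine[where h = "\<lambda>a b. a - b", OF c baire_const Compl.IH])
  moreover have "indicator (UNIV - A) = (\<lambda>x. 1 - indicator A x :: real)" by (auto simp: indicator_def)
  ultimately show ?case by simp
 next
  case (Union A)
  have c: "continuous_on UNIV (\<lambda>z :: real \<times> real. max (fst z) (snd z))" by (intro continuous_intros)
  have b: "baire (indicator (\<Union>i<k. A i))" for k
  proof (induction k)
   case (Suc k)
   have "baire (\<lambda>x. max (indicator (A k) x) (indicator (\<Union>i<k. A i) x))"
    by (rule baire_combine[where h = max, OF c Union.IH Suc.IH])
   moreover have "indicator (\<Union>i<Suc k. A i) = (\<lambda>x. max (indicator (A k) x) (indicator (\<Union>i<k. A i) x) :: real)"
    by (auto simp: indicator_def lessThan_Suc fun_eq_iff)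
   ultimately show ?case by simp
  qed (simp add: baire_const)
  show ?case
  proof (rule baire_lim[OF b, where B = 1])
   show "(\<lambda>k. indicator (\<Union>i<k. A i) x) \<longlonglongrightarrow> (indicator (\<Union>i. A i) x :: real)" for x by (rule LIMSEQ_indicator_UN)
  qed (simp add: indicator_def)
 qed
qed

lemma baire_borel:
 fixes f :: "real => real"
 assumes f: "f \<in> borel_measurable borel" and B: "\<And>x. \<bar>f x\<bar> <= B"
 shows "baire f"
proof -
 obtain F where F: "\<And>i. simple_function borel (F i)" "\<And>x. (\<lambda>i. F i x) \<longlonglongrightarrow> f x" "\<And>i x. dist (F i x) 0 <= 2 * dist (f x) 0"
  using borel_measurable_implies_sequence_metric[OF f, of 0] by auto
 show ?thesis
 proof (rule baire_lim[OF _ _ F(2)])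
  show "\<bar>F i x\<bar> <= 2 * B" for i x using F(3)[of i x] B[of x] by (simp add: dist_real_def)
  fix i
  have fin: "finite (range (F i))" using simple_functionD(1)[OF F(1)[of i]] by simp
  have s: "F i -` {y} \<in> sets borel" for y
   using measurable_sets[OF borel_measurable_simple_function[OF F(1)[of i]], of "{y}"] by simp
  have eq: "F i = (\<lambda>x. \<Sum>y\<in>range (F i). y * indicator (F i -` {y}) x)"
  proof
   fix x
   have "(\<Sum>y\<in>range (F i). y * indicator (F i -` {y}) x) = (\<Sum>y\<in>range (F i). if y = F i x then y else 0)"
    by (intro sum.cong) (auto simp: indicator_def)
   then show "F i x = (\<Sum>y\<in>range (F i). y * indicator (F i -` {y}) x)" using fin by simp
  qed
  have "baire (\<lambda>x. \<Sum>y\<in>range (F i). y * indicator (F i -` {y}) x)"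
   by (rule baire_sum[where c = "\<lambda>y. y" and g = "\<lambda>y. indicator (F i -` {y})", OF fin baire_indicator[OF s]])
  then show "baire (F i)" by (rule iffD2[OF arg_cong[OF eq, of baire]])
 qed
qed

section \<open>Determinants of polynomials and small initial spectra\<close>

text \<open>The matrix of values is the Vandermonde matrix times the coefficient matrix, which the
  degree bounds make triangular.\<close>

lemma det_poly_columns:
 fixes P :: "nat => complex poly"
 assumes deg: "\<And>a. a < n ==> degree (P a) <= a"
 shows "Determinant.det (Matrix.mat n n (\<lambda>(b, a). poly (P a) (x b))) =
  Determinant.det (Matrix.mat n n (\<lambda>(b, a). x b ^ a)) * (\<Prod>a<n. coeff (P a) a)"
proof -
 define V where "V = Matrix.mat n n (\<lambda>(b, a). x b ^ a)"
 define C where "C = Matrix.mat n n (\<lambda>(m, a). coeff (P a) m)"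
 have "Matrix.mat n n (\<lambda>(b, a). poly (P a) (x b)) = V * C"
 proof (rule eq_matI)
  fix b a assume "b < dim_row (V * C)" "a < dim_col (V * C)"
  then have ba: "b < n" "a < n" by (auto simp: V_def C_def)
  have "poly (P a) (x b) = (\<Sum>i\<le>degree (P a). coeff (P a) i * x b ^ i)" by (rule poly_altdef)
  also have "... = (\<Sum>i<n. coeff (P a) i * x b ^ i)"
   using deg[OF ba(2)] ba by (intro sum.mono_neutral_left) (auto simp: coeff_eq_0)
  finally show "Matrix.mat n n (\<lambda>(b, a). poly (P a) (x b)) $$ (b, a) = (V * C) $$ (b, a)"
   using ba by (simp add: V_def C_def scalar_prod_def lessThan_atLeast0 mult.commute)
 qed (auto simp: V_def C_def)
 then have "Determinant.det (Matrix.mat n n (\<lambda>(b, a). poly (P a) (x b))) = Determinant.det V * Determinant.det C"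
  by (simp only:) (rule det_mult[of _ n], auto simp: V_def C_def)
 moreover have "Determinant.det C = (\<Prod>a<n. coeff (P a) a)"
 proof -
  have "Determinant.det C = prod_list (diag_mat C)"
  proof (rule det_upper_triangular)
   show "upper_triangular C"
   proof (rule upper_triangularI)
    fix i j assume "j < i" "i < dim_row C"
    then show "C $$ (i, j) = 0" using deg[of j] by (auto simp: C_def intro!: coeff_eq_0)
   qed
  qed (auto simp: C_def)
  then show ?thesis by (simp add: prod_list_diag_prod C_def lessThan_atLeast0)
 qed
 ultimately show ?thesis by (simp add: V_def)
qed

text \<open>Newton's basis: replacing the monomials by the monic products \<open>N a\<close> keeps
  the determinant and makes the matrix of values triangular.\<close>

lemma det_vandermonde:
 fixes x :: "nat => complex"
 shows "Determinant.det (Matrix.mat n n (\<lambda>(b, a). x b ^ a)) = (\<Prod>b<n. \<Prod>j<b. x b - x j)"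
proof -
 define N where "N a = (\<Prod>j<a. [:- x j, 1:])" for a
 have N: "degree (N a) = a" "coeff (N a) a = 1" for a
 proof -
  have "lead_coeff (N a) = 1" by (simp add: N_def lead_coeff_prod)
  moreover show "degree (N a) = a" unfolding N_def by (subst degree_prod_eq_sum_degree) auto
  ultimately show "coeff (N a) a = 1" by simp
 qed
 have ev: "poly (N a) y = (\<Prod>j<a. y - x j)" for a y by (simp add: N_def poly_prod)
 have "Determinant.det (Matrix.mat n n (\<lambda>(b, a). x b ^ a)) = Determinant.det (Matrix.mat n n (\<lambda>(b, a). poly (N a) (x b)))"
  by (subst det_poly_columns) (auto simp: N)
 also have "... = prod_list (diag_mat (Matrix.mat n n (\<lambda>(b, a). poly (N a) (x b))))"
 proof (rule det_lower_triangular[of n])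
  fix i j assume "i < j" "j < n"
  then show "Matrix.mat n n (\<lambda>(b, a). poly (N a) (x b)) $$ (i, j) = 0" by (auto simp: ev)
 qed auto
 also have "... = (\<Prod>b<n. \<Prod>j<b. x b - x j)" by (simp add: prod_list_diag_prod ev lessThan_atLeast0)
 finally show ?thesis .
qed

text \<open>\<open>vandermonde_prod\<close> takes the entry of smaller index minus the other, so
  that it is positive for decreasing sequences; the determinant takes the opposite
  differences.\<close>

definition vandermonde_sign :: "nat => complex" where "vandermonde_sign n = (\<Prod>b<n. \<Prod>j<b. - 1)"

lemma vandermonde_sign_nonzero: "vandermonde_sign n ~= 0" by (simp add: vandermonde_sign_def)

lemma det_vandermonde_real:
 "Determinant.det (Matrix.mat n n (\<lambda>(b, a). complex_of_real (l b) ^ a)) = vandermonde_sign n * of_real (vandermonde_prod n l)"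
proof -
 have "(\<Prod>b<n. \<Prod>j<b. complex_of_real (l b) - of_real (l j)) = (\<Prod>b<n. \<Prod>j<b. - 1 * of_real (l j - l b))"
  by (intro prod.cong refl) simp
 then show ?thesis
  unfolding det_vandermonde by (simp only: prod.distrib vandermonde_sign_def vandermonde_prod_def of_real_prod)
qed

lemma exp_growth_add: "exp_growth \<kappa> f ==> exp_growth \<kappa> g ==> exp_growth \<kappa> (\<lambda>x. f x + g x)"
proof -
 assume "exp_growth \<kappa> f" "exp_growth \<kappa> g"
 then obtain C D where m: "f \<in> borel_measurable borel" "g \<in> borel_measurable borel"
  and C: "\<And>x. 0 <= x ==> cmod (f x) <= C * exp (\<kappa> * x)" and D: "\<And>x. 0 <= x ==> cmod (g x) <= D * exp (\<kappa> * x)"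
  by (auto simp: exp_growth_def)
 have "cmod (f x + g x) <= (C + D) * exp (\<kappa> * x)" if "0 <= x" for x
  using norm_triangle_ineq[of "f x" "g x"] C[OF that] D[OF that] by (simp add: distrib_right)
 then show ?thesis using m unfolding exp_growth_def by (auto intro!: exI[of _ "C + D"])
qed

lemma exp_growth_cmult: "exp_growth \<kappa> f ==> exp_growth \<kappa> (\<lambda>x. c * f x)"
proof -
 assume "exp_growth \<kappa> f"
 then obtain C where m: "f \<in> borel_measurable borel"
  and C: "\<And>x. 0 <= x ==> cmod (f x) <= C * exp (\<kappa> * x)"
  by (auto simp: exp_growth_def)
 have "cmod (c * f x) <= (cmod c * C) * exp (\<kappa> * x)" if "0 <= x" for x
  using mult_left_mono[OF C[OF that], of "cmod c"] by (simp add: norm_mult mult.assoc)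
 then show ?thesis using m unfolding exp_growth_def by (auto intro!: exI[of _ "cmod c * C"])
qed

lemma exp_growth_sum: "finite I ==> (\<And>i. i \<in> I ==> exp_growth \<kappa> (f i)) ==> exp_growth \<kappa> (\<lambda>x. \<Sum>i\<in>I. f i x)"
proof (induction I rule: finite_induct)
 case empty
 show ?case by (auto simp: exp_growth_def intro!: exI[of _ 0])
next
 case (insert i I)
 then show ?case by (simp add: exp_growth_add)
qed

text \<open>A power is below an exponential of any positive rate, by
  \<open>c * x \<le> exp (c * x)\<close>; the choice \<open>c = \<kappa> / (n + 1)\<close> gives
  \<open>n * c \<le> \<kappa>\<close> and stays meaningful at \<open>n = 0\<close>.\<close>

lemma exp_growth_poly:
 assumes "0 < \<kappa>"
 shows "exp_growth \<kappa> (\<lambda>x. poly p (of_real x))"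
proof -
 have "exp_growth \<kappa> (\<lambda>x. of_real x ^ n)" for n
 proof -
  define c where "c = \<kappa> / (n + 1)"
  have c: "0 < c" using assms by (simp add: c_def)
  have "cmod (of_real x ^ n) <= (1 / c) ^ n * exp (\<kappa> * x)" if x: "0 <= x" for x
  proof -
   have "c * x <= exp (c * x)" using exp_ge_add_one_self[of "c * x"] by linarith
   then have "x <= (1 / c) * exp (c * x)" using c by (simp add: field_simps)
   then have "x ^ n <= ((1 / c) * exp (c * x)) ^ n" using x by (intro power_mono) auto
   also have "... = (1 / c) ^ n * exp (n * (c * x))" by (simp only: power_mult_distrib exp_of_nat_mult)
   also have "... <= (1 / c) ^ n * exp (\<kappa> * x)"
   proof -
    have "real n * c <= \<kappa>" using assms by (simp add: c_def field_simps)
    then have "real n * c * x <= \<kappa> * x" using x by (intro mult_right_mono) auto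
    then show ?thesis using c by (intro mult_left_mono) (auto simp: mult.assoc)
   qed
   finally show ?thesis using x by (simp add: norm_power)
  qed
  then show ?thesis unfolding exp_growth_def by (auto intro!: exI[of _ "(1 / c) ^ n"])
 qed
 then have "exp_growth \<kappa> (\<lambda>x. \<Sum>i\<le>degree p. coeff p i * of_real x ^ i)"
  by (intro exp_growth_sum exp_growth_cmult) auto
 then show ?thesis by (simp add: poly_altdef)
qed

lemma borel_measurable_poly_of_real: "(\<lambda>x. poly p (of_real x) :: complex) \<in> borel_measurable borel"
 using exp_growth_poly[of 1 p] by (simp add: exp_growth_def)

lemma exp_growth_bounded_mult:
 assumes "exp_growth \<kappa> f" "b \<in> borel_measurable borel" "\<And>x. cmod (b x) <= B"
 shows "exp_growth \<kappa> (\<lambda>x. b x * f x)"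
proof -
 obtain C where m: "f \<in> borel_measurable borel" and C: "\<And>x. 0 <= x ==> cmod (f x) <= C * exp (\<kappa> * x)"
  using assms(1) by (auto simp: exp_growth_def)
 have "cmod (b x * f x) <= (B * C) * exp (\<kappa> * x)" if "0 <= x" for x
  using mult_mono[OF assms(3)[of x] C[OF that]] assms(3)[of x] norm_ge_zero[of "b x"]
  by (simp add: norm_mult mult.assoc)
 then show ?thesis using m assms(2) unfolding exp_growth_def by (auto intro!: exI[of _ "B * C"])
qed

section \<open>Iterated exponential averages, in particular of polynomials\<close>

lemma exp_avg_cong:
 assumes "\<And>y. 0 <= y ==> f y = g y" "0 <= x" "f \<in> borel_measurable borel" "g \<in> borel_measurable borel"
 shows "exp_avg r f x = exp_avg r g x"
proof -
 note [measurable] = assms(3,4)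
 have "AE s in exp_law r. 0 < s" unfolding exp_law_def by (subst AE_density) (auto simp: indicator_def)
 then show ?thesis unfolding exp_avg_def
  using assms(1,2) by (intro integral_cong_AE) (auto elim!: eventually_mono)
qed

lemma exp_avg_lincomb:
 assumes "exp_growth \<kappa> f" "exp_growth \<kappa> g" "\<kappa> < r" "0 < r" "0 <= x"
 shows "exp_avg r (\<lambda>y. c * f y + d * g y) x = c * exp_avg r f x + d * exp_avg r g x"
 using integrable_exp_law[OF assms(1,3,4,5)] integrable_exp_law[OF assms(2,3,4,5)]
 unfolding exp_avg_def by simp

lemma exp_growth_foldr_exp_avg:
 assumes "\<And>r. r \<in> set rs ==> \<kappa> < r \<and> 0 < r" "exp_growth \<kappa> f"
 shows "exp_growth \<kappa> (foldr exp_avg rs f)"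
 using assms by (induction rs) (auto intro!: exp_growth_exp_avg)

text \<open>Linearity holds at nonnegative points only, where the integrals converge;
  \<open>exp_avg_cong\<close> carries it inwards, since an average looks only upwards.\<close>

lemma foldr_exp_avg_lincomb:
 assumes "\<And>r. r \<in> set rs ==> \<kappa> < r \<and> 0 < r" and f: "exp_growth \<kappa> f" and g: "exp_growth \<kappa> g" and "0 <= x"
 shows "foldr exp_avg rs (\<lambda>y. c * f y + d * g y) x = c * foldr exp_avg rs f x + d * foldr exp_avg rs g x"
 using assms(1,4)
proof (induction rs arbitrary: x)
 case (Cons r rs)
 have G: "exp_growth \<kappa> (foldr exp_avg rs f')" if "exp_growth \<kappa> f'" for f'
  using Cons.prems(1) that by (intro exp_growth_foldr_exp_avg) auto
 have lc: "exp_growth \<kappa> (\<lambda>y. c * f y + d * g y)" by (intro exp_growth_add exp_growth_cmult f g)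
 have "exp_avg r (foldr exp_avg rs (\<lambda>y. c * f y + d * g y)) x = exp_avg r (\<lambda>y. c * foldr exp_avg rs f y + d * foldr exp_avg rs g y) x"
  using Cons.prems G[OF lc] G[OF f] G[OF g] by (intro exp_avg_cong Cons.IH) (auto simp: exp_growth_def)
 also have "... = c * exp_avg r (foldr exp_avg rs f) x + d * exp_avg r (foldr exp_avg rs g) x"
  by (rule exp_avg_lincomb[OF G[OF f] G[OF g]]) (use Cons.prems in auto)
 finally show ?case by simp
qed simp

definition root_poly :: "real list => complex poly" where
 "root_poly rs = (\<Prod>r\<leftarrow>rs. [:of_real r, - 1:])"

text \<open>\<open>tau_poly rs b\<close> is the coefficient of \<open>w ^ b\<close> in \<open>exp (x * w) * (\<Prod>r\<leftarrow>rs. r - w)\<close>, as a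
 polynomial in \<open>x\<close>; averaging over an exponential law of rate \<open>r\<close> removes the factor \<open>r - w\<close>.\<close>

definition tau_poly :: "real list => nat => complex poly" where
 "tau_poly rs b = (\<Sum>a\<le>b. monom (coeff (root_poly rs) (b - a) / fact a) a)"

lemma coeff_tau_poly: "coeff (tau_poly rs b) a = (if a <= b then coeff (root_poly rs) (b - a) / fact a else 0)"
 by (simp add: tau_poly_def coeff_sum)

lemma degree_tau_poly: "degree (tau_poly rs b) <= b"
 by (rule degree_le) (simp add: coeff_tau_poly)

lemma coeff_root_poly_0: "coeff (root_poly rs) 0 = of_real (prod_list rs)"
 by (induction rs) (simp_all add: root_poly_def coeff_mult)

text \<open>Multiplying the generating function by \<open>r - w\<close> acts on polynomials in
  \<open>x\<close> as \<open>r - d/dx\<close>, because differentiating \<open>exp (x * w)\<close> in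
  \<open>x\<close> multiplies it by \<open>w\<close>.\<close>

lemma tau_poly_Cons: "tau_poly (r # rs) b = Polynomial.smult (of_real r) (tau_poly rs b) - pderiv (tau_poly rs b)"
proof (rule poly_eqI)
 fix a
 have c: "coeff (root_poly (r # rs)) k = of_real r * coeff (root_poly rs) k - (if k = 0 then 0 else coeff (root_poly rs) (k - 1))" for k
  by (cases k) (simp_all add: root_poly_def mult_pCons_left)
 show "coeff (tau_poly (r # rs) b) a = coeff (Polynomial.smult (of_real r) (tau_poly rs b) - pderiv (tau_poly rs b)) a"
 proof (cases "a < b")
  case True
  then have "Suc a <= b" "b - Suc a = b - a - 1" by auto
  moreover have "of_nat (Suc a) / fact (Suc a) = (1 / fact a :: complex)" by (simp add: field_simps del: of_nat_Suc)
  ultimately show ?thesis using True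
   by (simp add: coeff_tau_poly coeff_pderiv c diff_divide_distrib del: of_nat_Suc fact_Suc)
    (metis (no_types, lifting) mult.commute times_divide_eq_left times_divide_eq_right mult.left_neutral)
 next
  case False
  then show ?thesis by (auto simp: coeff_tau_poly coeff_pderiv c)
 qed
qed

text \<open>The integrand is the derivative of \<open>G\<close>, that is, of
  \<open>- r * exp (- r * (y - x)) * P\<close>; the average is a boundary term.\<close>

lemma exp_avg_poly:
 assumes r: "0 < r" and x: "0 <= x"
 shows "exp_avg r (\<lambda>y. poly (Polynomial.smult (of_real r) P - pderiv P) (of_real y)) x = of_real r * poly P (of_real x)"
proof -
 let ?h = "\<lambda>y. poly (Polynomial.smult (of_real r) P - pderiv P) (of_real y :: complex)"
 define G where "G y = - (of_real (r * exp (- r * (y - x))) * poly P (of_real y))" for y :: real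
 have deriv: "(G has_vector_derivative of_real (r * exp (- r * (y - x))) * ?h y) (at y)" for y
 proof -
  have 1: "((\<lambda>z. exp (- of_real r * (z - of_real x)) * poly P z) has_field_derivative
    (exp (- of_real r * (z - of_real x)) * poly (pderiv P) z + (- of_real r) * exp (- of_real r * (z - of_real x)) * poly P z)) (at z)" for z :: complex
   by (auto intro!: derivative_eq_intros poly_DERIV)
  have 2: "((\<lambda>y. exp (- of_real r * (of_real y - of_real x)) * poly P (of_real y)) has_vector_derivative
   (exp (- of_real r * (of_real y - of_real x)) * poly (pderiv P) (of_real y) + (- of_real r) * exp (- of_real r * (of_real y - of_real x)) * poly P (of_real y))) (at y)"
   by (rule has_vector_derivative_real_field[OF 1])
  have 3: "G = (\<lambda>y. (- of_real r) * (exp (- of_real r * (of_real y - of_real x)) * poly P (of_real y)))"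
   by (simp add: G_def fun_eq_iff exp_of_real[symmetric])
  show ?thesis unfolding 3
   by (rule has_vector_derivative_eq_rhs[OF has_vector_derivative_mult_right[OF 2]])
    (simp add: exp_of_real[symmetric] algebra_simps)
 qed
 obtain C where C: "\<And>y. 0 <= y ==> cmod (poly P (of_real y)) <= C * exp (r / 2 * y)"
  using exp_growth_poly[of "r / 2" P] r by (auto simp: exp_growth_def)
 have int: "set_integrable lborel {x<..} (\<lambda>y. of_real (r * exp (- r * (y - x))) * ?h y)"
  unfolding set_integrable_def
  by (rule set_integrable_exp_growth[OF exp_growth_poly[of "r / 2"]]) (use r x in auto)
 have "exp_avg r ?h x = (LBINT y=ereal x..\<infinity>. of_real (r * exp (- r * (y - x))) * ?h y)"
  by (subst exp_avg_lborel[OF exp_growth_poly[of 1, unfolded exp_growth_def, THEN conjunct1] r]) (auto simp: interval_lebesgue_integral_def set_lebesgue_integral_def einterval_def greaterThan_def)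
 also have "... = 0 - G x"
 proof (rule interval_integral_FTC_integrable)
  show "set_integrable lborel (einterval (ereal x) \<infinity>) (\<lambda>y. of_real (r * exp (- r * (y - x))) * ?h y)"
   using int by (simp add: einterval_def greaterThan_def)
  show "((G \<circ> real_of_ereal) \<longlongrightarrow> G x) (at_right (ereal x))"
  proof -
   have "isCont G x" by (rule has_vector_derivative_continuous[OF deriv])
   then have "(G \<longlongrightarrow> G x) (at_right x)" unfolding isCont_def by (rule tendsto_within_subset) auto
   then show ?thesis by (simp add: ereal_tendsto_simps)
  qed
  show "((G \<circ> real_of_ereal) \<longlongrightarrow> 0) (at_left \<infinity>)"
  proof -
   have "((\<lambda>y. (\<bar>r\<bar> * C * exp (r * x)) * exp (- (r / 2) * y)) \<longlongrightarrow> 0) at_top"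
    using r by (intro tendsto_mult_right_zero) real_asymp
   moreover have "eventually (\<lambda>y. norm (G y) <= (\<bar>r\<bar> * C * exp (r * x)) * exp (- (r / 2) * y)) at_top"
    using eventually_ge_at_top[of 0]
   proof eventually_elim
    case (elim y)
    have "norm (G y) = \<bar>r\<bar> * exp (- r * (y - x)) * cmod (poly P (of_real y))" by (simp add: G_def norm_mult)
    also have "... <= \<bar>r\<bar> * exp (- r * (y - x)) * (C * exp (r / 2 * y))" using C[OF elim] by (intro mult_left_mono) auto
    also have "... = \<bar>r\<bar> * C * (exp (- r * (y - x)) * exp (r / 2 * y))" by simp
    also have "exp (- r * (y - x)) * exp (r / 2 * y) = exp (r * x) * exp (- (r / 2) * y)"
     by (simp add: exp_add[symmetric] algebra_simps)
    finally show ?case by simp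
   qed
   ultimately have "(G \<longlongrightarrow> 0) at_top" by (rule Lim_null_comparison[rotated])
   then show ?thesis by (simp add: ereal_tendsto_simps)
  qed
  show "isCont (\<lambda>y. of_real (r * exp (- r * (y - x))) * ?h y) y" for y
   by (intro continuous_intros)
 qed (use deriv in auto)
 also have "... = of_real r * poly P (of_real x)" by (simp add: G_def)
 finally show ?thesis .
qed

text \<open>The outermost average undoes the last operator \<open>r - d/dx\<close>. The inner
  averages commute with the derivative here, because differentiation lowers the index of
  \<open>tau_poly\<close> by one.\<close>

lemma foldr_exp_avg_tau:
 assumes "\<And>r. r \<in> set rs ==> 0 < r" "0 <= x"
 shows "foldr exp_avg rs (\<lambda>y. poly (tau_poly rs b) (of_real y)) x = of_real (prod_list rs) * (of_real x ^ b / fact b)"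
 using assms
proof (induction rs arbitrary: x b)
 case Nil
 have "tau_poly [] b = monom (1 / fact b) b"
  by (rule poly_eqI) (auto simp: coeff_tau_poly root_poly_def coeff_1)
 then show ?case by (simp add: poly_monom)
next
 case (Cons r rs)
 \<comment> \<open>One growth rate for all averages: half of the smallest rate.\<close>
 obtain \<kappa> where \<kappa>: "0 < \<kappa>" "\<And>s. s \<in> set (r # rs) ==> \<kappa> < s"
 proof (rule that)
  have M: "0 < Min (set (r # rs))" using Cons.prems by (subst Min_gr_iff) auto
  then show "0 < Min (set (r # rs)) / 2" by simp
  show "Min (set (r # rs)) / 2 < s" if "s \<in> set (r # rs)" for s
  proof -
   have "Min (set (r # rs)) <= s" using that by (intro Min_le) auto
   then show ?thesis using M by linarith
  qed
 qed
 define Q :: "complex poly" where "Q = monom (of_real (prod_list rs) / fact b) b"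
 define T T' where "T y = poly (tau_poly rs b) (of_real y)" and "T' y = poly (pderiv (tau_poly rs b)) (of_real y)" for y :: real
 have eg: "exp_growth \<kappa> T" "exp_growth \<kappa> T'" unfolding T_def T'_def by (auto intro!: exp_growth_poly \<kappa>)
 have IH: "foldr exp_avg rs T y = poly Q (of_real y)" if "0 <= y" for y
  unfolding T_def Q_def using Cons.IH[OF _ that] Cons.prems(1) by (simp add: poly_monom)
 have IH': "foldr exp_avg rs T' y = poly (pderiv Q) (of_real y)" if "0 <= y" for y
 proof (cases b)
  case 0
  then have "pderiv (tau_poly rs b) = 0" using degree_tau_poly[of rs b] by (simp add: pderiv_eq_0_iff)
  then have "T' = (\<lambda>y. 0 * T y + 0 * T y)" by (simp add: T'_def fun_eq_iff)
  then have "foldr exp_avg rs T' y = 0" using foldr_exp_avg_lincomb[OF _ eg(1) eg(1) that, of rs 0 0] \<kappa> Cons.prems(1) by auto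
  moreover have "pderiv Q = 0" using 0 by (simp add: Q_def pderiv_monom)
  ultimately show ?thesis by simp
 next
  case (Suc c)
  have "pderiv (tau_poly rs b) = tau_poly rs c"
   by (rule poly_eqI) (auto simp: coeff_pderiv coeff_tau_poly Suc simp del: of_nat_Suc)
  then have "foldr exp_avg rs T' y = of_real (prod_list rs) * (of_real y ^ c / fact c)"
   unfolding T'_def using Cons.IH[OF _ that] Cons.prems(1) by simp
  also have "... = poly (pderiv Q) (of_real y)"
   by (simp add: Q_def Suc pderiv_monom poly_monom field_simps del: of_nat_Suc)
  finally show ?thesis .
 qed
 have "(\<lambda>y. poly (tau_poly (r # rs) b) (of_real y)) = (\<lambda>y. of_real r * T y + (- 1) * T' y)"
  by (simp add: tau_poly_Cons T_def T'_def)
 then have "foldr exp_avg (r # rs) (\<lambda>y. poly (tau_poly (r # rs) b) (of_real y)) x = exp_avg r (foldr exp_avg rs (\<lambda>y. of_real r * T y + (- 1) * T' y)) x" by simp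
 also have "... = exp_avg r (\<lambda>y. poly (Polynomial.smult (of_real r) Q - pderiv Q) (of_real y)) x"
 proof (rule exp_avg_cong)
  fix y :: real assume y: "0 <= y"
  show "foldr exp_avg rs (\<lambda>y. of_real r * T y + (- 1) * T' y) y = poly (Polynomial.smult (of_real r) Q - pderiv Q) (of_real y)"
   using foldr_exp_avg_lincomb[OF _ eg y, of rs "of_real r" "- 1"] \<kappa> Cons.prems(1) IH[OF y] IH'[OF y] by auto
 next
  have "exp_growth \<kappa> (\<lambda>y. of_real r * T y + (- 1) * T' y)" by (intro exp_growth_add exp_growth_cmult eg)
  then have "exp_growth \<kappa> (foldr exp_avg rs (\<lambda>y. of_real r * T y + (- 1) * T' y))"
   by (rule exp_growth_foldr_exp_avg[rotated]) (use \<kappa> Cons.prems(1) in auto)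
  then show "foldr exp_avg rs (\<lambda>y. of_real r * T y + (- 1) * T' y) \<in> borel_measurable borel" by (simp add: exp_growth_def)
  show "(\<lambda>y. poly (Polynomial.smult (of_real r) Q - pderiv Q) (of_real y)) \<in> borel_measurable borel"
   by (rule borel_measurable_poly_of_real)
 qed (use Cons.prems in auto)
 also have "... = of_real r * poly Q (of_real x)" by (rule exp_avg_poly) (use Cons.prems in auto)
 also have "... = of_real (prod_list (r # rs)) * (of_real x ^ b / fact b)" by (simp add: Q_def poly_monom)
 finally show ?case .
qed

text \<open>On the positive half-line and for \<open>m = 0\<close>, the density of a sum of
  independent exponential variables with the rates \<open>rs\<close>; in general its
  \<open>m\<close>-th derivative times \<open>(- 1) ^ m\<close>.\<close>

definition hypoexp_density :: "(real => complex) => real list => nat => real => complex" where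
 "hypoexp_density g rs m t = - of_real (prod_list rs) / (2 * of_real pi * \<i>) * laplace_contour g rs m t"

lemma hypoexp_density_single:
 assumes "encloses g q [r]"
 shows "hypoexp_density g [r] 0 t = of_real (r * exp (- r * t))"
 by (simp add: hypoexp_density_def laplace_contour_single[OF assms] exp_of_real[symmetric] mult_ac)

lemma hypoexp_density_deriv:
 assumes "encloses g q rs" "0 <= t"
 shows "(hypoexp_density g rs k has_vector_derivative - hypoexp_density g rs (Suc k) t) (at t)"
 unfolding hypoexp_density_def[abs_def]
 by (rule has_vector_derivative_eq_rhs[OF has_vector_derivative_mult_right[OF laplace_contour_deriv[OF assms]]]) simp

lemma hypoexp_density_Cons:
 assumes "encloses g q (r # rs)"
 shows "of_real r * hypoexp_density g (r # rs) 0 t - hypoexp_density g (r # rs) 1 t = of_real r * hypoexp_density g rs 0 t"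
 unfolding hypoexp_density_def laplace_contour_Cons[OF assms, symmetric]
 by (simp add: algebra_simps diff_divide_distrib)

lemma hypoexp_density_zero:
 assumes "encloses g q (r # rs)" "rs ~= []"
 shows "hypoexp_density g (r # rs) 0 0 = 0"
proof -
 have "2 <= length (r # rs)" using assms(2) by (cases rs) auto
 then show ?thesis unfolding hypoexp_density_def by (simp add: laplace_contour_zero[OF assms(1)])
qed

lemma hypoexp_density_bounds:
 assumes "encloses g q rs"
 shows "\<exists>L R. 0 <= L \<and> 0 < R \<and> (\<forall>u\<ge>0. (\<forall>m. cmod (hypoexp_density g rs m u) <= L * R ^ m * exp (- q * u)) \<and>
  (\<forall>n x. cmod (hypoexp_density g rs 0 (u - x) - (\<Sum>m\<le>n. of_real (x ^ m / fact m) * hypoexp_density g rs m u)) \<le>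
    L * exp (- q * u) * (exp (\<bar>x\<bar> * R) * (\<bar>x\<bar> * R) ^ Suc n)))"
proof -
 obtain L R where L: "0 < L" "0 < R" and b: "\<And>u m. 0 <= u ==> cmod (laplace_contour g rs m u) <= L * R ^ m * exp (- q * u)"
  and t: "\<And>u n x. 0 <= u ==> cmod (laplace_contour g rs 0 (u - x) - (\<Sum>m\<le>n. of_real (x ^ m / fact m) * laplace_contour g rs (0 + m) u)) \<le>
    L * R ^ 0 * exp (- q * u) * (exp (\<bar>x\<bar> * R) * (\<bar>x\<bar> * R) ^ Suc n)"
  using laplace_contour_taylor[OF assms] by meson
 define c where "c = - of_real (prod_list rs) / (2 * of_real pi * \<i>)"
 have h: "hypoexp_density g rs m u = c * laplace_contour g rs m u" for m u by (simp add: hypoexp_density_def c_def)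
 have 1: "cmod (hypoexp_density g rs m u) <= (cmod c * L) * R ^ m * exp (- q * u)" if "0 <= u" for m u
  using mult_left_mono[OF b[OF that, of m], of "cmod c"] by (simp add: h norm_mult mult.assoc)
 have 2: "cmod (hypoexp_density g rs 0 (u - x) - (\<Sum>m\<le>n. of_real (x ^ m / fact m) * hypoexp_density g rs m u)) \<le>
    (cmod c * L) * exp (- q * u) * (exp (\<bar>x\<bar> * R) * (\<bar>x\<bar> * R) ^ Suc n)" if "0 <= u" for u x n
 proof -
  have "hypoexp_density g rs 0 (u - x) - (\<Sum>m\<le>n. of_real (x ^ m / fact m) * hypoexp_density g rs m u) =
   c * (laplace_contour g rs 0 (u - x) - (\<Sum>m\<le>n. of_real (x ^ m / fact m) * laplace_contour g rs m u))"
   by (simp add: h right_diff_distrib sum_distrib_left mult_ac)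
  then show ?thesis using mult_left_mono[OF t[OF that, of x n], of "cmod c"] by (simp add: norm_mult mult.assoc)
 qed
 show ?thesis using 1 2 L by (intro exI[of _ "cmod c * L"] exI[of _ R]) auto
qed

lemma hypoexp_density_measurable:
 assumes "encloses g q rs"
 shows "(\<lambda>t. indicator {0<..} t *\<^sub>R hypoexp_density g rs m t) \<in> borel_measurable borel"
proof (rule borel_measurable_continuous_on_indicator)
 show "continuous_on {0<..} (hypoexp_density g rs m)"
 proof (rule continuous_at_imp_continuous_on, rule ballI)
  fix t :: real assume "t \<in> {0<..}"
  then show "isCont (hypoexp_density g rs m) t"
   using has_vector_derivative_continuous[OF hypoexp_density_deriv[OF assms, of t]] by simp
 qed
qed simp

text \<open>By \<open>hypoexp_density_Cons\<close> the integrand is the derivative of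
  \<open>?A\<close>. The boundary term at \<open>s = t\<close> vanishes because the longer list has
  at least two poles.\<close>

lemma hypoexp_density_convolution:
 assumes e: "encloses g q (r # rs)" and rs: "rs ~= []" and t: "0 <= t"
 shows "(\<integral>s. indicator {0..t} s *\<^sub>R (of_real (r * exp (- r * s)) * hypoexp_density g rs 0 (t - s)) \<partial>lborel) = hypoexp_density g (r # rs) 0 t"
proof -
 have e': "encloses g q rs" using e by (simp add: encloses_Cons)
 let ?A = "\<lambda>s. - (of_real (exp (- r * s)) * hypoexp_density g (r # rs) 0 (t - s))"
 let ?a = "\<lambda>s. of_real (r * exp (- r * s)) * hypoexp_density g rs 0 (t - s)"
 have "(\<integral>s. indicator {0..t} s *\<^sub>R ?a s \<partial>lborel) = ?A t - ?A 0"
 proof (rule integral_FTC_Icc[OF t])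
  have d1: "((\<lambda>s. hypoexp_density g (r # rs) 0 (t - s)) has_vector_derivative hypoexp_density g (r # rs) 1 (t - s)) (at s)"
   if "s <= t" for s
  proof -
   have "((\<lambda>s. t - s) has_vector_derivative - 1) (at s)" by (auto intro!: derivative_eq_intros simp: has_real_derivative_iff_has_vector_derivative[symmetric])
   moreover have "(hypoexp_density g (r # rs) 0 has_vector_derivative - hypoexp_density g (r # rs) 1 (t - s)) (at (t - s))"
    using hypoexp_density_deriv[OF e, of "t - s" 0] that by simp
   ultimately show ?thesis using vector_diff_chain_at[of "\<lambda>s. t - s" "- 1" s "hypoexp_density g (r # rs) 0"] by (force simp: o_def)
  qed
  have d2: "((\<lambda>s. complex_of_real (exp (- r * s))) has_vector_derivative of_real (- r * exp (- r * s))) (at s)" for s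
  proof -
   have "((\<lambda>s. exp (- r * s)) has_real_derivative - r * exp (- r * s)) (at s)" by (auto intro!: derivative_eq_intros)
   then show ?thesis by (simp only: has_real_derivative_iff_has_vector_derivative has_vector_derivative_of_real)
  qed
  show "(?A has_vector_derivative ?a s) (at s within {0..t})" if "0 <= s" "s <= t" for s
  proof -
   have "(?A has_vector_derivative - (of_real (exp (- r * s)) * hypoexp_density g (r # rs) 1 (t - s) + of_real (- r * exp (- r * s)) * hypoexp_density g (r # rs) 0 (t - s))) (at s)"
    by (rule has_vector_derivative_minus[OF has_vector_derivative_mult[OF d2 d1[OF that(2)]]])
   also have "- (of_real (exp (- r * s)) * hypoexp_density g (r # rs) 1 (t - s) + of_real (- r * exp (- r * s)) * hypoexp_density g (r # rs) 0 (t - s)) =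
     of_real (exp (- r * s)) * (of_real r * hypoexp_density g (r # rs) 0 (t - s) - hypoexp_density g (r # rs) 1 (t - s))"
    by (simp add: algebra_simps)
   also have "... = ?a s" unfolding hypoexp_density_Cons[OF e] by simp
   finally show ?thesis by (rule has_vector_derivative_at_within)
  qed
  show "continuous_on {0..t} ?a"
  proof (intro continuous_intros)
   show "continuous_on {0..t} (\<lambda>s. hypoexp_density g rs 0 (t - s))"
   proof (rule continuous_on_compose2[of "{0..t}" "hypoexp_density g rs 0"])
    show "continuous_on {0..t} (hypoexp_density g rs 0)"
     by (rule continuous_at_imp_continuous_on) (auto intro!: has_vector_derivative_continuous[OF hypoexp_density_deriv[OF e']])
   qed (auto intro!: continuous_intros)
  qed
 qed
 also have "... = hypoexp_density g (r # rs) 0 t" by (simp add: hypoexp_density_zero[OF e rs])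
 finally show ?thesis .
qed

lemma integrable_exponential_density:
 assumes "0 < b"
 shows "integrable lborel (exponential_density b)"
proof -
 interpret E: prob_space "density lborel (exponential_density b)" by (rule prob_space_exponential_density[OF assms])
 have "(\<integral>\<^sup>+x. ennreal (exponential_density b x) \<partial>lborel) = 1" using E.emeasure_space_1 by (simp add: emeasure_density)
 then show ?thesis using assms by (intro integrableI_nonneg) (auto simp: exponential_density_nonneg)
qed

text \<open>Iterated averages convolve the exponential laws, and Fubini with
  \<open>hypoexp_density_convolution\<close> collapses them into one kernel. The bound
  \<open>dom\<close>, which rests on \<open>\<kappa> < q\<close>, justifies Fubini.\<close>

lemma foldr_exp_avg_kernel:
 assumes "encloses g q rs" "rs ~= []" and F: "exp_growth \<kappa> F" and \<kappa>: "0 <= \<kappa>" "\<kappa> < q" and "0 <= x"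
 shows "integrable lborel (\<lambda>u. (indicator {0<..} (u - x) *\<^sub>R hypoexp_density g rs 0 (u - x)) * F u)"
  and "foldr exp_avg rs F x = (\<integral>u. (indicator {0<..} (u - x) *\<^sub>R hypoexp_density g rs 0 (u - x)) * F u \<partial>lborel)"
proof -
 have Fm[measurable]: "F \<in> borel_measurable borel" using F by (simp add: exp_growth_def)
 obtain C where C: "\<And>y. 0 <= y ==> cmod (F y) <= C * exp (\<kappa> * y)" using F by (auto simp: exp_growth_def)
 have C0: "0 <= C" using C[of 0] norm_ge_zero[of "F 0"] by (simp del: norm_ge_zero)
 define K where "K rs t = indicator {0<..} t *\<^sub>R hypoexp_density g rs 0 t" for rs t
 have Km: "K rs \<in> borel_measurable borel" if "encloses g q rs" for rs
  unfolding K_def by (rule hypoexp_density_measurable[OF that])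
 let ?\<beta> = "q - \<kappa>"
 have ed: "integrable lborel (exponential_density ?\<beta>)"
  by (rule integrable_exponential_density) (use \<kappa> in simp)
 have dom: "\<exists>D\<ge>0. \<forall>y\<ge>0. integrable lborel (\<lambda>u. K rs (u - y) * F u) \<and> (\<integral>u. cmod (K rs (u - y) * F u) \<partial>lborel) <= D * exp (\<kappa> * y)"
  if enc: "encloses g q rs" for rs
 proof -
  note [measurable] = Km[OF enc]
  obtain L where L: "0 <= L" "\<And>t. 0 <= t ==> cmod (hypoexp_density g rs 0 t) <= L * exp (- q * t)"
   using hypoexp_density_bounds[OF enc] by (metis mult.right_neutral power_0)
  define D where "D = L * C / ?\<beta>"
  have pt: "cmod (K rs (u - y) * F u) <= D * exp (\<kappa> * y) * exponential_density ?\<beta> (- y + 1 * u)" if y: "0 <= y" for y u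
  proof (cases "y < u")
   case True
   have "cmod (K rs (u - y) * F u) <= (L * exp (- q * (u - y))) * (C * exp (\<kappa> * u))"
    using True y L(2)[of "u - y"] C[of u] L(1) by (simp add: K_def norm_mult) (intro mult_mono, auto)
   also have "... = L * C * (exp (- q * (u - y)) * exp (\<kappa> * u))" by simp
   also have "exp (- q * (u - y)) * exp (\<kappa> * u) = exp (\<kappa> * y) * exp (- (u - y) * ?\<beta>)"
    by (simp add: exp_add[symmetric] algebra_simps)
   also have "L * C * (exp (\<kappa> * y) * exp (- (u - y) * ?\<beta>)) = D * exp (\<kappa> * y) * exponential_density ?\<beta> (- y + 1 * u)"
    using True \<kappa> by (simp add: D_def exponential_density_def)
   finally show ?thesis .
  next
   case False
   then show ?thesis using L C0 \<kappa> by (simp add: K_def D_def exponential_density_nonneg)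
  qed
  have D0: "0 <= D" using L C0 \<kappa> by (simp add: D_def)
  have iy: "integrable lborel (\<lambda>u. exponential_density ?\<beta> (- y + 1 * u))" for y
   by (rule lborel_integrable_real_affine[OF ed]) simp
  have vy: "(\<integral>u. exponential_density ?\<beta> (- y + 1 * u) \<partial>lborel) = (\<integral>u. exponential_density ?\<beta> u \<partial>lborel)" for y
   using lborel_integral_real_affine[of 1 "exponential_density ?\<beta>" "- y"] by simp
  have i: "integrable lborel (\<lambda>u. K rs (u - y) * F u)" if "0 <= y" for y
  proof (rule Bochner_Integration.integrable_bound[OF integrable_mult_right[OF iy[of y], of "D * exp (\<kappa> * y)"]])
   show "AE u in lborel. norm (K rs (u - y) * F u) <= norm (D * exp (\<kappa> * y) * exponential_density ?\<beta> (- y + 1 * u))"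
   proof (rule AE_I2)
    show "norm (K rs (u - y) * F u) <= norm (D * exp (\<kappa> * y) * exponential_density ?\<beta> (- y + 1 * u))" for u
     using pt[OF that, of u] by (simp only: real_norm_def; linarith)
   qed
  qed measurable
  have "(\<integral>u. cmod (K rs (u - y) * F u) \<partial>lborel) <= (\<integral>u. D * exp (\<kappa> * y) * exponential_density ?\<beta> (- y + 1 * u) \<partial>lborel)" if "0 <= y" for y
   by (rule integral_mono) (use i[OF that] iy pt[OF that] in auto)
  also have "(\<integral>u. D * exp (\<kappa> * y) * exponential_density ?\<beta> (- y + 1 * u) \<partial>lborel) = (D * (\<integral>u. exponential_density ?\<beta> u \<partial>lborel)) * exp (\<kappa> * y)" for y
   using vy[of y] by simp
  finally show ?thesis using i D0
   by (intro exI[of _ "D * (\<integral>u. exponential_density ?\<beta> u \<partial>lborel)"]) (auto intro!: mult_nonneg_nonneg integral_nonneg_AE simp: exponential_density_nonneg \<kappa>)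
 qed
 show "integrable lborel (\<lambda>u. (indicator {0<..} (u - x) *\<^sub>R hypoexp_density g rs 0 (u - x)) * F u)"
  using dom[OF assms(1)] assms(6) by (auto simp: K_def)
 have "foldr exp_avg rs F x = (\<integral>u. K rs (u - x) * F u \<partial>lborel)"
  using assms(1,2,6)
 proof (induction rs arbitrary: x)
  case (Cons r rs)
  have r: "q < r" "0 < r" and qp: "0 < q" using Cons.prems(1) by (auto simp: encloses_def)
  show ?case
  proof (cases "rs = []")
   case True
   then have "K (r # rs) t = indicator {0<..} t *\<^sub>R of_real (r * exp (- r * t))" for t
    using hypoexp_density_single[of g q r t] Cons.prems(1) by (simp add: K_def)
   then show ?thesis using True
    by (simp add: exp_avg_lborel[OF Fm r(2)], intro Bochner_Integration.integral_cong) (auto simp: indicator_def)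
  next
   case False
   have enc: "encloses g q rs" using Cons.prems(1) by (simp add: encloses_Cons)
   note [measurable] = Km[OF enc]
   obtain D where D: "0 <= D" "\<And>y. 0 <= y ==> integrable lborel (\<lambda>u. K rs (u - y) * F u)"
    "\<And>y. 0 <= y ==> (\<integral>u. cmod (K rs (u - y) * F u) \<partial>lborel) <= D * exp (\<kappa> * y)"
    using dom[OF enc] by blast
   define G where "G y = (\<integral>u. K rs (u - y) * F u \<partial>lborel)" for y
   have Gm[measurable]: "G \<in> borel_measurable borel" unfolding G_def by measurable
   have egF: "exp_growth \<kappa> (foldr exp_avg rs F)"
    by (rule exp_growth_foldr_exp_avg[OF _ F]) (use enc \<kappa> in \<open>auto simp: encloses_def\<close>)
   define \<phi> where "\<phi> s u = indicator {x<..} s *\<^sub>R (of_real (r * exp (- r * (s - x))) * (K rs (u - s) * F u))" for s u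
   have "foldr exp_avg (r # rs) F x = exp_avg r G x"
    using egF Cons.prems(3) Cons.IH[OF enc False] by (simp add: G_def[symmetric]) (intro exp_avg_cong, auto simp: exp_growth_def G_def)
   also have "... = (\<integral>s. indicator {x<..} s *\<^sub>R (of_real (r * exp (- r * (s - x))) * G s) \<partial>lborel)"
    by (rule exp_avg_lborel[OF Gm r(2)])
   also have "... = (\<integral>s. (\<integral>u. \<phi> s u \<partial>lborel) \<partial>lborel)"
    unfolding \<phi>_def G_def by simp
   also have "... = (\<integral>u. (\<integral>s. \<phi> s u \<partial>lborel) \<partial>lborel)"
   proof (rule lborel_pair.Fubini_integral[symmetric])
    show "integrable (lborel \<Otimes>\<^sub>M lborel) (case_prod \<phi>)"
    proof (rule lborel_pair.Fubini_integrable)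
     show "case_prod \<phi> \<in> borel_measurable (lborel \<Otimes>\<^sub>M lborel)"
      unfolding \<phi>_def by measurable
     have eqn: "(\<integral>u. norm (case_prod \<phi> (s, u)) \<partial>lborel) = indicator {x<..} s * (r * exp (- r * (s - x))) * (\<integral>u. cmod (K rs (u - s) * F u) \<partial>lborel)" for s
      using r by (simp add: \<phi>_def norm_mult mult_ac flip: integral_mult_right_zero)
     have gi: "integrable lborel (\<lambda>s. indicator {x<..} s *\<^sub>R (of_real (r * exp (- r * (s - x))) * of_real (D * exp (\<kappa> * s))) :: complex)"
     proof (rule set_integrable_exp_growth[of \<kappa>])
      show "exp_growth \<kappa> (\<lambda>s. of_real (D * exp (\<kappa> * s)))" unfolding exp_growth_def
       proof (intro conjI exI[of _ D] allI impI)
        show "(\<lambda>s. complex_of_real (D * exp (\<kappa> * s))) \<in> borel_measurable borel" by measurable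
        show "cmod (complex_of_real (D * exp (\<kappa> * x))) <= D * exp (\<kappa> * x)" for x using D(1) by (simp only: norm_of_real abs_mult) simp
       qed
     qed (use r \<kappa> Cons.prems(3) in auto)
     have nm: "(\<lambda>s. \<integral>u. norm (case_prod \<phi> (s, u)) \<partial>lborel) \<in> borel_measurable lborel"
      unfolding \<phi>_def by measurable
     show "integrable lborel (\<lambda>s. \<integral>u. norm (case_prod \<phi> (s, u)) \<partial>lborel)"
     proof (rule Bochner_Integration.integrable_bound[OF gi nm], rule AE_I2)
      fix s
      show "norm (\<integral>u. norm (case_prod \<phi> (s, u)) \<partial>lborel) <= norm (indicator {x<..} s *\<^sub>R (of_real (r * exp (- r * (s - x))) * of_real (D * exp (\<kappa> * s))) :: complex)"
      proof (cases "x < s")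
       case True
       have nn: "0 <= (\<integral>u. cmod (K rs (u - s) * F u) \<partial>lborel)" by (rule integral_nonneg_AE) auto
       show ?thesis unfolding eqn using True D(3)[of s] Cons.prems(3) r D(1) nn
        by (simp add: norm_mult abs_mult mult_left_mono)
      next
       case False
       then show ?thesis unfolding eqn by simp
      qed
     qed
     show "AE s in lborel. integrable lborel (\<lambda>u. case_prod \<phi> (s, u))"
     proof (rule AE_I2)
      fix s
      show "integrable lborel (\<lambda>u. case_prod \<phi> (s, u))"
       using D(2)[of s] Cons.prems(3) by (cases "x < s") (simp_all add: \<phi>_def)
     qed
    qed
   qed
   also have "... = (\<integral>u. K (r # rs) (u - x) * F u \<partial>lborel)"
   proof (rule Bochner_Integration.integral_cong[OF refl])
    fix u
    have "(\<integral>s. \<phi> s u \<partial>lborel) = (\<integral>s. (indicator {x<..} s *\<^sub>R (of_real (r * exp (- r * (s - x))) * K rs (u - s))) * F u \<partial>lborel)"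
     by (intro Bochner_Integration.integral_cong) (simp_all add: \<phi>_def)
    also have "... = (\<integral>s. indicator {x<..} s *\<^sub>R (of_real (r * exp (- r * (s - x))) * K rs (u - s)) \<partial>lborel) * F u"
     by (rule integral_mult_left_zero)
    also have "(\<integral>s. indicator {x<..} s *\<^sub>R (of_real (r * exp (- r * (s - x))) * K rs (u - s)) \<partial>lborel) =
     (\<integral>s. indicator {x<..} (x + 1 * s) *\<^sub>R (of_real (r * exp (- r * ((x + 1 * s) - x))) * K rs (u - (x + 1 * s))) \<partial>lborel)"
     by (subst lborel_integral_real_affine[where c = 1 and t = x]) auto
    also have "... = (\<integral>s. indicator {0..u - x} s *\<^sub>R (of_real (r * exp (- r * s)) * hypoexp_density g rs 0 ((u - x) - s)) \<partial>lborel)"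
    proof (rule integral_cong_AE)
     show m1: "(\<lambda>s. indicator {x<..} (x + 1 * s) *\<^sub>R (of_real (r * exp (- r * ((x + 1 * s) - x))) * K rs (u - (x + 1 * s)))) \<in> borel_measurable lborel"
      by measurable
     \<comment> \<open>The two integrands differ at most at the end points \<open>0\<close> and
       \<open>u - x\<close>.\<close>
     have ae: "AE s in lborel. indicator {x<..} (x + 1 * s) *\<^sub>R (of_real (r * exp (- r * ((x + 1 * s) - x))) * K rs (u - (x + 1 * s))) =
      indicator {0..u - x} s *\<^sub>R (of_real (r * exp (- r * s)) * hypoexp_density g rs 0 ((u - x) - s))"
      using AE_lborel_singleton[of "0::real"] AE_lborel_singleton[of "u - x"]
      by eventually_elim (auto simp: K_def indicator_def algebra_simps)
     then show "AE s in lborel. indicator {x<..} (x + 1 * s) *\<^sub>R (of_real (r * exp (- r * ((x + 1 * s) - x))) * K rs (u - (x + 1 * s))) =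
      indicator {0..u - x} s *\<^sub>R (of_real (r * exp (- r * s)) * hypoexp_density g rs 0 ((u - x) - s))" .
     have "(\<lambda>s. indicator {0..u - x} s *\<^sub>R (of_real (r * exp (- r * s)) * hypoexp_density g rs 0 ((u - x) - s))) \<in> borel_measurable borel"
     proof (rule borel_measurable_continuous_on_indicator)
      show "continuous_on {0..u - x} (\<lambda>s. of_real (r * exp (- r * s)) * hypoexp_density g rs 0 ((u - x) - s))"
      proof (intro continuous_intros)
       show "continuous_on {0..u - x} (\<lambda>s. hypoexp_density g rs 0 ((u - x) - s))"
       proof (rule continuous_on_compose2[of "{0..u - x}" "hypoexp_density g rs 0"])
        show "continuous_on {0..u - x} (hypoexp_density g rs 0)"
         by (rule continuous_at_imp_continuous_on) (auto intro!: has_vector_derivative_continuous[OF hypoexp_density_deriv[OF enc]])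
       qed (auto intro!: continuous_intros)
      qed
     qed simp
     then show "(\<lambda>s. indicator {0..u - x} s *\<^sub>R (of_real (r * exp (- r * s)) * hypoexp_density g rs 0 ((u - x) - s))) \<in> borel_measurable lborel" by simp
    qed
    also have "... = K (r # rs) (u - x)"
    proof (cases "0 < u - x")
     case True
     then show ?thesis using hypoexp_density_convolution[OF Cons.prems(1) False, of "u - x"] by (simp add: K_def)
    next
     case F: False
     have "indicator {0..u - x} s *\<^sub>R (of_real (r * exp (- r * s)) * hypoexp_density g rs 0 ((u - x) - s)) = 0" if "s ~= 0" for s
      using F that by (auto simp: indicator_def)
     then have "(\<integral>s. indicator {0..u - x} s *\<^sub>R (of_real (r * exp (- r * s)) * hypoexp_density g rs 0 ((u - x) - s)) \<partial>lborel) = 0"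
      by (intro integral_eq_zero_AE) (use AE_lborel_singleton[of "0::real"] in \<open>auto elim!: eventually_mono\<close>)
     then show ?thesis using F by (simp add: K_def)
    qed
    finally show "(\<integral>s. \<phi> s u \<partial>lborel) = K (r # rs) (u - x) * F u" .
   qed
   finally show ?thesis .
  qed
 qed simp
 then show "foldr exp_avg rs F x = (\<integral>u. (indicator {0<..} (u - x) *\<^sub>R hypoexp_density g rs 0 (u - x)) * F u \<partial>lborel)"
  by (simp add: K_def)
qed

section \<open>Alternants at points that collapse to zero\<close>

lemma vandermonde_inverse:
 fixes y :: "nat => complex"
 assumes "\<And>i j. i < n ==> j < i ==> y i ~= y j"
 shows "\<exists>w. \<forall>b<n. \<forall>c<n. (\<Sum>m<n. y b ^ m * w m c) = (if b = c then 1 else 0)"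
proof -
 define V where "V = Matrix.mat n n (\<lambda>(b, a). y b ^ a)"
 have V: "V \<in> carrier_mat n n" by (simp add: V_def)
 have d: "Determinant.det V ~= 0" unfolding V_def det_vandermonde using assms by auto
 define W where "W = inverse (Determinant.det V) \<cdot>\<^sub>m adj_mat V"
 have W: "W \<in> carrier_mat n n" unfolding W_def using adj_mat(1)[OF V] by simp
 have "V * W = inverse (Determinant.det V) \<cdot>\<^sub>m (V * adj_mat V)"
  unfolding W_def by (rule mult_smult_distrib[OF V adj_mat(1)[OF V]])
 also have "... = inverse (Determinant.det V) \<cdot>\<^sub>m (Determinant.det V \<cdot>\<^sub>m 1\<^sub>m n)" by (simp only: adj_mat(2)[OF V])
 also have "... = 1\<^sub>m n" by (rule eq_matI) (use d in auto)
 finally have VW: "V * W = 1\<^sub>m n" .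
 have "(\<Sum>m<n. y b ^ m * W $$ (m, c)) = (if b = c then 1 else 0)" if "b < n" "c < n" for b c
 proof -
  have "(V * W) $$ (b, c) = (\<Sum>m<n. V $$ (b, m) * W $$ (m, c))"
   using V W that by (simp add: scalar_prod_def atLeast0LessThan)
  also have "... = (\<Sum>m<n. y b ^ m * W $$ (m, c))" using that by (intro sum.cong) (auto simp: V_def)
  finally show ?thesis using VW that by simp
 qed
 then show ?thesis by (intro exI[of _ "\<lambda>m c. W $$ (m, c)"]) blast
qed

text \<open>The remainders at the \<open>n\<close> points are interpolated by a polynomial of degree
  below \<open>n\<close>, whose coefficients \<open>E\<close> are of order
  \<open>s ^ (n - m)\<close> and vanish in the limit. The alternant is then exactly a Vandermonde
  determinant times a determinant of coefficients.\<close>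

lemma alternant_ratio_limit:
 fixes H :: "nat => real => complex" and c :: "nat => nat => complex"
 assumes d: "0 < d" and H: "\<And>a x. a < n ==> 0 <= x ==> x < d ==> cmod (H a x - (\<Sum>m<n. of_real x ^ m * c m a)) <= D * x ^ n"
 shows "(\<lambda>l. alternant_ratio n H (\<lambda>b. real (n - b) / real (Suc l))) \<longlonglongrightarrow>
  vandermonde_sign n * Determinant.det (Matrix.mat n n (\<lambda>(m, a). c m a))"
proof -
 \<comment> \<open>Nodes of fixed shape, later scaled by \<open>s l\<close>; the inverse
   \<open>w\<close> of their Vandermonde matrix does not depend on the scale.\<close>
 define y where "y b = real (n - b)" for b
 define s where "s l = 1 / real (Suc l)" for l
 have s: "0 < s l" for l by (simp add: s_def)
 have sl: "s \<longlonglongrightarrow> 0" unfolding s_def by (rule lim_inverse_n'[THEN LIMSEQ_Suc])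
 have yn: "0 < y b" "y b <= real n" if "b < n" for b using that by (auto simp: y_def)
 have "\<exists>w. \<forall>b<n. \<forall>c<n. (\<Sum>m<n. complex_of_real (y b) ^ m * w m c) = (if b = c then 1 else 0)"
  by (rule vandermonde_inverse) (auto simp: y_def)
 then obtain w where w: "\<And>b c. b < n ==> c < n ==> (\<Sum>m<n. complex_of_real (y b) ^ m * w m c) = (if b = c then 1 else 0)" by blast
 define R where "R l b a = H a (s l * y b) - (\<Sum>m<n. of_real (s l * y b) ^ m * c m a)" for l b a
 define E where "E l m a = inverse (of_real (s l) ^ m) * (\<Sum>b<n. w m b * R l b a)" for l m a
 have split: "H a (s l * y b) = (\<Sum>m<n. of_real (s l * y b) ^ m * (c m a + E l m a))" if "b < n" for l a b
 proof -
  have "(\<Sum>m<n. of_real (s l * y b) ^ m * E l m a) = (\<Sum>m<n. \<Sum>b'<n. of_real (y b) ^ m * w m b' * R l b' a)"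
  proof (rule sum.cong[OF refl])
   fix m
   have "complex_of_real (s l * y b) ^ m * inverse (of_real (s l) ^ m) = of_real (y b) ^ m"
    using s[of l] by (simp add: power_mult_distrib)
   then have "of_real (s l * y b) ^ m * E l m a = of_real (y b) ^ m * (\<Sum>b'<n. w m b' * R l b' a)"
    by (simp only: E_def mult.assoc[symmetric])
   then show "of_real (s l * y b) ^ m * E l m a = (\<Sum>b'<n. of_real (y b) ^ m * w m b' * R l b' a)"
    by (simp only: sum_distrib_left mult.assoc)
  qed
  also have "... = (\<Sum>b'<n. (\<Sum>m<n. of_real (y b) ^ m * w m b') * R l b' a)"
   by (subst sum.swap) (simp add: sum_distrib_right)
  also have "... = (\<Sum>b'<n. if b = b' then R l b' a else 0)" using w[OF that] by (intro sum.cong) auto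
  also have "... = R l b a" using that by simp
  finally show ?thesis by (simp add: R_def distrib_left sum.distrib)
 qed
 have "alternant_ratio n H (\<lambda>b. s l * y b) = vandermonde_sign n * Determinant.det (Matrix.mat n n (\<lambda>(m, a). c m a + E l m a))" for l
 proof -
  let ?V = "Matrix.mat n n (\<lambda>(b, a). complex_of_real (s l * y b) ^ a)" and ?C = "Matrix.mat n n (\<lambda>(m, a). c m a + E l m a)"
  have "Matrix.mat n n (\<lambda>(b, a). H a (s l * y b)) = ?V * ?C"
   by (rule eq_matI) (auto simp: scalar_prod_def split atLeast0LessThan)
  then have "alternant n H (\<lambda>b. s l * y b) = Determinant.det ?V * Determinant.det ?C"
   unfolding alternant_def by (simp add: Determinant.det_mult[of _ n])
  also have "Determinant.det ?V = vandermonde_sign n * of_real (vandermonde_prod n (\<lambda>b. s l * y b))"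
   by (rule det_vandermonde_real)
  finally have a: "alternant n H (\<lambda>b. s l * y b) = vandermonde_sign n * of_real (vandermonde_prod n (\<lambda>b. s l * y b)) * Determinant.det ?C" .
  have "0 < vandermonde_prod n (\<lambda>b. s l * y b)"
   by (rule vandermonde_prod_pos) (auto simp: strict_dec_def y_def s)
  then show ?thesis by (simp add: alternant_ratio_def a)
 qed
 moreover have "(\<lambda>b. s l * y b) = (\<lambda>b. real (n - b) / real (Suc l))" for l by (simp add: s_def y_def)
 moreover have "(\<lambda>l. vandermonde_sign n * Determinant.det (Matrix.mat n n (\<lambda>(m, a). c m a + E l m a))) \<longlonglongrightarrow>
   vandermonde_sign n * Determinant.det (Matrix.mat n n (\<lambda>(m, a). c m a + 0))"
 proof (intro tendsto_mult tendsto_const tendsto_det_mat tendsto_add)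
  fix m a assume m: "m < n" and a: "a < n"
  define K where "K = (\<Sum>b<n. cmod (w m b) * (D * real n ^ n))"
  have ev: "eventually (\<lambda>l. s l * real n < d \<and> s l <= 1) sequentially"
  proof -
   have "(\<lambda>l. s l * real n) \<longlonglongrightarrow> 0 * real n" by (intro tendsto_intros sl)
   then have "eventually (\<lambda>l. s l * real n < d) sequentially" using d by (simp add: order_tendstoD(2))
   then show ?thesis by (rule eventually_mono) (simp add: s_def)
  qed
  have "eventually (\<lambda>l. norm (E l m a) <= s l * K) sequentially"
   using ev
  proof eventually_elim
   case (elim l)
   have Rb: "cmod (R l b a) <= (D * real n ^ n) * s l ^ n" if "b < n" for b
   proof -
    have lt: "s l * y b < d" using yn(2)[OF that] elim s[of l] by (smt (verit) mult_left_mono)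
    have p: "0 < s l * y b" using yn(1)[OF that] s[of l] by simp
    have h: "cmod (R l b a) <= D * (s l * y b) ^ n" unfolding R_def using H[OF a _ lt] p by simp
    have D: "0 <= D"
    proof (rule ccontr)
     assume "\<not> 0 <= D"
     then have "D * (s l * y b) ^ n < 0" using p by (intro mult_neg_pos) auto
     then show False using h norm_ge_zero[of "R l b a"] by linarith
    qed
    have "(s l * y b) ^ n <= (s l * real n) ^ n" using yn[OF that] s[of l] by (intro power_mono mult_left_mono) auto
    then have "D * (s l * y b) ^ n <= D * (s l * real n) ^ n" using D by (rule mult_left_mono)
    then show ?thesis using h by (simp add: power_mult_distrib mult_ac)
   qed
   have "norm (E l m a) = inverse (s l ^ m) * cmod (\<Sum>b<n. w m b * R l b a)"
    using s[of l] by (simp add: E_def norm_mult norm_inverse norm_power)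
   also have "... <= inverse (s l ^ m) * (\<Sum>b<n. cmod (w m b) * ((D * real n ^ n) * s l ^ n))"
   proof (rule mult_left_mono)
    show "cmod (\<Sum>b<n. w m b * R l b a) <= (\<Sum>b<n. cmod (w m b) * ((D * real n ^ n) * s l ^ n))"
     by (rule order_trans[OF norm_sum sum_mono]) (use Rb in \<open>auto simp: norm_mult intro!: mult_left_mono\<close>)
   qed (use s[of l] in simp)
   also have "... = inverse (s l ^ m) * s l ^ n * K" by (simp add: K_def sum_distrib_left mult_ac)
   also have "inverse (s l ^ m) * s l ^ n = s l ^ (n - m)"
    using s[of l] m by (simp add: power_diff field_simps)
   also have "s l ^ (n - m) * K <= s l * K"
   proof (rule mult_right_mono)
    have "s l ^ (n - m) <= s l ^ 1" by (rule power_decreasing) (use m s[of l] elim in auto)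
    then show "s l ^ (n - m) <= s l" by simp
    have "0 <= cmod (w m b) * (D * real n ^ n)" if "b < n" for b
    proof -
     have "0 <= (D * real n ^ n) * s l ^ n" using Rb[OF that] norm_ge_zero[of "R l b a"] by linarith
     moreover have "0 < s l ^ n" using s[of l] by simp
     ultimately have "0 <= D * real n ^ n" using mult_neg_pos[of "D * real n ^ n" "s l ^ n"] by linarith
     then show ?thesis by simp
    qed
    then show "0 <= K" unfolding K_def by (intro sum_nonneg) auto
   qed
   finally show ?case .
  qed
  moreover have "(\<lambda>l. s l * K) \<longlonglongrightarrow> 0" using tendsto_mult_right[OF sl, of K] by simp
  ultimately show "(\<lambda>l. E l m a) \<longlonglongrightarrow> 0" by (rule Lim_null_comparison)
 qed
 ultimately show ?thesis by simp
qed

text \<open>The matrix entries in which both sides of the theorem meet: \<open>m\<close> counts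
  derivatives of the density, \<open>a\<close> selects the polynomial.\<close>

definition hypoexp_moment :: "(real => complex) => real list => (real => complex) => nat => nat => complex" where
 "hypoexp_moment g rs f m a = (\<integral>u. (indicator {0<..} u *\<^sub>R hypoexp_density g rs m u) * (f u * poly (tau_poly rs a) (of_real u)) \<partial>lborel)"

lemma integrable_hypoexp_moment:
 assumes enc: "encloses g q rs" and F: "exp_growth \<kappa> F" and \<kappa>: "\<kappa> < q"
 shows "integrable lborel (\<lambda>u. (indicator {0<..} u *\<^sub>R hypoexp_density g rs m u) * F u)"
  and "integrable lborel (\<lambda>u. indicator {0<..} u * (exp (- q * u) * cmod (F u)))"
proof -
 have Fm[measurable]: "F \<in> borel_measurable borel" using F by (simp add: exp_growth_def)
 obtain C where C: "\<And>y. 0 <= y ==> cmod (F y) <= C * exp (\<kappa> * y)" using F by (auto simp: exp_growth_def)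
 have C0: "0 <= C" using C[of 0] norm_ge_zero[of "F 0"] by (simp del: norm_ge_zero)
 note [measurable] = hypoexp_density_measurable[OF enc]
 obtain L R where L: "0 <= L" "0 < R" "\<And>t m. 0 <= t ==> cmod (hypoexp_density g rs m t) <= L * R ^ m * exp (- q * t)"
  using hypoexp_density_bounds[OF enc] by blast
 have ei: "integrable lborel (\<lambda>u. exponential_density (q - \<kappa>) u)"
  by (rule integrable_exponential_density) (use \<kappa> in simp)
 have pt: "indicator {0<..} u * (exp (- q * u) * cmod (F u)) <= (C / (q - \<kappa>)) * exponential_density (q - \<kappa>) u" for u :: real
 proof (cases "0 < u")
  case True
  have "exp (- q * u) * cmod (F u) <= exp (- q * u) * (C * exp (\<kappa> * u))" using C[of u] True by (intro mult_left_mono) auto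
  also have "... = C * exp (- u * (q - \<kappa>))" by (simp add: exp_add[symmetric] algebra_simps)
  also have "... = (C / (q - \<kappa>)) * exponential_density (q - \<kappa>) u" using True \<kappa> by (simp add: exponential_density_def)
  finally show ?thesis using True by simp
 qed (use C0 \<kappa> in \<open>simp add: exponential_density_nonneg\<close>)
 show 2: "integrable lborel (\<lambda>u. indicator {0<..} u * (exp (- q * u) * cmod (F u)))"
 proof (rule Bochner_Integration.integrable_bound[OF integrable_mult_right[OF ei, of "C / (q - \<kappa>)"]])
  show "AE u in lborel. norm (indicator {0<..} u * (exp (- q * u) * cmod (F u))) <= norm ((C / (q - \<kappa>)) * exponential_density (q - \<kappa>) u)"
  proof (rule AE_I2)
   fix u :: real
   have "norm (indicator {0<..} u * (exp (- q * u) * cmod (F u))) = indicator {0<..} u * (exp (- q * u) * cmod (F u))" by (simp add: abs_mult)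
   then show "norm (indicator {0<..} u * (exp (- q * u) * cmod (F u))) <= norm ((C / (q - \<kappa>)) * exponential_density (q - \<kappa>) u)"
    using pt[of u] by (simp only: real_norm_def; linarith)
  qed
 qed measurable
 show "integrable lborel (\<lambda>u. (indicator {0<..} u *\<^sub>R hypoexp_density g rs m u) * F u)"
 proof (rule Bochner_Integration.integrable_bound[OF integrable_mult_right[OF 2, of "L * R ^ m"]])
  show "AE u in lborel. norm ((indicator {0<..} u *\<^sub>R hypoexp_density g rs m u) * F u) <= norm (L * R ^ m * (indicator {0<..} u * (exp (- q * u) * cmod (F u))))"
  proof (rule AE_I2)
   fix u :: real
   show "norm ((indicator {0<..} u *\<^sub>R hypoexp_density g rs m u) * F u) <= norm (L * R ^ m * (indicator {0<..} u * (exp (- q * u) * cmod (F u))))"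
   proof (cases "0 < u")
    case True
    have "cmod (hypoexp_density g rs m u) * cmod (F u) <= (L * R ^ m * exp (- q * u)) * cmod (F u)"
     using L(3)[of u m] True by (intro mult_right_mono) auto
    then show ?thesis using True L by (simp add: norm_mult abs_mult mult_ac)
   qed simp
  qed
 qed measurable
qed

text \<open>The starting point enters through the density at \<open>u - x\<close>, cut off at
  \<open>u = x\<close>. As \<open>f\<close> vanishes up to \<open>d > x\<close>, the cut can be put
  at \<open>u = 0\<close>, and the contour integral, which makes sense for every argument, is
  expanded in \<open>x\<close>. The bound \<open>x < 1\<close> keeps \<open>exp (x * R)\<close>
  below \<open>exp R\<close>.\<close>

lemma foldr_exp_avg_expansion:
 fixes f :: "real => complex"
 assumes enc: "encloses g q rs" and rs: "rs ~= []" and n: "0 < n" and d: "0 < d"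
  and f: "f \<in> borel_measurable borel" "\<And>x. cmod (f x) <= B" "\<And>x. x <= d ==> f x = 0"
 shows "\<exists>D. \<forall>a<n. \<forall>x. 0 <= x --> x < min d 1 -->
  cmod (foldr exp_avg rs (\<lambda>y. (1 + f y) * poly (tau_poly rs a) (of_real y)) x -
   (\<Sum>m<n. of_real x ^ m * ((if m = a then of_real (prod_list rs) / fact a else 0) + hypoexp_moment g rs f m a / fact m))) <= D * x ^ n"
proof -
 have q: "0 < q" and rq: "\<And>r. r \<in> set rs ==> q / 2 < r \<and> 0 < r" using enc by (auto simp: encloses_def intro: order.strict_trans)
 have q2: "0 < q / 2" "0 <= q / 2" "q / 2 < q" using q by auto
 obtain L R where L: "0 <= L" "0 < R" and T: "\<And>u n x. 0 <= u ==> cmod (hypoexp_density g rs 0 (u - x) - (\<Sum>m\<le>n. of_real (x ^ m / fact m) * hypoexp_density g rs m u)) \<le>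
    L * exp (- q * u) * (exp (\<bar>x\<bar> * R) * (\<bar>x\<bar> * R) ^ Suc n)"
  using hypoexp_density_bounds[OF enc] by blast
 define \<tau> where "\<tau> a y = poly (tau_poly rs a) (of_real y)" for a and y :: real
 define F where "F a y = f y * \<tau> a y" for a y
 have eg\<tau>: "exp_growth (q / 2) (\<tau> a)" for a unfolding \<tau>_def by (rule exp_growth_poly[OF q2(1)])
 have egF: "exp_growth (q / 2) (F a)" for a unfolding F_def by (rule exp_growth_bounded_mult[OF eg\<tau> f(1,2)])
 define J where "J a = (\<integral>u. indicator {0<..} u * (exp (- q * u) * cmod (F a u)) \<partial>lborel)" for a
 define D where "D = (\<Sum>a<n. L * exp R * R ^ n * J a)"
 have J0: "0 <= J a" for a unfolding J_def by (rule integral_nonneg_AE) auto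
 have "cmod (foldr exp_avg rs (\<lambda>y. (1 + f y) * \<tau> a y) x -
   (\<Sum>m<n. of_real x ^ m * ((if m = a then of_real (prod_list rs) / fact a else 0) + hypoexp_moment g rs f m a / fact m))) <= D * x ^ n"
  if a: "a < n" and x: "0 <= x" "x < min d 1" for a x
 proof -
  have eq1: "foldr exp_avg rs (\<lambda>y. (1 + f y) * \<tau> a y) x = of_real (prod_list rs) * (of_real x ^ a / fact a) + foldr exp_avg rs (F a) x"
  proof -
   have "foldr exp_avg rs (\<lambda>y. 1 * \<tau> a y + 1 * F a y) x = 1 * foldr exp_avg rs (\<tau> a) x + 1 * foldr exp_avg rs (F a) x"
    by (rule foldr_exp_avg_lincomb[OF rq eg\<tau> egF x(1)])
   moreover have "foldr exp_avg rs (\<tau> a) x = of_real (prod_list rs) * (of_real x ^ a / fact a)"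
    unfolding \<tau>_def by (rule foldr_exp_avg_tau) (use rq x in auto)
   ultimately show ?thesis by (simp add: F_def distrib_right)
  qed
  have eq2: "foldr exp_avg rs (F a) x = (\<integral>u. (indicator {0<..} u *\<^sub>R hypoexp_density g rs 0 (u - x)) * F a u \<partial>lborel)"
   and int2: "integrable lborel (\<lambda>u. (indicator {0<..} u *\<^sub>R hypoexp_density g rs 0 (u - x)) * F a u)"
  proof -
   have c: "(indicator {0<..} (u - x) *\<^sub>R hypoexp_density g rs 0 (u - x)) * F a u = (indicator {0<..} u *\<^sub>R hypoexp_density g rs 0 (u - x)) * F a u" for u
    using x f(3)[of u] by (cases "u <= d") (auto simp: F_def indicator_def)
   show "foldr exp_avg rs (F a) x = (\<integral>u. (indicator {0<..} u *\<^sub>R hypoexp_density g rs 0 (u - x)) * F a u \<partial>lborel)"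
    using foldr_exp_avg_kernel(2)[OF enc rs egF q2(2,3) x(1)] by (simp only: c)
   show "integrable lborel (\<lambda>u. (indicator {0<..} u *\<^sub>R hypoexp_density g rs 0 (u - x)) * F a u)"
    using foldr_exp_avg_kernel(1)[OF enc rs egF q2(2,3) x(1)] by (metis (no_types, lifting) ext c)
  qed
  have eq3: "(\<Sum>m<n. of_real x ^ m * ((if m = a then of_real (prod_list rs) / fact a else 0) + hypoexp_moment g rs f m a / fact m)) =
   of_real (prod_list rs) * (of_real x ^ a / fact a) + (\<Sum>m<n. of_real (x ^ m / fact m) * hypoexp_moment g rs f m a)"
   using a by (simp add: distrib_left sum.distrib if_distrib[of "\<lambda>t. _ * t"] mult_ac cong: if_cong)
  define h where "h m u = (indicator {0<..} u *\<^sub>R hypoexp_density g rs m u) * F a u" for m u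
  have hi: "integrable lborel (h m)" for m unfolding h_def by (rule integrable_hypoexp_moment(1)[OF enc egF q2(3)])
  have hm: "hypoexp_moment g rs f m a = integral\<^sup>L lborel (h m)" for m by (simp add: hypoexp_moment_def h_def[abs_def] F_def \<tau>_def)
  let ?W = "\<lambda>u. (indicator {0<..} u *\<^sub>R hypoexp_density g rs 0 (u - x)) * F a u - (\<Sum>m<n. of_real (x ^ m / fact m) * h m u)"
  have si: "integrable lborel (\<lambda>u. \<Sum>m<n. of_real (x ^ m / fact m) * h m u)" by (intro Bochner_Integration.integrable_sum integrable_mult_right hi)
  have f1: "foldr exp_avg rs (F a) x - (\<Sum>m<n. of_real (x ^ m / fact m) * hypoexp_moment g rs f m a) = (\<integral>u. ?W u \<partial>lborel)"
   unfolding eq2 hm using int2 si hi by (simp add: Bochner_Integration.integral_diff Bochner_Integration.integral_sum integrable_mult_right)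
  have f2: "cmod (\<integral>u. ?W u \<partial>lborel) <= (\<integral>u. (L * exp R * (x * R) ^ n) * (indicator {0<..} u * (exp (- q * u) * cmod (F a u))) \<partial>lborel)"
  proof (rule Bochner_Integration.integral_norm_bound_integral)
   show "integrable lborel ?W" by (rule Bochner_Integration.integrable_diff[OF int2 si])
   show "integrable lborel (\<lambda>u. (L * exp R * (x * R) ^ n) * (indicator {0<..} u * (exp (- q * u) * cmod (F a u))))"
    by (rule integrable_mult_right) (rule integrable_hypoexp_moment(2)[OF enc egF q2(3)])
   fix u :: real
   \<comment> \<open>The Taylor sum in \<open>T\<close> runs up to its index inclusive, hence the
     shift by one.\<close>
   obtain n' where n': "n = Suc n'" using n by (cases n) auto
   show "cmod (?W u) <= (L * exp R * (x * R) ^ n) * (indicator {0<..} u * (exp (- q * u) * cmod (F a u)))"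
   proof (cases "0 < u")
    case True
    have "?W u = (hypoexp_density g rs 0 (u - x) - (\<Sum>m<n. of_real (x ^ m / fact m) * hypoexp_density g rs m u)) * F a u"
     using True by (simp add: h_def left_diff_distrib sum_distrib_right mult.assoc)
    then have "cmod (?W u) = cmod (hypoexp_density g rs 0 (u - x) - (\<Sum>m<n. of_real (x ^ m / fact m) * hypoexp_density g rs m u)) * cmod (F a u)"
     by (simp add: norm_mult)
    also have "... <= (L * exp (- q * u) * (exp (\<bar>x\<bar> * R) * (\<bar>x\<bar> * R) ^ n)) * cmod (F a u)"
     using T[of u x n'] True by (intro mult_right_mono) (simp_all add: n' lessThan_Suc_atMost)
    also have "... <= (L * exp (- q * u) * (exp R * (x * R) ^ n)) * cmod (F a u)"
    proof -
     have "x * R <= R" using mult_right_mono[of x 1 R] x L by simp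
     then have "exp (\<bar>x\<bar> * R) * (\<bar>x\<bar> * R) ^ n <= exp R * (x * R) ^ n"
      using x L by (simp add: mult_right_mono)
     then show ?thesis using L by (intro mult_right_mono mult_left_mono) auto
    qed
    finally show ?thesis using True by (simp add: mult_ac)
   qed (simp add: h_def)
  qed
  have f3: "(\<integral>u. (L * exp R * (x * R) ^ n) * (indicator {0<..} u * (exp (- q * u) * cmod (F a u))) \<partial>lborel) = L * exp R * (x * R) ^ n * J a"
   unfolding J_def by (rule integral_mult_right_zero)
  have f4: "L * exp R * (x * R) ^ n * J a <= D * x ^ n"
  proof -
   have "L * exp R * R ^ n * J a <= D"
    unfolding D_def by (rule member_le_sum[of a "{..<n}" "\<lambda>a. L * exp R * R ^ n * J a"]) (use a L J0 in auto)
   then have "(L * exp R * R ^ n * J a) * x ^ n <= D * x ^ n" using x by (intro mult_right_mono) auto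
   then show ?thesis by (simp add: power_mult_distrib mult_ac)
  qed
  show ?thesis unfolding eq1 eq3 add_diff_add diff_self add_0_left f1 by (rule order_trans[OF f2[unfolded f3] f4])
 qed
 then show ?thesis unfolding \<tau>_def by blast
qed

section \<open>The kernel\<close>

lemma poly_root_poly: "poly (root_poly rs) w = (\<Prod>r\<leftarrow>rs. of_real r - w)"
 by (induction rs) (auto simp: root_poly_def algebra_simps)

lemma higher_deriv_exp_mult: "(deriv ^^ k) (\<lambda>w :: complex. exp (t * w)) = (\<lambda>w. t ^ k * exp (t * w))"
proof (induction k)
 case (Suc k)
 have "deriv (\<lambda>w. t ^ k * exp (t * w)) = (\<lambda>w. t ^ Suc k * exp (t * w))"
  by (rule ext, rule DERIV_imp_deriv) (auto intro!: derivative_eq_intros)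
 then show ?case by (simp add: Suc)
qed simp

lemma higher_deriv_poly: "(deriv ^^ k) (poly p) = poly ((pderiv ^^ k) p)" for p :: "complex poly"
proof (induction k)
 case (Suc k)
 have "deriv (poly ((pderiv ^^ k) p)) = poly (pderiv ((pderiv ^^ k) p))"
  by (rule ext, rule DERIV_imp_deriv, rule poly_DERIV)
 then show ?case by (simp add: Suc)
qed simp

text \<open>At a pole of order \<open>b + 1\<close> in 0 the residue is the coefficient of
  \<open>w ^ b\<close>, computed by Leibniz' rule.\<close>

lemma contour_integral_tau:
 assumes v: "valid_path c" "pathfinish c = pathstart c" and 0: "0 \<notin> path_image c" and w: "winding_number c 0 = 1"
 shows "contour_integral c (\<lambda>w. exp (t * w) * poly (root_poly rs) w / w ^ Suc b) = 2 * of_real pi * \<i> * poly (tau_poly rs b) t"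
proof -
 let ?f = "\<lambda>w. exp (t * w) * poly (root_poly rs) w"
 have hf: "?f holomorphic_on UNIV" by (intro holomorphic_intros)
 have "contour_integral c (\<lambda>w. ?f w / w ^ Suc b) = 2 * pi * \<i> * (\<Sum>p\<in>{0}. winding_number c p * residue (\<lambda>w. ?f w / w ^ Suc b) p)"
  by (rule Residue_theorem[of UNIV]) (use v 0 in \<open>auto intro!: holomorphic_intros\<close>)
 also have "... = 2 * of_real pi * \<i> * ((deriv ^^ b) ?f 0 / fact b)"
  using residue_holomorphic_over_power[OF open_UNIV _ hf, of 0 b] w by simp
 also have "(deriv ^^ b) ?f 0 = (\<Sum>i = 0..b. of_nat (b choose i) * (deriv ^^ i) (\<lambda>w. exp (t * w)) 0 * (deriv ^^ (b - i)) (poly (root_poly rs)) 0)"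
  by (rule higher_deriv_mult[of _ UNIV]) (auto intro!: holomorphic_intros)
 also have "... = (\<Sum>i\<le>b. fact b * (coeff (root_poly rs) (b - i) / fact i * t ^ i))"
  unfolding higher_deriv_exp_mult higher_deriv_poly atMost_atLeast0[symmetric]
 proof (rule sum.cong[OF refl])
  fix i assume "i \<in> {..b}"
  then have i: "i <= b" by simp
  have "poly ((pderiv ^^ (b - i)) (root_poly rs)) 0 = fact (b - i) * coeff (root_poly rs) (b - i)"
   by (simp add: poly_0_coeff_0 coeff_higher_pderiv pochhammer_fact[symmetric])
  moreover have "of_nat (b choose i) * (fact (b - i) :: complex) = fact b / fact i"
   using binomial_fact[OF i, where ?'a = complex] by simp
  ultimately show "of_nat (b choose i) * (t ^ i * exp (t * 0)) * poly ((pderiv ^^ (b - i)) (root_poly rs)) 0 = fact b * (coeff (root_poly rs) (b - i) / fact i * t ^ i)"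
   by (simp add: mult_ac) (metis (no_types, lifting) mult.assoc mult.commute times_divide_eq_right)
 qed
 also have "... / fact b = (\<Sum>i\<le>b. coeff (root_poly rs) (b - i) / fact i * t ^ i)"
  unfolding sum_distrib_left[symmetric] by simp
 also have "... = poly (tau_poly rs b) t"
  by (simp add: tau_poly_def poly_sum poly_monom)
 finally show ?thesis .
qed

lemma geometric_pole:
 assumes "w ~= 0" "w ~= (z :: complex)"
 shows "1 / (w - z) * (z / w) ^ n = 1 / (w - z) - (\<Sum>b<n. z ^ b / w ^ Suc b)"
 using assms
proof (induction n)
 case (Suc n)
 have "d * (r * X) = d * X - (1 - r) * d * X" for d r X :: complex by (simp add: algebra_simps)
 from this[of "1 / (w - z)" "z / w" "(z / w) ^ n"]
 have "1 / (w - z) * (z / w) ^ Suc n = 1 / (w - z) * (z / w) ^ n - (1 - z / w) * (1 / (w - z)) * (z / w) ^ n"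
  by (simp only: power_Suc)
 also have "(1 - z / w) * (1 / (w - z)) = 1 / w" using Suc.prems by (simp add: field_simps)
 finally show ?case using Suc by (simp add: power_divide)
qed simp

text \<open>The pole at \<open>z\<close> lies outside the half-plane that contains \<open>c\<close>,
  so the term \<open>1 / (w - z)\<close> contributes 0 and the finite geometric sum remains.\<close>

lemma kernel_inner_integral:
 assumes c: "ccw_contour c" "0 \<in> inside (path_image c)" "path_image c \<subseteq> {w. Re w < q}" and z: "q < Re z"
 shows "((\<lambda>w. exp (t * w) * poly (root_poly rs) w * (1 / (w - z) * (z / w) ^ n)) has_contour_integral
  - (2 * of_real pi * \<i>) * (\<Sum>b<n. z ^ b * poly (tau_poly rs b) t)) c"
proof -
 have v: "valid_path c" "pathfinish c = pathstart c" "winding_number c 0 = 1" using c by (auto simp: ccw_contour_def)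
 have 0: "0 \<notin> path_image c" using inside_no_overlap[of "path_image c"] c(2) by blast
 let ?f = "\<lambda>w. exp (t * w) * poly (root_poly rs) w"
 have i1: "((\<lambda>w. ?f w / (w - z)) has_contour_integral 0) c"
  by (rule Cauchy_theorem_convex_simple[of _ "{w. Re w < q}"])
   (use z c v in \<open>auto intro!: holomorphic_intros convex_halfspace_Re_lt\<close>)
 have i2: "((\<lambda>w. ?f w / w ^ Suc b) has_contour_integral (2 * of_real pi * \<i> * poly (tau_poly rs b) t)) c" for b
 proof -
  have "(\<lambda>w. ?f w / w ^ Suc b) contour_integrable_on c"
   by (rule contour_integrable_holomorphic_simple[of _ "- {0}"]) (use v 0 in \<open>auto intro!: holomorphic_intros\<close>)
  then show ?thesis using contour_integral_tau[OF v(1,2) 0 v(3), of t rs b] has_contour_integral_integral by metis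
 qed
 have "((\<lambda>w. ?f w / (w - z) - (\<Sum>b<n. z ^ b * (?f w / w ^ Suc b))) has_contour_integral
   (0 - (\<Sum>b<n. z ^ b * (2 * of_real pi * \<i> * poly (tau_poly rs b) t)))) c"
  by (intro has_contour_integral_diff has_contour_integral_sum has_contour_integral_lmul i1 i2) auto
 then have "((\<lambda>w. ?f w * (1 / (w - z) * (z / w) ^ n)) has_contour_integral
   (0 - (\<Sum>b<n. z ^ b * (2 * of_real pi * \<i> * poly (tau_poly rs b) t)))) c"
 proof (rule has_contour_integral_eq)
  fix w assume w: "w \<in> path_image c"
  then have "w ~= 0" "w ~= z" using 0 c(3) z by auto
  from geometric_pole[OF this, of n] show "?f w / (w - z) - (\<Sum>b<n. z ^ b * (?f w / w ^ Suc b)) = ?f w * (1 / (w - z) * (z / w) ^ n)"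
   by (simp add: right_diff_distrib sum_distrib_left mult_ac)
 qed
 then show ?thesis by (simp add: sum_distrib_left sum_negf mult_ac)
qed

text \<open>After the inner integral the kernel is a sum of \<open>n\<close> products of a
  polynomial in \<open>\<zeta>\<close> and a contour integral in \<open>\<eta>\<close>; the terms
  with \<open>q\<close> are collected in one exponential.\<close>

lemma K_kernel_eq:
 fixes \<pi> :: "nat => real"
 assumes g: "encloses g q (map \<pi> [1..<Suc p])" and c: "ccw_contour c" "0 \<in> inside (path_image c)" "path_image c \<subseteq> {w. Re w < q}"
 defines "rs \<equiv> map \<pi> [1..<Suc p]"
 shows "K_kernel n p \<pi> q g c \<eta> \<zeta> = of_nat n / of_real (prod_list rs) * of_real (exp (real n * q * (\<eta> - \<zeta>))) *
  (\<Sum>b<n. poly (tau_poly rs b) (of_real (real n * \<zeta>)) * hypoexp_density g rs b (real n * \<eta>))"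
proof -
 let ?\<tau> = "\<lambda>b. poly (tau_poly rs b) (of_real (real n * \<zeta>))"
 let ?I = "2 * of_real pi * \<i>"
 have vg: "valid_path g" and pg: "path_image g \<subseteq> {z. q < Re z}" using g by (auto simp: encloses_def ccw_contour_def)
 have pr: "(\<Prod>k=1..p. (of_real (\<pi> k) - w) / (of_real (\<pi> k) - z)) = poly (root_poly rs) w * pole_product rs z" for w z :: complex
 proof -
  have "(\<Prod>k=1..p. h (\<pi> k)) = (\<Prod>r\<leftarrow>rs. h r)" for h :: "real => complex"
   unfolding rs_def by (induction p) (auto simp: prod.nat_ivl_Suc' mult.commute)
  from this[of "\<lambda>r. (of_real r - w) / (of_real r - z)"] have "(\<Prod>k=1..p. (of_real (\<pi> k) - w) / (of_real (\<pi> k) - z)) = (\<Prod>r\<leftarrow>rs. (of_real r - w) / (of_real r - z))" .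
  also have "... = (\<Prod>r\<leftarrow>rs. of_real r - w) * (\<Prod>r\<leftarrow>rs. 1 / (of_real r - z))"
   by (induction rs) auto
  finally show ?thesis unfolding poly_root_poly pole_product_def .
 qed
 define E where "E z = of_real (exp (real n * q * (\<eta> - \<zeta>))) * (exp (- of_real (real n * \<eta>) * z) * pole_product rs z)" for z
 have inner: "contour_integral c (\<lambda>w. exp (- of_real \<eta> * of_nat n * (z - of_real q) + of_real \<zeta> * of_nat n * (w - of_real q)) *
    (1 / (w - z)) * (z / w) ^ n * (\<Prod>k=1..p. (of_real (\<pi> k) - w) / (of_real (\<pi> k) - z))) = E z * (- ?I * (\<Sum>b<n. z ^ b * ?\<tau> b))"
  if z: "z \<in> path_image g" for z
 proof -
  have qz: "q < Re z" using z pg by auto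
  have "contour_integral c (\<lambda>w. exp (- of_real \<eta> * of_nat n * (z - of_real q) + of_real \<zeta> * of_nat n * (w - of_real q)) *
    (1 / (w - z)) * (z / w) ^ n * (\<Prod>k=1..p. (of_real (\<pi> k) - w) / (of_real (\<pi> k) - z))) =
   contour_integral c (\<lambda>w. E z * (exp (of_real (real n * \<zeta>) * w) * poly (root_poly rs) w * (1 / (w - z) * (z / w) ^ n)))"
  proof (rule arg_cong[where f = "contour_integral c"], rule ext)
   fix w
   have "exp (- of_real \<eta> * of_nat n * (z - of_real q) + of_real \<zeta> * of_nat n * (w - of_real q)) =
    of_real (exp (real n * q * (\<eta> - \<zeta>))) * exp (- of_real (real n * \<eta>) * z) * exp (of_real (real n * \<zeta>) * w)"
    by (simp add: exp_of_real[symmetric] exp_add[symmetric] algebra_simps)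
   then show "exp (- of_real \<eta> * of_nat n * (z - of_real q) + of_real \<zeta> * of_nat n * (w - of_real q)) *
    (1 / (w - z)) * (z / w) ^ n * (\<Prod>k=1..p. (of_real (\<pi> k) - w) / (of_real (\<pi> k) - z)) =
    E z * (exp (of_real (real n * \<zeta>) * w) * poly (root_poly rs) w * (1 / (w - z) * (z / w) ^ n))"
    unfolding pr E_def by (simp only: mult_ac)
  qed
  also have "... = E z * (- ?I * (\<Sum>b<n. z ^ b * ?\<tau> b))"
   by (rule contour_integral_unique, rule has_contour_integral_lmul, rule kernel_inner_integral[OF c qz])
  finally show ?thesis .
 qed
 obtain L R where LR: "\<And>\<phi> :: complex => complex. \<phi> holomorphic_on UNIV ==> (\<lambda>z. \<phi> z * pole_product rs z) contour_integrable_on g"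
  using contour_bound[OF g[folded rs_def]] by metis
 have ib: "((\<lambda>z. z ^ b * exp (- of_real (real n * \<eta>) * z) * pole_product rs z) has_contour_integral laplace_contour g rs b (real n * \<eta>)) g" for b
  unfolding laplace_contour_def by (rule has_contour_integral_integral, rule LR) (intro holomorphic_intros)
 have "((\<lambda>z. \<Sum>b<n. (of_real (exp (real n * q * (\<eta> - \<zeta>))) * - ?I * ?\<tau> b) * (z ^ b * exp (- of_real (real n * \<eta>) * z) * pole_product rs z)) has_contour_integral
   (\<Sum>b<n. (of_real (exp (real n * q * (\<eta> - \<zeta>))) * - ?I * ?\<tau> b) * laplace_contour g rs b (real n * \<eta>))) g"
  by (intro has_contour_integral_sum has_contour_integral_lmul ib) auto
 then have "((\<lambda>z. E z * (- ?I * (\<Sum>b<n. z ^ b * ?\<tau> b))) has_contour_integral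
   (\<Sum>b<n. (of_real (exp (real n * q * (\<eta> - \<zeta>))) * - ?I * ?\<tau> b) * laplace_contour g rs b (real n * \<eta>))) g"
  by (rule has_contour_integral_eq) (simp add: E_def sum_distrib_left mult_ac)
 then have "((\<lambda>z. contour_integral c (\<lambda>w. exp (- of_real \<eta> * of_nat n * (z - of_real q) + of_real \<zeta> * of_nat n * (w - of_real q)) *
    (1 / (w - z)) * (z / w) ^ n * (\<Prod>k=1..p. (of_real (\<pi> k) - w) / (of_real (\<pi> k) - z)))) has_contour_integral
   (\<Sum>b<n. (of_real (exp (real n * q * (\<eta> - \<zeta>))) * - ?I * ?\<tau> b) * laplace_contour g rs b (real n * \<eta>))) g"
  by (rule has_contour_integral_eq) (simp only: inner)
 then have K: "K_kernel n p \<pi> q g c \<eta> \<zeta> = of_nat n / ?I\<^sup>2 *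
   (\<Sum>b<n. (of_real (exp (real n * q * (\<eta> - \<zeta>))) * - ?I * ?\<tau> b) * laplace_contour g rs b (real n * \<eta>))"
  unfolding K_kernel_def by (simp only: contour_integral_unique)
 have pl0: "complex_of_real (prod_list rs) ~= 0"
  using g unfolding rs_def encloses_def by (auto simp: prod_list_zero_iff)
 have hd: "hypoexp_density g rs b t / of_real (prod_list rs) = - laplace_contour g rs b t / ?I" for b t
  using pl0 by (simp add: hypoexp_density_def)
 have I0: "?I ~= 0" by simp
 have "of_nat n / ?I\<^sup>2 * ((of_real (exp (real n * q * (\<eta> - \<zeta>))) * - ?I * ?\<tau> b) * laplace_contour g rs b (real n * \<eta>)) =
   of_nat n * of_real (exp (real n * q * (\<eta> - \<zeta>))) * (?\<tau> b * (hypoexp_density g rs b (real n * \<eta>) / of_real (prod_list rs)))" for b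
  unfolding hd using I0 by (simp add: power2_eq_square field_simps)
 then show ?thesis unfolding K by (simp add: sum_distrib_left mult_ac)
qed

text \<open>The factor \<open>exp (n * q * \<eta>)\<close> of the kernel grows at exactly the rate
  at which the density is known to decay. A slightly larger \<open>q'\<close>, available by
  compactness, leaves room for square integrability.\<close>

lemma encloses_margin:
 assumes "encloses g q rs"
 obtains q' where "q < q'" "encloses g q' rs"
proof -
 have cpt: "compact (path_image g)" and ne: "path_image g ~= {}" and pg: "path_image g \<subseteq> {z. q < Re z}"
  using assms by (auto simp: encloses_def ccw_contour_def compact_valid_path_image)
 obtain z0 where z0: "z0 \<in> path_image g" "\<And>z. z \<in> path_image g ==> Re z0 <= Re z"
  using continuous_attains_inf[OF cpt ne continuous_on_Re[OF continuous_on_id]] by blast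
 define m where "m = Min (insert (Re z0) (set rs))"
 have m: "q < m" unfolding m_def using z0(1) pg assms by (subst Min_gr_iff) (auto simp: encloses_def)
 have m1: "m <= Re z0" "\<And>r. r \<in> set rs ==> m <= r" unfolding m_def by (auto intro: Min_le)
 define q' where "q' = (q + m) / 2"
 have q': "q < q'" "q' < m" using m by (auto simp: q'_def)
 have "path_image g \<subseteq> {z. q' < Re z}"
 proof
  fix z assume "z \<in> path_image g"
  from z0(2)[OF this] show "z \<in> {z. q' < Re z}" using m1(1) q'(2) by simp
 qed
 moreover have "q' < r" if "r \<in> set rs" for r using m1(2)[OF that] q'(2) by simp
 ultimately have "encloses g q' rs" using assms q' unfolding encloses_def by auto
 then show ?thesis using that q' by blast
qed

lemma exp_weight_L2:
 assumes [measurable]: "h \<in> borel_measurable half_line" and a: "0 < a" and h: "\<And>x. 0 < x ==> cmod (h x) <= C * exp (- a * x)"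
 shows "h \<in> L2"
proof -
 have ei: "integrable lborel (\<lambda>u. exponential_density (2 * a) u)"
  by (rule integrable_exponential_density) (use a in simp)
 have "integrable half_line (exponential_density (2 * a))"
  using integrable_mult_indicator[OF _ ei, of "{0<..}"] by (simp add: integrable_restrict_space)
 then have "integrable half_line (\<lambda>u. (C\<^sup>2 / (2 * a)) * exponential_density (2 * a) u)" by (rule integrable_mult_right)
 then have "integrable half_line (\<lambda>x. (cmod (h x))\<^sup>2)"
 proof (rule Bochner_Integration.integrable_bound)
  show "AE x in half_line. norm ((cmod (h x))\<^sup>2) <= norm (C\<^sup>2 / (2 * a) * exponential_density (2 * a) x)"
  proof (rule AE_I2)
   fix x assume "x \<in> space half_line"
   then have x: "0 < x" by (simp add: space_restrict_space)
   have "(cmod (h x))\<^sup>2 <= (C * exp (- a * x))\<^sup>2" by (rule power_mono[OF h[OF x]]) simp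
   also have "... = C\<^sup>2 * exp (- x * (2 * a))" by (simp add: power_mult_distrib exp_double[symmetric] mult_ac)
   also have "... = C\<^sup>2 / (2 * a) * exponential_density (2 * a) x" using x a by (simp add: exponential_density_def)
   finally show "norm ((cmod (h x))\<^sup>2) <= norm (C\<^sup>2 / (2 * a) * exponential_density (2 * a) x)"
    using abs_ge_self[of "C\<^sup>2 / (2 * a) * exponential_density (2 * a) x"] by (simp only: real_norm_def abs_power2; linarith)
  qed
 qed measurable
 then show ?thesis by (simp add: L2_def)
qed

text \<open>The exponential in \<open>q\<close> is shared between the two factors of each product,
  which makes both square-integrable, and it cancels in their inner products. These become moments
  by the substitution \<open>t = n * x\<close>.\<close>

lemma K_kernel_fredholm_det:
 fixes \<pi> :: "nat => real" and f :: "real => real"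
 assumes g: "encloses g q (map \<pi> [1..<Suc p])" and c: "ccw_contour c" "0 \<in> inside (path_image c)" "path_image c \<subseteq> {w. Re w < q}"
  and n: "0 < n" and f[measurable]: "f \<in> borel_measurable borel" and fB: "\<And>x. \<bar>f x\<bar> <= B"
 defines "rs \<equiv> map \<pi> [1..<Suc p]"
 shows "has_fredholm_det (\<lambda>h x. h x + kernel_operator (K_kernel n p \<pi> q g c) (mult_operator f h) x)
  (Determinant.det (Matrix.mat n n (\<lambda>(m, a). (if m = a then 1 else 0) +
   hypoexp_moment g rs (\<lambda>x. of_real (f (x / real n))) m a / of_real (prod_list rs))))"
proof -
 have enc: "encloses g q rs" using g by (simp add: rs_def)
 obtain q' where q': "q < q'" "encloses g q' rs" by (rule encloses_margin[OF enc])
 have q: "0 < q" using enc by (simp add: encloses_def)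
 note [measurable] = hypoexp_density_measurable[OF enc] borel_measurable_poly_of_real
 define \<tau> where "\<tau> b x = poly (tau_poly rs b) (complex_of_real x)" for b x
 have [measurable]: "\<tau> b \<in> borel_measurable borel" for b unfolding \<tau>_def by measurable
 define u where "u b \<eta> = of_nat n / of_real (prod_list rs) * of_real (exp (real n * q * \<eta>)) * hypoexp_density g rs b (real n * \<eta>)" for b \<eta>
 \<comment> \<open>Conjugated because \<open>L2_inner\<close> is conjugate-linear in its first
   argument; the multiplication by \<open>f\<close> is absorbed here.\<close>
 define v where "v b \<zeta> = cnj (of_real (f \<zeta>) * of_real (exp (- (real n * q * \<zeta>))) * \<tau> b (real n * \<zeta>))" for b \<zeta>
 have um: "u b \<in> borel_measurable half_line" for b
 proof -
  have "(\<lambda>\<eta>. of_nat n / of_real (prod_list rs) * of_real (exp (real n * q * \<eta>)) * (indicator {0<..} (real n * \<eta>) *\<^sub>R hypoexp_density g rs b (real n * \<eta>))) \<in> borel_measurable borel"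
   by measurable
  then have "(\<lambda>\<eta>. of_nat n / of_real (prod_list rs) * of_real (exp (real n * q * \<eta>)) * (indicator {0<..} (real n * \<eta>) *\<^sub>R hypoexp_density g rs b (real n * \<eta>))) \<in> borel_measurable half_line"
   by (intro measurable_restrict_space1) simp
  moreover have "u b \<eta> = of_nat n / of_real (prod_list rs) * of_real (exp (real n * q * \<eta>)) * (indicator {0<..} (real n * \<eta>) *\<^sub>R hypoexp_density g rs b (real n * \<eta>))" if "\<eta> \<in> space half_line" for \<eta>
   using that n by (simp add: u_def space_restrict_space)
  ultimately show ?thesis by (smt (verit, ccfv_SIG) measurable_cong_simp)
 qed
 have uL: "u b \<in> L2" for b
 proof -
  obtain L R where L: "0 <= L" "0 < R" "\<And>t m. 0 <= t ==> cmod (hypoexp_density g rs m t) <= L * R ^ m * exp (- q' * t)"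
   using hypoexp_density_bounds[OF q'(2)] by blast
  show ?thesis
  proof (rule exp_weight_L2[OF um, where a = "real n * (q' - q)" and C = "cmod (of_nat n / of_real (prod_list rs)) * (L * R ^ b)"])
   show "0 < real n * (q' - q)" using n q' by simp
   fix x :: real assume x: "0 < x"
   have "cmod (u b x) <= cmod (of_nat n / of_real (prod_list rs)) * exp (real n * q * x) * (L * R ^ b * exp (- q' * (real n * x)))"
    unfolding u_def norm_mult norm_of_real abs_exp_cancel using L(3)[of "real n * x" b] x n by (intro mult_left_mono) auto
   also have "... = cmod (of_nat n / of_real (prod_list rs)) * (L * R ^ b) * (exp (real n * q * x) * exp (- q' * (real n * x)))" by (simp only: mult_ac)
   also have "exp (real n * q * x) * exp (- q' * (real n * x)) = exp (- (real n * (q' - q)) * x)" by (simp add: exp_add[symmetric] algebra_simps)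
   finally show "cmod (u b x) <= cmod (of_nat n / of_real (prod_list rs)) * (L * R ^ b) * exp (- (real n * (q' - q)) * x)" .
  qed
 qed
 have vL: "v b \<in> L2" for b
 proof -
  \<comment> \<open>The polynomial is granted half of the decay rate \<open>q\<close>; the other
    half remains for \<open>exp_weight_L2\<close>.\<close>
  have "exp_growth (q / 2) (\<tau> b)" unfolding \<tau>_def by (rule exp_growth_poly) (use q in simp)
  then obtain C where C: "\<And>y. 0 <= y ==> cmod (\<tau> b y) <= C * exp (q / 2 * y)" unfolding exp_growth_def by blast
  have vm: "v b \<in> borel_measurable half_line" unfolding v_def by (intro measurable_restrict_space1) measurable
  show ?thesis
  proof (rule exp_weight_L2[OF vm, where a = "real n * (q / 2)" and C = "B * C"])
   show "0 < real n * (q / 2)" using n q by simp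
   fix x :: real assume x: "0 < x"
   have B0: "0 <= B" using fB[of 0] by linarith
   have "cmod (v b x) = \<bar>f x\<bar> * (exp (- (real n * q * x)) * cmod (\<tau> b (real n * x)))" by (simp add: v_def norm_mult)
   also have "... <= B * (exp (- (real n * q * x)) * (C * exp (q / 2 * (real n * x))))"
    using C[of "real n * x"] x B0 by (intro mult_mono fB mult_left_mono) auto
   also have "... = B * C * (exp (- (real n * q * x)) * exp (q / 2 * (real n * x)))" by simp
   also have "exp (- (real n * q * x)) * exp (q / 2 * (real n * x)) = exp (- (real n * (q / 2)) * x)" by (simp add: exp_add[symmetric] algebra_simps)
   finally show "cmod (v b x) <= B * C * exp (- (real n * (q / 2)) * x)" .
  qed
 qed
 have "has_fredholm_det (\<lambda>h x. h x + kernel_operator (K_kernel n p \<pi> q g c) (mult_operator f h) x)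
  (Determinant.det (Matrix.mat n n (\<lambda>(b, c). (if b = c then 1 else 0) + L2_inner (v b) (u c))))"
 proof (rule finite_rank_fredholm_det[OF uL vL])
  fix h :: "real => complex" and x assume h: "h \<in> L2"
  have "kernel_operator (K_kernel n p \<pi> q g c) (mult_operator f h) x = (\<integral>\<zeta>. (\<Sum>b<n. (cnj (v b \<zeta>) * h \<zeta>) * u b x) \<partial>half_line)"
   unfolding kernel_operator_def
  proof (rule Bochner_Integration.integral_cong[OF refl])
   fix \<zeta>
   have e: "complex_of_real (exp (real n * q * (x - \<zeta>))) = of_real (exp (real n * q * x)) * of_real (exp (- (real n * q * \<zeta>)))"
    by (simp add: exp_add[symmetric] of_real_mult[symmetric] right_diff_distrib del: of_real_mult)
   show "K_kernel n p \<pi> q g c x \<zeta> * mult_operator f h \<zeta> = (\<Sum>b<n. (cnj (v b \<zeta>) * h \<zeta>) * u b x)"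
    unfolding K_kernel_eq[OF g c, folded rs_def] e mult_operator_def u_def v_def \<tau>_def complex_cnj_cnj
    by (simp only: sum_distrib_left sum_distrib_right mult_ac)
  qed
  also have "... = (\<Sum>b<n. L2_inner (v b) h * u b x)"
   unfolding L2_inner_def using L2_integrable_mult(2)[OF vL h]
   by (subst Bochner_Integration.integral_sum) (auto intro: integrable_mult_left)
  finally show "h x + kernel_operator (K_kernel n p \<pi> q g c) (mult_operator f h) x = h x + (\<Sum>b<n. L2_inner (v b) h * u b x)" by simp
 qed
 moreover have "L2_inner (v b) (u a) = hypoexp_moment g rs (\<lambda>x. of_real (f (x / real n))) a b / of_real (prod_list rs)" for a b
 proof -
  let ?H = "\<lambda>t. (indicator {0<..} t *\<^sub>R hypoexp_density g rs a t) * (of_real (f (t / real n)) * \<tau> b t)"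
  have pw: "cnj (v b x) * u a x = of_nat n / of_real (prod_list rs) * ?H (real n * x)" if "0 < x" for x
  proof -
   have "complex_of_real (exp (real n * q * x)) * of_real (exp (- (real n * q * x))) = 1"
    by (simp add: exp_add[symmetric] of_real_mult[symmetric] del: of_real_mult)
   then have "of_real (exp (- (real n * q * x))) * (complex_of_real (exp (real n * q * x)) * y) = y" for y
    by (metis mult.assoc mult.commute mult_1)
   then show ?thesis using that n by (simp add: u_def v_def mult_ac)
  qed
  have "L2_inner (v b) (u a) = (\<integral>x. indicator {0<..} x *\<^sub>R (cnj (v b x) * u a x) \<partial>lborel)"
   by (simp add: L2_inner_def integral_restrict_space)
  also have "... = (\<integral>x. of_nat n / of_real (prod_list rs) * ?H (real n * x) \<partial>lborel)"
  proof (rule Bochner_Integration.integral_cong[OF refl])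
   show "indicator {0<..} x *\<^sub>R (cnj (v b x) * u a x) = of_nat n / of_real (prod_list rs) * ?H (real n * x)" for x :: real
    using pw[of x] n by (cases "0 < x") (auto simp: zero_less_mult_iff)
  qed
  also have "... = of_nat n / of_real (prod_list rs) * (\<integral>x. ?H (0 + real n * x) \<partial>lborel)"
   unfolding add_0_left by (rule integral_mult_right_zero)
  also have "(\<integral>x. ?H x \<partial>lborel) = \<bar>real n\<bar> *\<^sub>R (\<integral>x. ?H (0 + real n * x) \<partial>lborel)"
   by (rule lborel_integral_real_affine) (use n in simp)
  then have "(\<integral>x. ?H (0 + real n * x) \<partial>lborel) = hypoexp_moment g rs (\<lambda>x. of_real (f (x / real n))) a b / of_nat n"
   using n by (simp add: hypoexp_moment_def \<tau>_def scaleR_conv_of_real)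
  finally show ?thesis using n by simp
 qed
 ultimately have fd: "has_fredholm_det (\<lambda>h x. h x + kernel_operator (K_kernel n p \<pi> q g c) (mult_operator f h) x)
  (Determinant.det (Matrix.mat n n (\<lambda>(b, a). (if b = a then 1 else 0) + hypoexp_moment g rs (\<lambda>x. of_real (f (x / real n))) a b / of_real (prod_list rs))))"
  by (simp only:)
 let ?A = "Matrix.mat n n (\<lambda>(m, a). (if m = a then 1 else 0) + hypoexp_moment g rs (\<lambda>x. of_real (f (x / real n))) m a / of_real (prod_list rs))"
 \<comment> \<open>The finite rank lemma delivers the matrix with its indices exchanged.\<close>
 have "Matrix.mat n n (\<lambda>(b, a). (if b = a then 1 else 0) + hypoexp_moment g rs (\<lambda>x. of_real (f (x / real n))) a b / of_real (prod_list rs)) = transpose_mat ?A"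
  by (rule eq_matI) auto
 moreover have "Determinant.det (transpose_mat ?A) = Determinant.det ?A" using Determinant.det_transpose mat_carrier by blast
 ultimately show ?thesis using fd by simp
qed

section \<open>Spectra of complex matrices\<close>

text \<open>Being symmetric in the roots, it needs no enumeration of them and is continuous on all
  matrices when \<open>G\<close> is.\<close>

definition spectral_prod :: "(real => real) => complex ^ 'p ^ 'p => real" where
 "spectral_prod G A = (\<Prod>z\<in>#proots (charpoly A). G (Re z))"

lemma poly_charpoly:
 fixes A :: "complex ^ 'p ^ 'p"
 shows "poly (charpoly A) z = det (\<chi> i j. (if i = j then z else 0) - A $ i $ j)"
proof -
 have e: "poly ((if i = j then [:0, 1:] else 0) - [:A $ i $ j:]) z = (if i = j then z else 0) - A $ i $ j" for i j
  by simp
 have "poly (charpoly A) z = (\<Sum>p | p permutes UNIV. of_int (sign p) * (\<Prod>i\<in>UNIV. poly ((if i = p i then [:0, 1:] else 0) - [:A $ i $ p i:]) z))"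
  by (simp add: charpoly_def Determinants.det_def poly_sum poly_prod)
 also have "... = det (\<chi> i j. (if i = j then z else 0) - A $ i $ j)"
  unfolding e by (simp add: Determinants.det_def)
 finally show ?thesis .
qed

text \<open>The identity permutation contributes a product of monic linear factors; every other one
  moves a point and loses degree.\<close>

lemma charpoly_monic:
 fixes A :: "complex ^ 'p ^ 'p"
 shows "degree (charpoly A) = CARD('p)" and "lead_coeff (charpoly A) = 1"
proof -
 define M where "M i j = (if i = j then [:0, 1:] else 0) - [:A $ i $ j:]" for i j
 define P where "P = (\<Prod>i\<in>UNIV. M i i)"
 define R where "R = (\<Sum>p \<in> {p. p permutes UNIV} - {id}. of_int (sign p) * (\<Prod>i\<in>UNIV. M i (p i)))"
 have fin: "finite {p :: 'p => 'p. p permutes UNIV}" by (rule finite_permutations) simp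
 have PR: "charpoly A = P + R"
 proof -
  have "charpoly A = (\<Sum>p | p permutes UNIV. of_int (sign p) * (\<Prod>i\<in>UNIV. M i (p i)))"
   by (simp add: charpoly_def Determinants.det_def M_def)
  also have "... = of_int (sign (id :: 'p => 'p)) * (\<Prod>i\<in>UNIV. M i (id i)) + R"
   unfolding R_def by (rule sum.remove[OF fin]) (simp add: permutes_id)
  finally show ?thesis by (simp add: P_def)
 qed
 have Mii: "M i i = [:- A $ i $ i, 1:]" for i by (simp add: M_def)
 have dP: "degree P = CARD('p)"
  unfolding P_def Mii by (subst degree_prod_sum_eq) auto
 have lP: "lead_coeff P = 1" unfolding P_def Mii by (subst lead_coeff_prod) simp
 have dM: "degree (M i j) <= (if i = j then 1 else 0)" for i j by (simp add: M_def)
 have dR: "degree R < CARD('p)"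
  unfolding R_def
 proof (rule degree_sum_less)
  fix p :: "'p => 'p" assume p: "p \<in> {p. p permutes UNIV} - {id}"
  then obtain a where a: "p a ~= a" by (auto simp: fun_eq_iff)
  have "degree (of_int (sign p) * (\<Prod>i\<in>UNIV. M i (p i))) <= degree (\<Prod>i\<in>UNIV. M i (p i))"
   by (cases p rule: sign_cases) simp_all
  also have "... <= (\<Sum>i\<in>UNIV. degree (M i (p i)))"
   using degree_prod_sum_le[of UNIV "\<lambda>i. M i (p i)"] by (simp add: o_def)
  also have "... <= (\<Sum>i\<in>UNIV. if i = p i then 1 else 0)" by (intro sum_mono dM)
  also have "... = card {i. i = p i}" by (simp add: sum.If_cases)
  also have "... < CARD('p)" 
  proof (rule psubset_card_mono)
   show "{i. i = p i} \<subset> UNIV"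
   proof (rule psubsetI[OF subset_UNIV], rule notI)
    assume "{i. i = p i} = UNIV"
    then have "a \<in> {i. i = p i}" by (simp only: UNIV_I)
    then show False using a by simp
   qed
  qed simp
  finally show "degree (of_int (sign p) * (\<Prod>i\<in>UNIV. M i (p i))) < CARD('p)" .
 qed simp
 show "degree (charpoly A) = CARD('p)" unfolding PR using dP dR by (simp add: degree_add_eq_left)
 then show "lead_coeff (charpoly A) = 1"
  unfolding PR using lP dP dR by (simp add: coeff_eq_0)
qed

lemma charpoly_roots_exist:
 fixes A :: "complex ^ 'p ^ 'p"
 shows "\<exists>m. charpoly A = (\<Prod>j<CARD('p). [:- m j, 1:])"
proof -
 have "charpoly A ~= 0" using charpoly_monic(2)[of A] by auto
 then obtain R where R: "size R = degree (charpoly A)" "charpoly A = Polynomial.smult (lead_coeff (charpoly A)) (\<Prod>x\<in>#R. [:- x, 1:])"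
  using alg_closed_imp_factorization by blast
 obtain xs where xs: "mset xs = R" using ex_mset by blast
 have len: "length xs = CARD('p)" using R(1) charpoly_monic(1)[of A] xs by auto
 have "charpoly A = (\<Prod>x\<leftarrow>xs. [:- x, 1:])"
  using R(2) charpoly_monic(2)[of A] by (simp add: xs[symmetric] prod_mset_prod_list flip: mset_map)
 also have "... = (\<Prod>j<CARD('p). [:- xs ! j, 1:])"
  by (simp add: prod.list_conv_set_nth len atLeast0LessThan)
 finally show ?thesis by blast
qed

lemma proots_prod_linear: "proots (\<Prod>j<n. [:- m j, 1:]) = image_mset m (mset_set {..<n})"
 for m :: "nat => complex"
 by (subst proots_prod) (auto simp: sum_unfold_sum_mset)

text \<open>The polynomials agree at infinitely many points, for instance on the positive imaginary
  integers.\<close>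

lemma prod_linear_eqI:
 fixes l m :: "nat => complex"
 assumes "\<And>z. Im z ~= 0 ==> (\<Prod>j<n. z - l j) = (\<Prod>j<n. z - m j)"
 shows "(\<Prod>j<n. [:- l j, 1:]) = (\<Prod>j<n. [:- m j, 1:])"
proof (rule ccontr)
 let ?P = "(\<Prod>j<n. [:- l j, 1:]) - (\<Prod>j<n. [:- m j, 1:])"
 assume "(\<Prod>j<n. [:- l j, 1:]) ~= (\<Prod>j<n. [:- m j, 1:])"
 then have "finite {z. poly ?P z = 0}" by (intro poly_roots_finite) simp
 moreover have "range (\<lambda>k. Complex 0 (real (Suc k))) \<subseteq> {z. poly ?P z = 0}"
  using assms by (auto simp: poly_prod)
 ultimately have "finite (range (\<lambda>k. Complex 0 (real (Suc k))))" by (rule rev_finite_subset)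
 moreover have "inj (\<lambda>k. Complex 0 (real (Suc k)))" by (auto simp: inj_on_def)
 ultimately show False using finite_imageD infinite_UNIV_nat by blast
qed

lemma prod_roots_cong:
 fixes l m :: "nat => complex" and g :: "complex => 'a::comm_monoid_mult"
 assumes "(\<Prod>j<n. [:- l j, 1:]) = (\<Prod>j<n. [:- m j, 1:])"
 shows "(\<Prod>j<n. g (l j)) = (\<Prod>j<n. g (m j))"
proof -
 have "image_mset l (mset_set {..<n}) = image_mset m (mset_set {..<n})"
  using assms by (metis proots_prod_linear)
 then have "prod_mset (image_mset g (image_mset l (mset_set {..<n}))) = prod_mset (image_mset g (image_mset m (mset_set {..<n})))"
  by simp
 then show ?thesis by (simp add: prod_unfold_prod_mset multiset.map_comp o_def)
qed

lemma spectral_prod_roots: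
 fixes A :: "complex ^ 'p ^ 'p"
 assumes "charpoly A = (\<Prod>j<CARD('p). [:- m j, 1:])"
 shows "spectral_prod G A = (\<Prod>j<CARD('p). G (Re (m j)))"
 unfolding spectral_prod_def assms proots_prod_linear
 by (simp add: prod_unfold_prod_mset multiset.map_comp o_def)

lemma spectral_prod_eqI:
 fixes A :: "complex ^ 'p ^ 'p"
 assumes "\<And>z. Im z ~= 0 ==> det (\<chi> i j. (if i = j then z else 0) - A $ i $ j) = (\<Prod>j<CARD('p). z - m j)"
 shows "spectral_prod G A = (\<Prod>j<CARD('p). G (Re (m j)))"
proof -
 obtain m' where m': "charpoly A = (\<Prod>j<CARD('p). [:- m' j, 1:])" using charpoly_roots_exist by blast
 have "(\<Prod>j<CARD('p). [:- m' j, 1:]) = (\<Prod>j<CARD('p). [:- m j, 1:])"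
  by (rule prod_linear_eqI) (use assms in \<open>simp add: poly_charpoly[symmetric] m' poly_prod\<close>)
 then show ?thesis using m' by (intro spectral_prod_roots) simp
qed

text \<open>In the row of the largest coordinate of a kernel vector, the eigenvalue equation bounds
  \<open>z\<close> by a row sum.\<close>

lemma charpoly_root_bound:
 fixes A :: "complex ^ 'p ^ 'p"
 assumes "poly (charpoly A) z = 0"
 shows "cmod z <= (\<Sum>i\<in>UNIV. \<Sum>j\<in>UNIV. cmod (A $ i $ j))"
proof -
 define M where "M = (\<chi> i j. (if i = j then z else 0) - A $ i $ j)"
 have "det M = 0" using assms by (simp add: poly_charpoly M_def)
 then have "\<not> invertible M" by (simp add: invertible_det_nz)
 then have "\<not> (\<exists>B. B ** M = mat 1)" using invertible_left_inverse by blast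
 then obtain v where v: "M *v v = 0" "v ~= 0" unfolding matrix_left_invertible_ker by blast
 obtain i where i: "\<And>j. cmod (v $ j) <= cmod (v $ i)"
 proof -
  have f: "finite (range (\<lambda>j. cmod (v $ j)))" by simp
  have "Max (range (\<lambda>j. cmod (v $ j))) \<in> range (\<lambda>j. cmod (v $ j))" by (rule Max_in) auto
  then obtain i where "Max (range (\<lambda>j. cmod (v $ j))) = cmod (v $ i)" by blast
  then show ?thesis using that[of i] Max_ge[OF f] by force
 qed
 have vi: "0 < cmod (v $ i)"
 proof (rule ccontr)
  assume "\<not> 0 < cmod (v $ i)"
  then have "v $ j = 0" for j using i[of j] by simp
  then show False using v(2) by (simp add: Finite_Cartesian_Product.vec_eq_iff)
 qed
 have "(\<Sum>j\<in>UNIV. ((if i = j then z else 0) - A $ i $ j) * v $ j) = 0"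
  using arg_cong[OF v(1), of "\<lambda>x. x $ i"] by (simp add: M_def matrix_vector_mult_def)
 then have "z * v $ i = (\<Sum>j\<in>UNIV. A $ i $ j * v $ j)"
  by (simp add: left_diff_distrib sum_subtractf if_distrib[of "\<lambda>x. x * _"] cong: if_cong)
 then have "cmod z * cmod (v $ i) <= (\<Sum>j\<in>UNIV. cmod (A $ i $ j) * cmod (v $ j))"
  by (metis (no_types, lifting) norm_mult norm_sum sum.cong)
 also have "... <= (\<Sum>j\<in>UNIV. cmod (A $ i $ j) * cmod (v $ i))" by (intro sum_mono mult_left_mono i) auto
 also have "... = (\<Sum>j\<in>UNIV. cmod (A $ i $ j)) * cmod (v $ i)" by (simp add: sum_distrib_right)
 finally have "cmod z <= (\<Sum>j\<in>UNIV. cmod (A $ i $ j))" using vi by simp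
 also have "... <= (\<Sum>i\<in>UNIV. \<Sum>j\<in>UNIV. cmod (A $ i $ j))"
  by (rule member_le_sum[of i UNIV "\<lambda>i. \<Sum>j\<in>UNIV. cmod (A $ i $ j)"]) (auto intro: sum_nonneg)
 finally show ?thesis .
qed

text \<open>The roots need not converge one by one. From a subsequence violating the limit a further
  one with convergent roots is extracted, and their limits are the \<open>m j\<close> up to order,
  because the products agree off the real axis.\<close>

lemma prod_roots_limit:
 fixes l :: "nat => nat => complex" and g :: "complex => 'a::real_normed_field"
 assumes bd: "\<And>k j. j < n ==> cmod (l k j) <= B"
  and lim: "\<And>z. Im z ~= 0 ==> (\<lambda>k. \<Prod>j<n. z - l k j) \<longlonglongrightarrow> (\<Prod>j<n. z - m j)"
  and g: "continuous_on UNIV g"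
 shows "(\<lambda>k. \<Prod>j<n. g (l k j)) \<longlonglongrightarrow> (\<Prod>j<n. g (m j))"
proof (rule ccontr)
 assume "\<not> ?thesis"
 then obtain e where e: "0 < e" "\<not> eventually (\<lambda>k. dist (\<Prod>j<n. g (l k j)) (\<Prod>j<n. g (m j)) < e) sequentially"
  unfolding tendsto_iff by blast
 have "infinite {k. \<not> dist (\<Prod>j<n. g (l k j)) (\<Prod>j<n. g (m j)) < e}"
  using e(2) unfolding cofinite_eq_sequentially[symmetric] eventually_cofinite .
 then obtain s :: "nat => nat" where s: "strict_mono s" "\<And>k. s k \<in> {k. \<not> dist (\<Prod>j<n. g (l k j)) (\<Prod>j<n. g (m j)) < e}"
  using infinite_enumerate by blast
 have "\<exists>l' r. strict_mono r \<and> (\<forall>j<n. (\<lambda>k. l (s (r k)) j) \<longlonglongrightarrow> l' j)"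
  by (rule bounded_tuple_subseq[of n "\<lambda>k j. l (s k) j"]) (auto intro!: boundedI bd)
 then obtain l' r where r: "strict_mono r" "\<And>j. j < n ==> (\<lambda>k. l (s (r k)) j) \<longlonglongrightarrow> l' j" by blast
 have eq: "(\<Prod>j<n. z - l' j) = (\<Prod>j<n. z - m j)" if "Im z ~= 0" for z
 proof (rule LIMSEQ_unique)
  show "(\<lambda>k. \<Prod>j<n. z - l (s (r k)) j) \<longlonglongrightarrow> (\<Prod>j<n. z - l' j)"
   by (rule tendsto_prod, rule tendsto_diff[OF tendsto_const r(2)]) simp
  show "(\<lambda>k. \<Prod>j<n. z - l (s (r k)) j) \<longlonglongrightarrow> (\<Prod>j<n. z - m j)"
   using LIMSEQ_subseq_LIMSEQ[OF lim[OF that] strict_mono_o[OF s(1) r(1)]] by (simp add: o_def)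
 qed
 have "(\<Prod>j<n. g (l' j)) = (\<Prod>j<n. g (m j))" by (rule prod_roots_cong[OF prod_linear_eqI[OF eq]])
 moreover have "(\<lambda>k. \<Prod>j<n. g (l (s (r k)) j)) \<longlonglongrightarrow> (\<Prod>j<n. g (l' j))"
 proof (rule tendsto_prod)
  fix j assume "j \<in> {..<n}"
  then have "(\<lambda>k. l (s (r k)) j) \<longlonglongrightarrow> l' j" using r by simp
  moreover have "isCont g (l' j)" using g by (simp add: continuous_on_eq_continuous_at)
  ultimately show "(\<lambda>k. g (l (s (r k)) j)) \<longlonglongrightarrow> g (l' j)" by (rule isCont_tendsto_compose[rotated])
 qed
 ultimately have "eventually (\<lambda>k. dist (\<Prod>j<n. g (l (s (r k)) j)) (\<Prod>j<n. g (m j)) < e) sequentially"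
  using e(1) by (simp add: tendsto_iff)
 then obtain k where "dist (\<Prod>j<n. g (l (s (r k)) j)) (\<Prod>j<n. g (m j)) < e"
  unfolding eventually_sequentially by blast
 then show False using s(2)[of "r k"] by simp
qed

lemma continuous_spectral_prod:
 fixes G :: "real => real"
 assumes "continuous_on UNIV G"
 shows "continuous_on UNIV (spectral_prod G :: complex ^ 'p ^ 'p => real)"
proof (rule continuous_on_sequentiallyI)
 fix u :: "nat => complex ^ 'p ^ 'p" and A assume u: "u \<longlonglongrightarrow> A"
 have "\<forall>k. \<exists>l. charpoly (u k) = (\<Prod>j<CARD('p). [:- l j, 1:])" using charpoly_roots_exist by blast
 then obtain l where l: "\<And>k. charpoly (u k) = (\<Prod>j<CARD('p). [:- l k j, 1:])" unfolding choice_iff by blast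
 obtain m where m: "charpoly A = (\<Prod>j<CARD('p). [:- m j, 1:])" using charpoly_roots_exist by blast
 have en: "(\<lambda>k. u k $ i $ j) \<longlonglongrightarrow> A $ i $ j" for i j by (intro tendsto_vec_nth u)
 have "(\<lambda>k. \<Sum>i\<in>UNIV. \<Sum>j\<in>UNIV. cmod (u k $ i $ j)) \<longlonglongrightarrow> (\<Sum>i\<in>UNIV. \<Sum>j\<in>UNIV. cmod (A $ i $ j))"
  by (intro tendsto_intros en)
 then have "Bseq (\<lambda>k. \<Sum>i\<in>UNIV. \<Sum>j\<in>UNIV. cmod (u k $ i $ j))" by (rule convergent_imp_Bseq[OF convergentI])
 then obtain B where B: "\<And>k. norm (\<Sum>i\<in>UNIV. \<Sum>j\<in>UNIV. cmod (u k $ i $ j)) <= B" unfolding Bseq_def by blast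
 have lB: "cmod (l k j) <= B" if "j < CARD('p)" for k j
 proof -
  have "poly (charpoly (u k)) (l k j) = 0" unfolding l poly_prod using that by (auto intro!: prod_zero)
  then have "cmod (l k j) <= (\<Sum>i\<in>UNIV. \<Sum>j\<in>UNIV. cmod (u k $ i $ j))" by (rule charpoly_root_bound)
  also have "... <= B" using B[of k] by simp
  finally show ?thesis .
 qed
 have "(\<lambda>k. \<Prod>j<CARD('p). (\<lambda>z. G (Re z)) (l k j)) \<longlonglongrightarrow> (\<Prod>j<CARD('p). (\<lambda>z. G (Re z)) (m j))"
 proof (rule prod_roots_limit[OF lB])
  fix z :: complex
  have pl: "poly (\<Prod>j<CARD('p). [:- x j, 1:]) z = (\<Prod>j<CARD('p). z - x j)" for x by (simp add: poly_prod)
  have "(\<lambda>k. poly (charpoly (u k)) z) \<longlonglongrightarrow> poly (charpoly A) z"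
   unfolding poly_charpoly
  proof (rule tendsto_det)
   fix i j
   have "(\<lambda>k. (if i = j then z else 0) - u k $ i $ j) \<longlonglongrightarrow> (if i = j then z else 0) - A $ i $ j"
    by (rule tendsto_diff[OF tendsto_const en])
   then show "(\<lambda>k. (\<chi> i j. (if i = j then z else 0) - u k $ i $ j) $ i $ j) \<longlonglongrightarrow> (\<chi> i j. (if i = j then z else 0) - A $ i $ j) $ i $ j"
    by (simp only: vec_lambda_beta)
  qed
  then show "(\<lambda>k. \<Prod>j<CARD('p). z - l k j) \<longlonglongrightarrow> (\<Prod>j<CARD('p). z - m j)" by (simp only: l m pl)
  show "continuous_on UNIV (\<lambda>z. G (Re z))"
   by (rule continuous_on_compose2[OF assms]) (auto intro!: continuous_intros)
 qed
 then show "(\<lambda>k. spectral_prod G (u k)) \<longlonglongrightarrow> spectral_prod G A" by (simp add: spectral_prod_roots[OF l] spectral_prod_roots[OF m])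
qed

lemma measurable_spectral_prod [measurable]:
 "continuous_on UNIV G ==> spectral_prod G \<in> borel_measurable borel"
 by (intro borel_measurable_continuous_onI continuous_spectral_prod)

lemma nth_sorted_greater:
 fixes ys :: "real list"
 assumes "sorted_wrt (\<ge>) ys" "i < length ys"
 shows "t < ys ! i \<longleftrightarrow> i < length (filter (\<lambda>x. t < x) ys)"
 using assms
proof (induction ys arbitrary: i)
 case (Cons y ys)
 show ?case
 proof (cases "t < y")
  case True
  then show ?thesis using Cons by (cases i) auto
 next
  case False
  then have "filter (\<lambda>x. t < x) ys = []" using Cons.prems(1) by (auto simp: filter_empty_conv)
  moreover have "(y # ys) ! i <= y" using Cons.prems by (cases i) auto
  ultimately show ?thesis using False by simp
 qed
qed simp

lemma size_proots_charpoly: "size (proots (charpoly (A :: complex ^ 'p ^ 'p))) = CARD('p)"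
proof -
 obtain m where "charpoly A = (\<Prod>j<CARD('p). [:- m j, 1:])" using charpoly_roots_exist by blast
 then show ?thesis by (simp add: proots_prod_linear)
qed

text \<open>The exponent of 2 counts the eigenvalues above \<open>t\<close>, which turns an order
  statistic into a symmetric function.\<close>

lemma nth_largest_eigenvalue_greater:
 fixes A :: "complex ^ 'p ^ 'p"
 assumes "j \<in> {1..CARD('p)}"
 shows "t < nth_largest_eigenvalue A j \<longleftrightarrow> 2 ^ j <= spectral_prod (\<lambda>x. if t < x then 2 else 1) A"
proof -
 define N where "N = image_mset Re (proots (charpoly A))"
 have s: "size N = CARD('p)" by (simp add: N_def size_proots_charpoly)
 define ys where "ys = rev (sorted_list_of_multiset N)"
 have ys: "mset ys = N" "sorted_wrt (\<ge>) ys" unfolding ys_def by (simp_all add: sorted_wrt_rev)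
 then have len: "length ys = CARD('p)" using s by (metis size_mset)
 have "spectral_prod (\<lambda>x. if t < x then 2 else 1) A = (\<Prod>x\<in>#mset ys. if t < x then 2 else 1)"
  by (simp add: spectral_prod_def ys N_def multiset.map_comp o_def)
 also have "... = 2 ^ length (filter (\<lambda>x. t < x) ys)" by (induction ys) auto
 finally have "2 ^ j <= spectral_prod (\<lambda>x. if t < x then 2 else 1) A \<longleftrightarrow> j <= length (filter (\<lambda>x. t < x) ys)" by simp
 moreover have "t < ys ! (j - 1) \<longleftrightarrow> j - 1 < length (filter (\<lambda>x. t < x) ys)"
  using assms len by (intro nth_sorted_greater ys(2)) auto
 moreover have "nth_largest_eigenvalue A j = ys ! (j - 1)" by (simp add: nth_largest_eigenvalue_def ys_def N_def)
 ultimately show ?thesis using assms by auto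
qed

lemma prod_nth_largest_eigenvalue:
 fixes A :: "complex ^ 'p ^ 'p"
 shows "(\<Prod>j=1..CARD('p). G (nth_largest_eigenvalue A j)) = spectral_prod G A"
proof -
 define N where "N = image_mset Re (proots (charpoly A))"
 define ys where "ys = rev (sorted_list_of_multiset N)"
 have ys: "mset ys = N" unfolding ys_def by simp
 then have len: "length ys = CARD('p)" by (metis N_def size_image_mset size_mset size_proots_charpoly)
 have "(\<Prod>j=1..CARD('p). G (nth_largest_eigenvalue A j)) = (\<Prod>j=1..CARD('p). G (ys ! (j - 1)))"
  by (simp add: nth_largest_eigenvalue_def ys_def N_def)
 also have "... = (\<Prod>j<CARD('p). G (ys ! j))"
  by (rule prod.reindex_bij_witness[of _ Suc "\<lambda>j. j - 1"]) auto
 also have "... = prod_list (map G ys)" by (simp add: prod.list_conv_set_nth len atLeast0LessThan)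
 also have "... = (\<Prod>x\<in>#mset ys. G x)" by (simp add: prod_mset_prod_list flip: mset_map)
 also have "... = spectral_prod G A" by (simp add: spectral_prod_def ys N_def multiset.map_comp o_def)
 finally show ?thesis .
qed

text \<open>The step function of \<open>nth_largest_eigenvalue_greater\<close> is a pointwise limit
  of the continuous ramps \<open>\<phi> k\<close>, for which the spectral product is
  continuous.\<close>

lemma borel_measurable_nth_largest_eigenvalue:
 assumes "j \<in> {1..CARD('p)}"
 shows "(\<lambda>A :: complex ^ 'p ^ 'p. nth_largest_eigenvalue A j) \<in> borel_measurable borel"
proof (rule borel_measurableI_greater)
 fix t :: real
 define \<phi> where "\<phi> k x = 1 + min 1 (max 0 (real k * (x - t)))" for k x
 have lim1: "(\<lambda>k. \<phi> k x) \<longlonglongrightarrow> (if t < x then 2 else 1)" for x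
 proof (cases "t < x")
  case True
  obtain K where K: "1 / (x - t) < real K" using reals_Archimedean2 by blast
  have "\<phi> k x = 2" if "K <= k" for k
  proof -
   have "1 <= real K * (x - t)" using K True by (simp add: divide_simps split: if_splits)
   also have "... <= real k * (x - t)" using that True by (intro mult_right_mono) auto
   finally show ?thesis by (simp add: \<phi>_def)
  qed
  then have "eventually (\<lambda>k. \<phi> k x = 2) sequentially" by (auto simp: eventually_sequentially)
  then show ?thesis using True by (simp add: tendsto_eventually)
 next
  case False
  then have "\<phi> k x = 1" for k by (simp add: \<phi>_def mult_nonneg_nonpos)
  then show ?thesis using False by simp
 qed
 have "(\<lambda>k. spectral_prod (\<phi> k) A) \<longlonglongrightarrow> spectral_prod (\<lambda>x. if t < x then 2 else 1) A" for A :: "complex ^ 'p ^ 'p"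
 proof -
  obtain m where m: "charpoly A = (\<Prod>j<CARD('p). [:- m j, 1:])" using charpoly_roots_exist by blast
  show ?thesis unfolding spectral_prod_roots[OF m] by (intro tendsto_prod lim1)
 qed
 moreover have "spectral_prod (\<phi> k) \<in> borel_measurable (borel :: (complex ^ 'p ^ 'p) measure)" for k
  by (rule measurable_spectral_prod) (auto simp: \<phi>_def intro!: continuous_intros)
 ultimately have [measurable]: "spectral_prod (\<lambda>x. if t < x then 2 else 1) \<in> borel_measurable (borel :: (complex ^ 'p ^ 'p) measure)"
  by (rule borel_measurable_LIMSEQ_real)
 show "{A \<in> space (borel :: (complex ^ 'p ^ 'p) measure). t < nth_largest_eigenvalue A j} \<in> sets borel"
  unfolding nth_largest_eigenvalue_greater[OF assms] by measurable
qed

definition gram_rows :: "nat => ('p::finite => nat => complex) => complex^'p^'p" where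
 "gram_rows n X = (\<chi> i j. \<Sum>k<n. X i k * cnj (X j k))"

section \<open>Diagonalization and complex Wishart matrices\<close>

lemma measurable_PiM_PiM_component:
 assumes "i \<in> I" "k \<in> J"
 shows "(\<lambda>x. x i k) \<in> PiM I (\<lambda>i. PiM J (N i)) \<rightarrow>\<^sub>M N i k"
 by (rule measurable_compose[OF measurable_component_singleton[OF assms(1)] measurable_component_singleton[OF assms(2)]])

text \<open>As for unitary maps of product spaces: the double integral of
  \<open>g y * F (y + T x)\<close> is evaluated in two ways by translation invariance, here with the
  unit ball as the invariant test function.\<close>

lemma lborel_isometry_nn_integral:
 fixes T U :: "'a::euclidean_space => 'a"
 assumes T: "linear T" and U: "linear U" and TU: "\<And>x. T (U x) = x" and n: "\<And>x. norm (T x) = norm x"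
  and F[measurable]: "F \<in> borel_measurable borel"
 shows "(\<integral>\<^sup>+x. F (T x) \<partial>lborel) = (\<integral>\<^sup>+x. F x \<partial>lborel)"
proof -
 define g :: "'a => ennreal" where "g = indicator (ball 0 1)"
 define C where "C = (\<integral>\<^sup>+x. g x \<partial>lborel)"
 have [measurable]: "T \<in> borel_measurable borel" using T by (intro borel_measurable_continuous_onI linear_continuous_on) (simp add: linear_conv_bounded_linear)
 have gm[measurable]: "g \<in> borel_measurable borel" unfolding g_def by (rule borel_measurable_indicator) simp
 have CE: "C = emeasure lborel (ball (0::'a) 1)" by (simp add: C_def g_def)
 have "0 < measure lborel (ball (0::'a) 1)" using content_ball_pos[of 1 "0::'a"] by simp
 then have C: "C ~= 0" "C ~= \<infinity>" unfolding CE by (auto simp: measure_def)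
 have tr: "(\<integral>\<^sup>+y. H (a + y) \<partial>lborel) = (\<integral>\<^sup>+y. H y \<partial>lborel)" if "H \<in> borel_measurable borel" for H and a :: 'a
  by (rule lborel_translation_nn_integral[OF that])
 have Tadd: "T (U y + x) = y + T x" for x y by (simp add: linear_add[OF T] TU)
 have "C * (\<integral>\<^sup>+x. F (T x) \<partial>lborel) = (\<integral>\<^sup>+y. g y * (\<integral>\<^sup>+x. F (T x) \<partial>lborel) \<partial>lborel)"
  unfolding C_def by (rule nn_integral_multc[symmetric]) simp
 also have "... = (\<integral>\<^sup>+y. \<integral>\<^sup>+x. g y * F (y + T x) \<partial>lborel \<partial>lborel)"
 proof (rule nn_integral_cong)
  fix y
  have "(\<integral>\<^sup>+x. F (T x) \<partial>lborel) = (\<integral>\<^sup>+x. F (T (U y + x)) \<partial>lborel)" by (rule tr[symmetric]) measurable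
  also have "... = (\<integral>\<^sup>+x. F (y + T x) \<partial>lborel)" by (simp only: Tadd)
  finally show "g y * (\<integral>\<^sup>+x. F (T x) \<partial>lborel) = (\<integral>\<^sup>+x. g y * F (y + T x) \<partial>lborel)"
   by (simp add: nn_integral_cmult)
 qed
 also have "... = (\<integral>\<^sup>+x. \<integral>\<^sup>+y. g y * F (y + T x) \<partial>lborel \<partial>lborel)"
  by (rule lborel_pair.Fubini') measurable
 also have "... = (\<integral>\<^sup>+x. \<integral>\<^sup>+y. g (y - T x) * F y \<partial>lborel \<partial>lborel)"
 proof (rule nn_integral_cong)
  fix x
  have "(\<integral>\<^sup>+y. g ((T x + y) - T x) * F (T x + y) \<partial>lborel) = (\<integral>\<^sup>+y. g (y - T x) * F y \<partial>lborel)" by (rule tr) measurable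
  then show "(\<integral>\<^sup>+y. g y * F (y + T x) \<partial>lborel) = (\<integral>\<^sup>+y. g (y - T x) * F y \<partial>lborel)" by (simp add: add.commute)
 qed
 also have "... = (\<integral>\<^sup>+y. \<integral>\<^sup>+x. g (y - T x) * F y \<partial>lborel \<partial>lborel)"
  by (rule lborel_pair.Fubini') measurable
 also have "... = (\<integral>\<^sup>+y. C * F y \<partial>lborel)"
 proof (rule nn_integral_cong)
  fix y
  have "(\<integral>\<^sup>+x. g (y - T x) \<partial>lborel) = (\<integral>\<^sup>+x. g (y - T (U y + x)) \<partial>lborel)" by (rule tr[symmetric]) measurable
  also have "... = C" unfolding C_def by (rule nn_integral_cong) (simp add: Tadd g_def indicator_def n)
  finally have "(\<integral>\<^sup>+x. g (y - T x) \<partial>lborel) = C" .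
  then show "(\<integral>\<^sup>+x. g (y - T x) * F y \<partial>lborel) = C * F y" by (simp add: nn_integral_multc)
 qed
 also have "... = C * (\<integral>\<^sup>+y. F y \<partial>lborel)" by (rule nn_integral_cmult) measurable
 finally show ?thesis using C by (simp add: ennreal_mult_cancel_left)
qed

lemma measurable_vec_lambda:
 "(\<lambda>f. \<chi> i. f i) \<in> PiM UNIV (\<lambda>_::'p::finite. borel :: complex measure) \<rightarrow>\<^sub>M (borel :: (complex^'p) measure)"
proof (subst borel_measurable_euclidean_space, rule ballI)
 fix b :: "complex ^ 'p" assume "b \<in> Basis"
 then obtain i c where "b = axis i c" by (auto simp: Basis_vec_def)
 then have b: "(\<chi> i. f i) \<bullet> b = f i \<bullet> c" for f by (simp add: inner_axis)
 show "(\<lambda>f. (\<chi> i. f i) \<bullet> b) \<in> borel_measurable (PiM UNIV (\<lambda>_. borel))"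
  unfolding b by measurable
qed

lemma prod_Basis_vec:
 fixes h :: "complex^'p => real"
 shows "(\<Prod>b\<in>Basis. h b) = (\<Prod>i\<in>UNIV. \<Prod>c\<in>Basis. h (axis i c))"
proof -
 have "bij_betw (\<lambda>(i, c). axis i c) (UNIV \<times> Basis) (Basis :: (complex^'p) set)"
  by (auto simp: bij_betw_def inj_on_def Basis_vec_def axis_eq_axis)
 from prod.reindex_bij_betw[OF this, of h] show ?thesis
  by (simp add: prod.cartesian_product split_beta)
qed

lemma nn_integral_lborel_vec:
 fixes F :: "complex^'p => ennreal"
 assumes "F \<in> borel_measurable borel"
 shows "(\<integral>\<^sup>+x. F x \<partial>lborel) = (\<integral>\<^sup>+f. F (\<chi> i. f i) \<partial>PiM UNIV (\<lambda>_::'p. lborel))"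
proof -
 let ?P = "PiM UNIV (\<lambda>_::'p. lborel :: complex measure)"
 interpret product_sigma_finite "\<lambda>_::'p. lborel :: complex measure" by standard
 have sP: "sets ?P = sets (PiM UNIV (\<lambda>_::'p. borel :: complex measure))" by (intro sets_PiM_cong) auto
 have m: "(\<lambda>f. \<chi> i. f i) \<in> ?P \<rightarrow>\<^sub>M (borel :: (complex^'p) measure)"
  using measurable_vec_lambda by (simp only: measurable_cong_sets[OF sP refl])
 have eq: "lborel = distr ?P borel (\<lambda>f. \<chi> i. f i)"
 proof (rule lborel_eqI)
  fix l u :: "complex^'p" assume lu: "\<And>b. b \<in> Basis ==> l \<bullet> b <= u \<bullet> b"
  have le: "l $ i \<bullet> c <= u $ i \<bullet> c" if "c \<in> Basis" for i c
   using lu[of "axis i c"] that by (auto simp: Basis_vec_def inner_axis)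
  have mb: "(\<chi> i. f i) \<in> box l u \<longleftrightarrow> (\<forall>i. f i \<in> box (l $ i) (u $ i))" for f
   by (auto simp: mem_box Basis_vec_def inner_axis)
  have "(\<lambda>f. \<chi> i. f i) -` box l u \<inter> space ?P = Pi\<^sub>E UNIV (\<lambda>i. box (l $ i) (u $ i))"
   by (auto simp: space_PiM mb PiE_UNIV_domain Pi_iff)
  then have "emeasure (distr ?P borel (\<lambda>f. \<chi> i. f i)) (box l u) = emeasure ?P (Pi\<^sub>E UNIV (\<lambda>i. box (l $ i) (u $ i)))"
   by (subst emeasure_distr[OF m]) auto
  also have "... = (\<Prod>i\<in>UNIV. emeasure lborel (box (l $ i) (u $ i)))" by (rule emeasure_PiM) auto
  also have "... = (\<Prod>i\<in>UNIV. ennreal (\<Prod>c\<in>Basis. (u $ i - l $ i) \<bullet> c))" by (simp only: emeasure_lborel_box[OF le])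
  also have "... = ennreal (\<Prod>i\<in>UNIV. \<Prod>c\<in>Basis. (u $ i - l $ i) \<bullet> c)"
   by (rule prod_ennreal) (auto intro!: prod_nonneg simp: inner_diff_left le)
  also have "(\<Prod>i\<in>UNIV. \<Prod>c\<in>Basis. (u $ i - l $ i) \<bullet> c) = (\<Prod>b\<in>Basis. (u - l) \<bullet> b)"
   by (simp add: prod_Basis_vec inner_axis)
  finally show "emeasure (distr ?P borel (\<lambda>f. \<chi> i. f i)) (box l u) = ennreal (\<Prod>b\<in>Basis. (u - l) \<bullet> b)" .
 qed simp
 show ?thesis by (subst eq, subst nn_integral_distr[OF m]) (use assms in simp_all)
qed

text \<open>Integrating out one index \<open>k0\<close> replaces each factor \<open>\<phi> j\<close>
  by its own partial integral, as coordinates with different \<open>j\<close> are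
  independent.\<close>

lemma nn_integral_prod_transpose:
 fixes N :: "'j => 'b measure" and \<phi> :: "'j => ('i => 'b) => ennreal"
 assumes N: "\<And>j. prob_space (N j)" and "finite I" and J: "finite J"
  and "\<And>j. j \<in> J ==> \<phi> j \<in> borel_measurable (PiM I (\<lambda>_. N j))"
 shows "(\<integral>\<^sup>+x. (\<Prod>j\<in>J. \<phi> j (\<lambda>k\<in>I. x k j)) \<partial>PiM I (\<lambda>_. PiM J N)) = (\<Prod>j\<in>J. \<integral>\<^sup>+r. \<phi> j r \<partial>PiM I (\<lambda>_. N j))"
 using assms(2,4)
proof (induction I arbitrary: \<phi> rule: finite_induct)
 case empty
 have [simp]: "space (PiM {} M) = {\<lambda>_. undefined}" for M :: "'i => 'c measure" by (simp add: space_PiM)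
 show ?case by (simp add: PiM_empty nn_integral_count_space_finite)
next
 case (insert k0 I)
 interpret N: prob_space "N j" for j by (rule N)
 interpret NJ: product_sigma_finite N by standard
 interpret PJ: prob_space "PiM J N" by (rule prob_space_PiM) (rule N)
 interpret II: product_sigma_finite "\<lambda>_::'i. PiM J N" by standard
 interpret Nj: product_sigma_finite "\<lambda>_::'i. N j" for j by standard
 let ?Q = "\<lambda>I. PiM I (\<lambda>_::'i. PiM J N)"
 have upd: "(\<lambda>k\<in>insert k0 I. (x(k0 := y)) k j) = (\<lambda>k\<in>I. x k j)(k0 := y j)" for x :: "'i => 'j => 'b" and y j
  using insert.hyps by (auto simp: fun_eq_iff)
 have rowm: "(\<lambda>x. \<lambda>k\<in>I'. x k j) \<in> ?Q I' \<rightarrow>\<^sub>M PiM I' (\<lambda>_. N j)" if "j \<in> J" for j I'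
  by (rule measurable_restrict, rule measurable_PiM_PiM_component) (use that in auto)
 have \<phi>r: "(\<lambda>x. \<phi> j (\<lambda>k\<in>insert k0 I. x k j)) \<in> borel_measurable (?Q (insert k0 I))" if "j \<in> J" for j
  by (rule measurable_compose[OF rowm[OF that] insert.prems[OF that]])
 have \<phi>c: "(\<lambda>y. \<phi> j (r(k0 := y))) \<in> borel_measurable (N j)" if "j \<in> J" "r \<in> space (PiM I (\<lambda>_. N j))" for j r
  by (rule measurable_compose[OF _ insert.prems[OF that(1)]]) (rule measurable_component_update[OF that(2) insert.hyps(2)])
 define \<psi> where "\<psi> j r = (\<integral>\<^sup>+y. \<phi> j (r(k0 := y)) \<partial>N j)" for j r
 have \<psi>m: "\<psi> j \<in> borel_measurable (PiM I (\<lambda>_. N j))" if "j \<in> J" for j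
  unfolding \<psi>_def
 proof (rule N.borel_measurable_nn_integral)
  have "(\<lambda>z. (fst z)(k0 := snd z)) \<in> PiM I (\<lambda>_. N j) \<Otimes>\<^sub>M N j \<rightarrow>\<^sub>M PiM (insert k0 I) (\<lambda>_. N j)"
   using measurable_add_dim[of k0 I "\<lambda>_. N j"] by (simp only: split_beta')
  from measurable_compose[OF this insert.prems[OF that]]
  show "(\<lambda>(r, y). \<phi> j (r(k0 := y))) \<in> borel_measurable (PiM I (\<lambda>_. N j) \<Otimes>\<^sub>M N j)" by (simp only: split_beta')
 qed
 have "(\<integral>\<^sup>+x. (\<Prod>j\<in>J. \<phi> j (\<lambda>k\<in>insert k0 I. x k j)) \<partial>?Q (insert k0 I)) =
  (\<integral>\<^sup>+x. \<integral>\<^sup>+y. (\<Prod>j\<in>J. \<phi> j (\<lambda>k\<in>insert k0 I. (x(k0 := y)) k j)) \<partial>PiM J N \<partial>?Q I)"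
  by (rule II.product_nn_integral_insert[OF insert.hyps]) (intro borel_measurable_prod_ennreal \<phi>r)
 also have "... = (\<integral>\<^sup>+x. (\<Prod>j\<in>J. \<psi> j (\<lambda>k\<in>I. x k j)) \<partial>?Q I)"
 proof (rule nn_integral_cong)
  fix x assume x: "x \<in> space (?Q I)"
  show "(\<integral>\<^sup>+y. (\<Prod>j\<in>J. \<phi> j (\<lambda>k\<in>insert k0 I. (x(k0 := y)) k j)) \<partial>PiM J N) = (\<Prod>j\<in>J. \<psi> j (\<lambda>k\<in>I. x k j))"
   unfolding upd \<psi>_def
   by (rule NJ.product_nn_integral_prod[OF J]) (rule \<phi>c, assumption, rule measurable_space[OF rowm x], assumption)
 qed
 also have "... = (\<Prod>j\<in>J. \<integral>\<^sup>+r. \<psi> j r \<partial>PiM I (\<lambda>_. N j))" by (rule insert.IH[OF \<psi>m])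
 also have "... = (\<Prod>j\<in>J. \<integral>\<^sup>+r. \<phi> j r \<partial>PiM (insert k0 I) (\<lambda>_. N j))"
  unfolding \<psi>_def by (intro prod.cong refl Nj.product_nn_integral_insert[OF insert.hyps, symmetric] insert.prems)
 finally show ?case .
qed

text \<open>Wishart matrices are built from independent columns, the recursion from independent
  rows; this exchanges the two for arrays with independent entries.\<close>

lemma distr_PiM_transpose:
 fixes N :: "'j => 'b measure"
 assumes N: "\<And>j. prob_space (N j)" and I: "finite I" and J: "finite J"
 shows "distr (PiM I (\<lambda>_. PiM J N)) (PiM J (\<lambda>j. PiM I (\<lambda>_. N j))) (\<lambda>x. \<lambda>j\<in>J. \<lambda>k\<in>I. x k j) = PiM J (\<lambda>j. PiM I (\<lambda>_. N j))"
  (is "distr ?Q ?R ?t = _")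
proof -
 interpret P: prob_space "PiM I (\<lambda>_. N j)" for j by (rule prob_space_PiM) (rule N)
 interpret R: product_sigma_finite "\<lambda>j. PiM I (\<lambda>_. N j)" by standard
 have tm: "?t \<in> ?Q \<rightarrow>\<^sub>M ?R"
  by (rule measurable_restrict, rule measurable_restrict, rule measurable_PiM_PiM_component) auto
 show ?thesis
 proof (rule R.PiM_eqI[OF J])
  fix A assume A: "\<And>j. j \<in> J ==> A j \<in> sets (PiM I (\<lambda>_. N j))"
  have AJ: "Pi\<^sub>E J A \<in> sets ?R" using A J by (intro sets_PiM_I_finite) auto
  have "emeasure (distr ?Q ?R ?t) (Pi\<^sub>E J A) = (\<integral>\<^sup>+x. indicator (Pi\<^sub>E J A) (?t x) \<partial>?Q)"
   using AJ nn_integral_distr[OF tm, of "indicator (Pi\<^sub>E J A)"] by simp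
  also have "... = (\<integral>\<^sup>+x. (\<Prod>j\<in>J. indicator (A j) (\<lambda>k\<in>I. x k j)) \<partial>?Q)"
  proof (rule nn_integral_cong)
   fix x
   show "indicator (Pi\<^sub>E J A) (?t x) = (\<Prod>j\<in>J. indicator (A j) (\<lambda>k\<in>I. x k j) :: ennreal)"
   proof (cases "\<forall>j\<in>J. (\<lambda>k\<in>I. x k j) \<in> A j")
    case True
    then have "?t x \<in> Pi\<^sub>E J A" by auto
    then show ?thesis using True by simp
   next
    case False
    then obtain j where j: "j \<in> J" "(\<lambda>k\<in>I. x k j) \<notin> A j" by blast
    then have "?t x \<notin> Pi\<^sub>E J A" by (auto simp: PiE_iff)
    moreover have "(\<Prod>j\<in>J. indicator (A j) (\<lambda>k\<in>I. x k j) :: ennreal) = 0" using j J by force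
    ultimately show ?thesis by simp
   qed
  qed
  also have "... = (\<Prod>j\<in>J. \<integral>\<^sup>+r. indicator (A j) r \<partial>PiM I (\<lambda>_. N j))"
   by (rule nn_integral_prod_transpose[OF N I J]) (use A in auto)
  also have "... = (\<Prod>j\<in>J. emeasure (PiM I (\<lambda>_. N j)) (A j))" using A by (intro prod.cong) auto
  finally show "emeasure (distr ?Q ?R ?t) (Pi\<^sub>E J A) = (\<Prod>j\<in>J. emeasure (PiM I (\<lambda>_. N j)) (A j))" .
 qed simp
qed

section \<open>Unitary diagonalization of Hermitian matrices\<close>

definition cinner :: "complex^'p => complex^'p => complex" where
 "cinner u v = (\<Sum>i\<in>UNIV. cnj (u $ i) * v $ i)"

definition adjoint_mat :: "complex^'p^'p => complex^'p^'p" where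
 "adjoint_mat A = (\<chi> i j. cnj (A $ j $ i))"

lemma inner_cinner: "u \<bullet> v = Re (cinner u v)"
 by (simp add: inner_vec_def cinner_def inner_complex_def)

lemma cinner_self: "cinner u u = of_real ((norm u)\<^sup>2)"
proof -
 have "(norm u)\<^sup>2 = (\<Sum>i\<in>UNIV. (cmod (u $ i))\<^sup>2)" by (simp add: norm_vec_def L2_set_def sum_nonneg)
 then show ?thesis by (simp only: cinner_def of_real_sum complex_norm_square) (simp only: mult.commute)
qed

lemma cinner_adjoint: "cinner (A *v u) v = cinner u (adjoint_mat A *v v)"
proof -
 have "cinner (A *v u) v = (\<Sum>i\<in>UNIV. \<Sum>j\<in>UNIV. cnj (u $ j) * (cnj (A $ i $ j) * v $ i))"
  by (simp add: cinner_def matrix_vector_mult_def sum_distrib_right sum_distrib_left mult_ac)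
 also have "... = cinner u (adjoint_mat A *v v)"
  by (subst sum.swap) (simp add: cinner_def matrix_vector_mult_def adjoint_mat_def sum_distrib_left)
 finally show ?thesis .
qed

lemma cinner_add_right: "cinner u (v + w) = cinner u v + cinner u w"
 by (simp add: cinner_def distrib_left sum.distrib)

lemma cinner_scaleR_right: "cinner u (c *\<^sub>R v) = of_real c * cinner u v"
 unfolding cinner_def vector_scaleR_component by (simp add: sum_distrib_left scaleR_conv_of_real mult_ac)

text \<open>At a maximum of the Rayleigh quotient on the unit sphere of \<open>W\<close>, moving in
  the direction of the defect \<open>w\<close> would increase the quotient to first order unless
  \<open>w = 0\<close>.\<close>

lemma self_adjoint_max_eigenvector:
 fixes T :: "'a::euclidean_space => 'a"
 assumes T: "linear T" and sa: "\<And>u v. T u \<bullet> v = u \<bullet> T v"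
  and W: "subspace W" "\<And>v. v \<in> W ==> T v \<in> W" and v0: "v0 \<in> W" "v0 ~= 0"
 shows "\<exists>v c. v \<in> W \<and> norm v = 1 \<and> T v = c *\<^sub>R v"
proof -
 have cont: "continuous_on A T" for A using T by (simp add: linear_continuous_on linear_conv_bounded_linear)
 have "compact (W \<inter> sphere 0 1)" using closed_subspace[OF W(1)] by (intro closed_Int_compact) auto
 moreover have "W \<inter> sphere 0 1 ~= {}"
 proof -
  have "(1 / norm v0) *\<^sub>R v0 \<in> W \<inter> sphere 0 1" using v0 subspace_scale[OF W(1)] by simp
  then show ?thesis by blast
 qed
 moreover have "continuous_on (W \<inter> sphere 0 1) (\<lambda>v. v \<bullet> T v)" by (intro continuous_intros cont)
 ultimately obtain v where v: "v \<in> W" "norm v = 1" and mx: "\<And>u. u \<in> W ==> norm u = 1 ==> u \<bullet> T u <= v \<bullet> T v"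
  using continuous_attains_sup[of "W \<inter> sphere 0 1" "\<lambda>v. v \<bullet> T v"] by fastforce
 define c where "c = v \<bullet> T v"
 have le: "u \<bullet> T u <= c * (norm u)\<^sup>2" if "u \<in> W" for u
 proof (cases "u = 0")
  case False
  have "((1 / norm u) *\<^sub>R u) \<bullet> T ((1 / norm u) *\<^sub>R u) <= c"
   unfolding c_def by (rule mx) (use False that subspace_scale[OF W(1)] in auto)
  then have "(u \<bullet> T u) / (norm u)\<^sup>2 <= c" by (simp add: linear_scale[OF T] power2_eq_square)
  then show ?thesis using False by (simp add: pos_divide_le_eq)
 qed (simp add: linear_0[OF T])
 define w where "w = T v - c *\<^sub>R v"
 have wW: "w \<in> W" unfolding w_def by (intro subspace_diff[OF W(1)] subspace_scale[OF W(1)] W(2) v(1))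
 define K where "K = c * (norm w)\<^sup>2 - w \<bullet> T w"
 have ineq: "2 * t * (norm w)\<^sup>2 <= t\<^sup>2 * K" for t
 proof -
  have "v + t *\<^sub>R w \<in> W" by (intro subspace_add[OF W(1)] subspace_scale[OF W(1)] v(1) wW)
  from le[OF this] have h1: "(v + t *\<^sub>R w) \<bullet> T (v + t *\<^sub>R w) <= c * ((v + t *\<^sub>R w) \<bullet> (v + t *\<^sub>R w))" by (simp add: power2_norm_eq_inner)
  have h2: "(v + t *\<^sub>R w) \<bullet> T (v + t *\<^sub>R w) = c + 2 * t * (w \<bullet> T v) + t\<^sup>2 * (w \<bullet> T w)"
   using sa[of v w] by (simp add: linear_add[OF T] linear_scale[OF T] inner_add_left inner_add_right c_def power2_eq_square inner_commute algebra_simps)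
  have h3: "(v + t *\<^sub>R w) \<bullet> (v + t *\<^sub>R w) = 1 + 2 * t * (w \<bullet> v) + t\<^sup>2 * (w \<bullet> w)"
   using v(2) by (simp add: inner_add_left inner_add_right power2_eq_square inner_commute algebra_simps norm_eq_1)
  have h4: "w \<bullet> T v = (norm w)\<^sup>2 + c * (w \<bullet> v)"
   by (simp add: w_def power2_norm_eq_inner inner_diff_left inner_diff_right algebra_simps inner_commute)
  show ?thesis using h1[unfolded h2 h3 h4] unfolding K_def power2_norm_eq_inner by (simp add: algebra_simps)
 qed
 have "(norm w)\<^sup>2 <= 0"
 proof (rule ccontr)
  assume "\<not> (norm w)\<^sup>2 <= 0"
  then have p: "0 < (norm w)\<^sup>2" by simp
  \<comment> \<open>The denominator is positive and makes \<open>t * K\<close> at most the squared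
    norm of \<open>w\<close>, against the required twice that norm.\<close>
  define t where "t = (norm w)\<^sup>2 / (\<bar>K\<bar> + 1)"
  have t: "0 < t" using p by (simp add: t_def)
  have "t * (2 * (norm w)\<^sup>2) <= t * (t * K)" using ineq[of t] by (simp add: power2_eq_square mult_ac)
  then have "2 * (norm w)\<^sup>2 <= t * K" using t by simp
  also have "... <= t * (\<bar>K\<bar> + 1)" using t by (intro mult_left_mono) auto
  also have "... = (norm w)\<^sup>2" by (simp add: t_def)
  finally show False using p by simp
 qed
 then have "T v = c *\<^sub>R v" by (simp add: w_def)
 then show ?thesis using v by blast
qed

text \<open>The orthogonal complement \<open>W\<close> of the eigenvectors found so far is
  invariant, and it is nonzero because it contains the kernel of \<open>M\<close>, which has the
  zero row \<open>j\<close>.\<close>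

lemma hermitian_orthonormal_eigenvectors:
 fixes S :: "complex^'p^'p" and J :: "'p set"
 assumes S: "adjoint_mat S = S" and "finite J"
 shows "\<exists>b c. (\<forall>i\<in>J. S *v b i = (c i :: real) *\<^sub>R b i) \<and> (\<forall>i\<in>J. \<forall>j\<in>J. cinner (b i) (b j) = (if i = j then 1 else 0))"
 using \<open>finite J\<close>
proof (induction J rule: finite_induct)
 case (insert j J)
 then obtain b c where b: "\<And>i. i \<in> J ==> S *v b i = (c i :: real) *\<^sub>R b i"
  and on: "\<And>i k. i \<in> J ==> k \<in> J ==> cinner (b i) (b k) = (if i = k then 1 else 0)" by blast
 define W where "W = {v. \<forall>i\<in>J. cinner (b i) v = 0}"
 have sub: "subspace W" unfolding W_def subspace_def
  by (auto simp: cinner_add_right cinner_scaleR_right) (simp add: cinner_def)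
 have inv: "S *v v \<in> W" if "v \<in> W" for v
 proof -
  have "cinner (b i) (S *v v) = 0" if i: "i \<in> J" for i
  proof -
   have "cinner (b i) (S *v v) = cinner (S *v b i) v" by (simp add: cinner_adjoint S)
   also have "... = of_real (c i) * cinner (b i) v"
    unfolding b[OF i] cinner_def vector_scaleR_component by (simp add: sum_distrib_left scaleR_conv_of_real mult_ac)
   finally show ?thesis using \<open>v \<in> W\<close> i by (simp add: W_def)
  qed
  then show ?thesis by (simp add: W_def)
 qed
 define M where "M = (\<chi> i k. if i \<in> J then cnj (b i $ k) else 0)"
 have "Finite_Cartesian_Product.row j M = 0" using insert.hyps by (simp add: M_def Finite_Cartesian_Product.row_def Finite_Cartesian_Product.vec_eq_iff)
 then have "det M = 0" by (rule det_zero_row)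
 then have "\<not> invertible M" by (simp add: invertible_det_nz)
 then have "\<not> (\<exists>B. B ** M = mat 1)" using invertible_left_inverse by blast
 then obtain v where v: "M *v v = 0" "v ~= 0" unfolding matrix_left_invertible_ker by blast
 have vW: "v \<in> W"
 proof -
  have "cinner (b i) v = 0" if "i \<in> J" for i
   using arg_cong[OF v(1), of "\<lambda>x. x $ i"] that by (simp add: M_def matrix_vector_mult_def cinner_def)
  then show ?thesis by (simp add: W_def)
 qed
 have lin: "linear ((*v) S)"
  by auto
 have sa: "(S *v u) \<bullet> w = u \<bullet> (S *v w)" for u w by (simp add: inner_cinner cinner_adjoint S)
 obtain x d where x: "x \<in> W" "norm x = 1" "S *v x = (d :: real) *\<^sub>R x"
  using self_adjoint_max_eigenvector[of "(*v) S" W v, OF lin sa sub inv vW v(2)] by blast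
 have xb: "cinner (b i) x = 0" if "i \<in> J" for i using x(1) that by (simp add: W_def)
 have bx: "cinner x (b i) = 0" if "i \<in> J" for i
 proof -
  have "cinner x (b i) = cnj (cinner (b i) x)" by (simp add: cinner_def mult.commute)
  then show ?thesis using xb[OF that] by simp
 qed
 have xx: "cinner x x = 1" by (simp add: cinner_self x(2))
 show ?case
  by (intro exI[of _ "b(j := x)"] exI[of _ "c(j := d)"]) (use insert.hyps b on xb bx xx x(3) in auto)
qed auto

lemma hermitian_diagonalization:
 fixes S :: "complex^'p^'p"
 assumes "hermitian_pos_def S"
 obtains B c where "\<And>i. (0 :: real) < c i" "adjoint_mat B ** B = mat 1" "B ** adjoint_mat B = mat 1"
  "S = B ** (\<chi> i j. if i = j then of_real (c i) else 0) ** adjoint_mat B"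
proof -
 have h: "S $ i $ j = cnj (S $ j $ i)" for i j using assms unfolding hermitian_pos_def_def by blast
 have "adjoint_mat S $ i $ j = S $ i $ j" for i j
  unfolding adjoint_mat_def vec_lambda_beta by (rule h[symmetric])
 then have S: "adjoint_mat S = S" by (simp only: Finite_Cartesian_Product.vec_eq_iff) blast
 obtain b :: "'p => complex^'p" and c :: "'p => real" where b: "\<And>i. S *v b i = c i *\<^sub>R b i" and on: "\<And>i j. cinner (b i) (b j) = (if i = j then 1 else 0)"
  using hermitian_orthonormal_eigenvectors[OF S, of UNIV] by auto
 define B where "B = (\<chi> i k. b k $ i)"
 define D where "D = (\<chi> i j. if i = j then of_real (c i) else 0 :: complex^'p^'p)"
 have c: "0 < c i" for i
 proof -
  have "b i ~= 0" using on[of i i] by (auto simp: cinner_def)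
  then have "0 < Re (cinner (b i) (S *v b i))" using assms by (simp add: hermitian_pos_def_def cinner_def)
  then show ?thesis by (simp add: b cinner_scaleR_right on)
 qed
 have BB: "adjoint_mat B ** B = mat 1"
  using on by (simp add: Finite_Cartesian_Product.vec_eq_iff adjoint_mat_def B_def matrix_matrix_mult_def Finite_Cartesian_Product.mat_def cinner_def)
 then have BB': "B ** adjoint_mat B = mat 1" by (simp add: matrix_left_right_inverse)
 have "S ** B = B ** D"
 proof -
  have "(S ** B) $ i $ k = (B ** D) $ i $ k" for i k
   using arg_cong[OF b[of k], of "\<lambda>x. x $ i", unfolded vector_scaleR_component]
   by (simp add: matrix_matrix_mult_def matrix_vector_mult_def B_def D_def scaleR_conv_of_real if_distrib[of "\<lambda>t. _ * t"] mult.commute cong: if_cong)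
  then show ?thesis by (simp add: Finite_Cartesian_Product.vec_eq_iff)
 qed
 then have "S ** B ** adjoint_mat B = B ** D ** adjoint_mat B" by simp
 then have "S = B ** D ** adjoint_mat B" by (simp add: matrix_mul_assoc[symmetric] BB')
 then show ?thesis using that c BB BB' unfolding D_def by blast
qed

lemma charpoly_conj:
 fixes A B B' :: "complex^'p^'p"
 assumes BB: "B ** B' = mat 1"
 shows "charpoly (B ** A ** B') = charpoly A"
proof -
 have sub: "(\<chi> i j. (if i = j then z else 0) - M $ i $ j) = mat z - M" for z and M :: "complex^'p^'p"
  by (simp add: Finite_Cartesian_Product.vec_eq_iff Finite_Cartesian_Product.mat_def)
 have comm: "B ** mat z = mat z ** B" for z
  by (simp add: Finite_Cartesian_Product.vec_eq_iff matrix_matrix_mult_def Finite_Cartesian_Product.mat_def if_distrib[of "\<lambda>t. _ * t"] if_distrib[of "\<lambda>t. t * _"] mult.commute cong: if_cong)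
 have "mat z - B ** A ** B' = B ** (mat z - A) ** B'" for z
 proof -
  have "B ** mat z ** B' = mat z" by (simp add: comm matrix_mul_assoc[symmetric] BB)
  moreover have "X ** (Y - Z) = X ** Y - X ** Z" "(Y - Z) ** X = Y ** X - Z ** X" for X Y Z :: "complex^'p^'p"
   by (simp_all add: Finite_Cartesian_Product.vec_eq_iff matrix_matrix_mult_def left_diff_distrib right_diff_distrib sum_subtractf)
  then have "B ** (mat z - A) ** B' = B ** mat z ** B' - B ** A ** B'" by (simp only:)
  ultimately show ?thesis by simp
 qed
 moreover have "det B * det B' = 1" using arg_cong[OF BB, of det] by (simp add: Determinants.det_mul)
 ultimately have "det (mat z - B ** A ** B') = det (mat z - A)" for z
  by (simp add: det_mul)
 then have "poly (charpoly (B ** A ** B')) = poly (charpoly A)"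
  by (intro ext) (simp only: poly_charpoly sub)
 then show ?thesis by (simp add: poly_eq_poly_eq_iff)
qed

text \<open>On the product space the coordinates \<open>k \<ge> n\<close> are constantly
  \<open>undefined\<close>, so every coordinate map is measurable and the space maps measurably into
  the full function space, where continuity is stated.\<close>

lemma measurable_PiM_PiM_continuous:
 fixes \<Phi> :: "('p::finite => nat => complex) => real"
 assumes "continuous_on UNIV \<Phi>"
 shows "\<Phi> \<in> borel_measurable (PiM UNIV (\<lambda>_. PiM {..<n} (\<lambda>_. borel)))"
proof -
 let ?M = "PiM UNIV (\<lambda>_::'p. PiM {..<n} (\<lambda>_. borel :: complex measure))"
 have c: "(\<lambda>X. X i k) \<in> borel_measurable ?M" for i k
 proof (cases "k < n")
  case True
  show ?thesis by (rule measurable_PiM_PiM_component) (use True in auto)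
 next
  case False
  have "X i k = undefined" if "X \<in> space ?M" for X
   using that False by (auto simp: space_PiM PiE_def extensional_def)
  then have "(\<lambda>X. X i k) \<in> borel_measurable ?M \<longleftrightarrow> (\<lambda>X. undefined :: complex) \<in> borel_measurable ?M"
   by (intro measurable_cong) simp
  then show ?thesis by simp
 qed
 have "(\<lambda>X. X) \<in> ?M \<rightarrow>\<^sub>M borel"
  by (rule measurable_coordinatewise_then_product, rule measurable_coordinatewise_then_product, rule c)
 then show ?thesis using measurable_compose[OF _ borel_measurable_continuous_onI[OF assms], of "\<lambda>X. X"] by simp
qed

text \<open>\<open>L\<close> is any choice of roots and need not be continuous, but a symmetric
  product of them is; the trace identity supplies the bound that \<open>prod_roots_limit\<close>
  asks for.\<close>

lemma continuous_prod_spectrum: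
 fixes G :: "real => real" and L :: "('p::finite => nat => complex) => nat => real"
 assumes G: "continuous_on UNIV G"
  and L0: "\<And>X j. j < n ==> 0 <= L X j"
  and LP: "\<And>X x. Im x ~= 0 ==> (\<Prod>k<n. x - of_real (e k)) * det (gram_mat e n UNIV X x) = (\<Prod>j<n. x - of_real (L X j))"
  and LS: "\<And>X. (\<Sum>j<n. L X j) = (\<Sum>j<n. e j) + (\<Sum>i\<in>UNIV. \<Sum>k<n. (cmod (X i k))\<^sup>2)"
 shows "continuous_on UNIV (\<lambda>X. \<Prod>j<n. G (L X j))"
proof (rule continuous_on_sequentiallyI)
 fix u :: "nat => 'p => nat => complex" and X assume u: "u \<longlonglongrightarrow> X"
 have cc: "continuous_on UNIV (\<lambda>X :: 'p => nat => complex. X i k)" for i k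
  by (rule continuous_on_compose2[of UNIV "\<lambda>x. x k"]) auto
 have uc: "(\<lambda>k. u k i j) \<longlonglongrightarrow> X i j" for i j
  by (rule continuous_on_tendsto_compose[OF cc u]) auto
 have "(\<lambda>k. \<Sum>j<n. L (u k) j) \<longlonglongrightarrow> (\<Sum>j<n. L X j)" unfolding LS by (intro tendsto_intros uc)
 then have "Bseq (\<lambda>k. \<Sum>j<n. L (u k) j)" by (rule convergent_imp_Bseq[OF convergentI])
 then obtain B where B: "\<And>k. norm (\<Sum>j<n. L (u k) j) <= B" unfolding Bseq_def by blast
 have "(\<lambda>k. \<Prod>j<n. (\<lambda>z. G (Re z)) (of_real (L (u k) j))) \<longlonglongrightarrow> (\<Prod>j<n. (\<lambda>z. G (Re z)) (of_real (L X j)))"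
 proof (rule prod_roots_limit[where B = B])
  fix k j assume j: "j < n"
  have "L (u k) j <= (\<Sum>j<n. L (u k) j)" by (rule member_le_sum) (use j L0 in auto)
  then show "cmod (of_real (L (u k) j)) <= B" using B[of k] L0[OF j, of "u k"] by (simp only: norm_of_real real_norm_def; linarith)
 next
  fix z :: complex assume z: "Im z ~= 0"
  have ze: "z - of_real (e k) ~= 0" for k using z by (auto simp: complex_eq_iff)
  have "(\<lambda>k. (\<Prod>k<n. z - of_real (e k)) * det (gram_mat e n UNIV (u k) z)) \<longlonglongrightarrow> (\<Prod>k<n. z - of_real (e k)) * det (gram_mat e n UNIV X z)"
  proof (intro tendsto_mult tendsto_const tendsto_det)
   fix i j
   have "(\<lambda>k. (if i = j then 1 else 0) - (\<Sum>b<n. u k i b * cnj (u k j b) / (z - of_real (e b)))) \<longlonglongrightarrow>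
     (if i = j then 1 else 0) - (\<Sum>b<n. X i b * cnj (X j b) / (z - of_real (e b)))"
    using ze by (intro tendsto_diff tendsto_const tendsto_sum tendsto_divide tendsto_mult tendsto_cnj uc) auto
   then show "(\<lambda>k. gram_mat e n UNIV (u k) z $ i $ j) \<longlonglongrightarrow> gram_mat e n UNIV X z $ i $ j"
    by (simp add: gram_mat_def)
  qed
  then show "(\<lambda>k. \<Prod>j<n. z - of_real (L (u k) j)) \<longlonglongrightarrow> (\<Prod>j<n. z - of_real (L X j))" by (simp only: LP[OF z])
 next
  show "continuous_on UNIV (\<lambda>z. G (Re z))"
   by (rule continuous_on_compose2[OF G]) (auto intro!: continuous_intros)
 qed
 then show "(\<lambda>k. \<Prod>j<n. G (L (u k) j)) \<longlonglongrightarrow> (\<Prod>j<n. G (L X j))" by simp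
qed

section \<open>Letting the initial spectrum tend to zero\<close>

lemma prod_lessThan_add: "(\<Prod>j<n + p. f j) = (\<Prod>j<n. f j) * (\<Prod>j<p. f (n + j))"
 for f :: "nat => 'a::comm_monoid_mult"
 by (induction p) (auto simp: mult.assoc)

text \<open>The approximations have \<open>n\<close> roots, the limit matrix has size
  \<open>CARD('p)\<close>. Both lists are padded with zeros to the sum of the two lengths, and
  \<open>G 0 = 1\<close> makes the padding invisible, whichever is larger.\<close>

lemma prod_spectrum_limit:
 fixes G :: "real => real" and X :: "'p::finite => nat => complex"
 assumes G: "continuous_on UNIV G" "G 0 = 1"
  and l0: "\<And>k j. j < n ==> 0 <= l k j"
  and e: "\<And>k j. j < n ==> e k j <= E" "\<And>j. j < n ==> (\<lambda>k. e k j) \<longlonglongrightarrow> 0"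
  and lP: "\<And>k x. Im x ~= 0 ==> (\<Prod>j<n. x - of_real (e k j)) * det (gram_mat (e k) n UNIV X x) = (\<Prod>j<n. x - of_real (l k j))"
  and lS: "\<And>k. (\<Sum>j<n. l k j) = (\<Sum>j<n. e k j) + (\<Sum>i\<in>UNIV. \<Sum>k<n. (cmod (X i k))\<^sup>2)"
 shows "(\<lambda>k. \<Prod>j<n. G (l k j)) \<longlonglongrightarrow> spectral_prod G (gram_rows n X)"
proof -
 obtain m where m: "charpoly (gram_rows n X) = (\<Prod>j<CARD('p). [:- m j, 1:])" using charpoly_roots_exist by blast
 define l' where "l' k j = (if j < n then complex_of_real (l k j) else 0)" for k j
 define m' where "m' j = (if j < n then 0 else m (j - n))" for j
 define B where "B = (\<Sum>j<n. \<bar>E\<bar>) + (\<Sum>i\<in>UNIV. \<Sum>k<n. (cmod (X i k))\<^sup>2)"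
 have B0: "0 <= B" unfolding B_def by (intro add_nonneg_nonneg sum_nonneg) auto
 have "(\<lambda>k. \<Prod>j<n + CARD('p). (\<lambda>z. G (Re z)) (l' k j)) \<longlonglongrightarrow> (\<Prod>j<n + CARD('p). (\<lambda>z. G (Re z)) (m' j))"
 proof (rule prod_roots_limit[where B = B])
  fix k j
  show "cmod (l' k j) <= B"
  proof (cases "j < n")
   case True
   have "l k j <= (\<Sum>j<n. l k j)" by (rule member_le_sum) (use True l0 in auto)
   also have "... <= B" unfolding lS B_def using e(1) by (intro add_right_mono sum_mono) (auto intro: order_trans[OF _ abs_ge_self])
   finally show ?thesis using True l0[of j k] by (simp add: l'_def)
  qed (simp add: l'_def B0)
 next
  fix z :: complex assume z: "Im z ~= 0"
  have z0: "z ~= 0" using z by auto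
  have c: "(\<chi> i j. (if i = j then z else 0) - gram_rows n X $ i $ j) = (\<chi> i. z *s (gram_mat (\<lambda>_. 0) n UNIV X z) $ i)"
   using z0 by (simp add: Finite_Cartesian_Product.vec_eq_iff gram_rows_def gram_mat_def right_diff_distrib sum_distrib_left)
  have d: "det (\<chi> i j. (if i = j then z else 0) - gram_rows n X $ i $ j) = z ^ CARD('p) * det (gram_mat (\<lambda>_. 0) n UNIV X z)"
   using Determinants.det_rows_mul[of "\<lambda>_. z" "\<lambda>i. gram_mat (\<lambda>_. 0) n UNIV X z $ i"] by (simp add: c)
  have pm: "(\<Prod>j<n + CARD('p). z - m' j) = z ^ n * (z ^ CARD('p) * det (gram_mat (\<lambda>_. 0) n UNIV X z))"
  proof -
   have "(\<Prod>j<CARD('p). z - m j) = poly (charpoly (gram_rows n X)) z" unfolding m by (simp add: poly_prod)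
   then show ?thesis unfolding poly_charpoly d by (simp add: prod_lessThan_add m'_def)
  qed
  have pl: "(\<Prod>j<n + CARD('p). z - l' k j) = ((\<Prod>j<n. z - of_real (e k j)) * det (gram_mat (e k) n UNIV X z)) * z ^ CARD('p)" for k
   unfolding lP[OF z] by (simp add: prod_lessThan_add l'_def)
  have "(\<lambda>k. ((\<Prod>j<n. z - of_real (e k j)) * det (gram_mat (e k) n UNIV X z)) * z ^ CARD('p)) \<longlonglongrightarrow>
   ((\<Prod>j<n. z - of_real 0) * det (gram_mat (\<lambda>_. 0) n UNIV X z)) * z ^ CARD('p)"
  proof (intro tendsto_mult tendsto_const tendsto_prod tendsto_diff tendsto_of_real tendsto_det)
   fix i j
   have "(\<lambda>k. (if i = j then 1 else 0) - (\<Sum>b<n. X i b * cnj (X j b) / (z - of_real (e k b)))) \<longlonglongrightarrow>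
     (if i = j then 1 else 0) - (\<Sum>b<n. X i b * cnj (X j b) / (z - of_real 0))"
    using e(2) z0 by (intro tendsto_sum tendsto_divide tendsto_const tendsto_diff tendsto_of_real) auto
   then show "(\<lambda>k. gram_mat (e k) n UNIV X z $ i $ j) \<longlonglongrightarrow> gram_mat (\<lambda>_. 0) n UNIV X z $ i $ j"
    by (simp add: gram_mat_def)
  qed (use e(2) in auto)
  then show "(\<lambda>k. \<Prod>j<n + CARD('p). z - l' k j) \<longlonglongrightarrow> (\<Prod>j<n + CARD('p). z - m' j)"
   unfolding pl pm by (simp add: mult_ac)
 next
  show "continuous_on UNIV (\<lambda>z. G (Re z))"
   by (rule continuous_on_compose2[OF G(1)]) (auto intro!: continuous_intros)
 qed
 moreover have "(\<Prod>j<n + CARD('p). (\<lambda>z. G (Re z)) (l' k j)) = (\<Prod>j<n. G (l k j))" for k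
  by (simp add: prod_lessThan_add l'_def G(2))
 moreover have "(\<Prod>j<n + CARD('p). (\<lambda>z. G (Re z)) (m' j)) = spectral_prod G (gram_rows n X)"
  by (simp add: prod_lessThan_add m'_def G(2) spectral_prod_roots[OF m])
 ultimately show ?thesis by simp
qed

lemma det_mat_row_scale:
 "Determinant.det (Matrix.mat n n (\<lambda>(i, j). r i * a i j)) = (\<Prod>i<n. r i) * Determinant.det (Matrix.mat n n (\<lambda>(i, j). a i j))"
 for r :: "nat => complex"
 by (simp add: det_mat_Leibniz prod.distrib sum_distrib_left mult_ac)

text \<open>The row factors \<open>G (l b)\<close> leave the determinant, and a polynomial
  Vandermonde determinant remains; so products over the spectrum are alternant ratios.\<close>

lemma alternant_ratio_weighted:
 fixes G :: "real => real" and P :: "nat => complex poly"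
 assumes deg: "\<And>a. a < n ==> degree (P a) <= a" and l: "strict_dec n l"
 shows "alternant_ratio n (\<lambda>a y. of_real (G y) * poly (P a) (of_real y)) l =
  vandermonde_sign n * (\<Prod>a<n. coeff (P a) a) * of_real (\<Prod>j<n. G (l j))"
 using vandermonde_prod_pos[OF l]
 by (simp add: alternant_ratio_def alternant_def det_mat_row_scale det_poly_columns[OF deg] det_vandermonde_real)

text \<open>For each initial spectrum \<open>e k\<close> the mean is an alternant ratio of averaged
  functions. Both are sent to the limit, one by dominated convergence, the other by the Taylor
  expansion.\<close>

lemma gauss_rows_expectation:
 fixes rate :: "'p::finite => real" and f :: "real => real"
 assumes js: "distinct js" "set js = UNIV" and enc: "encloses g q (map rate js)" and n: "0 < n"
  and f: "continuous_on UNIV f" "\<And>x. \<bar>f x\<bar> <= B" and d: "0 < d" "\<And>x. x <= d ==> f x = 0"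
 shows "complex_of_real (\<integral>X. spectral_prod (\<lambda>x. 1 + f x) (gram_rows n X) \<partial>PiM UNIV (\<lambda>i. gauss_vec n (rate i))) =
  Determinant.det (Matrix.mat n n (\<lambda>(m, a). (if m = a then 1 else 0) +
   hypoexp_moment g (map rate js) (\<lambda>x. of_real (f x)) m a / of_real (prod_list (map rate js))))"
proof -
 let ?rs = "map rate js" and ?M = "PiM UNIV (\<lambda>i. gauss_vec n (rate i))"
 let ?B = "PiM UNIV (\<lambda>_::'p. PiM {..<n} (\<lambda>_. borel :: complex measure))"
 define G where "G x = 1 + f x" for x
 have q: "0 < q" and rate: "q < rate i" "0 < rate i" for i
 proof -
  have "i \<in> set js" using js(2) by simp
  then show "0 < q" "q < rate i" "0 < rate i" using enc by (auto simp: encloses_def intro: order.strict_trans)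
 qed
 have rs0: "?rs ~= []" using js(2) by auto
 have G: "continuous_on UNIV G" "G 0 = 1" unfolding G_def using f d by (auto intro!: continuous_intros)
 have GB: "\<bar>G x\<bar> <= 1 + B" for x using f(2)[of x] by (simp add: G_def)
 have fM[measurable]: "f \<in> borel_measurable borel" by (rule borel_measurable_continuous_onI[OF f(1)])
 have GM: "(\<lambda>y. complex_of_real (G y)) \<in> borel_measurable borel" unfolding G_def by measurable
 have GB': "cmod (complex_of_real (G y)) <= 1 + B" for y using GB[of y] by (simp only: norm_of_real)
 \<comment> \<open>Simple, positive, tending to 0, and of the shape that
   \<open>alternant_ratio_limit\<close> expects.\<close>
 define e where "e k b = real (n - b) / real (Suc k)" for k b
 have e: "strict_dec n (e k)" "\<And>j. j < n ==> 0 < e k j" for k by (auto simp: e_def strict_dec_def divide_simps)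
 have "\<forall>k X. \<exists>l. (\<forall>j<n. 0 <= l j) \<and>
  (\<forall>x. Im x ~= 0 --> (\<Prod>j<n. x - of_real (e k j)) * det (gram_mat (e k) n UNIV X x) = (\<Prod>j<n. x - of_real (l j))) \<and>
  (\<Sum>j<n. l j) = (\<Sum>j<n. e k j) + (\<Sum>i\<in>UNIV. \<Sum>k<n. (cmod (X i k))\<^sup>2)" for X :: "'p => nat => complex"
  using diag_spectrum_values_exist[OF e] by blast
 then have "\<forall>k (X :: 'p => nat => complex). \<exists>l. (\<forall>j<n. 0 <= l j) \<and>
  (\<forall>x. Im x ~= 0 --> (\<Prod>j<n. x - of_real (e k j)) * det (gram_mat (e k) n UNIV X x) = (\<Prod>j<n. x - of_real (l j))) \<and>
  (\<Sum>j<n. l j) = (\<Sum>j<n. e k j) + (\<Sum>i\<in>UNIV. \<Sum>k<n. (cmod (X i k))\<^sup>2)" by blast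
 \<comment> \<open>Chosen for all configurations, also those without a simple spectrum, so that the
   integrand \<open>\<Phi> k\<close> is defined and continuous everywhere.\<close>
 then obtain L :: "nat => ('p => nat => complex) => nat => real" where L: "\<forall>k X. (\<forall>j<n. 0 <= L k X j) \<and>
  (\<forall>x. Im x ~= 0 --> (\<Prod>j<n. x - of_real (e k j)) * det (gram_mat (e k) n UNIV X x) = (\<Prod>j<n. x - of_real (L k X j))) \<and>
  (\<Sum>j<n. L k X j) = (\<Sum>j<n. e k j) + (\<Sum>i\<in>UNIV. \<Sum>k<n. (cmod (X i k))\<^sup>2)" unfolding choice_iff by blast
 have L0: "0 <= L k X j" if "j < n" for k X j using L that by blast
 have LP: "(\<Prod>j<n. x - of_real (e k j)) * det (gram_mat (e k) n UNIV X x) = (\<Prod>j<n. x - of_real (L k X j))" if "Im x ~= 0" for k X x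
  using L that by blast
 have LS: "(\<Sum>j<n. L k X j) = (\<Sum>j<n. e k j) + (\<Sum>i\<in>UNIV. \<Sum>k<n. (cmod (X i k))\<^sup>2)" for k X using L by blast
 define \<Phi> where "\<Phi> k X = (\<Prod>j<n. G (L k X j))" for k X
 have sM: "sets ?M = sets ?B" by (intro sets_PiM_cong refl) (simp add: sets_gauss_vec)
 have sm: "borel_measurable ?M = borel_measurable ?B" by (rule measurable_cong_sets[OF sM refl])
 have \<Phi>M: "\<Phi> k \<in> borel_measurable ?B" for k
  unfolding \<Phi>_def by (rule measurable_PiM_PiM_continuous[OF continuous_prod_spectrum[OF G(1), of n "L k" "e k"]]) (use L0 LP LS in auto)
 have \<Phi>B: "\<bar>\<Phi> k X\<bar> <= (1 + B) ^ n" for k X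
 proof -
  have "\<bar>\<Phi> k X\<bar> = (\<Prod>j<n. \<bar>G (L k X j)\<bar>)" by (simp add: \<Phi>_def abs_prod)
  also have "... <= (\<Prod>j<n. 1 + B)" by (intro prod_mono) (simp add: GB)
  finally show ?thesis by simp
 qed
 have \<Phi>lim: "(\<lambda>k. \<Phi> k X) \<longlonglongrightarrow> spectral_prod G (gram_rows n X)" for X
  unfolding \<Phi>_def
 proof (rule prod_spectrum_limit[OF G L0, where e = e and E = "real n"])
  show "e k j <= real n" if "j < n" for k j
  proof -
   have "e k j <= real (n - j) / 1" unfolding e_def by (intro divide_left_mono) auto
   then show ?thesis by simp
  qed
  show "(\<lambda>k. e k j) \<longlonglongrightarrow> 0" for j
  proof -
   have "(\<lambda>k. real (n - j) * (1 / real (Suc k))) \<longlonglongrightarrow> real (n - j) * 0"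
    by (intro tendsto_mult tendsto_const lim_inverse_n'[THEN LIMSEQ_Suc])
   then show ?thesis by (simp add: e_def)
  qed
 qed (use LP LS in auto)
 interpret P: prob_space "gauss_vec n (rate i)" for i by (rule prob_space_gauss_vec[OF rate(2)])
 interpret PP: prob_space ?M by (rule prob_space_PiM) (rule P.prob_space_axioms)
 have lim: "(\<lambda>k. \<integral>X. \<Phi> k X \<partial>?M) \<longlonglongrightarrow> (\<integral>X. spectral_prod G (gram_rows n X) \<partial>?M)"
 proof (rule integral_dominated_convergence[where w = "\<lambda>_. (1 + B) ^ n"])
  show "(\<lambda>X. spectral_prod G (gram_rows n X)) \<in> borel_measurable ?M"
   unfolding sm by (rule borel_measurable_LIMSEQ_real[OF \<Phi>lim \<Phi>M])
  show "\<Phi> k \<in> borel_measurable ?M" for k unfolding sm by (rule \<Phi>M)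
  show "AE X in ?M. (\<lambda>k. \<Phi> k X) \<longlonglongrightarrow> spectral_prod G (gram_rows n X)" using \<Phi>lim by simp
  show "AE X in ?M. norm (\<Phi> k X) <= (1 + B) ^ n" for k using \<Phi>B by simp
 qed simp
 \<comment> \<open>The constant between product and alternant ratio; the same constant leaves the
   limit determinant, and the two cancel.\<close>
 define c where "c = vandermonde_sign n * (\<Prod>a<n. of_real (prod_list ?rs) / fact a)"
 have pl0: "prod_list ?rs ~= 0" using rate by (auto simp: prod_list_zero_iff) (metis less_irrefl)
 have c0: "c ~= 0" using pl0 by (simp add: c_def vandermonde_sign_nonzero)
 define h where "h a y = complex_of_real (G y) * poly (tau_poly ?rs a) (of_real y)" for a y
 have lead: "coeff (tau_poly ?rs a) a = of_real (prod_list ?rs) / fact a" for a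
  by (simp add: coeff_tau_poly coeff_root_poly_0)
 have key: "c * of_real (\<integral>X. \<Phi> k X \<partial>?M) = alternant_ratio n (\<lambda>a. foldr exp_avg ?rs (h a)) (e k)" for k
 proof -
  have "(\<integral>X. c * of_real (\<Phi> k X) \<partial>PiM (set js) (\<lambda>i. gauss_vec n (rate i))) = alternant_ratio n (\<lambda>a. foldr (\<lambda>i. exp_avg (rate i)) js (h a)) (e k)"
  proof (rule gauss_rows_alternant_ratio[OF e, where \<kappa> = "q / 2" and C = "cmod c * (1 + B) ^ n"])
   show "q / 2 < rate i" "0 < rate i" for i using rate(1)[of i] q by auto
   show "exp_growth (q / 2) (h a)" for a
    unfolding h_def by (rule exp_growth_bounded_mult[OF exp_growth_poly GM GB']) (use q in simp)
   show "(\<lambda>X. c * of_real (\<Phi> k X)) \<in> borel_measurable (PiM (set js) (\<lambda>_. PiM {..<n} (\<lambda>_. borel)))"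
    unfolding js(2) using \<Phi>M[of k] by measurable
   show "cmod (c * of_real (\<Phi> k X)) <= cmod c * (1 + B) ^ n" for X
    using \<Phi>B[of k X] by (simp add: norm_mult mult_left_mono)
   fix X v l assume "diag_spectrum (e k) n (set js) X v l"
   then have l: "strict_dec n l" "\<And>x. Im x ~= 0 ==> (\<Prod>j<n. x - of_real (e k j)) * det (gram_mat (e k) n UNIV X x) = (\<Prod>j<n. x - of_real (l j))"
    unfolding js(2) diag_spectrum_def by auto
   have "(\<Prod>j<n. (\<lambda>z. G (Re z)) (complex_of_real (L k X j))) = (\<Prod>j<n. (\<lambda>z. G (Re z)) (of_real (l j)))"
    by (rule prod_roots_cong[OF prod_linear_eqI[OF trans[OF LP[symmetric] l(2)]]])
   then have "\<Phi> k X = (\<Prod>j<n. G (l j))" by (simp add: \<Phi>_def)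
   then show "c * of_real (\<Phi> k X) = alternant_ratio n h l"
    unfolding h_def by (subst alternant_ratio_weighted[OF degree_tau_poly l(1)]) (simp add: c_def lead)
  qed (use js in auto)
  then show ?thesis by (simp add: js(2) foldr_map o_def)
 qed
 define S where "S m a = hypoexp_moment g ?rs (\<lambda>x. of_real (f x)) m a" for m a
 define C where "C m a = (if m = a then of_real (prod_list ?rs) / fact a else 0) + S m a / fact m" for m a
 obtain D where D: "\<And>a x. a < n ==> 0 <= x ==> x < min d 1 ==>
  cmod (foldr exp_avg ?rs (h a) x - (\<Sum>m<n. of_real x ^ m * C m a)) <= D * x ^ n"
 proof -
  have "\<exists>D. \<forall>a<n. \<forall>x. 0 <= x --> x < min d 1 -->
  cmod (foldr exp_avg ?rs (\<lambda>y. (1 + of_real (f y)) * poly (tau_poly ?rs a) (of_real y)) x -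
   (\<Sum>m<n. of_real x ^ m * ((if m = a then of_real (prod_list ?rs) / fact a else 0) + hypoexp_moment g ?rs (\<lambda>x. of_real (f x)) m a / fact m))) <= D * x ^ n"
   by (rule foldr_exp_avg_expansion[OF enc rs0 n d(1), where B = B]) (use f d in auto)
  then show ?thesis using that by (auto simp: h_def[abs_def] C_def S_def G_def)
 qed
 have "(\<lambda>k. alternant_ratio n (\<lambda>a. foldr exp_avg ?rs (h a)) (e k)) \<longlonglongrightarrow> vandermonde_sign n * Determinant.det (Matrix.mat n n (\<lambda>(m, a). C m a))"
  unfolding e_def by (rule alternant_ratio_limit[of "min d 1", OF _ D]) (use d in auto)
 moreover have "(\<lambda>k. c * of_real (\<integral>X. \<Phi> k X \<partial>?M)) \<longlonglongrightarrow> c * of_real (\<integral>X. spectral_prod G (gram_rows n X) \<partial>?M)"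
  by (intro tendsto_intros lim)
 ultimately have eq: "c * of_real (\<integral>X. spectral_prod G (gram_rows n X) \<partial>?M) = vandermonde_sign n * Determinant.det (Matrix.mat n n (\<lambda>(m, a). C m a))"
  unfolding key by (metis LIMSEQ_unique)
 \<comment> \<open>Dividing the row \<open>m\<close> by its factor turns the polynomial part into
   the identity matrix.\<close>
 have Ceq: "C m a = of_real (prod_list ?rs) / fact m * ((if m = a then 1 else 0) + S m a / of_real (prod_list ?rs))" for m a
  using pl0 by (simp add: C_def distrib_left)
 have "Determinant.det (Matrix.mat n n (\<lambda>(m, a). C m a)) = (\<Prod>a<n. of_real (prod_list ?rs) / fact a) *
   Determinant.det (Matrix.mat n n (\<lambda>(m, a). (if m = a then 1 else 0) + S m a / of_real (prod_list ?rs)))"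
  unfolding Ceq by (rule det_mat_row_scale)
 then have "c * of_real (\<integral>X. spectral_prod G (gram_rows n X) \<partial>?M) = c *
   Determinant.det (Matrix.mat n n (\<lambda>(m, a). (if m = a then 1 else 0) + S m a / of_real (prod_list ?rs)))"
  using eq by (simp add: c_def mult.assoc)
 then have "of_real (\<integral>X. spectral_prod G (gram_rows n X) \<partial>?M) =
   Determinant.det (Matrix.mat n n (\<lambda>(m, a). (if m = a then 1 else 0) + S m a / of_real (prod_list ?rs)))"
  using c0 by (simp only: mult_cancel_left) simp
 then show ?thesis unfolding S_def G_def .
qed

section \<open>From complex Wishart matrices to independent Gaussian rows\<close>

lemma linear_matrix_vector: "linear ((*v) (A :: complex^'p^'q))"
 by simp

lemma norm_unitary:
 assumes "adjoint_mat B ** B = mat 1"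
 shows "norm (B *v x) = norm x"
proof -
 have "cinner (B *v x) (B *v x) = cinner x x"
  by (simp add: cinner_adjoint matrix_vector_mul_assoc assms)
 then have "complex_of_real ((norm (B *v x))\<^sup>2) = of_real ((norm x)\<^sup>2)" by (simp only: cinner_self)
 then have "(norm (B *v x))\<^sup>2 = (norm x)\<^sup>2" by (simp only: of_real_eq_iff)
 then show ?thesis by (simp add: power2_eq_iff_nonneg)
qed

lemma measurable_matI:
 fixes w :: "'a => complex^'p^'q"
 assumes "\<And>i j. (\<lambda>x. w x $ i $ j) \<in> borel_measurable M"
 shows "w \<in> borel_measurable M"
proof (subst borel_measurable_euclidean_space, rule ballI)
 fix b :: "complex^'p^'q" assume "b \<in> Basis"
 then obtain i j c where "b = axis i (axis j c)" by (auto simp: Basis_vec_def)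
 then have b: "w x \<bullet> b = w x $ i $ j \<bullet> c" for x by (simp add: inner_axis)
 show "(\<lambda>x. w x \<bullet> b) \<in> borel_measurable M"
  unfolding b by (intro borel_measurable_inner borel_measurable_const assms)
qed

text \<open>In the eigenbasis the quadratic form is diagonal and the density factors, an eigenvalue
  \<open>c i\<close> giving the rate \<open>1 / c i\<close>; the change of variables by
  \<open>B\<close> is an isometry.\<close>

lemma nn_integral_complex_normal:
 fixes S B :: "complex^'p^'p" and c :: "'p => real"
 assumes c: "\<And>i. 0 < c i" and B: "adjoint_mat B ** B = mat 1" "B ** adjoint_mat B = mat 1"
  and S: "S = B ** (\<chi> i j. if i = j then of_real (c i) else 0) ** adjoint_mat B"
  and F: "F \<in> borel_measurable borel"
 shows "(\<integral>\<^sup>+x. F x \<partial>complex_normal S) = (\<integral>\<^sup>+y. F (B *v (\<chi> i. y i)) \<partial>PiM UNIV (\<lambda>i. complex_gauss (1 / c i)))"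
proof -
 let ?L = "PiM UNIV (\<lambda>_::'p. lborel :: complex measure)"
 define D where "D = (\<chi> i j. if i = j then of_real (c i) else 0 :: complex^'p^'p)"
 define E where "E = (\<chi> i j. if i = j then of_real (1 / c i) else 0 :: complex^'p^'p)"
 define dn where "dn x = ennreal (exp (- Re (\<Sum>i\<in>UNIV. cnj (x $ i) * (matrix_inv S *v x) $ i)) / (pi ^ CARD('p) * Re (det S)))" for x
 note [measurable] = F
 have lin: "linear ((*v) B)" by (rule linear_matrix_vector)
 have Bm[measurable]: "(*v) B \<in> borel_measurable borel"
  using lin by (intro borel_measurable_continuous_onI linear_continuous_on) (simp add: linear_conv_bounded_linear)
 have dm[measurable]: "dn \<in> borel_measurable borel"
 proof -
  have "(\<lambda>x. Re (\<Sum>i\<in>UNIV. cnj (x $ i) * (matrix_inv S *v x) $ i)) \<in> borel_measurable borel"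
   unfolding matrix_vector_mult_def by (intro borel_measurable_continuous_onI) (auto intro!: continuous_intros)
  then show ?thesis unfolding dn_def by measurable
 qed
 have c0: "c i ~= 0" for i using c[of i] by simp
 have DE: "D ** E = mat 1"
  using c0 by (simp add: D_def E_def matrix_matrix_mult_def Finite_Cartesian_Product.mat_def Finite_Cartesian_Product.vec_eq_iff if_distrib[of "\<lambda>t. t * _"] cong: if_cong)
 have "S ** (B ** E ** adjoint_mat B) = B ** (D ** (adjoint_mat B ** B) ** E) ** adjoint_mat B"
  unfolding S D_def[symmetric] by (simp only: matrix_mul_assoc)
 then have SI: "S ** (B ** E ** adjoint_mat B) = mat 1" by (simp add: B DE)
 then have "invertible S" using invertible_right_inverse by blast
 then have "\<exists>S'. S ** S' = mat 1 \<and> S' ** S = mat 1" by (simp only: invertible_def)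
 \<comment> \<open>\<open>matrix_inv\<close> is defined by choice, so its defining property is
   accessible once invertibility is known.\<close>
 from someI_ex[OF this] have SS: "matrix_inv S ** S = mat 1" by (simp only: matrix_inv_def)
 have mi: "matrix_inv S *v (B *v x) = B *v (E *v x)" for x
 proof -
  have "B *v x = S *v (B *v (E *v x))"
  proof -
   have "S *v (B *v (E *v x)) = S *v ((B ** E ** adjoint_mat B) *v (B *v x))"
    by (simp add: matrix_vector_mul_assoc matrix_mul_assoc[symmetric] B)
   also have "... = B *v x" by (simp only: matrix_vector_mul_assoc[of S] SI matrix_vector_mul_lid)
   finally show ?thesis by simp
  qed
  then have "matrix_inv S *v (B *v x) = (matrix_inv S ** S) *v (B *v (E *v x))" using matrix_vector_mul_assoc by auto
  then show ?thesis by (simp only: SS matrix_vector_mul_lid)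
 qed
 have dS: "Re (det S) = (\<Prod>i\<in>UNIV. c i)"
 proof -
  have "det (adjoint_mat B) * det B = 1" using arg_cong[OF B(1), of det] by (simp add: Determinants.det_mul)
  moreover have "det D = of_real (\<Prod>i\<in>UNIV. c i)" unfolding D_def by (subst det_diagonal) auto
  ultimately have "det S = of_real (\<Prod>i\<in>UNIV. c i)"
   unfolding S D_def[symmetric] by (simp add: Determinants.det_mul) (metis mult.assoc mult.commute mult_1)
  then show ?thesis by (simp only: Re_complex_of_real)
 qed
 have quad: "Re (\<Sum>i\<in>UNIV. cnj ((B *v x) $ i) * (matrix_inv S *v (B *v x)) $ i) = (\<Sum>i\<in>UNIV. (1 / c i) * (cmod (x $ i))\<^sup>2)" for x
 proof -
  have "(\<Sum>i\<in>UNIV. cnj ((B *v x) $ i) * (matrix_inv S *v (B *v x)) $ i) = cinner (B *v x) (B *v (E *v x))"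
   by (simp only: mi cinner_def)
  also have "... = cinner x (E *v x)" by (simp add: cinner_adjoint matrix_vector_mul_assoc matrix_mul_assoc B)
  also have "... = (\<Sum>i\<in>UNIV. of_real ((1 / c i) * (cmod (x $ i))\<^sup>2))"
  proof -
   have "(E *v x) $ i = of_real (1 / c i) * x $ i" for i
    by (simp add: E_def matrix_vector_mult_def if_distrib[of "\<lambda>t. t * _"] cong: if_cong)
   then show ?thesis by (simp only: cinner_def of_real_mult complex_norm_square) (simp only: mult_ac)
  qed
  finally show ?thesis by (simp only: of_real_sum[symmetric] Re_complex_of_real)
 qed
 have dB: "dn (B *v (\<chi> i. y i)) = (\<Prod>i\<in>UNIV. ennreal ((1 / c i) / pi * exp (- (1 / c i) * (cmod (y i))\<^sup>2)))" for y
 proof -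
  have "dn (B *v (\<chi> i. y i)) = ennreal (exp (- (\<Sum>i\<in>UNIV. (1 / c i) * (cmod (y i))\<^sup>2)) / (pi ^ CARD('p) * (\<Prod>i\<in>UNIV. c i)))"
   by (simp only: dn_def quad dS) simp
  also have "exp (- (\<Sum>i\<in>UNIV. (1 / c i) * (cmod (y i))\<^sup>2)) / (pi ^ CARD('p) * (\<Prod>i\<in>UNIV. c i)) =
   (\<Prod>i\<in>UNIV. (1 / c i) / pi * exp (- (1 / c i) * (cmod (y i))\<^sup>2))"
   by (simp add: prod.distrib prod_dividef exp_sum sum_negf[symmetric] mult_ac)
  also have "ennreal ... = (\<Prod>i\<in>UNIV. ennreal ((1 / c i) / pi * exp (- (1 / c i) * (cmod (y i))\<^sup>2)))"
   by (rule prod_ennreal[symmetric]) (simp add: less_imp_le[OF c])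
  finally show ?thesis .
 qed
 interpret G: prob_space "complex_gauss (1 / c i)" for i by (rule prob_space_complex_gauss) (simp add: c)
 have "(\<integral>\<^sup>+x. F x \<partial>complex_normal S) = (\<integral>\<^sup>+x. dn x * F x \<partial>lborel)"
  unfolding complex_normal_def dn_def[symmetric] by (rule nn_integral_density) simp_all
 also have "... = (\<integral>\<^sup>+x. dn (B *v x) * F (B *v x) \<partial>lborel)"
  by (rule lborel_isometry_nn_integral[OF lin linear_matrix_vector[of "adjoint_mat B"], symmetric])
   (simp_all add: matrix_vector_mul_assoc B norm_unitary)
 also have "... = (\<integral>\<^sup>+y. dn (B *v (\<chi> i. y i)) * F (B *v (\<chi> i. y i)) \<partial>?L)"
  by (rule nn_integral_lborel_vec) measurable
 also have "... = (\<integral>\<^sup>+y. (\<Prod>i\<in>UNIV. ennreal ((1 / c i) / pi * exp (- (1 / c i) * (cmod (y i))\<^sup>2))) * F (B *v (\<chi> i. y i)) \<partial>?L)"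
  by (simp only: dB)
 also have "... = (\<integral>\<^sup>+y. F (B *v (\<chi> i. y i)) \<partial>PiM UNIV (\<lambda>i. complex_gauss (1 / c i)))"
 proof (rule nn_integral_PiM_density[symmetric])
  show "product_sigma_finite (\<lambda>_::'p. lborel :: complex measure)" by standard
  show "product_sigma_finite (\<lambda>i. complex_gauss (1 / c i))" by standard
  have sP: "sets ?L = sets (PiM UNIV (\<lambda>_::'p. borel :: complex measure))" by (intro sets_PiM_cong) auto
  have m: "(\<lambda>f. \<chi> i. f i) \<in> ?L \<rightarrow>\<^sub>M (borel :: (complex^'p) measure)"
   using measurable_vec_lambda by (simp only: measurable_cong_sets[OF sP refl])
  show "(\<lambda>y. F (B *v (\<chi> i. y i))) \<in> borel_measurable ?L"
   by (rule measurable_compose[OF measurable_compose[OF m Bm] F])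
 qed (simp_all add: complex_gauss_def)
 finally show ?thesis .
qed

text \<open>The columns are \<open>B\<close> times vectors with independent entries, so the Wishart
  matrix is conjugated by \<open>B\<close>, which \<open>H\<close> does not see; transposing the
  array then turns columns into rows.\<close>

lemma nn_integral_complex_wishart:
 fixes S B :: "complex^'p^'p" and c :: "'p => real"
 assumes c: "\<And>i. 0 < c i" and B: "adjoint_mat B ** B = mat 1" "B ** adjoint_mat B = mat 1"
  and S: "S = B ** (\<chi> i j. if i = j then of_real (c i) else 0) ** adjoint_mat B"
  and H: "H \<in> borel_measurable borel" and inv: "\<And>A. H (B ** A ** adjoint_mat B) = H A"
 shows "(\<integral>\<^sup>+A. H A \<partial>complex_wishart S n) =
  (\<integral>\<^sup>+X. H (\<chi> i j. gram_rows n X $ i $ j / of_nat n) \<partial>PiM UNIV (\<lambda>i. gauss_vec n (1 / c i)))"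
proof -
 let ?G = "PiM UNIV (\<lambda>i. complex_gauss (1 / c i))"
 define T where "T y = B *v (\<chi> i. y i)" for y
 define w where "w x = (\<chi> i j. (\<Sum>k<n. x k $ i * cnj (x k $ j)) / of_nat n :: complex^'p^'p)" for x :: "nat => complex^'p"
 define H' where "H' X = H (\<chi> i j. gram_rows n X $ i $ j / of_nat n)" for X
 interpret G: prob_space "complex_gauss (1 / c i)" for i by (rule prob_space_complex_gauss) (simp add: c)
 interpret GG: prob_space ?G by (rule prob_space_PiM) (rule G.prob_space_axioms)
 have sG: "sets ?G = sets (PiM UNIV (\<lambda>_::'p. borel :: complex measure))" by (intro sets_PiM_cong) auto
 have Bm: "(*v) B \<in> borel_measurable borel"
  using linear_matrix_vector[of B] by (intro borel_measurable_continuous_onI linear_continuous_on) (simp add: linear_conv_bounded_linear)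
 have vm: "(\<lambda>f. \<chi> i. f i) \<in> ?G \<rightarrow>\<^sub>M (borel :: (complex^'p) measure)"
  using measurable_vec_lambda by (simp only: measurable_cong_sets[OF sG refl])
 have Tm: "T \<in> ?G \<rightarrow>\<^sub>M borel" unfolding T_def by (rule measurable_compose[OF vm Bm])
 have sN: "sets (complex_normal S) = sets borel" by (simp add: complex_normal_def)
 have nn: "(\<integral>\<^sup>+x. F x \<partial>complex_normal S) = (\<integral>\<^sup>+y. F (T y) \<partial>?G)" if "F \<in> borel_measurable borel" for F
  unfolding T_def by (rule nn_integral_complex_normal[OF c B S that])
 interpret N: prob_space "complex_normal S"
 proof
  have "emeasure (complex_normal S) (space (complex_normal S)) = (\<integral>\<^sup>+x. 1 \<partial>complex_normal S)" by simp
  also have "... = (\<integral>\<^sup>+y. 1 \<partial>?G)" by (rule nn) simp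
  also have "... = 1" by (simp add: GG.emeasure_space_1)
  finally show "emeasure (complex_normal S) (space (complex_normal S)) = 1" .
 qed
 have wm: "w \<in> borel_measurable (PiM {..<n} (\<lambda>_. complex_normal S))"
 proof (rule measurable_matI)
  fix i j
  have "(\<lambda>x. x k $ i) \<in> borel_measurable (PiM {..<n} (\<lambda>_. complex_normal S))" if "k < n" for k i
  proof (rule measurable_compose[of "\<lambda>x. x k"])
   show "(\<lambda>x. x k) \<in> PiM {..<n} (\<lambda>_. complex_normal S) \<rightarrow>\<^sub>M complex_normal S" using that by (intro measurable_component_singleton) simp
   have "(\<lambda>v :: complex^'p. v $ i) \<in> borel_measurable borel" by (intro borel_measurable_continuous_onI continuous_on_component continuous_on_id)
   then show "(\<lambda>v. v $ i) \<in> borel_measurable (complex_normal S)" by (simp only: measurable_cong_sets[OF sN refl])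
  qed
  note [measurable] = this
  show "(\<lambda>x. w x $ i $ j) \<in> borel_measurable (PiM {..<n} (\<lambda>_. complex_normal S))"
   unfolding w_def by simp measurable
 qed
 have wT: "w (\<lambda>k\<in>{..<n}. T (y k)) = B ** (\<chi> i j. (\<Sum>k<n. y k i * cnj (y k j)) / of_nat n) ** adjoint_mat B" for y
 proof -
  have "(\<Sum>k<n. T (y k) $ i * cnj (T (y k) $ j)) / of_nat n =
   (\<Sum>b\<in>UNIV. (\<Sum>a\<in>UNIV. B $ i $ a * ((\<Sum>k<n. y k a * cnj (y k b)) / of_nat n)) * cnj (B $ j $ b))" for i j
  proof -
   define t where "t k a b = B $ i $ a * y k a * (cnj (B $ j $ b) * cnj (y k b)) / of_nat n" for k a b
   have "(\<Sum>b\<in>UNIV. (\<Sum>a\<in>UNIV. B $ i $ a * ((\<Sum>k<n. y k a * cnj (y k b)) / of_nat n)) * cnj (B $ j $ b)) = (\<Sum>b\<in>UNIV. \<Sum>a\<in>UNIV. \<Sum>k<n. t k a b)"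
    by (simp add: t_def sum_distrib_left sum_distrib_right sum_divide_distrib mult_ac)
   also have "... = (\<Sum>a\<in>UNIV. \<Sum>b\<in>UNIV. \<Sum>k<n. t k a b)" by (rule sum.swap)
   also have "... = (\<Sum>a\<in>UNIV. \<Sum>k<n. \<Sum>b\<in>UNIV. t k a b)" by (intro sum.cong refl sum.swap)
   also have "... = (\<Sum>k<n. \<Sum>a\<in>UNIV. \<Sum>b\<in>UNIV. t k a b)" by (rule sum.swap)
   also have "... = (\<Sum>k<n. T (y k) $ i * cnj (T (y k) $ j)) / of_nat n"
    by (simp add: t_def T_def matrix_vector_mult_def sum_product sum_divide_distrib)
   finally show ?thesis by simp
  qed
  then show ?thesis
   by (simp add: Finite_Cartesian_Product.vec_eq_iff w_def matrix_matrix_mult_def adjoint_mat_def)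
 qed
 have Hw: "(\<lambda>x. H (w x)) \<in> borel_measurable (PiM {..<n} (\<lambda>_. complex_normal S))" by (rule measurable_compose[OF wm H])
 have "(\<integral>\<^sup>+A. H A \<partial>complex_wishart S n) = (\<integral>\<^sup>+x. H (w x) \<partial>PiM {..<n} (\<lambda>_. complex_normal S))"
  unfolding complex_wishart_def w_def[symmetric] by (rule nn_integral_distr) (use wm H in \<open>simp_all add: w_def[abs_def]\<close>)
 also have "... = (\<integral>\<^sup>+y. H (w (\<lambda>k\<in>{..<n}. T (y k))) \<partial>PiM {..<n} (\<lambda>_. ?G))"
 proof -
  have "(\<integral>\<^sup>+y. H (w (\<lambda>k\<in>{..<n}. T (y k))) \<partial>PiM {..<n} (\<lambda>_. ?G)) = (\<Prod>k<n. 1) * (\<integral>\<^sup>+x. H (w x) \<partial>PiM {..<n} (\<lambda>_. complex_normal S))"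
  proof (rule nn_integral_PiM_map)
   show "product_sigma_finite (\<lambda>_::nat. complex_normal S)" by standard
   show "product_sigma_finite (\<lambda>_::nat. ?G)" by standard
   show "T \<in> ?G \<rightarrow>\<^sub>M complex_normal S" using Tm by (simp only: measurable_cong_sets[OF refl sN])
   show "(\<integral>\<^sup>+y. F (T y) \<partial>?G) = 1 * (\<integral>\<^sup>+y. F y \<partial>complex_normal S)" if "F \<in> borel_measurable (complex_normal S)" for F
    using nn[of F] that by (simp add: measurable_cong_sets[OF sN refl])
  qed (use Hw in simp_all)
  then show ?thesis by simp
 qed
 also have "... = (\<integral>\<^sup>+y. H' (\<lambda>i\<in>UNIV. \<lambda>k\<in>{..<n}. y k i) \<partial>PiM {..<n} (\<lambda>_. ?G))"
  by (simp add: wT inv H'_def gram_rows_def)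
 also have "... = (\<integral>\<^sup>+X. H' X \<partial>PiM UNIV (\<lambda>i. gauss_vec n (1 / c i)))"
 proof -
  let ?R = "PiM UNIV (\<lambda>i. PiM {..<n} (\<lambda>_. complex_gauss (1 / c i)))"
  have tm: "(\<lambda>y. \<lambda>i\<in>UNIV. \<lambda>k\<in>{..<n}. y k i) \<in> PiM {..<n} (\<lambda>_. ?G) \<rightarrow>\<^sub>M ?R"
   by (rule measurable_restrict, rule measurable_restrict, rule measurable_PiM_PiM_component) auto
  have Hm: "H' \<in> borel_measurable ?R"
   unfolding H'_def
  proof (rule measurable_compose[OF measurable_matI H])
   fix i j
   have "(\<lambda>X. X i k) \<in> borel_measurable ?R" if "k < n" for k i
   proof -
    have "(\<lambda>X. X i k) \<in> ?R \<rightarrow>\<^sub>M complex_gauss (1 / c i)"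
     by (rule measurable_PiM_PiM_component) (use that in auto)
    then show ?thesis by (simp add: measurable_cong_sets[OF refl sets_complex_gauss])
   qed
   note [measurable] = this
   show "(\<lambda>X. (\<chi> i j. gram_rows n X $ i $ j / of_nat n) $ i $ j) \<in> borel_measurable ?R"
    by (simp add: gram_rows_def) measurable
  qed
  have "(\<integral>\<^sup>+X. H' X \<partial>?R) = (\<integral>\<^sup>+X. H' X \<partial>distr (PiM {..<n} (\<lambda>_. ?G)) ?R (\<lambda>y. \<lambda>i\<in>UNIV. \<lambda>k\<in>{..<n}. y k i))"
   by (subst distr_PiM_transpose) (auto intro: G.prob_space_axioms)
  also have "... = (\<integral>\<^sup>+y. H' (\<lambda>i\<in>UNIV. \<lambda>k\<in>{..<n}. y k i) \<partial>PiM {..<n} (\<lambda>_. ?G))"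
   by (rule nn_integral_distr[OF tm]) (use Hm in simp)
  finally show ?thesis by (simp add: gauss_vec_def)
 qed
 finally show ?thesis by (simp add: H'_def)
qed

text \<open>The nonnegative case, applied to indicators, shows that \<open>\<Phi>\<close> has the
  same law on both sides; the integral depends on the law alone, integrable or not.\<close>

lemma integral_complex_wishart:
 fixes S B :: "complex^'p^'p" and c :: "'p => real" and \<Phi> :: "complex^'p^'p => real"
 assumes c: "\<And>i. 0 < c i" and B: "adjoint_mat B ** B = mat 1" "B ** adjoint_mat B = mat 1"
  and S: "S = B ** (\<chi> i j. if i = j then of_real (c i) else 0) ** adjoint_mat B"
  and \<Phi>: "\<Phi> \<in> borel_measurable borel" and inv: "\<And>A. \<Phi> (B ** A ** adjoint_mat B) = \<Phi> A"
 shows "(\<integral>A. \<Phi> A \<partial>complex_wishart S n) =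
  (\<integral>X. \<Phi> (\<chi> i j. gram_rows n X $ i $ j / of_nat n) \<partial>PiM UNIV (\<lambda>i. gauss_vec n (1 / c i)))"
proof -
 let ?R = "PiM UNIV (\<lambda>i. gauss_vec n (1 / c i))" and ?h = "\<lambda>X. \<Phi> (\<chi> i j. gram_rows n X $ i $ j / of_nat n)"
 have \<Phi>m: "\<Phi> \<in> borel_measurable (complex_wishart S n)" using \<Phi> by (simp add: complex_wishart_def)
 have hm: "?h \<in> borel_measurable ?R"
 proof (rule measurable_compose[OF measurable_matI \<Phi>])
  fix i j
  have "(\<lambda>X. X i k) \<in> borel_measurable ?R" if "k < n" for k i
  proof -
   have "(\<lambda>X. X i k) \<in> PiM UNIV (\<lambda>i. PiM {..<n} (\<lambda>_. complex_gauss (1 / c i))) \<rightarrow>\<^sub>M complex_gauss (1 / c i)"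
    by (rule measurable_PiM_PiM_component) (use that in auto)
   then show ?thesis by (simp add: gauss_vec_def measurable_cong_sets[OF refl sets_complex_gauss])
  qed
  note [measurable] = this
  show "(\<lambda>X. (\<chi> i j. gram_rows n X $ i $ j / of_nat n) $ i $ j) \<in> borel_measurable ?R"
   by (simp add: gram_rows_def) measurable
 qed
 have "distr (complex_wishart S n) borel \<Phi> = distr ?R borel ?h"
 proof (rule measure_eqI)
  fix A assume "A \<in> sets (distr (complex_wishart S n) borel \<Phi>)"
  then have A: "A \<in> sets borel" by simp
  have "emeasure (distr (complex_wishart S n) borel \<Phi>) A = (\<integral>\<^sup>+x. indicator A (\<Phi> x) \<partial>complex_wishart S n)"
   using nn_integral_distr[OF \<Phi>m, of "indicator A"] A by simp
  also have "... = (\<integral>\<^sup>+X. indicator A (?h X) \<partial>?R)"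
   by (rule nn_integral_complex_wishart[OF c B S, where H = "\<lambda>x. indicator A (\<Phi> x)"]) (use A \<Phi> inv in simp_all)
  also have "... = emeasure (distr ?R borel ?h) A"
   using nn_integral_distr[OF hm, of "indicator A"] A by simp
  finally show "emeasure (distr (complex_wishart S n) borel \<Phi>) A = emeasure (distr ?R borel ?h) A" .
 qed simp
 then show ?thesis using integral_distr[OF \<Phi>m, of "\<lambda>x. x"] integral_distr[OF hm, of "\<lambda>x. x"] by simp
qed

lemma spectral_prod_scale:
 fixes A :: "complex^'p^'p"
 assumes "0 < n"
 shows "spectral_prod G (\<chi> i j. A $ i $ j / of_nat n) = spectral_prod (\<lambda>x. G (x / real n)) A"
proof -
 obtain m where m: "charpoly A = (\<Prod>j<CARD('p). [:- m j, 1:])" using charpoly_roots_exist by blast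
 have n0: "of_nat n ~= (0 :: complex)" using assms by simp
 have "spectral_prod G (\<chi> i j. A $ i $ j / of_nat n) = (\<Prod>j<CARD('p). G (Re (m j / of_nat n)))"
 proof (rule spectral_prod_eqI)
  fix z :: complex
  let ?Z = "\<chi> i j. (if i = j then of_nat n * z else 0) - A $ i $ j"
  have "(\<chi> i j. (if i = j then z else 0) - (\<chi> i j. A $ i $ j / of_nat n) $ i $ j) = (\<chi> i. (1 / of_nat n) *s ?Z $ i)"
   using n0 by (simp add: Finite_Cartesian_Product.vec_eq_iff field_simps)
  then have "det (\<chi> i j. (if i = j then z else 0) - (\<chi> i j. A $ i $ j / of_nat n) $ i $ j) = (\<Prod>i\<in>(UNIV :: 'p set). 1 / of_nat n) * det (\<chi> i. ?Z $ i)"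
   using Determinants.det_rows_mul[of "\<lambda>_. 1 / of_nat n" "\<lambda>i. ?Z $ i"] by (simp only:)
  also have "det (\<chi> i. ?Z $ i) = poly (charpoly A) (of_nat n * z)" by (simp add: poly_charpoly)
  also have "... = (\<Prod>j<CARD('p). of_nat n * z - m j)" by (simp add: m poly_prod)
  also have "(\<Prod>i\<in>(UNIV :: 'p set). 1 / of_nat n) = (\<Prod>j<CARD('p). 1 / of_nat n :: complex)" by simp
  also have "... * (\<Prod>j<CARD('p). of_nat n * z - m j) = (\<Prod>j<CARD('p). z - m j / of_nat n)"
   unfolding prod.distrib[symmetric] using n0 by (intro prod.cong) (auto simp: field_simps)
  finally show "det (\<chi> i j. (if i = j then z else 0) - (\<chi> i j. A $ i $ j / of_nat n) $ i $ j) = (\<Prod>j<CARD('p). z - m j / of_nat n)" .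
 qed
 then show ?thesis by (simp add: spectral_prod_roots[OF m])
qed

text \<open>The diagonalization indexes eigenvalues by the finite type, the theorem by decreasing
  size; sorting the indices by \<open>c\<close> matches the two, multiplicities included.\<close>

lemma eigenvalue_enumeration:
 fixes S B :: "complex^'p^'p" and c :: "'p => real"
 assumes B: "B ** adjoint_mat B = mat 1"
  and S: "S = B ** (\<chi> i j. if i = j then of_real (c i) else 0) ** adjoint_mat B"
 shows "\<exists>js. distinct js \<and> set js = UNIV \<and> (\<forall>j\<in>{1..CARD('p)}. nth_largest_eigenvalue S j = c (js ! (j - 1)))"
proof -
 obtain xs :: "'p list" where xs: "set xs = UNIV" "distinct xs" using finite_distinct_list[of "UNIV :: 'p set"] by auto
 define js where "js = rev (sort_key c xs)"
 have len: "length js = CARD('p)" unfolding js_def using xs distinct_card[of xs] by simp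
 let ?D = "(\<chi> i j. if i = j then of_real (c i) else 0) :: complex^'p^'p"
 have "charpoly S = (\<Prod>i\<in>UNIV. [:- of_real (c i), 1:])"
 proof -
  have e: "(\<chi> i j. (if i = j then z else 0) - ?D $ i $ j) = (\<chi> i j. if i = j then z - of_real (c i) else 0)" for z
   by (simp add: Finite_Cartesian_Product.vec_eq_iff)
  have "poly (charpoly ?D) z = (\<Prod>i\<in>UNIV. z - of_real (c i))" for z
   unfolding poly_charpoly e by (subst det_diagonal) auto
  then have "poly (charpoly ?D) = poly (\<Prod>i\<in>UNIV. [:- of_real (c i), 1:])" by (simp add: fun_eq_iff poly_prod)
  then have "charpoly ?D = (\<Prod>i\<in>UNIV. [:- of_real (c i), 1:])" by (simp only: poly_eq_poly_eq_iff)
  then show ?thesis unfolding S by (simp only: charpoly_conj[OF B])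
 qed
 then have "proots (charpoly S) = image_mset (\<lambda>i. of_real (c i)) (mset_set UNIV)"
  by (simp add: proots_prod sum_unfold_sum_mset)
 then have "image_mset Re (proots (charpoly S)) = image_mset c (mset_set UNIV)" by (simp add: multiset.map_comp o_def)
 also have "mset_set UNIV = mset xs" using xs by (simp add: mset_set_set[symmetric])
 finally have N: "image_mset Re (proots (charpoly S)) = mset (map c xs)" by simp
 have "sort (map c xs) = map c (sort_key c xs)" by (rule properties_for_sort) simp_all
 then have "rev (sorted_list_of_multiset (image_mset Re (proots (charpoly S)))) = map c js"
  unfolding N sorted_list_of_multiset_mset js_def by (simp add: rev_map)
 then have "nth_largest_eigenvalue S j = c (js ! (j - 1))" if "j \<in> {1..CARD('p)}" for j
  unfolding nth_largest_eigenvalue_def using that len by auto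
 moreover have "distinct js" "set js = UNIV" using xs by (simp_all add: js_def)
 ultimately show ?thesis by blast
qed

text \<open>The normalization \<open>1 / n\<close> of the Wishart matrix moves into the argument of
  \<open>f\<close>, which stretches the margin \<open>d\<close> to \<open>n * d\<close>.\<close>

lemma wishart_expectation_continuous:
 fixes S :: "complex^'p^'p" and f :: "real => real" and \<pi> :: "nat => real"
 assumes S: "hermitian_pos_def S" and \<pi>: "\<And>j. j \<in> {1..CARD('p)} ==> \<pi> j = 1 / nth_largest_eigenvalue S j"
  and enc: "encloses g q (map \<pi> [1..<Suc CARD('p)])" and n: "0 < n"
  and f: "continuous_on UNIV f" "\<And>x. \<bar>f x\<bar> <= C" and d: "0 < d" "\<And>x. x <= d ==> f x = 0"
 defines "rs \<equiv> map \<pi> [1..<Suc CARD('p)]"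
 shows "complex_of_real (\<integral>A. spectral_prod (\<lambda>x. 1 + f x) A \<partial>complex_wishart S n) =
  Determinant.det (Matrix.mat n n (\<lambda>(m, a). (if m = a then 1 else 0) +
   hypoexp_moment g rs (\<lambda>x. of_real (f (x / real n))) m a / of_real (prod_list rs)))"
proof -
 obtain c B where c: "\<And>i. (0 :: real) < c i" and B: "adjoint_mat B ** B = mat 1" "B ** adjoint_mat B = mat 1"
  and SB: "S = B ** (\<chi> i j. if i = j then of_real (c i) else 0) ** adjoint_mat B"
  using assms(1) hermitian_diagonalization by blast
 obtain js where js: "distinct js" "set js = UNIV" "\<And>j. j \<in> {1..CARD('p)} ==> nth_largest_eigenvalue S j = c (js ! (j - 1))"
  using eigenvalue_enumeration[OF B(2) SB] by blast
 have len: "length js = CARD('p)" using distinct_card[OF js(1)] js(2) by simp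
 have rs: "map (\<lambda>i. 1 / c i) js = rs"
 proof (rule nth_equalityI)
  show "length (map (\<lambda>i. 1 / c i) js) = length rs" by (simp add: rs_def len)
  fix i assume "i < length (map (\<lambda>i. 1 / c i) js)"
  then have i: "i < CARD('p)" by (simp add: len)
  have "rs ! i = \<pi> (Suc i)" using i by (simp add: rs_def nth_append del: upt_Suc)
  then show "map (\<lambda>i. 1 / c i) js ! i = rs ! i" using i js(3)[of "Suc i"] \<pi>[of "Suc i"] len by simp
 qed
 have "(\<integral>A. spectral_prod (\<lambda>x. 1 + f x) A \<partial>complex_wishart S n) =
  (\<integral>X. spectral_prod (\<lambda>x. 1 + f x) (\<chi> i j. gram_rows n X $ i $ j / of_nat n) \<partial>PiM UNIV (\<lambda>i. gauss_vec n (1 / c i)))"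
 proof (rule integral_complex_wishart[OF c B SB])
  show "spectral_prod (\<lambda>x. 1 + f x) \<in> borel_measurable borel" by (rule measurable_spectral_prod) (intro continuous_intros f)
  show "spectral_prod (\<lambda>x. 1 + f x) (B ** A ** adjoint_mat B) = spectral_prod (\<lambda>x. 1 + f x) A" for A
   by (simp add: spectral_prod_def charpoly_conj[OF B(2)])
 qed
 also have "... = (\<integral>X. spectral_prod (\<lambda>x. 1 + f (x / real n)) (gram_rows n X) \<partial>PiM UNIV (\<lambda>i. gauss_vec n (1 / c i)))"
  by (simp only: spectral_prod_scale[OF n])
 also have "complex_of_real ... = Determinant.det (Matrix.mat n n (\<lambda>(m, a). (if m = a then 1 else 0) +
   hypoexp_moment g (map (\<lambda>i. 1 / c i) js) (\<lambda>x. of_real (f (x / real n))) m a / of_real (prod_list (map (\<lambda>i. 1 / c i) js))))"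
 proof (rule gauss_rows_expectation[OF js(1,2)])
  show "encloses g q (map (\<lambda>i. 1 / c i) js)" unfolding rs using enc by (simp add: rs_def)
  show "continuous_on UNIV (\<lambda>x. f (x / real n))"
   by (rule continuous_on_compose2[OF f(1)]) (use n in \<open>auto intro!: continuous_intros\<close>)
  show "f (x / real n) = 0" if "x <= real n * d" for x using that n by (intro d(2)) (simp add: divide_le_eq mult.commute)
 qed (use n f d in auto)
 finally show ?thesis unfolding rs .
qed

section \<open>The expectation formula\<close>

text \<open>A Baire approximation of \<open>f\<close> need not vanish on the nonpositive half-line.
  The induction therefore runs over arbitrary \<open>h\<close> and proves the identity for
  \<open>h\<close> set to 0 there.\<close>

lemma wishart_expectation_measurable:
 fixes S :: "complex^'p^'p" and f :: "real => real" and \<pi> :: "nat => real" and W :: "'a => complex^'p^'p"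
 assumes S: "hermitian_pos_def S" and \<pi>: "\<And>j. j \<in> {1..CARD('p)} ==> \<pi> j = 1 / nth_largest_eigenvalue S j"
  and M: "prob_space M" and W: "W \<in> borel_measurable M" "distr M borel W = complex_wishart S n"
  and enc: "encloses g q (map \<pi> [1..<Suc CARD('p)])" and n: "0 < n"
  and f: "f \<in> borel_measurable borel" "\<And>x. \<bar>f x\<bar> <= C" "\<And>x. x <= 0 ==> f x = 0"
 defines "rs \<equiv> map \<pi> [1..<Suc CARD('p)]"
 shows "complex_of_real (\<integral>\<omega>. (\<Prod>j=1..CARD('p). 1 + f (nth_largest_eigenvalue (W \<omega>) j)) \<partial>M) =
  Determinant.det (Matrix.mat n n (\<lambda>(m, a). (if m = a then 1 else 0) +
   hypoexp_moment g rs (\<lambda>x. of_real (f (x / real n))) m a / of_real (prod_list rs)))"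
proof -
 interpret M: prob_space M by (rule M)
 have e: "encloses g q rs" using enc by (simp add: rs_def)
 have q: "0 < q" using e by (simp add: encloses_def)
 define X where "X j \<omega> = nth_largest_eigenvalue (W \<omega>) j" for j \<omega>
 have Xm: "X j \<in> borel_measurable M" if "j \<in> {1..CARD('p)}" for j
  unfolding X_def by (rule measurable_compose[OF W(1) borel_measurable_nth_largest_eigenvalue[OF that]])
 define E where "E h = (\<integral>\<omega>. (\<Prod>j=1..CARD('p). 1 + h (X j \<omega>)) \<partial>M)" for h :: "real => real"
 define D where "D h = Determinant.det (Matrix.mat n n (\<lambda>(m, a). (if m = a then 1 else 0) +
   hypoexp_moment g rs (\<lambda>x. of_real (h (x / real n))) m a / of_real (prod_list rs)))" for h :: "real => real"
 have closed: "complex_of_real (E h) = D h"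
  if F: "\<And>k. F k \<in> borel_measurable borel" "\<And>k x. \<bar>F k x\<bar> <= B" "\<And>x. (\<lambda>k. F k x) \<longlonglongrightarrow> h x" "\<And>k. complex_of_real (E (F k)) = D (F k)"
  for F :: "nat => real => real" and B h
 proof -
  have hm: "h \<in> borel_measurable borel" by (rule borel_measurable_LIMSEQ_real[OF F(3,1)])
  have pm: "(\<lambda>\<omega>. \<Prod>j=1..CARD('p). 1 + u (X j \<omega>)) \<in> borel_measurable M" if "u \<in> borel_measurable borel" for u :: "real => real"
   by (intro borel_measurable_prod borel_measurable_add borel_measurable_const measurable_compose[OF Xm that])
  have "(\<lambda>k. E (F k)) \<longlonglongrightarrow> E h"
   unfolding E_def
  proof (rule integral_dominated_convergence[where w = "\<lambda>_. (1 + B) ^ CARD('p)"])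
   show "AE \<omega> in M. (\<lambda>k. \<Prod>j=1..CARD('p). 1 + F k (X j \<omega>)) \<longlonglongrightarrow> (\<Prod>j=1..CARD('p). 1 + h (X j \<omega>))"
    by (intro AE_I2 tendsto_prod tendsto_add tendsto_const F(3))
   show "AE \<omega> in M. norm (\<Prod>j=1..CARD('p). 1 + F k (X j \<omega>)) <= (1 + B) ^ CARD('p)" for k
   proof (rule AE_I2)
    fix \<omega>
    have "\<bar>1 + F k x\<bar> <= 1 + B" for x using F(2)[of k x] by linarith
    then have "(\<Prod>j=1..CARD('p). \<bar>1 + F k (X j \<omega>)\<bar>) <= (\<Prod>j=1..CARD('p). 1 + B)" by (intro prod_mono) auto
    then show "norm (\<Prod>j=1..CARD('p). 1 + F k (X j \<omega>)) <= (1 + B) ^ CARD('p)" by (simp add: abs_prod)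
   qed
  qed (use pm hm F(1) in simp_all)
  then have "(\<lambda>k. complex_of_real (E (F k))) \<longlonglongrightarrow> of_real (E h)" by (rule tendsto_of_real)
  moreover have "(\<lambda>k. D (F k)) \<longlonglongrightarrow> D h"
   unfolding D_def
  proof (rule tendsto_det_mat)
   fix m a
   \<comment> \<open>The part of the integrand that does not involve the varying function; it
     provides the dominating function.\<close>
   define \<rho> where "\<rho> u = (indicator {0<..} u *\<^sub>R hypoexp_density g rs m u) * poly (tau_poly rs a) (of_real u)" for u :: real
   have \<rho>i: "integrable lborel \<rho>"
    unfolding \<rho>_def by (rule integrable_hypoexp_moment(1)[OF e exp_growth_poly[of "q / 2"]]) (use q in auto)
   have [measurable]: "\<rho> \<in> borel_measurable borel" using borel_measurable_integrable[OF \<rho>i] by simp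
   have S: "hypoexp_moment g rs (\<lambda>x. of_real (u (x / real n))) m a = (\<integral>x. of_real (u (x / real n)) * \<rho> x \<partial>lborel)" for u :: "real => real"
    unfolding hypoexp_moment_def \<rho>_def by (intro Bochner_Integration.integral_cong) (simp_all add: mult_ac)
   have "(\<lambda>k. hypoexp_moment g rs (\<lambda>x. of_real (F k (x / real n))) m a) \<longlonglongrightarrow> hypoexp_moment g rs (\<lambda>x. of_real (h (x / real n))) m a"
    unfolding S
   proof (rule integral_dominated_convergence[where w = "\<lambda>x. B * norm (\<rho> x)"])
    note [measurable] = hm F(1)
    show "(\<lambda>x. complex_of_real (h (x / real n)) * \<rho> x) \<in> borel_measurable lborel"
     "(\<lambda>x. complex_of_real (F k (x / real n)) * \<rho> x) \<in> borel_measurable lborel" for k by measurable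
    show "integrable lborel (\<lambda>x. B * norm (\<rho> x))" by (intro integrable_mult_right integrable_norm \<rho>i)
    show "AE x in lborel. (\<lambda>k. of_real (F k (x / real n)) * \<rho> x) \<longlonglongrightarrow> of_real (h (x / real n)) * \<rho> x"
     by (intro AE_I2 tendsto_mult tendsto_const tendsto_of_real F(3))
    show "AE x in lborel. norm (complex_of_real (F k (x / real n)) * \<rho> x) <= B * norm (\<rho> x)" for k
     by (intro AE_I2) (simp add: norm_mult mult_right_mono F(2))
   qed
   moreover have "prod_list rs ~= 0" using e q by (auto simp: encloses_def prod_list_zero_iff)
   ultimately show "(\<lambda>k. (if m = a then 1 else 0) + hypoexp_moment g rs (\<lambda>x. of_real (F k (x / real n))) m a / of_real (prod_list rs)) \<longlonglongrightarrow>
     (if m = a then 1 else 0) + hypoexp_moment g rs (\<lambda>x. of_real (h (x / real n))) m a / of_real (prod_list rs)"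
    by (intro tendsto_add tendsto_const tendsto_divide) auto
  qed
  ultimately show ?thesis unfolding F(4) by (rule LIMSEQ_unique)
 qed
 have "complex_of_real (E (\<lambda>x. if 0 < x then h x else 0)) = D (\<lambda>x. if 0 < x then h x else 0)" if "baire h" for h
  using that
 proof (induction rule: baire.induct)
  case (baire_cont h B)
  \<comment> \<open>A continuous ramp, 0 up to \<open>1 / (k + 1)\<close> and 1 from
    \<open>2 / (k + 1)\<close> on.\<close>
  define \<theta> where "\<theta> k x = min 1 (max 0 (real (Suc k) * x - 1))" for k and x :: real
  have \<theta>: "0 <= \<theta> k x" "\<theta> k x <= 1" for k x by (auto simp: \<theta>_def)
  have Fc: "continuous_on UNIV (\<lambda>x. h x * \<theta> k x)" for k unfolding \<theta>_def by (intro continuous_intros baire_cont)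
  have FB: "\<bar>h x * \<theta> k x\<bar> <= B" for k x
   using mult_mono[OF baire_cont(2)[of x] \<theta>(2)[of k x] _ \<theta>(1)[of k x]] baire_cont(2)[of x] \<theta>(1)[of k x] by (simp add: abs_mult)
  have F0: "h x * \<theta> k x = 0" if "x <= 1 / real (Suc k)" for k x
  proof -
   have "real (Suc k) * x <= 1" using that by (simp add: field_simps)
   then show ?thesis by (simp add: \<theta>_def)
  qed
  show ?case
  proof (rule closed[OF _ FB])
   show "(\<lambda>x. h x * \<theta> k x) \<in> borel_measurable borel" for k by (rule borel_measurable_continuous_onI[OF Fc])
   show "(\<lambda>k. h x * \<theta> k x) \<longlonglongrightarrow> (if 0 < x then h x else 0)" for x
   proof (cases "0 < x")
    case True
    obtain K where K: "2 < real K * x" using reals_Archimedean3[OF True] by blast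
    have "\<theta> k x = 1" if "K <= k" for k
    proof -
     have "real K * x <= real (Suc k) * x" using that True by (intro mult_right_mono) auto
     then show ?thesis using K by (simp add: \<theta>_def)
    qed
    then have "eventually (\<lambda>k. h x * \<theta> k x = h x) sequentially" by (auto simp: eventually_sequentially)
    then show ?thesis using True by (simp add: tendsto_eventually)
   next
    case False
    have z: "h x * \<theta> k x = 0" for k by (rule F0, rule order_trans[of _ 0]) (use False in auto)
    show ?thesis using False by (simp add: z del: mult_eq_0_iff)
   qed
   fix k
   have sm: "spectral_prod (\<lambda>x. 1 + h x * \<theta> k x) \<in> borel_measurable (borel :: (complex^'p^'p) measure)"
    by (rule measurable_spectral_prod) (intro continuous_intros Fc)
   have "E (\<lambda>x. h x * \<theta> k x) = (\<integral>\<omega>. spectral_prod (\<lambda>x. 1 + h x * \<theta> k x) (W \<omega>) \<partial>M)"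
    unfolding E_def X_def by (simp only: prod_nth_largest_eigenvalue[of "\<lambda>x. 1 + h x * \<theta> k x"])
   also have "... = (\<integral>A. spectral_prod (\<lambda>x. 1 + h x * \<theta> k x) A \<partial>complex_wishart S n)"
    unfolding W(2)[symmetric] by (rule integral_distr[OF W(1) sm, symmetric])
   finally have E: "E (\<lambda>x. h x * \<theta> k x) = (\<integral>A. spectral_prod (\<lambda>x. 1 + h x * \<theta> k x) A \<partial>complex_wishart S n)" .
   have d: "0 < 1 / real (Suc k)" by simp
   show "complex_of_real (E (\<lambda>x. h x * \<theta> k x)) = D (\<lambda>x. h x * \<theta> k x)"
    unfolding E unfolding D_def rs_def by (rule wishart_expectation_continuous[OF S \<pi> enc n Fc FB d F0])
  qed
 next
  case (baire_lim F B h)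
  have B0: "0 <= B" using baire_lim.hyps(2)[of 0 0] by linarith
  show ?case
  proof (rule closed)
   show "(\<lambda>x. if 0 < x then F k x else 0) \<in> borel_measurable borel" for k
    using baire_measurable[OF baire_lim.hyps(1)] by measurable
   show "\<bar>if 0 < x then F k x else 0\<bar> <= B" for k x using baire_lim.hyps(2) B0 by simp
   show "(\<lambda>k. if 0 < x then F k x else 0) \<longlonglongrightarrow> (if 0 < x then h x else 0)" for x using baire_lim.hyps(3) by simp
  qed (rule baire_lim.IH)
 qed
 note this[OF baire_borel[OF f(1,2)]]
 moreover have "(\<lambda>x. if 0 < x then f x else 0) = f" using f(3) by (auto simp: fun_eq_iff not_less)
 ultimately have "complex_of_real (E f) = D f" by (simp only:)
 then show ?thesis by (simp only: E_def D_def X_def)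
qed

theorem proposition1:
  fixes S :: "complex ^ 'p ^ 'p"
    and n :: nat
    and M :: "'a measure"
    and W :: "'a \<Rightarrow> complex ^ 'p ^ 'p"
    and \<pi> :: "nat \<Rightarrow> real"
    and q :: real
    and g c :: "real \<Rightarrow> complex"
    and f :: "real \<Rightarrow> real"
  assumes "n \<ge> 1"
    and "hermitian_pos_def S"
    and "\<And>j. j \<in> {1..CARD('p)} \<Longrightarrow> \<pi> j = 1 / nth_largest_eigenvalue S j"
    and "prob_space M"
    and "W \<in> borel_measurable M"
    and "distr M borel W = complex_wishart S n"
    and "0 < q"
    and "\<And>j. j \<in> {1..CARD('p)} \<Longrightarrow> q < \<pi> j"
    and "ccw_contour c"
    and "0 \<in> inside (path_image c)"
    and "path_image c \<subseteq> {w. Re w < q}"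
    and "ccw_contour g"
    and "\<And>j. j \<in> {1..CARD('p)} \<Longrightarrow> of_real (\<pi> j) \<in> inside (path_image g)"
    and "path_image g \<subseteq> {z. Re z > q}"
    and "f \<in> borel_measurable borel"
    and "bounded (range f)"
    and "\<And>x. x \<le> 0 \<Longrightarrow> f x = 0"
  shows "has_fredholm_det
    (\<lambda>h x. h x + kernel_operator (K_kernel n CARD('p) \<pi> q g c) (mult_operator f h) x)
    (of_real (\<integral>\<omega>. (\<Prod>j=1..CARD('p). 1 + f (nth_largest_eigenvalue (W \<omega>) j)) \<partial>M))"
proof -
 have mem: "r \<in> \<pi> ` {1..CARD('p)}" if "r \<in> set (map \<pi> [1..<Suc CARD('p)])" for r
  using that by (auto simp del: upt_Suc)
 have enc: "encloses g q (map \<pi> [1..<Suc CARD('p)])"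
  unfolding encloses_def
 proof (intro conjI ballI)
  fix r assume "r \<in> set (map \<pi> [1..<Suc CARD('p)])"
  then obtain j where j: "j \<in> {1..CARD('p)}" "r = \<pi> j" using mem by blast
  show "q < r" "of_real r \<in> inside (path_image g)" using assms(8)[OF j(1)] assms(13)[OF j(1)] j(2) by simp_all
 qed (use assms in auto)
 have n: "0 < n" using assms(1) by simp
 obtain C where C: "\<And>x. \<bar>f x\<bar> <= C" using assms(16) by (auto simp: bounded_iff)
 \<comment> \<open>The finite determinant in which the expectation and the Fredholm determinant
   meet.\<close>
 define D where "D = Determinant.det (Matrix.mat n n (\<lambda>(m, a). (if m = a then 1 else 0) +
   hypoexp_moment g (map \<pi> [1..<Suc CARD('p)]) (\<lambda>x. of_real (f (x / real n))) m a / of_real (prod_list (map \<pi> [1..<Suc CARD('p)]))))"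
 have E: "complex_of_real (\<integral>\<omega>. (\<Prod>j=1..CARD('p). 1 + f (nth_largest_eigenvalue (W \<omega>) j)) \<partial>M) = D"
  unfolding D_def by (rule wishart_expectation_measurable[OF assms(2,3,4,5,6) enc n assms(15) C assms(17)])
 have "has_fredholm_det (\<lambda>h x. h x + kernel_operator (K_kernel n CARD('p) \<pi> q g c) (mult_operator f h) x) D"
  unfolding D_def by (rule K_kernel_fredholm_det[OF enc assms(9,10,11) n assms(15) C])
 then show ?thesis by (simp only: E)
qed

end
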